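(* Let $n\ge 1$ and let $\Omega\in\wp_n$ be a polytope in $\mathbb{R}^n$. Then the following are equivalent: (1) The first eigenfunction for the Laplace eigenvalue equation on $\Omega$ with the Dirichlet boundary condition extends to a real analytic function on $\mathbb{R}^n$. (2) $\Omega$ strictly tessellates $\mathbb{R}^n$. (3) $\Omega$ is congruent to an alcove, that is, to a fundamental domain of a crystallographic Coxeter group (equivalently, there are a root system $R\subset\mathbb{R}^n$ and an alcove $A$ of $R$ such that $\Omega$ is the image of $A$ under an isometry of $\mathbb{R}^n$).
   Context: Polytopes: $\wp_1$ is the set of all bounded open intervals $(a,b)$ with $-\infty<a<b<\infty$. Inductively, for $n\ge 2$, $\wp_n$ is the set of connected bounded domains (open sets) $\Omega\subset\mathbb{R}^n$ such that $\partial\Omega=\bigcup_{j=1}^m\overline{P_j}$ for finitely many sets $P_j$, where each $P_j$ is contained in an $(n-1)$-dimensional hyperplane, i.e. a set of the form $\{x\in\mathbb{R}^n: M\cdot x=b\}$ for some fixed $M\in\mathbb{R}^n$, $b\in\mathbb{R}$, and, under the canonical identification of this hyperplane with $\mathbb{R}^{n-1}$, $P_j$ is identified with an element $Q_j\in\wp_{n-1}$. The $P_j$ are the boundary faces of $\Omega$ (for $n=1$ the boundary faces are the endpoints, and the hyperplanes containing them are these points). A polytope in $\mathbb{R}^n$ is an element of $\wp_n$. Dirichlet eigenfunctions: $\Delta=-\sum_{k=1}^n\partial^2/\partial x_k^2$. The Laplace eigenvalue equation with the Dirichlet boundary condition on a bounded domain $\Omega$ is to find functions $u\not\equiv 0$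 and constants $\lambda$ with $\Delta u=\lambda u$ in $\Omega$ and $u|_{\partial\Omega}=0$. The eigenvalues are discrete and positive, $0<\lambda_1\le\lambda_2\le\cdots\uparrow\infty$; the first eigenfunction is the eigenfunction with eigenvalue $\lambda_1$ (unique up to a nonzero scalar). Strict tessellation: $\Omega\in\wp_n$ strictly tessellates $\mathbb{R}^n$ if $\mathbb{R}^n=\bigcup_{j\in\mathbb{Z}}\overline{\Omega_j}$, where each $\Omega_j$ is isometric to $\Omega$, the $\Omega_j$ are the domains obtained from $\Omega$ by repeatedly reflecting across boundary faces (of $\Omega$ and of its reflected copies), and furthermore the hyperplanes which contain the boundary faces of each $\Omega_j$ have empty intersection with the interior of $\Omega_k$, for all $j$ and $k$. Root systems: a root system in $\mathbb{R}^n$ is a finite set $R$ of vectors such that (i) $0\notin R$; (ii) $R$ spans $\mathbb{R}^n$; (iii) the only scalar multiples of $v\in R$ lying in $R$ are $\pm v$; (iv) $v-2\frac{u\cdot v}{\|u\|^2}u\in R$ for all $u,v\in R$; (v) $2\frac{u\cdot v}{\|v\|^2}\in\mathbb{Z}$ for all $u,v\in R$. Alcoves: for a root system $R$, $v\in R$ and $k\in\mathbb{Z}$, let $H_{v,k}=\{x\in\mathbb{R}^n: v\cdot x=k\}$. An alcove of $R$ is a connected component of $\mathbb{R}^n\setminus\bigcup_{v\in R,\,k\in\mathbb{Z}}H_{v,k}$. Alcoves are also known as the fundamental domains of crystallographic Coxeter groups. *)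

theory Defs
  imports "HOL-Analysis.Analysis"
begin

definition hyperplane_in :: "'a::euclidean_space set \<Rightarrow> 'a set \<Rightarrow> bool" where
  "hyperplane_in A H \<longleftrightarrow>
     (\<exists>M b. H = {x \<in> A. M \<bullet> x = b}) \<and> aff_dim H = aff_dim A - 1"

text \<open>
  \<open>W\<close> is the class from which the faces are taken. For \<open>\<Omega>\<close> open in the whole space,
  \<open>affine hull \<Omega>\<close> is the space and \<open>rel_frontier \<Omega>\<close> is the ordinary boundary.
\<close>

definition face_decomposition ::
  "'a::euclidean_space set set \<Rightarrow> 'a set \<Rightarrow> 'a set set \<Rightarrow> bool" where
  "face_decomposition W \<Omega> \<P> \<longleftrightarrow>
     finite \<P> \<and>
     (\<forall>P\<in>\<P>. P \<in> W \<and> (\<exists>H. hyperplane_in (affine hull \<Omega>) H \<and> P \<subseteq> H)) \<and>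
     rel_frontier \<Omega> = (\<Union>P\<in>\<P>. closure P)"

text \<open>
  \<open>wp k\<close> is the class of \<open>k\<close>-dimensional polytopes lying in an arbitrary \<open>k\<close>-dimensional affine
  subspace of the ambient space; a hyperplane is thereby identified with the Euclidean space of
  one dimension less without changing the type (lemma \<open>wp_isometric_image\<close> below shows that the
  choice of identification is irrelevant). Polytopes of the ambient space itself are the members
  of \<open>wp DIM('a)\<close>; see lemma \<open>wp_full_dim\<close>.
  They are neither convex nor closed in general, in contrast to \<open>polytope\<close> from the library.
  The value at \<open>0\<close> is only a convention that makes the endpoints the faces of an interval.
\<close>

fun wp :: "nat \<Rightarrow> 'a::euclidean_space set set" where
  "wp 0 = {{x} |x. True}"
| "wp (Suc 0) = {open_segment a b |a b. a \<noteq> b}"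
| "wp (Suc (Suc k)) =
     {\<Omega>. aff_dim \<Omega> = int (Suc (Suc k)) \<and> rel_interior \<Omega> = \<Omega> \<and> connected \<Omega> \<and> bounded \<Omega> \<and>
         (\<exists>\<P>. face_decomposition (wp (Suc k)) \<Omega> \<P>)}"

text \<open>
  A polytope has many decompositions of its boundary into faces (a face may be subdivided), but
  the hyperplanes containing the faces do not depend on the decomposition.
\<close>

definition face_hyperplanes :: "'a::euclidean_space set \<Rightarrow> 'a set set" where
  "face_hyperplanes \<Omega> =
     {H. hyperplane_in UNIV H \<and>
         (\<exists>\<P>. face_decomposition (wp (DIM('a) - 1)) \<Omega> \<P> \<and> (\<exists>P\<in>\<P>. P \<subseteq> H))}"

definition partial_deriv :: "'n \<Rightarrow> (real ^ 'n \<Rightarrow> real) \<Rightarrow> real ^ 'n \<Rightarrow> real" where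
  "partial_deriv k u x = frechet_derivative u (at x) (axis k 1)"

definition laplacian :: "(real ^ 'n \<Rightarrow> real) \<Rightarrow> real ^ 'n \<Rightarrow> real" where
  "laplacian u x = - (\<Sum>k\<in>UNIV. partial_deriv k (partial_deriv k u) x)"

definition C2_on :: "'a::euclidean_space set \<Rightarrow> ('a \<Rightarrow> real) \<Rightarrow> bool" where
  "C2_on S u \<longleftrightarrow>
     (\<exists>(u' :: 'a \<Rightarrow> 'a \<Rightarrow>\<^sub>L real) (u'' :: 'a \<Rightarrow> 'a \<Rightarrow>\<^sub>L 'a \<Rightarrow>\<^sub>L real).
        (\<forall>x\<in>S. (u has_derivative blinfun_apply (u' x)) (at x)) \<and>
        (\<forall>x\<in>S. (u' has_derivative blinfun_apply (u'' x)) (at x)) \<and>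
        continuous_on S u'')"

text \<open>
  Solutions are classical. Only the values of \<open>u\<close> on \<open>closure \<Omega>\<close> are relevant.
\<close>

definition dirichlet_eigenfunction ::
  "(real ^ 'n) set \<Rightarrow> real \<Rightarrow> (real ^ 'n \<Rightarrow> real) \<Rightarrow> bool" where
  "dirichlet_eigenfunction \<Omega> \<mu> u \<longleftrightarrow>
     continuous_on (closure \<Omega>) u \<and> C2_on \<Omega> u \<and>
     (\<exists>x\<in>\<Omega>. u x \<noteq> 0) \<and>
     (\<forall>x\<in>\<Omega>. laplacian u x = \<mu> * u x) \<and>
     (\<forall>x\<in>frontier \<Omega>. u x = 0)"

definition first_eigenfunction :: "(real ^ 'n) set \<Rightarrow> (real ^ 'n \<Rightarrow> real) \<Rightarrow> bool" where
  "first_eigenfunction \<Omega> u \<longleftrightarrow>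
     (\<exists>\<mu>. dirichlet_eigenfunction \<Omega> \<mu> u \<and>
          (\<forall>\<nu> v. dirichlet_eigenfunction \<Omega> \<nu> v \<longrightarrow> \<mu> \<le> \<nu>))"

text \<open>
  The library has no real analyticity in several variables. The multi-indices \<open>\<alpha>\<close> are the
  functions \<open>'n \<Rightarrow> nat\<close>, and convergence of the power series is unconditional.
\<close>

definition real_analytic_on :: "(real ^ 'n) set \<Rightarrow> (real ^ 'n \<Rightarrow> real) \<Rightarrow> bool" where
  "real_analytic_on S f \<longleftrightarrow>
     (\<forall>x\<in>S. \<exists>(a :: ('n \<Rightarrow> nat) \<Rightarrow> real) r. r > 0 \<and>
        (\<forall>y\<in>ball x r.
           ((\<lambda>\<alpha>. a \<alpha> * (\<Prod>i\<in>UNIV. (y $ i - x $ i) ^ \<alpha> i)) has_sum f y) UNIV))"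

text \<open>
  The first eigenfunction is unique up to a nonzero factor, so the existential quantifier
  over \<open>u\<close> picks a representative.
\<close>

definition first_eigenfunction_extends_analytically :: "(real ^ 'n) set \<Rightarrow> bool" where
  "first_eigenfunction_extends_analytically \<Omega> \<longleftrightarrow>
     (\<exists>u. first_eigenfunction \<Omega> u \<and>
          (\<exists>f. real_analytic_on UNIV f \<and> (\<forall>x\<in>closure \<Omega>. f x = u x)))"

definition congruent_sets :: "'a::euclidean_space set \<Rightarrow> 'a set \<Rightarrow> bool" where
  "congruent_sets S T \<longleftrightarrow> (\<exists>f. (\<forall>x y. dist (f x) (f y) = dist x y) \<and> T = f ` S)"

definition reflection :: "'a::euclidean_space \<Rightarrow> real \<Rightarrow> 'a \<Rightarrow> 'a" where
  "reflection M b x = x - (2 * (M \<bullet> x - b) / (norm M)\<^sup>2) *\<^sub>R M"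

inductive_set reflected_copies :: "'a::euclidean_space set \<Rightarrow> 'a set set"
  for \<Omega> :: "'a set" where
  start: "\<Omega> \<in> reflected_copies \<Omega>"
| reflect: "D \<in> reflected_copies \<Omega> \<Longrightarrow> {x. M \<bullet> x = b} \<in> face_hyperplanes D \<Longrightarrow>
            reflection M b ` D \<in> reflected_copies \<Omega>"

definition strictly_tessellates :: "'a::euclidean_space set \<Rightarrow> bool" where
  "strictly_tessellates \<Omega> \<longleftrightarrow>
     (\<exists>D :: int \<Rightarrow> 'a set.
        range D = reflected_copies \<Omega> \<and>
        (\<Union>j. closure (D j)) = UNIV \<and>
        (\<forall>j. congruent_sets \<Omega> (D j)) \<and>
        (\<forall>j k. \<forall>H\<in>face_hyperplanes (D j). H \<inter> interior (D k) = {}))"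

definition root_system :: "'a::euclidean_space set \<Rightarrow> bool" where
  "root_system R \<longleftrightarrow>
     finite R \<and> 0 \<notin> R \<and> span R = UNIV \<and>
     (\<forall>v\<in>R. {c *\<^sub>R v |c. True} \<inter> R = {v, - v}) \<and>
     (\<forall>u\<in>R. \<forall>v\<in>R. v - (2 * (u \<bullet> v) / (norm u)\<^sup>2) *\<^sub>R u \<in> R) \<and>
     (\<forall>u\<in>R. \<forall>v\<in>R. 2 * (u \<bullet> v) / (norm v)\<^sup>2 \<in> \<int>)"

definition alcoves :: "'a::euclidean_space set \<Rightarrow> 'a set set" where
  "alcoves R = components (UNIV - (\<Union>v\<in>R. \<Union>k::int. {x. v \<bullet> x = of_int k}))"

lemma hyperplane_in_UNIV:
  "hyperplane_in (UNIV :: 'a::euclidean_space set) H \<longleftrightarrow>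
     (\<exists>M b. M \<noteq> 0 \<and> H = {x. M \<bullet> x = b})"
proof
  assume "hyperplane_in UNIV H"
  then obtain M b where H: "H = {x. M \<bullet> x = b}" and d: "aff_dim H = int DIM('a) - 1"
    by (auto simp: hyperplane_in_def)
  have "M \<noteq> 0"
  proof
    assume "M = 0"
    then have "H = UNIV \<or> H = {}" using H by auto
    then show False using d by auto
  qed
  then show "\<exists>M b. M \<noteq> 0 \<and> H = {x. M \<bullet> x = b}" using H by blast
qed (auto simp: hyperplane_in_def)

lemma wp_full_dim:
  fixes \<Omega> :: "'a::euclidean_space set"
  assumes "DIM('a) \<ge> 2"
  shows "\<Omega> \<in> wp DIM('a) \<longleftrightarrow>
    \<Omega> \<noteq> {} \<and> open \<Omega> \<and> connected \<Omega> \<and> bounded \<Omega> \<and>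
    (\<exists>\<P>. finite \<P> \<and>
         (\<forall>P\<in>\<P>. P \<in> wp (DIM('a) - 1) \<and> (\<exists>M b. M \<noteq> 0 \<and> P \<subseteq> {x. M \<bullet> x = b})) \<and>
         frontier \<Omega> = (\<Union>P\<in>\<P>. closure P))"
proof -
  obtain k where k: "DIM('a) = Suc (Suc k)"
    using assms by (metis Suc_diff_le diff_Suc_1 le_Suc_ex numeral_2_eq_2 add_Suc)
  have *: "aff_dim \<Omega> = int DIM('a) \<and> rel_interior \<Omega> = \<Omega> \<longleftrightarrow> \<Omega> \<noteq> {} \<and> open \<Omega>"
    (is "?L \<longleftrightarrow> ?R")
  proof
    assume L: ?L
    then have "affine hull \<Omega> = UNIV" by (simp add: aff_dim_eq_full)
    then have "rel_interior \<Omega> = interior \<Omega>" by (rule rel_interior_interior)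
    moreover have "\<Omega> \<noteq> {}" using L by auto
    ultimately show ?R using L by (metis open_interior)
  next
    assume ?R
    then show ?L by (simp add: aff_dim_open rel_interior_open)
  qed
  have **: "affine hull \<Omega> = UNIV" if "\<Omega> \<noteq> {}" "open \<Omega>"
    using that by (rule affine_hull_open[rotated])
  then have ***: "rel_frontier \<Omega> = frontier \<Omega>" if "\<Omega> \<noteq> {}" "open \<Omega>"
    using that by (simp add: rel_frontier_frontier)
  have eq: "\<Omega> \<in> wp DIM('a) \<longleftrightarrow> (\<Omega> \<noteq> {} \<and> open \<Omega>) \<and> connected \<Omega> \<and> bounded \<Omega> \<and>
         (\<exists>\<P>. face_decomposition (wp (DIM('a) - 1)) \<Omega> \<P>)"
    unfolding *[symmetric] by (simp add: k)
  show ?thesis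
  proof (cases "\<Omega> \<noteq> {} \<and> open \<Omega>")
    case True
    have "(\<exists>H. hyperplane_in (affine hull \<Omega>) H \<and> P \<subseteq> H) \<longleftrightarrow>
          (\<exists>M b. M \<noteq> 0 \<and> P \<subseteq> {x. M \<bullet> x = b})" for P
      using ** True unfolding hyperplane_in_UNIV[symmetric] by (metis hyperplane_in_UNIV)
    then show ?thesis
      unfolding eq face_decomposition_def using True *** by simp
  next
    case False
    then show ?thesis unfolding eq by blast
  qed
qed

lemma wp_isometric_image:
  fixes f :: "'a::euclidean_space \<Rightarrow> 'b::euclidean_space"
  assumes lin: "linear f" and norm: "\<And>x. norm (f x) = norm x"
  shows "(\<lambda>x. c + f x) ` \<Omega> \<in> wp k \<longleftrightarrow> \<Omega> \<in> wp k"
proof -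
  define g where "g = (\<lambda>x. c + f x)"
  have injf: "inj f"
    using lin norm by (metis linear_injective_0 norm_eq_zero)
  have injg: "inj g"
    using injf by (auto simp: g_def inj_on_def)
  have im: "g ` S = (+) c ` f ` S" for S
    by (auto simp: g_def)
  have ad: "aff_dim (g ` S) = aff_dim S" for S
    unfolding im using lin injf by (simp add: aff_dim_translation_eq)
  have ah: "affine hull (g ` S) = g ` (affine hull S)" for S
    unfolding im using lin
    by (simp add: affine_hull_translation affine_hull_linear_image linear_conv_bounded_linear)
  have ri: "rel_interior (g ` S) = g ` rel_interior S" for S
    unfolding im using lin injf
    by (simp add: rel_interior_translation rel_interior_injective_linear_image
        linear_conv_bounded_linear)
  have cl: "closure (g ` S) = g ` closure S" for S
    unfolding im using lin injf by (simp add: closure_translation closure_injective_linear_image)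
  have rf: "rel_frontier (g ` S) = g ` rel_frontier S" for S
    unfolding rel_frontier_def ri cl using injg by (simp add: image_set_diff)
  have ds: "dist (g x) (g y) = dist x y" for x y
    unfolding g_def dist_norm using norm[of "x - y"] lin by (simp add: linear_diff)
  have bd: "bounded (g ` S) \<longleftrightarrow> bounded S" for S
    using bounded_any_center[of "g ` S" "g 0"] bounded_any_center[of S 0] by (simp add: ds)
  have homeo: "homeomorphism S (g ` S) g (inv g)" for S
  proof -
    have "continuous_on S g"
      unfolding g_def using lin
      by (intro continuous_intros linear_continuous_on) (simp add: linear_conv_bounded_linear)
    moreover have "continuous_on (g ` S) (inv g)"
    proof (clarsimp simp: continuous_on_iff)
      fix x e :: real and z assume "z \<in> S" "0 < e"
      then show "\<exists>d>0. \<forall>x'\<in>S. dist (g x') (g z) < d \<longrightarrow> dist (inv g (g x')) (inv g (g z)) < e"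
        using injg by (auto simp: ds)
    qed
    ultimately show ?thesis using injg by (auto simp: homeomorphism_def)
  qed
  have cn: "connected (g ` S) \<longleftrightarrow> connected S" for S
    using homeo[of S] homeomorphic_connectedness homeomorphic_def by metis
  have inner: "f x \<bullet> f y = x \<bullet> y" for x y
  proof -
    have "(norm (f (x + y)))\<^sup>2 = (norm (x + y))\<^sup>2" by (simp add: norm)
    moreover have "f x \<bullet> f x = x \<bullet> x" "f y \<bullet> f y = y \<bullet> y"
      using norm by (metis power2_norm_eq_inner)+
    ultimately show ?thesis
      using lin by (simp add: power2_norm_eq_inner linear_add inner_simps inner_commute)
  qed
  have hyp: "hyperplane_in (g ` A) (g ` H) \<longleftrightarrow> hyperplane_in A H" for A H
  proof -
    have "(\<exists>M b. g ` H = {x \<in> g ` A. M \<bullet> x = b}) \<longleftrightarrow> (\<exists>M b. H = {x \<in> A. M \<bullet> x = b})"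
    proof
      assume "\<exists>M b. g ` H = {x \<in> g ` A. M \<bullet> x = b}"
      then obtain M b where M: "g ` H = {x \<in> g ` A. M \<bullet> x = b}" by blast
      have "{x \<in> g ` A. M \<bullet> x = b} = g ` {x \<in> A. adjoint f M \<bullet> x = b - M \<bullet> c}"
        using adjoint_works[OF lin] by (auto simp: g_def inner_simps inner_commute)
      then have "H = {x \<in> A. adjoint f M \<bullet> x = b - M \<bullet> c}"
        using M injg by (metis inj_image_eq_iff)
      then show "\<exists>M b. H = {x \<in> A. M \<bullet> x = b}" by blast
    next
      assume "\<exists>M b. H = {x \<in> A. M \<bullet> x = b}"
      then obtain M b where M: "H = {x \<in> A. M \<bullet> x = b}" by blast
      have "g ` H = {x \<in> g ` A. f M \<bullet> x = b + f M \<bullet> c}"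
        unfolding M by (auto simp: g_def inner_simps inner)
      then show "\<exists>M b. g ` H = {x \<in> g ` A. M \<bullet> x = b}" by blast
    qed
    then show ?thesis by (simp add: hyperplane_in_def ad)
  qed
  have sub: "hyperplane_in (g ` A) H \<Longrightarrow> \<exists>H'. H = g ` H'" for A H
    by (auto simp: hyperplane_in_def intro!: exI[of _ "g -` H"])
  have fd: "(\<exists>\<P>. face_decomposition W' (g ` S) \<P>) \<longleftrightarrow> (\<exists>\<P>. face_decomposition W S \<P>)"
    if W: "\<And>P. g ` P \<in> W' \<longleftrightarrow> P \<in> W" for W W' S
  proof
    assume "\<exists>\<P>. face_decomposition W S \<P>"
    then obtain \<P> where P: "face_decomposition W S \<P>" by blast
    have "face_decomposition W' (g ` S) ((`) g ` \<P>)"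
      unfolding face_decomposition_def ah rf
    proof (intro conjI)
      show "finite ((`) g ` \<P>)" using P by (simp add: face_decomposition_def)
      show "\<forall>Q\<in>(`) g ` \<P>. Q \<in> W' \<and> (\<exists>H. hyperplane_in (g ` (affine hull S)) H \<and> Q \<subseteq> H)"
        using P W hyp unfolding face_decomposition_def by (metis (no_types, lifting) image_iff image_mono)
      show "g ` rel_frontier S = (\<Union>Q\<in>(`) g ` \<P>. closure Q)"
        using P by (auto simp: face_decomposition_def cl)
    qed
    then show "\<exists>\<P>. face_decomposition W' (g ` S) \<P>" by blast
  next
    assume "\<exists>\<P>. face_decomposition W' (g ` S) \<P>"
    then obtain \<Q> where Q: "face_decomposition W' (g ` S) \<Q>" by blast
    have ex: "\<exists>P H'. Q = g ` P \<and> P \<in> W \<and> hyperplane_in (affine hull S) H' \<and> P \<subseteq> H'"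
      if "Q \<in> \<Q>" for Q
    proof -
      obtain H where H: "Q \<in> W'" "hyperplane_in (g ` (affine hull S)) H" "Q \<subseteq> H"
        using Q \<open>Q \<in> \<Q>\<close> unfolding face_decomposition_def ah by blast
      then obtain H' where H': "H = g ` H'" using sub by blast
      then obtain P where P: "P \<subseteq> H'" "Q = g ` P" using H(3) by (meson subset_imageE)
      then show ?thesis using H H' W hyp by blast
    qed
    define \<P> where "\<P> = (\<lambda>Q. g -` Q) ` \<Q>"
    have QP: "g ` (g -` Q) = Q" if "Q \<in> \<Q>" for Q using ex[OF that] by auto
    have "face_decomposition W S \<P>"
      unfolding face_decomposition_def
    proof (intro conjI)
      show "finite \<P>" using Q by (simp add: face_decomposition_def \<P>_def)
      show "\<forall>P\<in>\<P>. P \<in> W \<and> (\<exists>H. hyperplane_in (affine hull S) H \<and> P \<subseteq> H)"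
      proof
        fix P assume "P \<in> \<P>"
        then obtain Q where "Q \<in> \<Q>" "P = g -` Q" by (auto simp: \<P>_def)
        then show "P \<in> W \<and> (\<exists>H. hyperplane_in (affine hull S) H \<and> P \<subseteq> H)"
          using ex[of Q] injg by (auto simp: inj_vimage_image_eq)
      qed
      have "g ` rel_frontier S = (\<Union>Q\<in>\<Q>. closure Q)"
        using Q by (simp add: face_decomposition_def rf)
      also have "\<dots> = (\<Union>Q\<in>\<Q>. g ` closure (g -` Q))"
        using QP cl by (metis (no_types, lifting) SUP_cong)
      also have "\<dots> = g ` (\<Union>P\<in>\<P>. closure P)" by (auto simp: \<P>_def)
      finally show "rel_frontier S = (\<Union>P\<in>\<P>. closure P)"
        using injg by (simp add: inj_image_eq_iff)
    qed
    then show "\<exists>\<P>. face_decomposition W S \<P>" by blast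
  qed
  have "g ` \<Omega> \<in> wp k \<longleftrightarrow> \<Omega> \<in> wp k"
  proof (induction k arbitrary: \<Omega> rule: less_induct)
    case (less k)
    consider "k = 0" | "k = Suc 0" | j where "k = Suc (Suc j)"
      by (metis not0_implies_Suc)
    then show ?case
    proof cases
      case 1
      have "(\<exists>y. g ` \<Omega> = {y}) \<longleftrightarrow> (\<exists>x. \<Omega> = {x})"
      proof
        assume "\<exists>y. g ` \<Omega> = {y}"
        then obtain y where y: "g ` \<Omega> = {y}" by blast
        then obtain x where "y = g x" by blast
        then have "g ` \<Omega> = g ` {x}" using y by simp
        then show "\<exists>x. \<Omega> = {x}" using injg by (metis inj_image_eq_iff)
      qed auto
      then show ?thesis using 1 by simp
    next
      case 2
      have seg: "g ` open_segment a b = open_segment (g a) (g b)" for a b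
      proof -
        have "open_segment (g a) (g b) = (+) c ` open_segment (f a) (f b)"
          by (simp only: g_def open_segment_translation)
        then show ?thesis
          unfolding im using open_segment_linear_image[OF lin injf] by simp
      qed
      have "(\<exists>a b. g ` \<Omega> = open_segment a b \<and> a \<noteq> b) \<longleftrightarrow>
            (\<exists>a b. \<Omega> = open_segment a b \<and> a \<noteq> b)" (is "?L \<longleftrightarrow> ?R")
      proof
        assume ?R then show ?L using seg injg by (metis injD)
      next
        assume ?L
        then obtain a b where ab: "g ` \<Omega> = open_segment a b" "a \<noteq> b" by blast
        have "closure (open_segment a b) = closed_segment a b" using ab(2) by simp
        then have "closed_segment a b = g ` closure \<Omega>" using ab cl by metis
        moreover have "a \<in> closed_segment a b" "b \<in> closed_segment a b" by simp_all
        ultimately have "a \<in> g ` closure \<Omega>" "b \<in> g ` closure \<Omega>" by simp_all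
        then obtain a' b' where "a = g a'" "b = g b'" by blast
        then have "g ` \<Omega> = g ` open_segment a' b'" "a' \<noteq> b'" using ab seg by auto
        then show ?R using injg by (metis inj_image_eq_iff)
      qed
      then show ?thesis using 2 by simp
    next
      case 3
      then show ?thesis
        using fd[of "wp (Suc j)" "wp (Suc j)" \<Omega>] less.IH[of "Suc j"]
        by (simp add: ad ri bd cn inj_image_eq_iff[OF injg])
    qed
  qed
  then show ?thesis by (simp add: g_def)
qed

end

theory Submission
 imports Defs "HOL-Complex_Analysis.Great_Picard"
begin

text \<open>
The three conditions are linked in a cycle. A polytope \<Omega> enters only as an open, bounded,
connected set whose boundary consists of finitely many flat pieces.

(1) implies (2). The first eigenfunction has no zero in \<Omega>
(\<open>first_eigenfunction_nonzero\<close>). If it extends to an analytic function f, then the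
eigenvalue equation holds for f on the whole space, and f vanishes on every hyperplane that
contains a face. Across such a hyperplane f is odd: the tangential derivatives of f vanish on it,
so the equation trades two normal derivatives for a constant factor, and hence all normal
derivatives of even order vanish (\<open>analytic_eigenfunction_odd\<close>). Therefore the
reflected copies of \<Omega> are components of the set where f is nonzero; they are disjoint, no
face hyperplane enters one of them, and they fill the space, because a point outside a copy lies
beyond one of its face hyperplanes, and the reflection in this hyperplane brings the copy closer
by a definite amount (\<open>odd_function_strictly_tessellates\<close>).

That the first eigenfunction has no zero is classical, but needs the existence of an eigenfunction
of one sign. Such a function is obtained as a limit of ground states of finite lattice graphs
(\<open>positive_eigenfunction_exists\<close>): barriers on the lattice control it at the
boundary, difference quotients of all orders are bounded in the interior. A comparison argument
then shows that an eigenfunction for the smallest eigenvalue is a multiple of it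
(\<open>eigenfunction_positive_if_le\<close>).

(2) implies (3). The face hyperplanes of all copies form a locally finite arrangement that is
invariant under the reflections in its members, and \<Omega> is one of its chambers. There are
finitely many directions, and the hyperplanes of one direction are equally spaced. The normals,
scaled so that the spacing becomes 1, form a root system, and some point lies on a hyperplane of
every direction. With this point as origin the arrangement is the one that defines the alcoves
(\<open>congruent_to_alcove\<close>).

(3) implies (1). The product of the functions \<open>sin (pi * (v \<bullet> x))\<close> over the
positive roots v vanishes exactly on the walls. As in the Weyl denominator formula, its expansion
contains only frequencies of the same length (\<open>prod_sin_equal_frequencies\<close>), so it is
an entire eigenfunction of the Laplacian. It has no zero in an alcove, and since alcoves are
star-shaped a scaling argument shows that its eigenvalue is the smallest one
(\<open>positive_eigenvalue_minimal\<close>).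
\<close>

unbundle no fps_syntax

section \<open>Gradients, Hessians and the second derivative test\<close>

text \<open>The gradient p and the rows \<open>q i\<close> of the Hessian are explicit, so that
the trace \<open>\<Sum>i\<in>UNIV. q i x $ i\<close> follows sums, scalings and limits of
functions without derivatives that take values in spaces of linear maps.\<close>

definition C2_with ::
 "(real^'n) set => (real^'n => real) => (real^'n => real^'n) =>
  ('n => real^'n => real^'n) => bool" where
 "C2_with S u p q \<longleftrightarrow>
   (\<forall>x\<in>S. (u has_derivative (\<lambda>h. p x \<bullet> h)) (at x) \<and>
      (\<forall>i. ((\<lambda>y. p y $ i) has_derivative (\<lambda>h. q i x \<bullet> h)) (at x)))"

lemma C2_withD:
 assumes "C2_with S u p q" "x \<in> S"
 shows "(u has_derivative (\<lambda>h. p x \<bullet> h)) (at x)"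
  and "((\<lambda>y. p y $ i) has_derivative (\<lambda>h. q i x \<bullet> h)) (at x)"
 using assms by (auto simp: C2_with_def)

lemma C2_with_subset: "C2_with S u p q ==> T \<subseteq> S ==> C2_with T u p q"
 by (auto simp: C2_with_def)

lemma C2_with_lincomb:
 assumes "C2_with S u p q" "C2_with S v p' q'"
 shows "C2_with S (\<lambda>x. a * u x + b * v x) (\<lambda>x. a *\<^sub>R p x + b *\<^sub>R p' x)
      (\<lambda>i x. a *\<^sub>R q i x + b *\<^sub>R q' i x)"
 unfolding C2_with_def
proof (intro ballI conjI allI)
 fix x i assume x: "x \<in> S"
 show "((\<lambda>x. a * u x + b * v x) has_derivative (\<bullet>) (a *\<^sub>R p x + b *\<^sub>R p' x)) (at x)"
  by (rule derivative_eq_intros C2_withD[OF assms(1) x] C2_withD[OF assms(2) x] refl)+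
    (auto simp: inner_simps)
 show "((\<lambda>x. (a *\<^sub>R p x + b *\<^sub>R p' x) $ i) has_derivative (\<bullet>) (a *\<^sub>R q i x + b *\<^sub>R q' i x)) (at x)"
  unfolding vector_add_component vector_scaleR_component
  by (rule derivative_eq_intros C2_withD[OF assms(1) x] C2_withD[OF assms(2) x] refl)+
    (auto simp: inner_simps)
qed

lemma C2_with_sum:
 assumes "finite I" "\<And>k. k \<in> I ==> C2_with S (u k) (p k) (q k)"
 shows "C2_with S (\<lambda>x. \<Sum>k\<in>I. u k x) (\<lambda>x. \<Sum>k\<in>I. p k x) (\<lambda>i x. \<Sum>k\<in>I. q k i x)"
 using assms
proof (induction I rule: finite_induct)
 case empty
 thus ?case by (auto simp: C2_with_def)
next
 case (insert k I)
 hence "C2_with S (\<lambda>x. 1 * u k x + 1 * (\<Sum>k\<in>I. u k x)) (\<lambda>x. 1 *\<^sub>R p k x + 1 *\<^sub>R (\<Sum>k\<in>I. p k x))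
   (\<lambda>i x. 1 *\<^sub>R q k i x + 1 *\<^sub>R (\<Sum>k\<in>I. q k i x))"
  by (intro C2_with_lincomb) auto
 with insert show ?case by simp
qed

lemma C2_with_cong_on:
 assumes "open S" "C2_with S u p q" "\<And>x. x \<in> S ==> u x = v x"
 shows "C2_with S v p q"
 unfolding C2_with_def
proof (intro ballI conjI allI)
 fix x i assume x: "x \<in> S"
 show "(v has_derivative (\<bullet>) (p x)) (at x)"
  using has_derivative_transform_within_open[OF C2_withD(1)[OF assms(2) x] assms(1) x] assms(3) by auto
 show "((\<lambda>y. p y $ i) has_derivative (\<bullet>) (q i x)) (at x)" using C2_withD(2)[OF assms(2) x] .
qed

lemma laplacian_C2_with:
 assumes "open S" "C2_with S u p q" "x \<in> S"
 shows "laplacian u x = - (\<Sum>i\<in>UNIV. q i x $ i)"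
proof -
 have p: "partial_deriv i u y = p y $ i" if "y \<in> S" for y i
  using frechet_derivative_at[OF C2_withD(1)[OF assms(2) that]]
  by (simp add: partial_deriv_def inner_axis) (metis inner_axis mult.right_neutral inner_real_def)
 have "partial_deriv i (partial_deriv i u) x = q i x $ i" for i
 proof -
  have "((partial_deriv i u) has_derivative (\<lambda>h. q i x \<bullet> h)) (at x)"
   using has_derivative_transform_within_open[OF C2_withD(2)[OF assms(2,3)] assms(1,3)] p by simp
  thus ?thesis
   using frechet_derivative_at[of "partial_deriv i u" "\<lambda>h. q i x \<bullet> h" x]
   unfolding partial_deriv_def[of i "partial_deriv i u"]
   by (metis inner_axis inner_real_def mult.right_neutral)
 qed
 thus ?thesis by (simp add: laplacian_def)
qed

lemma C2_on_imp_C2_with: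
 fixes u :: "real^'n => real"
 assumes "C2_on S u"
 obtains p q where "C2_with S u p q"
proof -
 obtain u' :: "real^'n => (real^'n) \<Rightarrow>\<^sub>L real" and u'' :: "real^'n => (real^'n) \<Rightarrow>\<^sub>L (real^'n) \<Rightarrow>\<^sub>L real"
  where u': "\<And>x. x \<in> S ==> (u has_derivative blinfun_apply (u' x)) (at x)"
   and u'': "\<And>x. x \<in> S ==> (u' has_derivative blinfun_apply (u'' x)) (at x)"
  using assms unfolding C2_on_def by metis
 have lin: "f h = (\<chi> i. f (axis i 1)) \<bullet> h" if "linear f" for f :: "real^'n => real" and h
 proof -
  have "f h = f (\<Sum>i\<in>UNIV. h $ i *\<^sub>R axis i 1)"
   using basis_expansion[of h] by (simp add: scalar_mult_eq_scaleR)
  also have "... = (\<Sum>i\<in>UNIV. h $ i * f (axis i 1))"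
   using that by (simp add: linear_sum linear_scale)
  finally show ?thesis by (simp add: inner_vec_def mult.commute)
 qed
 define p where "p x = (\<chi> i. u' x (axis i 1))" for x
 define q where "q j x = (\<chi> i. u'' x (axis i 1) (axis j 1))" for j x
 have "C2_with S u p q"
  unfolding C2_with_def
 proof (intro ballI conjI allI)
  fix x i assume x: "x \<in> S"
  have "blinfun_apply (u' x) = (\<lambda>h. p x \<bullet> h)"
   unfolding p_def by (rule ext, rule lin) (simp add: bounded_linear.linear[OF blinfun.bounded_linear_right])
  thus "(u has_derivative (\<bullet>) (p x)) (at x)" using u'[OF x] by simp
  have d: "((\<lambda>y. u' y (axis i 1)) has_derivative (\<lambda>h. u'' x h (axis i 1))) (at x)"
   by (rule derivative_eq_intros u''[OF x] refl)+ (auto simp: blinfun.zero_right)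
  moreover have "(\<lambda>h. u'' x h (axis i 1)) = (\<lambda>h. q i x \<bullet> h)"
   unfolding q_def by (rule ext, rule lin) (intro has_derivative_linear[OF d])
  ultimately show "((\<lambda>y. p y $ i) has_derivative (\<bullet>) (q i x)) (at x)"
   by (simp add: p_def)
 qed
 thus ?thesis using that by blast
qed

lemma C2_with_imp_C2_on:
 fixes u :: "real^'n => real"
 assumes "C2_with S u p q" "\<And>i. continuous_on S (q i)"
 shows "C2_on S u"
proof -
 define u' where "u' x = blinfun_inner_right (p x)" for x
 define B where "B i = blinfun_inner_right (axis i (1::real) :: real^'n)" for i
 define u'' :: "real^'n => (real^'n) \<Rightarrow>\<^sub>L (real^'n) \<Rightarrow>\<^sub>L real"
  where "u'' x = (\<Sum>i\<in>UNIV. blinfun_scaleR_left (B i) o\<^sub>L blinfun_inner_right (q i x))" for x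
 have u'_eq: "u' x = (\<Sum>i\<in>UNIV. (p x $ i) *\<^sub>R B i)" for x
 proof (rule blinfun_eqI)
  fix h
  have "blinfun_apply (B i) h = h $ i" for i by (simp add: B_def inner_axis inner_commute[of "axis i 1" h])
  thus "u' x h = (\<Sum>i\<in>UNIV. (p x $ i) *\<^sub>R B i) h"
   by (simp add: u'_def blinfun.sum_left blinfun.scaleR_left inner_vec_def mult.commute)
 qed
 have 1: "(u has_derivative blinfun_apply (u' x)) (at x)" if "x \<in> S" for x
  using C2_withD(1)[OF assms(1) that] by (simp add: u'_def)
 have 2: "(u' has_derivative blinfun_apply (u'' x)) (at x)" if "x \<in> S" for x
 proof -
  have "((\<lambda>x. \<Sum>i\<in>UNIV. (p x $ i) *\<^sub>R B i) has_derivative (\<lambda>h. \<Sum>i\<in>UNIV. (q i x \<bullet> h) *\<^sub>R B i)) (at x)"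
   by (rule derivative_eq_intros C2_withD(2)[OF assms(1) that] refl)+ auto
  moreover have "blinfun_apply (u'' x) = (\<lambda>h. \<Sum>i\<in>UNIV. (q i x \<bullet> h) *\<^sub>R B i)"
   by (auto simp: u''_def blinfun.sum_left fun_eq_iff)
  ultimately show ?thesis using u'_eq by presburger
 qed
 have 3: "continuous_on S u''"
  unfolding u''_def
  by (intro continuous_intros bounded_linear.continuous_on[OF bounded_linear_blinfun_inner_right] assms(2))
 show ?thesis
  unfolding C2_on_def using 1 2 3 by blast
qed

lemma second_deriv_test_min:
 fixes g g' :: "real => real"
 assumes r: "r > 0"
  and g: "\<And>t. \<bar>t\<bar> < r ==> (g has_real_derivative g' t) (at t)"
  and g': "(g' has_real_derivative c) (at 0)"
  and mn: "\<And>t. \<bar>t\<bar> < r ==> g 0 \<le> g t"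
 shows "c \<ge> 0"
proof (rule ccontr)
 assume "\<not> c \<ge> 0"
 then obtain d where d: "d > 0" "\<And>h. 0 < h ==> h < d ==> g' (0 + h) < g' 0"
  using DERIV_neg_dec_right[OF g'] by fastforce
 have z: "g' 0 = 0"
  using DERIV_local_min[of g "g' 0" 0 r] g[of 0] r mn by (auto simp: abs_minus_commute)
 define t where "t = min d r / 2"
 have t: "0 < t" "t < d" "t < r" using d r by (auto simp: t_def)
 obtain s where s: "0 < s" "s < t" "g t - g 0 = (t - 0) * g' s"
  using MVT2[of 0 t g g'] g t by force
 have "g' s < 0" using d(2)[of s] s t z by simp
 hence "t * g' s < 0" using t by (simp add: mult_pos_neg)
 hence "g t < g 0" using s by simp
 with mn[of t] t show False by simp
qed

lemma C2_with_local_min: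
 assumes S: "open S" and C: "C2_with S w p q" and x: "x \<in> S"
  and mn: "\<And>y. y \<in> S ==> w x \<le> w y"
 shows "(\<Sum>i\<in>UNIV. q i x $ i) \<ge> 0"
proof (rule sum_nonneg)
 fix i :: 'a
 obtain r where r: "r > 0" "ball x r \<subseteq> S" using S x openE by blast
 have in_S: "x + t *\<^sub>R axis i 1 \<in> S" if "\<bar>t\<bar> < r" for t
 proof -
  have "x + t *\<^sub>R axis i 1 \<in> ball x r" using that by (simp add: dist_norm)
  thus ?thesis using r by blast
 qed
 have line: "((\<lambda>t. x + t *\<^sub>R axis i 1) has_derivative (\<lambda>h. h *\<^sub>R axis i 1)) (at t)" for t :: real
  by (rule derivative_eq_intros refl)+ auto
 show "q i x $ i \<ge> 0"
 proof (rule second_deriv_test_min[OF r(1)])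
  fix t :: real assume t: "\<bar>t\<bar> < r"
  show "((\<lambda>t. w (x + t *\<^sub>R axis i 1)) has_real_derivative (p (x + t *\<^sub>R axis i 1) $ i)) (at t)"
   using has_derivative_compose[OF line[of t] C2_withD(1)[OF C in_S[OF t]]]
   by (simp add: has_field_derivative_def inner_axis mult_commute_abs)
  show "w (x + 0 *\<^sub>R axis i 1) \<le> w (x + t *\<^sub>R axis i 1)" using mn in_S[OF t] by simp
 next
  have "((\<lambda>t. p (x + t *\<^sub>R axis i 1) $ i) has_derivative (\<lambda>h. q i (x + 0 *\<^sub>R axis i 1) \<bullet> (h *\<^sub>R axis i 1))) (at (0::real))"
   by (rule has_derivative_compose[OF line[of 0]], rule C2_withD(2)[OF C in_S]) (use r in simp)
  thus "((\<lambda>t. p (x + t *\<^sub>R axis i 1) $ i) has_real_derivative (q i x $ i)) (at 0)"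
   by (simp add: has_field_derivative_def inner_axis mult_commute_abs)
 qed
qed

section \<open>Maximum principles for the Laplacian\<close>

lemma inner_scaleR_left_fun: "(\<bullet>) (r *\<^sub>R v) = (\<lambda>h. r * (v \<bullet> h))"
 by (simp add: fun_eq_iff)

lemma C2_with_gaussian:
 fixes a :: "real^'n"
 shows "C2_with S (\<lambda>x. exp (- \<alpha> * ((x - a) \<bullet> (x - a))))
   (\<lambda>x. (- 2 * \<alpha> * exp (- \<alpha> * ((x - a) \<bullet> (x - a)))) *\<^sub>R (x - a))
   (\<lambda>i x. exp (- \<alpha> * ((x - a) \<bullet> (x - a))) *\<^sub>R
    ((4 * \<alpha>\<^sup>2 * (x - a) $ i) *\<^sub>R (x - a) - (2 * \<alpha>) *\<^sub>R axis i 1))"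
 unfolding C2_with_def
proof (intro ballI conjI allI)
 fix x :: "real^'n" and i :: 'n
 have E: "((\<lambda>x. exp (- \<alpha> * ((x - a) \<bullet> (x - a)))) has_derivative
   (\<lambda>h. (- 2 * \<alpha> * exp (- \<alpha> * ((x - a) \<bullet> (x - a)))) * ((x - a) \<bullet> h))) (at x)"
  by (rule derivative_eq_intros refl)+ (auto simp: inner_simps inner_commute algebra_simps)
 thus "((\<lambda>x. exp (- \<alpha> * ((x - a) \<bullet> (x - a)))) has_derivative
    (\<bullet>) ((- 2 * \<alpha> * exp (- \<alpha> * ((x - a) \<bullet> (x - a)))) *\<^sub>R (x - a))) (at x)"
  unfolding inner_scaleR_left_fun .
 have V: "((\<lambda>y. y $ i) has_derivative (\<lambda>h. h $ i)) (at x)"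
  by (rule bounded_linear_imp_has_derivative[OF bounded_linear_vec_nth])
 have "((\<lambda>y. (- 2 * \<alpha> * exp (- \<alpha> * ((y - a) \<bullet> (y - a)))) * (y $ i - a $ i)) has_derivative
   (\<lambda>h. exp (- \<alpha> * ((x - a) \<bullet> (x - a))) * (4 * \<alpha>\<^sup>2 * (x - a) $ i * ((x - a) \<bullet> h) - (2 * \<alpha>) * (h $ i)))) (at x)"
  by (rule derivative_eq_intros E V refl)+
    (simp add: power2_eq_square algebra_simps del: inner_diff_left inner_diff_right)
 thus "((\<lambda>y. ((- 2 * \<alpha> * exp (- \<alpha> * ((y - a) \<bullet> (y - a)))) *\<^sub>R (y - a)) $ i) has_derivative
   (\<bullet>) (exp (- \<alpha> * ((x - a) \<bullet> (x - a))) *\<^sub>R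
    ((4 * \<alpha>\<^sup>2 * (x - a) $ i) *\<^sub>R (x - a) - (2 * \<alpha>) *\<^sub>R axis i 1))) (at x)"
  by (simp add: inner_scaleR_left_fun inner_diff_left inner_commute[of "axis i 1"] inner_axis)
qed

lemma laplacian_gaussian:
 fixes a x :: "real^'n"
 shows "(\<Sum>i\<in>UNIV. (exp (- \<alpha> * ((x - a) \<bullet> (x - a))) *\<^sub>R
    ((4 * \<alpha>\<^sup>2 * (x - a) $ i) *\<^sub>R (x - a) - (2 * \<alpha>) *\<^sub>R axis i 1)) $ i)
   = exp (- \<alpha> * ((x - a) \<bullet> (x - a))) * (4 * \<alpha>\<^sup>2 * (norm (x - a))\<^sup>2 - 2 * \<alpha> * CARD('n))"
proof -
 have "(\<Sum>i\<in>UNIV. (4 * \<alpha>\<^sup>2 * (x - a) $ i) * ((x - a) $ i)) = 4 * \<alpha>\<^sup>2 * (norm (x - a))\<^sup>2"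
  by (simp add: power2_norm_eq_inner inner_vec_def sum_distrib_left mult.assoc)
 thus ?thesis
  by (simp add: sum_distrib_left[symmetric] sum_subtractf axis_def)
qed

lemma C2_with_continuous_on: "C2_with S u p q ==> continuous_on S u"
 by (intro continuous_at_imp_continuous_on ballI) (rule has_derivative_continuous[OF C2_withD(1)])

text \<open>Zeros spread. If \<open>w z0 = 0\<close> and \<open>w a > 0\<close> at a point a near
z0, let \<open>b = exp (- \<alpha> * r\<^sup>2) - exp (- \<alpha> * s\<^sup>2)\<close>, where r is
the distance from a, on the ball of radius s about a. Near a, a small multiple \<open>m *
b\<close> lies below w, on the sphere b is zero, and in between the Laplacian of b exceeds
\<open>c * b\<close> when \<alpha> is large; so \<open>w - m * b\<close> has no negative minimum.
But \<open>b z0 > 0\<close>. Hence the set of zeros is open, and it is closed in the connected set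
S.\<close>

lemma strong_maximum_principle:
 fixes w :: "real^'n => real"
 assumes S: "open S" "connected S" and C: "C2_with S w p q"
  and w0: "\<And>x. x \<in> S ==> w x \<ge> 0" and c: "c \<ge> 0"
  and sup: "\<And>x. x \<in> S ==> (\<Sum>i\<in>UNIV. q i x $ i) \<le> c * w x"
  and z: "z \<in> S" "w z = 0" and x: "x \<in> S"
 shows "w x = 0"
proof -
 have cont: "continuous_on S w" by (rule C2_with_continuous_on[OF C])
 have spread: "w a = 0" if R: "cball z0 R \<subseteq> S" and z0: "w z0 = 0" and a: "dist a z0 < R / 2" for a z0 R
 proof (rule ccontr)
  assume "w a \<noteq> 0"
  define s where "s = R / 2"
  have s0: "s > 0" "dist a z0 < s" using a zero_le_dist[of a z0] unfolding s_def by linarith+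
  have sS: "cball a s \<subseteq> S"
  proof
   fix y assume "y \<in> cball a s"
   hence "dist z0 y \<le> R" using s0 dist_triangle[of z0 y a] by (auto simp: s_def dist_commute)
   thus "y \<in> S" using R by auto
  qed
  define m where "m = w a / 2"
  have m: "m > 0" using w0[of a] sS s0 \<open>w a \<noteq> 0\<close> by (force simp: m_def)
  obtain \<eta> where \<eta>: "\<eta> > 0" "\<And>y. dist a y \<le> s ==> dist a y < \<eta> ==> w y > m"
  proof -
   have "continuous (at a within cball a s) w"
    using continuous_on_subset[OF cont sS] s0 by (simp add: continuous_on_eq_continuous_within)
   hence "\<forall>\<^sub>F y in at a within cball a s. w y > m"
    unfolding continuous_within by (rule order_tendstoD(1)) (use m in "simp add: m_def")
   then obtain d where "d > 0" "\<And>y. y \<in> cball a s ==> y \<noteq> a ==> dist y a < d ==> w y > m"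
    unfolding eventually_at by blast
   thus ?thesis using that[of d] m by (force simp: m_def dist_commute)
  qed
  define n where "n = real CARD('n)"
  \<comment> \<open>By the bound on \<open>\<alpha> * (4 * \<eta>\<^sup>2)\<close> the Laplacian
  of G is at least \<open>G * \<alpha>\<close> at distance \<eta> or more from a.\<close>
  define \<alpha> where "\<alpha> = (2 * n + 1) / (4 * \<eta>\<^sup>2) + c + 1"
  have n0: "n \<ge> 0" by (simp add: n_def)
  have al: "\<alpha> > 0" "\<alpha> \<ge> c + 1" "\<alpha> * (4 * \<eta>\<^sup>2) \<ge> 2 * n + 1"
  proof -
   show "\<alpha> > 0" "\<alpha> \<ge> c + 1" using c n0 \<eta>(1) by (simp_all add: \<alpha>_def add_nonneg_pos)
   have "\<alpha> * (4 * \<eta>\<^sup>2) = 2 * n + 1 + (c + 1) * (4 * \<eta>\<^sup>2)" using \<eta>(1) by (simp add: \<alpha>_def field_simps)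
   thus "\<alpha> * (4 * \<eta>\<^sup>2) \<ge> 2 * n + 1" using c by simp
  qed
  define G where "G = (\<lambda>x::real^'n. exp (- \<alpha> * ((x - a) \<bullet> (x - a))))"
  define b where "b x = G x - exp (- \<alpha> * s\<^sup>2)" for x
  obtain pG qG where CG: "C2_with UNIV G pG qG" and
   LG: "\<And>x. (\<Sum>i\<in>UNIV. qG i x $ i) = G x * (4 * \<alpha>\<^sup>2 * (dist a x)\<^sup>2 - 2 * \<alpha> * n)"
   using C2_with_gaussian[of UNIV \<alpha> a] laplacian_gaussian[of \<alpha> _ a]
   unfolding G_def n_def dist_norm norm_minus_commute[of a] by blast
  have Gd: "G x = exp (- \<alpha> * (dist a x)\<^sup>2)" for x
   by (simp add: G_def dist_norm dot_square_norm norm_minus_commute)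
  define f where "f x = w x - m * b x" for x
  have Cf: "C2_with S f (\<lambda>x. 1 *\<^sub>R p x + (-m) *\<^sub>R pG x) (\<lambda>i x. 1 *\<^sub>R q i x + (-m) *\<^sub>R qG i x)"
  proof -
   have "C2_with S b pG qG"
    unfolding b_def C2_with_def using CG by (auto simp: C2_with_def intro!: derivative_eq_intros)
   from C2_with_lincomb[OF C this, of 1 "-m"] show ?thesis by (simp add: f_def[abs_def])
  qed
  have "continuous_on (cball a s) f"
   using C2_with_continuous_on[OF Cf] sS continuous_on_subset by blast
  then obtain y where y: "y \<in> cball a s" "\<And>v. v \<in> cball a s ==> f y \<le> f v"
   using continuous_attains_inf[of "cball a s" f] s0 by auto
  have yS: "y \<in> S" using y sS by auto
  have "(dist a z0)\<^sup>2 < s\<^sup>2" using s0 by (intro power_strict_mono) auto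
  hence "b z0 > 0" using al(1) by (simp add: b_def Gd)
  hence neg: "f y < 0" using y(2)[of z0] s0 z0 mult_pos_pos[OF m] by (force simp: f_def)
  have far: "dist a y \<ge> \<eta>"
  proof (rule ccontr)
   assume "\<not> ?thesis"
   hence "w y > m" using \<eta>(2) y(1) by simp
   moreover have "b y \<le> 1" using al(1) exp_gt_zero[of "- \<alpha> * s\<^sup>2"] unfolding b_def Gd
    by (smt (verit) exp_le_one_iff mult_nonneg_nonneg mult_minus_left zero_le_power2)
   hence "m * b y \<le> m" using m by simp
   ultimately show False using neg by (simp add: f_def)
  qed
  have inside: "y \<in> ball a s"
  proof (rule ccontr)
   assume "\<not> ?thesis"
   hence "dist a y = s" using y(1) by simp
   thus False using neg w0[OF yS] by (simp add: f_def b_def Gd)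
  qed
  have "(\<Sum>i\<in>UNIV. (1 *\<^sub>R q i y + (-m) *\<^sub>R qG i y) $ i) \<ge> 0"
   by (rule C2_with_local_min[OF open_ball C2_with_subset[OF Cf] inside]) (use y sS ball_subset_cball in auto)
  moreover have "(\<Sum>i\<in>UNIV. (1 *\<^sub>R q i y + (-m) *\<^sub>R qG i y) $ i) = (\<Sum>i\<in>UNIV. q i y $ i) - m * (\<Sum>i\<in>UNIV. qG i y $ i)"
   by (simp add: sum_subtractf sum_distrib_left)
  ultimately have "m * (\<Sum>i\<in>UNIV. qG i y $ i) \<le> c * w y" using sup[OF yS] by linarith
  also have "... \<le> c * (m * b y)" using neg c by (intro mult_left_mono) (auto simp: f_def)
  finally have "(\<Sum>i\<in>UNIV. qG i y $ i) \<le> c * b y" using m by (simp add: mult.left_commute)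
  moreover have "c * b y \<le> G y * c" unfolding b_def using c by (simp add: algebra_simps)
  moreover have "G y * c < G y * \<alpha>" using al by (simp add: G_def)
  moreover have "G y * \<alpha> \<le> (\<Sum>i\<in>UNIV. qG i y $ i)"
  proof -
   have "\<alpha>\<^sup>2 * (4 * \<eta>\<^sup>2) \<le> \<alpha>\<^sup>2 * (4 * (dist a y)\<^sup>2)" using far \<eta>(1) by (intro mult_left_mono power_mono) auto
   moreover have "\<alpha> * (2 * n + 1) \<le> \<alpha>\<^sup>2 * (4 * \<eta>\<^sup>2)"
    using al mult_left_mono[OF al(3), of \<alpha>] by (simp add: power2_eq_square mult.assoc)
   ultimately have "\<alpha> \<le> 4 * \<alpha>\<^sup>2 * (dist a y)\<^sup>2 - 2 * \<alpha> * n" by (simp add: algebra_simps)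
   thus ?thesis unfolding LG by (intro mult_left_mono) (simp_all add: G_def)
  qed
  ultimately show False by linarith
 qed
 have o: "open {y \<in> S. w y = 0}"
  unfolding open_contains_ball
 proof clarify
  fix y assume y: "y \<in> S" "w y = 0"
  obtain R where R: "R > 0" "cball y R \<subseteq> S" using S(1) y(1) open_contains_cball by blast
  have "ball y (R / 2) \<subseteq> {y \<in> S. w y = 0}" using spread[OF R(2) y(2)] R by (auto simp: dist_commute)
  thus "\<exists>e>0. ball y e \<subseteq> {y \<in> S. w y = 0}" using R(1) half_gt_zero by blast
 qed
 have "open (S \<inter> w -` (- {0}))"
  by (rule continuous_open_preimage[OF cont S(1)]) (simp add: open_Compl)
 from connectedD[OF S(2) o this] have "{y \<in> S. w y = 0} \<inter> S = {} \<or> (S \<inter> w -` (- {0})) \<inter> S = {}" by auto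
 moreover have "z \<in> {y \<in> S. w y = 0} \<inter> S" using z by simp
 ultimately show ?thesis using x by auto
qed

lemma C2_with_ridge:
 fixes m :: "real^'n"
 assumes H: "\<And>s. (H has_real_derivative H' s) (at s)" "\<And>s. (H' has_real_derivative H'' s) (at s)"
 shows "C2_with S (\<lambda>x. H (m \<bullet> x - b)) (\<lambda>x. H' (m \<bullet> x - b) *\<^sub>R m) (\<lambda>i x. (H'' (m \<bullet> x - b) * m $ i) *\<^sub>R m)"
 unfolding C2_with_def
proof (intro ballI conjI allI)
 fix x :: "real^'n" and i :: 'n
 have L: "((\<lambda>x. m \<bullet> x - b) has_derivative (\<lambda>h. m \<bullet> h)) (at x)"
  by (rule derivative_eq_intros refl)+ auto
 show "((\<lambda>x. H (m \<bullet> x - b)) has_derivative (\<bullet>) (H' (m \<bullet> x - b) *\<^sub>R m)) (at x)"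
  using has_derivative_compose[OF L H(1)[unfolded has_field_derivative_def]] by (simp add: inner_scaleR_left_fun)
 have "((\<lambda>x. H' (m \<bullet> x - b) * m $ i) has_derivative (\<lambda>h. H'' (m \<bullet> x - b) * (m \<bullet> h) * m $ i)) (at x)"
  by (intro has_derivative_mult_left has_derivative_compose[OF L H(2)[unfolded has_field_derivative_def]])
 thus "((\<lambda>x. (H' (m \<bullet> x - b) *\<^sub>R m) $ i) has_derivative (\<bullet>) ((H'' (m \<bullet> x - b) * m $ i) *\<^sub>R m)) (at x)"
  by (simp add: inner_scaleR_left_fun mult_ac)
qed

text \<open>The function u equals the smallest multiple of \<phi> that lies above it. The quotient
of u and \<phi> is out of control near the boundary, where both vanish, so \<phi> is replaced by
\<open>\<phi> + \<delta> * g\<close>. Here \<open>1/2 \<le> g \<le> 1\<close>, and the Laplacian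
of g is at most \<open>- \<Lambda>\<close> with \<open>\<Lambda> > \<bar>\<mu>\<bar>\<close> in
the strips U of width \<epsilon> along the hyperplanes that contain the boundary. Let M be the
maximum of \<open>u / \<phi>\<close> on the compact rest K of the domain, or 0 if that is larger.
A maximum of \<open>u / (\<phi> + \<delta> * g)\<close> with a value above M would lie in a strip,
and the two equations exclude it there, since \<open>\<mu> \<le> \<theta>\<close>. As \<delta>
tends to 0 this gives \<open>u \<le> M * \<phi>\<close>, with equality at a point of K, hence
everywhere by the strong maximum principle.\<close>

lemma eigenfunction_positive_if_le:
 fixes \<phi> u :: "real^'n => real"
 assumes S: "open S" "connected S" "bounded S"
  and F: "finite F" "\<And>m b. (m, b) \<in> F ==> norm m = 1"
  and fr: "frontier S \<subseteq> (\<Union>(m, b)\<in>F. {x. m \<bullet> x = b})"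
  and \<phi>: "continuous_on (closure S) \<phi>" "C2_with S \<phi> p q"
   "\<And>x. x \<in> S ==> (\<Sum>i\<in>UNIV. q i x $ i) = - \<theta> * \<phi> x"
   "\<And>x. x \<in> frontier S ==> \<phi> x = 0" "\<And>x. x \<in> S ==> \<phi> x \<ge> 0" "x1 \<in> S" "\<phi> x1 > 0"
  and u: "continuous_on (closure S) u" "C2_with S u p' q'"
   "\<And>x. x \<in> S ==> (\<Sum>i\<in>UNIV. q' i x $ i) = - \<mu> * u x"
   "\<And>x. x \<in> frontier S ==> u x = 0" "x0 \<in> S" "u x0 > 0"
  and le: "\<mu> \<le> \<theta>" and x: "x \<in> S"
 shows "u x > 0"
proof -
 have pos: "\<phi> y > 0" if "y \<in> S" for y
 proof (rule ccontr)
  assume "\<not> \<phi> y > 0"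
  hence z: "\<phi> y = 0" using \<phi>(5)[OF that] by simp
  have "\<phi> x1 = 0"
  proof (rule strong_maximum_principle[OF S(1,2) \<phi>(2) \<phi>(5) _ _ that z \<phi>(6), of "\<bar>\<theta>\<bar>"])
   fix v assume v: "v \<in> S"
   show "(\<Sum>i\<in>UNIV. q i v $ i) \<le> \<bar>\<theta>\<bar> * \<phi> v"
    unfolding \<phi>(3)[OF v] using \<phi>(5)[OF v] by (intro mult_right_mono) auto
  qed auto
  with \<phi>(7) show False by simp
 qed
 define \<Lambda> where "\<Lambda> = \<bar>\<mu>\<bar> + 1"
 obtain B where B: "B > 0" "\<And>y. y \<in> closure S ==> norm y \<le> B"
  using S(3) by (metis bounded_closure bounded_normE bounded_pos)
 define D where "D = B + (\<Sum>(m, b)\<in>F. \<bar>b\<bar>)"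
 have D: "\<bar>m \<bullet> y - b\<bar> \<le> D" if "(m, b) \<in> F" "y \<in> closure S" for m b y
 proof -
  have "\<bar>b\<bar> \<le> (\<Sum>(m, b)\<in>F. \<bar>b\<bar>)"
   using member_le_sum[of "(m, b)" F "\<lambda>(m, b). \<bar>b\<bar>"] that F(1) by auto
  moreover have "\<bar>m \<bullet> y\<bar> \<le> B"
   using Cauchy_Schwarz_ineq2[of m y] F(2)[OF that(1)] B(2)[OF that(2)] by simp
  ultimately show ?thesis unfolding D_def by linarith
 qed
 have D0: "D \<ge> 0" unfolding D_def using B(1) by (intro add_nonneg_nonneg sum_nonneg) auto
 define N where "N = real (card F)"
 obtain \<epsilon> where e0: "\<epsilon> > 0" and e1: "N * (8 * \<epsilon> * \<Lambda>) * (\<epsilon> + D) < 1 / 2"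
 proof -
  have "((\<lambda>e. N * (8 * e * \<Lambda>) * (e + D)) \<longlongrightarrow> N * (8 * 0 * \<Lambda>) * (0 + D)) (at_right 0)"
   by (intro tendsto_intros)
  hence "\<forall>\<^sub>F e in at_right 0. N * (8 * e * \<Lambda>) * (e + D) < 1 / 2" by (rule order_tendstoD) simp
  hence "\<forall>\<^sub>F e in at_right 0. 0 < e \<and> N * (8 * e * \<Lambda>) * (e + D) < 1 / 2"
   using eventually_at_right_less by (rule eventually_elim2) simp
  thus ?thesis using that eventually_happens'[OF trivial_limit_at_right_real] by blast
 qed
 define \<kappa> where "\<kappa> = 8 * \<epsilon> * \<Lambda>"
 have \<kappa>: "\<kappa> > 0" "N * \<kappa> * (\<epsilon> + D) < 1 / 2" using e0 e1 by (auto simp: \<kappa>_def \<Lambda>_def intro!: mult_pos_pos)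
 \<comment> \<open>A smooth convex approximation of \<open>\<bar>s\<bar>\<close> whose curvature
 is concentrated at \<open>\<bar>s\<bar> < \<epsilon>\<close>; the factor \<kappa> makes the
 curvature there at least \<Lambda>.\<close>
 define H where "H s = sqrt (\<epsilon>\<^sup>2 + s\<^sup>2)" for s
 have rt: "\<epsilon>\<^sup>2 + s\<^sup>2 > 0" for s using e0 by (simp add: add_pos_nonneg)
 hence H: "H s > 0" "H s * H s = \<epsilon>\<^sup>2 + s\<^sup>2" for s using rt[of s] by (auto simp: H_def)
 define H2 where "H2 s = \<epsilon>\<^sup>2 / (H s * (H s * H s))" for s
 have dH: "(H has_real_derivative s / H s) (at s)" for s
  unfolding H_def using rt[of s] by (auto intro!: derivative_eq_intros simp: field_simps)
 have dH1: "((\<lambda>s. s / H s) has_real_derivative H2 s) (at s)" for s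
 proof -
  have "1 * H s - s * (s / H s) = (H s * H s - s * s) / H s" using H(1)[of s] by (simp add: diff_divide_distrib)
  also have "... = \<epsilon>\<^sup>2 / H s" unfolding H(2) by (simp add: power2_eq_square)
  finally have "(1 * H s - s * (s / H s)) / (H s * H s) = H2 s" by (simp add: H2_def)
  thus ?thesis using DERIV_divide[OF DERIV_ident dH, of s] H(1)[of s] by simp
 qed
 have H2pos: "H2 s \<ge> 0" for s unfolding H2_def using H(1)[of s] by simp
 have H2big: "\<kappa> * H2 s \<ge> \<Lambda>" if "\<bar>s\<bar> < \<epsilon>" for s
 proof -
  have "s\<^sup>2 \<le> \<epsilon>\<^sup>2" using that by (simp add: abs_le_square_iff[symmetric])
  hence "\<epsilon>\<^sup>2 + s\<^sup>2 \<le> 4 * \<epsilon>\<^sup>2" using zero_le_power2[of \<epsilon>] by linarith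
  hence "H s \<le> 2 * \<epsilon>" unfolding H_def using e0 by (intro real_le_lsqrt) (auto simp: power_mult_distrib)
  hence "H s * (H s * H s) \<le> (2 * \<epsilon>) * ((2 * \<epsilon>) * (2 * \<epsilon>))" using H(1)[of s] e0 by (intro mult_mono) auto
  hence "\<epsilon>\<^sup>2 / ((2 * \<epsilon>) * ((2 * \<epsilon>) * (2 * \<epsilon>))) \<le> H2 s"
   unfolding H2_def using H(1)[of s] by (intro divide_left_mono) (auto intro!: mult_pos_pos simp: e0)
  hence "\<kappa> * (\<epsilon>\<^sup>2 / ((2 * \<epsilon>) * ((2 * \<epsilon>) * (2 * \<epsilon>)))) \<le> \<kappa> * H2 s" using \<kappa>(1) by (intro mult_left_mono) auto
  thus ?thesis using e0 by (simp add: \<kappa>_def power2_eq_square)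
 qed
 define h where "h = (\<lambda>x. \<Sum>k\<in>F. H (fst k \<bullet> x - snd k))"
 define g where "g x = 1 - \<kappa> * h x" for x
 define ph where "ph x = (\<Sum>k\<in>F. ((fst k \<bullet> x - snd k) / H (fst k \<bullet> x - snd k)) *\<^sub>R fst k)" for x
 define qh where "qh i x = (\<Sum>k\<in>F. (H2 (fst k \<bullet> x - snd k) * fst k $ i) *\<^sub>R fst k)" for i x
 have Ch: "C2_with S h ph qh"
  unfolding h_def ph_def qh_def by (intro C2_with_sum F C2_with_ridge dH dH1)
 have Lh: "(\<Sum>i\<in>UNIV. qh i y $ i) = (\<Sum>k\<in>F. H2 (fst k \<bullet> y - snd k))" for y
 proof -
  have "(\<Sum>i\<in>UNIV. qh i y $ i) = (\<Sum>k\<in>F. \<Sum>i\<in>UNIV. H2 (fst k \<bullet> y - snd k) * (fst k $ i * fst k $ i))"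
   unfolding qh_def by (simp add: sum_component mult.assoc) (rule sum.swap)
  also have "... = (\<Sum>k\<in>F. H2 (fst k \<bullet> y - snd k) * (fst k \<bullet> fst k))"
   by (simp add: inner_vec_def sum_distrib_left)
  also have "... = (\<Sum>k\<in>F. H2 (fst k \<bullet> y - snd k))"
  proof (rule sum.cong)
   fix k assume "k \<in> F"
   hence "norm (fst k) = 1" using F(2)[of "fst k" "snd k"] by simp
   thus "H2 (fst k \<bullet> y - snd k) * (fst k \<bullet> fst k) = H2 (fst k \<bullet> y - snd k)"
    by (simp add: dot_square_norm)
  qed simp
  finally show ?thesis .
 qed
 define U where "U = (\<Union>(m, b)\<in>F. {x. \<bar>m \<bullet> x - b\<bar> < \<epsilon>})"
 have LU: "\<kappa> * (\<Sum>i\<in>UNIV. qh i y $ i) \<ge> \<Lambda>" if "y \<in> U" for y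
 proof -
  obtain m b where mb: "(m, b) \<in> F" "\<bar>m \<bullet> y - b\<bar> < \<epsilon>" using \<open>y \<in> U\<close> by (auto simp: U_def)
  have "H2 (m \<bullet> y - b) \<le> (\<Sum>k\<in>F. H2 (fst k \<bullet> y - snd k))"
   using member_le_sum[of "(m, b)" F "\<lambda>k. H2 (fst k \<bullet> y - snd k)"] mb(1) F(1) H2pos by auto
  hence "\<kappa> * H2 (m \<bullet> y - b) \<le> \<kappa> * (\<Sum>k\<in>F. H2 (fst k \<bullet> y - snd k))"
   using \<kappa>(1) by (intro mult_left_mono) auto
  thus ?thesis unfolding Lh using H2big[OF mb(2)] by linarith
 qed
 have h0: "h y \<ge> 0" for y unfolding h_def H_def by (intro sum_nonneg) auto
 have gle: "g y \<le> 1" for y unfolding g_def using h0[of y] \<kappa>(1) by simp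
 have gge: "g y \<ge> 1 / 2" if "y \<in> closure S" for y
 proof -
  have "h y \<le> (\<Sum>k\<in>F. \<epsilon> + D)"
   unfolding h_def
  proof (rule sum_mono)
   fix k assume k: "k \<in> F"
   have "H (fst k \<bullet> y - snd k) \<le> sqrt (\<epsilon>\<^sup>2) + sqrt ((fst k \<bullet> y - snd k)\<^sup>2)"
    unfolding H_def by (rule sqrt_add_le_add_sqrt) auto
   also have "... \<le> \<epsilon> + D" using e0 D[of "fst k" "snd k" y] k that by simp
   finally show "H (fst k \<bullet> y - snd k) \<le> \<epsilon> + D" .
  qed
  hence "h y \<le> N * (\<epsilon> + D)" by (simp add: N_def)
  hence "\<kappa> * h y \<le> \<kappa> * (N * (\<epsilon> + D))" using \<kappa>(1) by (intro mult_left_mono) auto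
  also have "... = N * \<kappa> * (\<epsilon> + D)" by simp
  finally show ?thesis unfolding g_def using \<kappa>(2) by linarith
 qed
 have contg: "continuous_on T g" for T unfolding g_def h_def H_def by (intro continuous_intros)
 define K where "K = closure S - U"
 have U: "open U" unfolding U_def
  by (intro open_UN ballI) (auto intro!: open_Collect_less continuous_intros)
 have K: "compact K" unfolding K_def using S(3) U by (simp add: compact_diff)
 have KS: "K \<subseteq> S"
 proof
  fix y assume y: "y \<in> K"
  have "y \<notin> frontier S"
  proof
   assume "y \<in> frontier S"
   then obtain m b where "(m, b) \<in> F" "m \<bullet> y = b" using fr by auto
   hence "y \<in> U" using e0 by (auto simp: U_def intro!: bexI[of _ "(m, b)"])
   thus False using y by (simp add: K_def)
  qed
  thus "y \<in> S" using y S(1) by (auto simp: K_def frontier_def interior_open)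
 qed
 have \<phi>0: "\<phi> y \<ge> 0" if "y \<in> closure S" for y
  using that \<phi>(4,5) S(1) by (cases "y \<in> S") (auto simp: frontier_def interior_open)
 obtain M where M: "M \<ge> 0" "\<And>y. y \<in> K ==> u y \<le> M * \<phi> y" "M > 0 ==> \<exists>y\<in>K. u y = M * \<phi> y"
 proof (cases "K = {}")
  case False
  have "continuous_on K (\<lambda>y. u y / \<phi> y)"
   using C2_with_continuous_on[OF \<phi>(2)] C2_with_continuous_on[OF u(2)] KS continuous_on_subset pos
   by (intro continuous_on_divide) (blast, blast, force)
  from continuous_attains_sup[OF K False this] obtain y
   where y: "y \<in> K" "\<And>v. v \<in> K ==> u v / \<phi> v \<le> u y / \<phi> y" by blast
  show ?thesis
  proof (rule that[of "max 0 (u y / \<phi> y)"])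
   show "u v \<le> max 0 (u y / \<phi> y) * \<phi> v" if "v \<in> K" for v
   proof -
    have "u v \<le> u y / \<phi> y * \<phi> v" using y(2)[OF that] pos[of v] that KS by (simp add: pos_divide_le_eq subset_iff)
    also have "... \<le> max 0 (u y / \<phi> y) * \<phi> v" using pos[of v] that KS by (intro mult_right_mono) force+
    finally show ?thesis .
   qed
   show "\<exists>v\<in>K. u v = max 0 (u y / \<phi> y) * \<phi> v" if "max 0 (u y / \<phi> y) > 0"
    using that y(1) pos[of y] KS by (intro bexI[of _ y]) (auto simp: max_def split: if_splits)
  qed simp
 qed (use that[of 0] in auto)
 have barrier: "u y \<le> M * (\<phi> y + \<delta> * g y)" if \<delta>: "\<delta> > 0" and y: "y \<in> S" for \<delta> y
 proof (rule ccontr)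
  assume n: "\<not> u y \<le> M * (\<phi> y + \<delta> * g y)"
  define \<psi> where "\<psi> x = \<phi> x + \<delta> * g x" for x
  have \<psi>: "\<psi> x > 0" if "x \<in> closure S" for x
   using \<phi>0[OF that] gge[OF that] \<delta> unfolding \<psi>_def by (intro add_nonneg_pos mult_pos_pos) auto
  have ycl: "y \<in> closure S" using y closure_subset by blast
  have "\<exists>z\<in>closure S. \<forall>v\<in>closure S. u v / \<psi> v \<le> u z / \<psi> z"
  proof (rule continuous_attains_sup)
   show "continuous_on (closure S) (\<lambda>x. u x / \<psi> x)"
    using \<psi> unfolding \<psi>_def by (intro continuous_intros \<phi>(1) u(1) contg) force
  qed (use S(3) ycl in auto)
  then obtain z where z: "z \<in> closure S" "\<And>v. v \<in> closure S ==> u v / \<psi> v \<le> u z / \<psi> z" by blast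
  define m where "m = u z / \<psi> z"
  have uz: "u z = m * \<psi> z" using \<psi>[OF z(1)] by (simp add: m_def)
  have "M < u y / \<psi> y" using n \<psi>[OF ycl] by (simp add: \<psi>_def pos_less_divide_eq)
  also have "... \<le> m" unfolding m_def by (rule z(2)[OF ycl])
  finally have m: "m > M" .
  have "z \<notin> frontier S" using uz u(4)[of z] \<psi>[OF z(1)] m M(1) by auto
  moreover have "z \<notin> K"
  proof
   assume zK: "z \<in> K"
   have "M * \<phi> z \<le> M * \<psi> z" using M(1) \<delta> gge[OF z(1)] by (intro mult_left_mono) (auto simp: \<psi>_def)
   also have "... < m * \<psi> z" using m \<psi>[OF z(1)] by simp
   finally show False using M(2)[OF zK] uz by simp
  qed
  ultimately have zS: "z \<in> S" and zU: "z \<in> U"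
   using z(1) S(1) by (auto simp: K_def frontier_def interior_open)
  have "(\<Sum>i\<in>UNIV. (1 *\<^sub>R (m *\<^sub>R q i z + (-1) *\<^sub>R q' i z) + (- m * \<delta> * \<kappa>) *\<^sub>R qh i z) $ i) \<ge> 0"
  proof (rule C2_with_local_min[OF S(1) C2_with_lincomb[OF C2_with_lincomb[OF \<phi>(2) u(2)] Ch] zS])
   fix v assume "v \<in> S"
   hence v: "v \<in> closure S" using closure_subset by blast
   have "u v \<le> m * \<psi> v" using z(2)[OF v] \<psi>[OF v] by (simp add: m_def pos_divide_le_eq)
   thus "1 * (m * \<phi> z + (-1) * u z) + (- m * \<delta> * \<kappa>) * h z \<le> 1 * (m * \<phi> v + (-1) * u v) + (- m * \<delta> * \<kappa>) * h v"
    using uz by (simp add: \<psi>_def g_def algebra_simps)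
  qed
  moreover have "(\<Sum>i\<in>UNIV. (1 *\<^sub>R (m *\<^sub>R q i z + (-1) *\<^sub>R q' i z) + (- m * \<delta> * \<kappa>) *\<^sub>R qh i z) $ i)
   = m * (\<Sum>i\<in>UNIV. q i z $ i) - (\<Sum>i\<in>UNIV. q' i z $ i) - m * \<delta> * (\<kappa> * (\<Sum>i\<in>UNIV. qh i z $ i))"
   by (simp add: sum_subtractf sum_distrib_left mult.assoc)
  ultimately have "0 \<le> m * ((\<mu> - \<theta>) * \<phi> z + \<delta> * (\<mu> * g z - \<kappa> * (\<Sum>i\<in>UNIV. qh i z $ i)))"
   unfolding \<phi>(3)[OF zS] u(3)[OF zS] uz \<psi>_def by (simp add: algebra_simps)
  hence "0 \<le> (\<mu> - \<theta>) * \<phi> z + \<delta> * (\<mu> * g z - \<kappa> * (\<Sum>i\<in>UNIV. qh i z $ i))"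
   using m M(1) by (simp add: zero_le_mult_iff)
  moreover have "(\<mu> - \<theta>) * \<phi> z \<le> 0" using le \<phi>0[OF z(1)] by (simp add: mult_nonpos_nonneg)
  moreover have "\<mu> * g z \<le> \<bar>\<mu>\<bar> * 1" using gle[of z] gge[OF z(1)] by (intro mult_mono) auto
  hence "\<delta> * (\<mu> * g z - \<kappa> * (\<Sum>i\<in>UNIV. qh i z $ i)) < 0"
   using LU[OF zU] \<delta> by (intro mult_pos_neg) (auto simp: \<Lambda>_def)
  ultimately show False by linarith
 qed
 have uM: "u y \<le> M * \<phi> y" if y: "y \<in> S" for y
 proof (rule field_le_epsilon)
  fix e :: real assume e: "e > 0"
  define \<delta> where "\<delta> = e / (M + 1)"
  have \<delta>: "\<delta> > 0" "M * \<delta> \<le> e" using e M(1) by (auto simp: \<delta>_def pos_divide_le_eq algebra_simps)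
  have "M * \<delta> * g y \<le> M * \<delta> * 1" using gle[of y] M(1) \<delta>(1) by (intro mult_left_mono) auto
  thus "u y \<le> M * \<phi> y + e" using barrier[OF \<delta>(1) y] \<delta>(2) by (simp add: algebra_simps)
 qed
 have "M > 0" using uM[OF u(5)] u(6) M(1) by (cases "M = 0") auto
 then obtain y where y: "y \<in> S" "M * \<phi> y + (-1) * u y = 0" using M(3) KS by auto
 have "M * \<phi> x + (-1) * u x = 0"
 proof (rule strong_maximum_principle[OF S(1,2) C2_with_lincomb[OF \<phi>(2) u(2)] _ _ _ y x, of "\<bar>\<mu>\<bar>"])
  fix v assume v: "v \<in> S"
  show "M * \<phi> v + (-1) * u v \<ge> 0" using uM[OF v] by simp
  hence "- \<mu> * (M * \<phi> v + (-1) * u v) \<le> \<bar>\<mu>\<bar> * (M * \<phi> v + (-1) * u v)" by (intro mult_right_mono) auto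
  moreover have "M * (\<mu> * \<phi> v) \<le> M * (\<theta> * \<phi> v)" using le \<phi>(5)[OF v] M(1) by (intro mult_left_mono mult_right_mono) auto
  moreover have "(\<Sum>i\<in>UNIV. (M *\<^sub>R q i v + (-1) *\<^sub>R q' i v) $ i) = - (M * (\<theta> * \<phi> v)) + \<mu> * u v"
   using \<phi>(3)[OF v] u(3)[OF v] by (simp add: sum_subtractf sum_distrib_left[symmetric])
  ultimately show "(\<Sum>i\<in>UNIV. (M *\<^sub>R q i v + (-1) *\<^sub>R q' i v) $ i) \<le> \<bar>\<mu>\<bar> * (M * \<phi> v + (-1) * u v)"
   by (simp add: algebra_simps)
 qed auto
 thus ?thesis using mult_pos_pos[OF \<open>M > 0\<close> pos[OF x]] by simp
qed

section \<open>Ground states of symmetric matrices, and the cubic lattice\<close>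

lemma linear_coeff_zero_if_quadratic_nonneg:
 fixes a b :: real
 assumes "\<And>t. a * t + b * t\<^sup>2 \<ge> 0"
 shows "a = 0"
proof (rule ccontr)
 assume a: "a \<noteq> 0"
 define c where "c = \<bar>b\<bar> + 1"
 have c: "c > 0" "b < c" by (auto simp: c_def)
 have "a * (- a / c) + b * (- a / c)\<^sup>2 = a\<^sup>2 / c * (b / c - 1)"
  by (simp add: power2_eq_square right_diff_distrib power_divide)
 also have "... < 0" using a c by (intro mult_pos_neg) (auto simp: divide_less_eq)
 finally show False using assms[of "- a / c"] by simp
qed

text \<open>The vector maximises the quadratic form on the unit sphere. Passing to absolute values
does not decrease the form, because the entries are nonnegative, and at a maximum the first
variation in every coordinate vanishes.\<close>

lemma symmetric_nonneg_matrix_eigenvector: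
 fixes A :: "'b => 'b => real"
 assumes S: "finite S" "S \<noteq> {}"
  and sym: "\<And>x y. x \<in> S ==> y \<in> S ==> A x y = A y x"
  and nn: "\<And>x y. x \<in> S ==> y \<in> S ==> A x y \<ge> 0"
 obtains \<theta> v where "\<And>x. x \<in> S ==> v x \<ge> 0" "\<exists>x\<in>S. v x > 0"
  "\<And>x. x \<in> S ==> (\<Sum>y\<in>S. A x y * v y) = \<theta> * v x"
  "\<And>w. (\<Sum>x\<in>S. w x * (\<Sum>y\<in>S. A x y * w y)) \<le> \<theta> * (\<Sum>x\<in>S. (w x)\<^sup>2)"
proof -
 define Q where "Q w = (\<Sum>x\<in>S. w x * (\<Sum>y\<in>S. A x y * w y))" for w
 define N where "N w = (\<Sum>x\<in>S. (w x)\<^sup>2)" for w :: "'b => real"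
 define V where "V = {w. N w = 1}"
 have le1: "\<bar>w x\<bar> \<le> 1" if "w \<in> V" "x \<in> S" for w x
 proof -
  have "(w x)\<^sup>2 \<le> N w" unfolding N_def by (rule member_le_sum) (use S that in auto)
  thus ?thesis using that by (simp add: V_def abs_square_le_1)
 qed
 have Qb: "Q w \<le> (\<Sum>x\<in>S. \<Sum>y\<in>S. A x y)" if w: "w \<in> V" for w
  unfolding Q_def sum_distrib_left
 proof (intro sum_mono)
  fix x y assume xy: "x \<in> S" "y \<in> S"
  have "w x * w y \<le> \<bar>w x\<bar> * \<bar>w y\<bar>" by (metis abs_ge_self abs_mult)
  also have "... \<le> 1 * 1" using le1[OF w] xy by (intro mult_mono) auto
  finally have "A x y * (w x * w y) \<le> A x y * 1" using nn[OF xy] by (intro mult_left_mono) auto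
  thus "w x * (A x y * w y) \<le> A x y" by (simp add: mult_ac)
 qed
 obtain x0 where x0: "x0 \<in> S" using S by auto
 have "(\<lambda>x. if x = x0 then 1 else 0) \<in> V"
  unfolding V_def N_def using x0 S by (simp add: if_distrib[of "\<lambda>t. t\<^sup>2"] cong: if_cong)
 hence Vne: "V \<noteq> {}" by blast
 define \<theta> where "\<theta> = Sup (Q ` V)"
 have bdd: "bdd_above (Q ` V)" using Qb by (auto intro!: bdd_aboveI)
 have up: "Q w \<le> \<theta>" if "w \<in> V" for w unfolding \<theta>_def using that bdd by (intro cSup_upper) auto
 have "\<exists>w\<in>V. Q w > \<theta> - inverse (real (Suc k))" for k
 proof -
  have "\<theta> - inverse (real (Suc k)) < \<theta>" by simp
  thus ?thesis unfolding \<theta>_def using less_cSup_iff[of "Q ` V"] Vne bdd by auto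
 qed
 then obtain W where W: "\<And>k. W k \<in> V" "\<And>k. Q (W k) > \<theta> - inverse (real (Suc k))" by metis
 obtain r where r: "strict_mono (r :: nat => nat)" "\<And>x. x \<in> S ==> \<exists>l. (\<lambda>n. W (r n) x) \<longlonglongrightarrow> l"
  using function_convergent_subsequence[of S W 1] le1 W(1) S countable_finite by (metis real_norm_def)
 then obtain v where v: "\<And>x. x \<in> S ==> (\<lambda>n. W (r n) x) \<longlonglongrightarrow> v x" by metis
 have limQ: "(\<lambda>n. Q (W (r n))) \<longlonglongrightarrow> Q v" unfolding Q_def by (intro tendsto_intros v)
 have limN: "(\<lambda>n. N (W (r n))) \<longlonglongrightarrow> N v" unfolding N_def by (intro tendsto_intros v)
 have Nv: "N v = 1"
  using limN W(1) by (simp add: V_def LIMSEQ_const_iff)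
 have "Q v \<ge> \<theta>"
 proof (rule LIMSEQ_le)
  have "(\<lambda>n. \<theta> - inverse (real (Suc (r n)))) \<longlonglongrightarrow> \<theta> - 0"
   by (intro tendsto_intros LIMSEQ_subseq_LIMSEQ[OF LIMSEQ_inverse_real_of_nat r(1), unfolded o_def])
  thus "(\<lambda>n. \<theta> - inverse (real (Suc (r n)))) \<longlonglongrightarrow> \<theta>" by simp
  show "\<exists>N. \<forall>n\<ge>N. \<theta> - inverse (real (Suc (r n))) \<le> Q (W (r n))" using W(2) less_imp_le by blast
 qed (rule limQ)
 define u where "u x = \<bar>v x\<bar>" for x
 have Nu: "N u = 1" using Nv by (simp add: N_def u_def)
 have "Q v \<le> Q u"
  unfolding Q_def sum_distrib_left
 proof (intro sum_mono)
  fix x y assume xy: "x \<in> S" "y \<in> S"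
  have "A x y * (v x * v y) \<le> A x y * (u x * u y)"
   using nn[OF xy] unfolding u_def by (intro mult_left_mono) (auto simp: abs_mult[symmetric])
  thus "v x * (A x y * v y) \<le> u x * (A x y * u y)" by (simp add: mult_ac)
 qed
 hence Qu: "Q u = \<theta>" using \<open>Q v \<ge> \<theta>\<close> up[of u] Nu by (simp add: V_def)
 have R: "Q w \<le> \<theta> * N w" for w
 proof (cases "N w = 0")
  case True
  hence "w x = 0" if "x \<in> S" for x using that S unfolding N_def by (simp add: sum_nonneg_eq_0_iff)
  thus ?thesis using True by (simp add: Q_def)
 next
  case False
  have N0: "N w > 0" using False unfolding N_def by (simp add: sum_nonneg order_less_le)
  define c where "c = sqrt (N w)"
  have c: "c > 0" "c\<^sup>2 = N w" using N0 by (auto simp: c_def)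
  have "(\<lambda>x. w x / c) \<in> V"
   using c False by (simp add: V_def N_def power_divide sum_divide_distrib[symmetric])
  hence "Q (\<lambda>x. w x / c) \<le> \<theta>" by (rule up)
  moreover have "Q (\<lambda>x. w x / c) = Q w / c\<^sup>2"
   unfolding Q_def by (simp add: sum_divide_distrib sum_distrib_left power2_eq_square)
  ultimately show ?thesis using c N0 by (simp add: divide_le_eq mult.commute)
 qed
 have eig: "(\<Sum>y\<in>S. A x y * u y) = \<theta> * u x" if x: "x \<in> S" for x
 proof -
  define L where "L = (\<Sum>y\<in>S. A x y * u y)"
  have "(2 * \<theta> * u x - 2 * L) * t + (\<theta> - A x x) * t\<^sup>2 \<ge> 0" for t
  proof -
   define w where "w y = u y + (if y = x then t else 0)" for y
   have "N w = (\<Sum>y\<in>S. (u y)\<^sup>2 + (if y = x then 2 * t * u x + t\<^sup>2 else 0))"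
    unfolding N_def w_def by (intro sum.cong) (auto simp: power2_eq_square algebra_simps)
   hence Nw: "N w = 1 + 2 * t * u x + t\<^sup>2"
    using x S Nu by (simp add: sum.distrib N_def)
   have in1: "(\<Sum>y\<in>S. A z y * w y) = (\<Sum>y\<in>S. A z y * u y) + A z x * t" if "z \<in> S" for z
   proof -
    have "(\<Sum>y\<in>S. A z y * w y) = (\<Sum>y\<in>S. A z y * u y + (if y = x then A z x * t else 0))"
     unfolding w_def by (intro sum.cong) (auto simp: algebra_simps)
    thus ?thesis using x S by (simp add: sum.distrib)
   qed
   have "Q w = (\<Sum>z\<in>S. w z * ((\<Sum>y\<in>S. A z y * u y) + A z x * t))"
    unfolding Q_def using in1 by (intro sum.cong) auto
   also have "... = (\<Sum>z\<in>S. (u z * (\<Sum>y\<in>S. A z y * u y) + t * (A z x * u z))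
     + (if z = x then t * (L + A x x * t) else 0))"
    unfolding w_def L_def by (intro sum.cong) (auto simp: algebra_simps)
   also have "... = Q u + t * (\<Sum>z\<in>S. A z x * u z) + t * (L + A x x * t)"
    using x S by (simp add: sum.distrib Q_def sum_distrib_left)
   also have "(\<Sum>z\<in>S. A z x * u z) = L" unfolding L_def using sym x by (intro sum.cong) auto
   finally have Qw: "Q w = \<theta> + 2 * t * L + A x x * t\<^sup>2" using Qu by (simp add: power2_eq_square algebra_simps)
   show ?thesis using R[of w] unfolding Nw Qw by (simp add: algebra_simps)
  qed
  from linear_coeff_zero_if_quadratic_nonneg[OF this] show ?thesis by (simp add: L_def)
 qed
 have "\<exists>x\<in>S. u x > 0"
 proof (rule ccontr)
  assume "\<not> ?thesis"
  hence "u x = 0" if "x \<in> S" for x using that by (auto simp: u_def)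
  hence "N u = 0" by (simp add: N_def)
  with Nu show False by simp
 qed
 thus ?thesis using that[of u \<theta>] eig R by (auto simp: u_def Q_def N_def)
qed

definition lattice :: "real => (real^'n) set" where
 "lattice h = {x. \<forall>i. x $ i / h \<in> \<int>}"

lemma finite_if_separated:
 fixes S :: "'a::euclidean_space set"
 assumes "bounded S" "d > 0" "\<And>x y. x \<in> S ==> y \<in> S ==> x \<noteq> y ==> dist x y \<ge> d"
 shows "finite S"
proof (rule ccontr)
 assume "infinite S"
 then obtain x where "x islimpt S" using assms(1) bounded_infinite_imp_islimpt by blast
 hence inf: "infinite (S \<inter> ball x (d / 2))" using assms(2) islimpt_eq_infinite_ball half_gt_zero by blast
 then obtain y where y: "y \<in> S \<inter> ball x (d / 2)" using infinite_imp_nonempty by blast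
 from inf have "infinite (S \<inter> ball x (d / 2) - {y})" by simp
 then obtain z where z: "z \<in> S \<inter> ball x (d / 2) - {y}" using infinite_imp_nonempty by blast
 have "dist y z < d" using y z dist_triangle2[of y z x] by (auto simp: dist_commute)
 with assms(3)[of y z] y z show False by auto
qed

lemma lattice_step:
 assumes "x \<in> lattice h" "h > 0"
 shows "x + h *\<^sub>R axis i 1 \<in> lattice h" "x - h *\<^sub>R axis i 1 \<in> lattice h"
proof -
 have "(x + h *\<^sub>R axis i 1) $ j / h = x $ j / h + (if j = i then 1 else 0)" for j
  using assms(2) by (simp add: axis_def add_divide_distrib)
 thus "x + h *\<^sub>R axis i 1 \<in> lattice h" using assms(1) by (auto simp: lattice_def)
 have "(x - h *\<^sub>R axis i 1) $ j / h = x $ j / h - (if j = i then 1 else 0)" for j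
  using assms(2) by (simp add: axis_def diff_divide_distrib)
 thus "x - h *\<^sub>R axis i 1 \<in> lattice h" using assms(1) by (auto simp: lattice_def)
qed

lemma lattice_separated:
 assumes "x \<in> lattice h" "y \<in> lattice h" "x \<noteq> y" "h > 0"
 shows "dist x y \<ge> h"
proof -
 obtain i where i: "x $ i \<noteq> y $ i" using assms(3) by (metis vec_eq_iff)
 obtain a b :: int where ab: "x $ i / h = a" "y $ i / h = b"
  using assms(1,2) unfolding lattice_def mem_Collect_eq by (metis Ints_cases)
 hence xy: "x $ i = h * a" "y $ i = h * b" using assms(4) by (auto simp: field_simps)
 have "\<bar>a - b\<bar> \<ge> 1" using i xy by auto
 hence "\<bar>real_of_int a - b\<bar> \<ge> 1" by linarith
 hence "h * 1 \<le> h * \<bar>real_of_int a - b\<bar>" using assms(4) by (intro mult_left_mono) auto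
 also have "... = \<bar>x $ i - y $ i\<bar>" unfolding xy right_diff_distrib[symmetric] abs_mult using assms(4) by simp
 also have "... \<le> dist x y" using dist_vec_nth_le[of x i y] by (simp add: dist_real_def)
 finally show ?thesis by simp
qed

definition lattice_floor :: "real => real^'n => real^'n" where
 "lattice_floor h x = (\<chi> i. h * of_int \<lfloor>x $ i / h\<rfloor>)"

lemma lattice_floor_in: "h > 0 ==> lattice_floor h x \<in> lattice h"
 by (simp add: lattice_floor_def lattice_def)

lemma lattice_floor_component:
 assumes "h > 0" shows "\<bar>x $ i - lattice_floor h x $ i\<bar> \<le> h"
proof -
 have "\<bar>x $ i / h - of_int \<lfloor>x $ i / h\<rfloor>\<bar> \<le> 1" by linarith
 hence "h * \<bar>x $ i / h - of_int \<lfloor>x $ i / h\<rfloor>\<bar> \<le> h * 1" using assms by (intro mult_left_mono) auto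
 moreover have "h * \<bar>x $ i / h - of_int \<lfloor>x $ i / h\<rfloor>\<bar> = \<bar>x $ i - h * of_int \<lfloor>x $ i / h\<rfloor>\<bar>"
 proof -
  have "h * \<bar>x $ i / h - of_int \<lfloor>x $ i / h\<rfloor>\<bar> = \<bar>h * (x $ i / h - of_int \<lfloor>x $ i / h\<rfloor>)\<bar>"
   using assms by (simp only: abs_mult abs_of_pos)
  also have "h * (x $ i / h - of_int \<lfloor>x $ i / h\<rfloor>) = x $ i - h * of_int \<lfloor>x $ i / h\<rfloor>"
   using assms by (simp add: right_diff_distrib)
  finally show ?thesis .
 qed
 ultimately show ?thesis by (simp add: lattice_floor_def)
qed

lemma dist_lattice_floor:
 fixes x :: "real^'n"
 assumes "h > 0" shows "dist x (lattice_floor h x) \<le> real CARD('n) * h"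
proof -
 have "dist x (lattice_floor h x) \<le> (\<Sum>i\<in>UNIV. \<bar>(x - lattice_floor h x) $ i\<bar>)"
  unfolding dist_norm by (rule norm_le_l1_cart)
 also have "... \<le> (\<Sum>i\<in>(UNIV :: 'n set). h)"
  using lattice_floor_component[OF assms] by (intro sum_mono) simp
 finally show ?thesis by simp
qed

section \<open>Ground states of a domain on the lattice\<close>

text \<open>The value at y as seen from its lattice neighbour x: an edge that leaves \<Omega>
carries the boundary value 0, also when both of its ends lie in \<Omega>, which may have points on
both sides of a face.\<close>

definition uncut :: "(real^'n) set => (real^'n => real) => real^'n => real^'n => real" where
 "uncut \<Omega> v x y = (if closed_segment x y \<subseteq> \<Omega> then v y else 0)"

definition neighbour_sum :: "(real^'n) set => real => (real^'n => real) => real^'n => real" where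
 "neighbour_sum \<Omega> h v x =
   (\<Sum>i\<in>UNIV. uncut \<Omega> v x (x + h *\<^sub>R axis i 1) + uncut \<Omega> v x (x - h *\<^sub>R axis i 1))"

text \<open>With cut edges read as 0 this is the difference equation for the eigenvalue l of the
Dirichlet problem on the lattice of mesh h.\<close>

definition lattice_eigenfunction ::
 "(real^'n) set => real => real => (real^'n => real) => bool" where
 "lattice_eigenfunction \<Omega> h l v \<longleftrightarrow>
   (\<forall>x. 0 \<le> v x \<and> v x \<le> 1) \<and> (\<forall>x. x \<notin> \<Omega> \<inter> lattice h --> v x = 0) \<and>
   (\<forall>x\<in>\<Omega> \<inter> lattice h. neighbour_sum \<Omega> h v x = (2 * real CARD('n) - h\<^sup>2 * l) * v x)"

text \<open>The eigenvector of the adjacency matrix, scaled to have maximum 1. At its maximum the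
neighbour sum is at most \<open>2 * CARD('n)\<close>, whence \<open>l \<ge> 0\<close>. The
variational inequality is kept, because it bounds l from above.\<close>

lemma lattice_eigenfunction_exists:
 fixes \<Omega> :: "(real^'n) set"
 assumes b: "bounded \<Omega>" and h: "h > 0" and ne: "\<Omega> \<inter> lattice h \<noteq> {}"
 obtains l v where "lattice_eigenfunction \<Omega> h l v" "\<exists>x\<in>\<Omega> \<inter> lattice h. v x = 1" "l \<ge> 0"
  "\<And>w. (\<And>x. x \<notin> \<Omega> \<inter> lattice h ==> w x = 0) ==>
    (\<Sum>x\<in>\<Omega> \<inter> lattice h. w x * neighbour_sum \<Omega> h w x) \<le>
    (2 * real CARD('n) - h\<^sup>2 * l) * (\<Sum>x\<in>\<Omega> \<inter> lattice h. (w x)\<^sup>2)"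
proof -
 define S where "S = \<Omega> \<inter> lattice h"
 have S: "finite S" unfolding S_def
 proof (rule finite_if_separated[OF _ h])
  show "bounded (\<Omega> \<inter> lattice h)" using b by (meson bounded_Int)
 qed (use lattice_separated h in auto)
 have S0: "S \<noteq> {}" using ne by (simp add: S_def)
 define P where "P i x y \<longleftrightarrow> y = x + h *\<^sub>R axis i 1 \<and> closed_segment x y \<subseteq> \<Omega>" for i :: 'n and x y :: "real^'n"
 define A where "A x y = (\<Sum>i\<in>UNIV. of_bool (P i x y) + of_bool (P i y x) :: real)" for x y
 have sym: "A x y = A y x" for x y unfolding A_def by (simp add: add.commute)
 have nn: "A x y \<ge> 0" for x y unfolding A_def by (intro sum_nonneg) auto
 have Aw: "(\<Sum>y\<in>S. A x y * w y) = neighbour_sum \<Omega> h w x"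
  if w: "\<And>x. x \<notin> S ==> w x = 0" for w x
 proof -
  have 1: "(\<Sum>y\<in>S. of_bool (P i x y) * w y) = uncut \<Omega> w x (x + h *\<^sub>R axis i 1)" for i
  proof -
   have "(\<Sum>y\<in>S. of_bool (P i x y) * w y) = (\<Sum>y\<in>S. if y = x + h *\<^sub>R axis i 1 then uncut \<Omega> w x y else 0)"
    by (intro sum.cong) (auto simp: P_def uncut_def)
   also have "... = uncut \<Omega> w x (x + h *\<^sub>R axis i 1)"
    using S w by (auto simp: uncut_def)
   finally show ?thesis .
  qed
  have 2: "(\<Sum>y\<in>S. of_bool (P i y x) * w y) = uncut \<Omega> w x (x - h *\<^sub>R axis i 1)" for i
  proof -
   have "(\<Sum>y\<in>S. of_bool (P i y x) * w y) = (\<Sum>y\<in>S. if y = x - h *\<^sub>R axis i 1 then uncut \<Omega> w x y else 0)"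
    by (intro sum.cong) (auto simp: P_def uncut_def closed_segment_commute)
   also have "... = uncut \<Omega> w x (x - h *\<^sub>R axis i 1)"
    using S w by (auto simp: uncut_def)
   finally show ?thesis .
  qed
  have "(\<Sum>y\<in>S. A x y * w y) = (\<Sum>i\<in>UNIV. \<Sum>y\<in>S. of_bool (P i x y) * w y + of_bool (P i y x) * w y)"
   unfolding A_def sum_distrib_right by (subst sum.swap) (simp add: distrib_right)
  thus ?thesis by (simp only: sum.distrib 1 2 neighbour_sum_def)
 qed
 obtain \<theta> u where u: "\<And>x. x \<in> S ==> u x \<ge> 0" "\<exists>x\<in>S. u x > 0"
  "\<And>x. x \<in> S ==> (\<Sum>y\<in>S. A x y * u y) = \<theta> * u x"
  "\<And>w. (\<Sum>x\<in>S. w x * (\<Sum>y\<in>S. A x y * w y)) \<le> \<theta> * (\<Sum>x\<in>S. (w x)\<^sup>2)"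
 proof (rule symmetric_nonneg_matrix_eigenvector[OF S S0, of A])
  fix u \<theta>
  assume "\<And>x. x \<in> S ==> u x \<ge> 0" "\<exists>x\<in>S. u x > 0"
   "\<And>x. x \<in> S ==> (\<Sum>y\<in>S. A x y * u y) = \<theta> * u x"
   "\<And>w. (\<Sum>x\<in>S. w x * (\<Sum>y\<in>S. A x y * w y)) \<le> \<theta> * (\<Sum>x\<in>S. (w x)\<^sup>2)"
  thus thesis by (rule that)
 qed (rule sym nn)+
 obtain x0 where x0: "x0 \<in> S" "\<And>x. x \<in> S ==> u x \<le> u x0"
 proof -
  have "Max (u ` S) \<in> u ` S" using S S0 by (intro Max_in) auto
  then obtain x0 where "x0 \<in> S" "Max (u ` S) = u x0" by auto
  thus ?thesis using that S by (metis Max_ge finite_imageI imageI)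
 qed
 have ux0: "u x0 > 0" using u(2) x0(2) by force
 define v where "v x = (if x \<in> S then u x / u x0 else 0)" for x
 define l where "l = (2 * real CARD('n) - \<theta>) / h\<^sup>2"
 have \<theta>: "\<theta> = 2 * real CARD('n) - h\<^sup>2 * l" using h by (simp add: l_def)
 have v0: "v x = 0" if "x \<notin> S" for x using that by (simp add: v_def)
 have v01: "0 \<le> v x \<and> v x \<le> 1" for x using u(1) x0(2) ux0 by (auto simp: v_def)
 have eig: "neighbour_sum \<Omega> h v x = \<theta> * v x" if "x \<in> S" for x
 proof -
  have "neighbour_sum \<Omega> h v x = (\<Sum>y\<in>S. A x y * v y)" using Aw[of v x] v0 by simp
  also have "... = (\<Sum>y\<in>S. A x y * u y) / u x0"
   by (simp add: v_def sum_divide_distrib cong: sum.cong)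
  finally show ?thesis using u(3)[OF that] that by (simp add: v_def)
 qed
 have un: "uncut \<Omega> v x y \<le> 1" for x y using v01 by (auto simp: uncut_def)
 have "neighbour_sum \<Omega> h v x0 \<le> (\<Sum>i\<in>(UNIV :: 'n set). 1 + 1)"
  unfolding neighbour_sum_def by (intro sum_mono add_mono un)
 moreover have "v x0 = 1" using x0(1) ux0 by (simp add: v_def)
 ultimately have "\<theta> \<le> 2 * real CARD('n)" using eig[OF x0(1)] by simp
 hence l0: "l \<ge> 0" using h by (simp add: l_def)
 show ?thesis
 proof (rule that[of l v])
  show "lattice_eigenfunction \<Omega> h l v"
   unfolding lattice_eigenfunction_def using v01 v0 eig \<theta> by (simp add: S_def)
  show "\<exists>x\<in>\<Omega> \<inter> lattice h. v x = 1" using x0(1) \<open>v x0 = 1\<close> S_def by blast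
  show "l \<ge> 0" by (rule l0)
 next
  fix w :: "real^'n => real" assume w: "\<And>x. x \<notin> \<Omega> \<inter> lattice h ==> w x = 0"
  show "(\<Sum>x\<in>\<Omega> \<inter> lattice h. w x * neighbour_sum \<Omega> h w x) \<le>
    (2 * real CARD('n) - h\<^sup>2 * l) * (\<Sum>x\<in>\<Omega> \<inter> lattice h. (w x)\<^sup>2)"
   using u(4)[of w] Aw[of w] w unfolding \<theta>[symmetric] by (simp add: S_def)
 qed
qed

text \<open>The test function is a product of cosines that vanishes on the faces of a cube inside
\<Omega>. Without truncation it is an eigenfunction of the neighbour sum for \<open>2 * CARD('n) *
cos (\<beta> * h)\<close>; truncation to the cube only increases the neighbour sums, since just
outside the cube one of the cosines is not positive.\<close>

lemma lattice_eigenvalue_bound: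
 fixes \<Omega> :: "(real^'n) set"
 assumes r: "r > 0" and cube: "\<And>x. (\<And>i. \<bar>x $ i - a $ i\<bar> < r) ==> x \<in> \<Omega>"
  and h: "0 < h" "h < r" and fin: "finite (\<Omega> \<inter> lattice h)"
  and R: "\<And>w. (\<And>x. x \<notin> \<Omega> \<inter> lattice h ==> w x = 0) ==>
    (\<Sum>x\<in>\<Omega> \<inter> lattice h. w x * neighbour_sum \<Omega> h w x) \<le>
    (2 * real CARD('n) - h\<^sup>2 * l) * (\<Sum>x\<in>\<Omega> \<inter> lattice h. (w x)\<^sup>2)"
 shows "l \<le> real CARD('n) * (pi / (2 * r))\<^sup>2"
proof -
 define S where "S = \<Omega> \<inter> lattice h"
 define \<beta> where "\<beta> = pi / (2 * r)"
 have \<beta>: "\<beta> > 0" "\<beta> * r = pi / 2" using r by (auto simp: \<beta>_def)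
 define Q where "Q = {x. \<forall>i. \<bar>x $ i - a $ i\<bar> < r}"
 define c where "c x i = cos (\<beta> * (x $ i - a $ i))" for x and i :: 'n
 define w where "w x = (if x \<in> Q \<inter> lattice h then \<Prod>i\<in>UNIV. c x i else 0)" for x
 have Q\<Omega>: "Q \<subseteq> \<Omega>" using cube by (auto simp: Q_def)
 have convQ: "convex Q"
 proof -
  have "Q = (\<Inter>i. {x. (x - a) $ i < r} \<inter> {x. - r < (x - a) $ i})"
   by (auto simp: Q_def abs_less_iff) (metis minus_less_iff minus_diff_eq)+
  also have "convex ..."
  proof (intro convex_INT convex_Int)
   fix i
   have "{x. (x - a) $ i < r} = {x. axis i 1 \<bullet> x < r + a $ i}" "{x. - r < (x - a) $ i} = {x. axis i 1 \<bullet> x > a $ i - r}"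
    by (auto simp: inner_axis inner_commute[of "axis i 1"])
   thus "convex {x. (x - a) $ i < r}" "convex {x. - r < (x - a) $ i}"
    by (simp_all add: convex_halfspace_lt convex_halfspace_gt)
  qed
  finally show ?thesis .
 qed
 have cpos: "c x i > 0" if "x \<in> Q" for x i
 proof -
  have "\<bar>\<beta> * (x $ i - a $ i)\<bar> < pi / 2"
   using mult_strict_left_mono[of "\<bar>x $ i - a $ i\<bar>" r \<beta>] that \<beta> by (simp add: Q_def abs_mult)
  thus ?thesis unfolding c_def by (intro cos_gt_zero_pi) auto
 qed
 have w0: "w x = 0" if "x \<notin> S" for x using that Q\<Omega> by (auto simp: w_def S_def)
 have wn: "w x \<ge> 0" for x unfolding w_def using cpos by (auto intro!: prod_nonneg intro: less_imp_le)
 have step: "uncut \<Omega> w x (x + s *\<^sub>R axis i 1) \<ge> c (x + s *\<^sub>R axis i 1) i * (\<Prod>j\<in>UNIV - {i}. c x j)"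
  if x: "x \<in> Q \<inter> lattice h" and s: "s = h \<or> s = - h" for x s i
 proof -
  define y where "y = x + s *\<^sub>R axis i 1"
  have y: "y $ i = x $ i + s" "\<And>j. j \<noteq> i ==> y $ j = x $ j" by (auto simp: y_def axis_def)
  have yl: "y \<in> lattice h" using s x lattice_step[of x h i] h by (auto simp: y_def)
  show ?thesis
  proof (cases "y \<in> Q")
   case True
   have "closed_segment x y \<subseteq> Q" using convQ x True by (intro closed_segment_subset) auto
   hence "uncut \<Omega> w x y = (\<Prod>j\<in>UNIV. c y j)" using True yl Q\<Omega> by (auto simp: uncut_def w_def)
   also have "... = c y i * (\<Prod>j\<in>UNIV - {i}. c y j)" by (simp add: prod.remove)
   also have "(\<Prod>j\<in>UNIV - {i}. c y j) = (\<Prod>j\<in>UNIV - {i}. c x j)"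
    using y(2) by (intro prod.cong) (auto simp: c_def)
   finally show ?thesis by (simp add: y_def)
  next
   case False
   define t where "t = y $ i - a $ i"
   obtain j where j: "\<bar>y $ j - a $ j\<bar> \<ge> r" using False by (auto simp: Q_def not_less)
   have "\<bar>x $ j - a $ j\<bar> < r" using x by (auto simp: Q_def)
   hence "j = i" using j y(2)[of j] by (cases "j = i") auto
   hence t1: "\<bar>t\<bar> \<ge> r" using j by (simp add: t_def)
   have "\<bar>x $ i - a $ i\<bar> < r" using x by (auto simp: Q_def)
   hence t2: "\<bar>t\<bar> \<le> 2 * r" using s h y(1) by (auto simp: t_def)
   have "cos (\<beta> * \<bar>t\<bar>) \<le> 0"
   proof -
    have "\<beta> * \<bar>t\<bar> \<ge> pi / 2" using mult_left_mono[OF t1, of \<beta>] \<beta> by simp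
    moreover have "\<beta> * \<bar>t\<bar> \<le> \<beta> * (2 * r)" using mult_left_mono[OF t2, of \<beta>] \<beta> by simp
    moreover have "\<beta> * (2 * r) = 2 * (\<beta> * r)" by simp
    ultimately have "cos (\<beta> * \<bar>t\<bar>) \<le> cos (pi / 2)" using \<beta>(2) pi_gt_zero by (intro cos_monotone_0_pi_le) linarith+
    thus ?thesis by simp
   qed
   moreover have "cos (\<beta> * \<bar>t\<bar>) = c y i" by (cases "t \<ge> 0") (simp_all add: c_def t_def[symmetric])
   ultimately have "c y i * (\<Prod>j\<in>UNIV - {i}. c x j) \<le> 0"
    using cpos x by (intro mult_nonpos_nonneg prod_nonneg) (auto intro: less_imp_le)
   moreover have "uncut \<Omega> w x y \<ge> 0" using wn by (simp add: uncut_def)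
   ultimately show ?thesis by (simp add: y_def)
  qed
 qed
 have key: "neighbour_sum \<Omega> h w x \<ge> 2 * real CARD('n) * cos (\<beta> * h) * w x" if x: "x \<in> Q \<inter> lattice h" for x
 proof -
  have "2 * cos (\<beta> * h) * w x \<le> uncut \<Omega> w x (x + h *\<^sub>R axis i 1) + uncut \<Omega> w x (x - h *\<^sub>R axis i 1)" for i
  proof -
   define p where "p = (\<Prod>j\<in>UNIV - {i}. c x j)"
   have "w x = c x i * p" using x by (simp add: w_def p_def prod.remove[of UNIV i])
   moreover have "c (x + h *\<^sub>R axis i 1) i + c (x + (-h) *\<^sub>R axis i 1) i = 2 * cos (\<beta> * h) * c x i"
   proof -
    have "c (x + h *\<^sub>R axis i 1) i = cos (\<beta> * (x $ i - a $ i) + \<beta> * h)"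
     "c (x + (-h) *\<^sub>R axis i 1) i = cos (\<beta> * (x $ i - a $ i) - \<beta> * h)"
     by (auto simp: c_def algebra_simps)
    thus ?thesis by (simp add: cos_add cos_diff c_def)
   qed
   ultimately have "2 * cos (\<beta> * h) * w x = c (x + h *\<^sub>R axis i 1) i * p + c (x + (-h) *\<^sub>R axis i 1) i * p"
    by (simp add: distrib_right[symmetric])
   also have "... \<le> uncut \<Omega> w x (x + h *\<^sub>R axis i 1) + uncut \<Omega> w x (x + (-h) *\<^sub>R axis i 1)"
    unfolding p_def by (intro add_mono step x) auto
   finally show ?thesis by simp
  qed
  hence "(\<Sum>i\<in>(UNIV::'n set). 2 * cos (\<beta> * h) * w x) \<le> neighbour_sum \<Omega> h w x"
   unfolding neighbour_sum_def by (intro sum_mono)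
  thus ?thesis by (simp add: mult_ac)
 qed
 define N where "N = (\<Sum>x\<in>S. (w x)\<^sup>2)"
 have "2 * real CARD('n) * cos (\<beta> * h) * N \<le> (\<Sum>x\<in>S. w x * neighbour_sum \<Omega> h w x)"
  unfolding N_def sum_distrib_left
 proof (rule sum_mono)
  fix x assume "x \<in> S"
  show "2 * real CARD('n) * cos (\<beta> * h) * (w x)\<^sup>2 \<le> w x * neighbour_sum \<Omega> h w x"
  proof (cases "x \<in> Q \<inter> lattice h")
   case True
   thus ?thesis using mult_left_mono[OF key[OF True] wn[of x]] by (simp add: power2_eq_square mult_ac)
  qed (auto simp: w_def)
 qed
 also have "... \<le> (2 * real CARD('n) - h\<^sup>2 * l) * N"
  unfolding N_def S_def by (rule R) (use w0 S_def in auto)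
 finally have ineq: "2 * real CARD('n) * cos (\<beta> * h) * N \<le> (2 * real CARD('n) - h\<^sup>2 * l) * N" .
 have "N > 0"
 proof -
  have "lattice_floor h a \<in> Q"
   using lattice_floor_component[OF h(1), of a] h(2) by (fastforce simp: Q_def abs_minus_commute intro: le_less_trans)
  hence f: "lattice_floor h a \<in> Q \<inter> lattice h" using lattice_floor_in[OF h(1)] by auto
  hence "w (lattice_floor h a) > 0" using cpos by (auto simp: w_def intro!: prod_pos)
  moreover have "lattice_floor h a \<in> S" using f Q\<Omega> by (auto simp: S_def)
  ultimately show ?thesis unfolding N_def using fin by (intro sum_pos2) (auto simp: S_def)
 qed
 with ineq have "2 * real CARD('n) * cos (\<beta> * h) \<le> 2 * real CARD('n) - h\<^sup>2 * l" by simp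
 moreover have "cos (\<beta> * h) \<ge> 1 - (\<beta> * h)\<^sup>2 / 2"
 proof -
  have "cos (\<beta> * h) = 1 - 2 * (sin (\<beta> * h / 2))\<^sup>2" using cos_double_sin[of "\<beta> * h / 2"] by simp
  moreover have "(sin (\<beta> * h / 2))\<^sup>2 \<le> (\<beta> * h / 2)\<^sup>2"
   using abs_sin_x_le_abs_x[of "\<beta> * h / 2"] by (simp only: abs_le_square_iff)
  ultimately show ?thesis by (simp add: power_divide)
 qed
 hence "2 * real CARD('n) * cos (\<beta> * h) \<ge> 2 * real CARD('n) * (1 - (\<beta> * h)\<^sup>2 / 2)" by (intro mult_left_mono) auto
 ultimately have "h\<^sup>2 * l \<le> h\<^sup>2 * (real CARD('n) * \<beta>\<^sup>2)" by (simp add: algebra_simps power_mult_distrib)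
 thus ?thesis using h by (simp add: \<beta>_def)
qed

section \<open>Gaussian barriers on the lattice\<close>

text \<open>The second differences are not divided by \<open>h\<^sup>2\<close>.\<close>

definition lattice_laplacian :: "real => (real^'n => real) => real^'n => real" where
 "lattice_laplacian h v x = (\<Sum>i\<in>UNIV. v (x + h *\<^sub>R axis i 1) + v (x - h *\<^sub>R axis i 1) - 2 * v x)"

lemma exp_plus_exp_minus_ge: "exp y + exp (- y) \<ge> 2 + y\<^sup>2" for y :: real
proof -
 have pos: "exp z - exp (- z) \<ge> 2 * z" if z: "z \<ge> 0" for z :: real
 proof -
  have e: "1 + z + z\<^sup>2 / 2 \<le> exp z" by (rule exp_lower_Taylor_quadratic[OF z])
  have p: "1 + z + z\<^sup>2 / 2 > 0" using z by (intro add_pos_nonneg) auto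
  have "(1 + z + z\<^sup>2 / 2) * (1 - z + z\<^sup>2 / 2) = 1 + (z\<^sup>2)\<^sup>2 / 4"
   by (simp add: power2_eq_square algebra_simps)
  hence "(1 + z + z\<^sup>2 / 2) * (1 - z + z\<^sup>2 / 2) \<ge> 1" by simp
  hence "inverse (1 + z + z\<^sup>2 / 2) \<le> 1 - z + z\<^sup>2 / 2" using p by (simp add: inverse_eq_divide divide_le_eq mult.commute)
  moreover have "inverse (exp z) \<le> inverse (1 + z + z\<^sup>2 / 2)" using e p by (rule le_imp_inverse_le)
  ultimately show ?thesis using e unfolding exp_minus by linarith
 qed
 have "(exp (y / 2) - exp (- y / 2))\<^sup>2 \<ge> y\<^sup>2"
 proof (cases "y \<ge> 0")
  case True
  thus ?thesis using pos[of "y / 2"] by (intro power_mono) auto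
 next
  case False
  hence "(exp (- y / 2) - exp (y / 2))\<^sup>2 \<ge> (- y)\<^sup>2" using pos[of "- y / 2"] by (intro power_mono) auto
  thus ?thesis by (simp add: power2_commute)
 qed
 moreover have "(exp (y / 2) - exp (- y / 2))\<^sup>2 = exp y + exp (- y) - 2"
 proof -
  have "exp (y / 2) * exp (y / 2) = exp y" "exp (- y / 2) * exp (- y / 2) = exp (- y)" "exp (y / 2) * exp (- y / 2) = 1"
   by (simp_all add: exp_add[symmetric])
  thus ?thesis unfolding power2_eq_square by (simp add: left_diff_distrib right_diff_distrib mult.commute)
 qed
 ultimately show ?thesis by linarith
qed

text \<open>Far from the centre the convexity of the Gaussian in the radial direction outweighs
its decrease, as for the continuous Laplacian.\<close>

lemma lattice_laplacian_gaussian: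
 fixes a x :: "real^'n"
 assumes al: "\<alpha> > 0" "\<alpha> * h\<^sup>2 \<le> 1 / 2" and far: "\<alpha> * (norm (x - a))\<^sup>2 \<ge> 2 * real CARD('n)"
 shows "lattice_laplacian h (\<lambda>x. exp (- \<alpha> * (norm (x - a))\<^sup>2)) x
   \<ge> exp (- \<alpha> * (norm (x - a))\<^sup>2) * (h\<^sup>2 * (2 * real CARD('n) * \<alpha>))"
proof -
 define d where "d = x - a"
 define E where "E = exp (- \<alpha> * (norm d)\<^sup>2)"
 define n where "n = real CARD('n)"
 have sq: "(norm (d + s *\<^sub>R axis i 1))\<^sup>2 = (norm d)\<^sup>2 + 2 * s * d $ i + s\<^sup>2" for s i
  unfolding power2_norm_eq_inner
  by (simp add: inner_add inner_axis inner_commute[of "axis i 1"] power2_eq_square algebra_simps)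
 have step: "exp (- \<alpha> * (norm (x + s *\<^sub>R axis i 1 - a))\<^sup>2) = E * exp (- (\<alpha> * s\<^sup>2)) * exp (- (2 * \<alpha> * s * d $ i))" for s i
 proof -
  have "x + s *\<^sub>R axis i 1 - a = d + s *\<^sub>R axis i 1" by (simp add: d_def)
  thus ?thesis unfolding E_def exp_add[symmetric] by (simp only: sq) (simp add: algebra_simps)
 qed
 have "E * (2 * (1 - \<alpha> * h\<^sup>2) * (1 + 2 * \<alpha>\<^sup>2 * h\<^sup>2 * (d $ i)\<^sup>2) - 2)
  \<le> exp (- \<alpha> * (norm (x + h *\<^sub>R axis i 1 - a))\<^sup>2) + exp (- \<alpha> * (norm (x - h *\<^sub>R axis i 1 - a))\<^sup>2)
    - 2 * exp (- \<alpha> * (norm (x - a))\<^sup>2)" for i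
 proof -
  define y where "y = 2 * \<alpha> * h * d $ i"
  have "2 * (1 - \<alpha> * h\<^sup>2) * (1 + 2 * \<alpha>\<^sup>2 * h\<^sup>2 * (d $ i)\<^sup>2) = (1 - \<alpha> * h\<^sup>2) * (2 + y\<^sup>2)"
   by (simp add: y_def power_mult_distrib algebra_simps)
  also have "... \<le> exp (- (\<alpha> * h\<^sup>2)) * (exp y + exp (- y))"
   using exp_plus_exp_minus_ge[of y] exp_ge_add_one_self[of "- (\<alpha> * h\<^sup>2)"] al
   by (intro mult_mono) (auto intro: add_nonneg_nonneg)
  finally have "E * (2 * (1 - \<alpha> * h\<^sup>2) * (1 + 2 * \<alpha>\<^sup>2 * h\<^sup>2 * (d $ i)\<^sup>2) - 2)
   \<le> E * (exp (- (\<alpha> * h\<^sup>2)) * (exp y + exp (- y)) - 2)"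
   by (intro mult_left_mono) (auto simp: E_def)
  also have "... = E * exp (- (\<alpha> * h\<^sup>2)) * exp (- y) + E * exp (- (\<alpha> * (- h)\<^sup>2)) * exp (- (2 * \<alpha> * (- h) * d $ i)) - 2 * E"
   by (simp add: algebra_simps y_def)
  finally show ?thesis using step[of h i] step[of "- h" i] by (simp add: y_def E_def d_def)
 qed
 hence "lattice_laplacian h (\<lambda>x. exp (- \<alpha> * (norm (x - a))\<^sup>2)) x
  \<ge> (\<Sum>i\<in>UNIV. E * (2 * (1 - \<alpha> * h\<^sup>2) * (1 + 2 * \<alpha>\<^sup>2 * h\<^sup>2 * (d $ i)\<^sup>2) - 2))"
  unfolding lattice_laplacian_def by (intro sum_mono)
 moreover have "(\<Sum>i\<in>UNIV. E * (2 * (1 - \<alpha> * h\<^sup>2) * (1 + 2 * \<alpha>\<^sup>2 * h\<^sup>2 * (d $ i)\<^sup>2) - 2))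
  = E * (h\<^sup>2 * (2 * \<alpha> * (2 * (1 - \<alpha> * h\<^sup>2) * (\<alpha> * (norm d)\<^sup>2) - n)))"
 proof -
  have "(\<Sum>i\<in>UNIV. (d $ i)\<^sup>2) = (norm d)\<^sup>2"
   unfolding power2_norm_eq_inner inner_vec_def by (simp add: power2_eq_square)
  moreover have "(\<Sum>i\<in>UNIV. E * (2 * (1 - \<alpha> * h\<^sup>2) * (1 + 2 * \<alpha>\<^sup>2 * h\<^sup>2 * (d $ i)\<^sup>2) - 2))
   = (\<Sum>i\<in>(UNIV :: 'n set). E * (2 * (1 - \<alpha> * h\<^sup>2) - 2)) + E * (2 * (1 - \<alpha> * h\<^sup>2) * (2 * \<alpha>\<^sup>2 * h\<^sup>2)) * (\<Sum>i\<in>UNIV. (d $ i)\<^sup>2)"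
   unfolding sum_distrib_left sum.distrib[symmetric] by (intro sum.cong refl) (simp add: algebra_simps)
  ultimately show ?thesis by (simp add: n_def power2_eq_square algebra_simps)
 qed
 moreover have "2 * (1 - \<alpha> * h\<^sup>2) * (\<alpha> * (norm d)\<^sup>2) - n \<ge> n"
 proof -
  have "(2 * (1 - \<alpha> * h\<^sup>2)) * (\<alpha> * (norm d)\<^sup>2) \<ge> 1 * (2 * n)"
   using al far by - (rule mult_mono, auto simp: n_def d_def)
  thus ?thesis by simp
 qed
 hence "E * (h\<^sup>2 * (2 * \<alpha> * (2 * (1 - \<alpha> * h\<^sup>2) * (\<alpha> * (norm d)\<^sup>2) - n))) \<ge> E * (h\<^sup>2 * (2 * \<alpha> * n))"
  using al by (intro mult_left_mono) (auto simp: E_def)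
 ultimately show ?thesis by (simp add: E_def d_def n_def mult_ac)
qed

text \<open>A maximum principle for \<open>w - b\<close>, where b is the bound in the conclusion,
defined for all points. It is at least M outside the ball of radius R and at least \<open>(1 - c)
* M\<close> everywhere, so a positive maximum of \<open>w - b\<close> lies in the annulus; there
the Laplacian of b is too negative by \<open>strict\<close>. The values up and dn are what w shows
along the edges: a cut edge contributes nothing positive, which does no harm since \<open>b \<ge>
0\<close>.\<close>

lemma lattice_annulus_estimate:
 fixes X :: "(real^'n) set" and up dn :: "'n => real^'n => real"
 assumes X: "finite X" and h: "h > 0" and M: "M \<ge> 0" "\<And>x. x \<in> X ==> w x \<le> M"
  and c: "0 \<le> c" "c \<le> 1" and inner: "\<And>x. x \<in> X ==> norm (x - a) < s ==> w x \<le> (1 - c) * M"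
  and up: "\<And>x i. x \<in> X ==> norm (x - a) < R ==> up i x \<le> 0 \<or> x + h *\<^sub>R axis i 1 \<in> X \<and> up i x \<le> w (x + h *\<^sub>R axis i 1)"
  and dn: "\<And>x i. x \<in> X ==> norm (x - a) < R ==> dn i x \<le> 0 \<or> x - h *\<^sub>R axis i 1 \<in> X \<and> dn i x \<le> w (x - h *\<^sub>R axis i 1)"
  and eq: "\<And>x. x \<in> X ==> norm (x - a) < R ==> (\<Sum>i\<in>UNIV. up i x + dn i x) \<ge> 2 * real CARD('n) * w x - h\<^sup>2 * (\<Lambda> * M)"
  and al: "\<alpha> > 0" "\<alpha> * h\<^sup>2 \<le> 1 / 2" "\<alpha> * s\<^sup>2 \<ge> 2 * real CARD('n)" "s > 0"
  and strict: "c * (exp (- \<alpha> * R\<^sup>2) * (2 * real CARD('n) * \<alpha>)) > \<Lambda>"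
  and x: "x \<in> X" "norm (x - a) < R"
 shows "w x \<le> M * (1 - c * (exp (- \<alpha> * (norm (x - a))\<^sup>2) - exp (- \<alpha> * R\<^sup>2)))"
proof (cases "M = 0")
 case True thus ?thesis using M x by force
next
 case False
 with M have M0: "M > 0" by simp
 define E where "E y = exp (- \<alpha> * (norm (y - a))\<^sup>2)" for y :: "real^'n"
 define b where "b y = M * (1 - c * (E y - exp (- \<alpha> * R\<^sup>2)))" for y
 have E1: "E y \<le> 1" for y using al by (simp add: E_def)
 have b0: "b y \<ge> 0" for y
 proof -
  have "E y - exp (- \<alpha> * R\<^sup>2) \<le> 1" using E1[of y] exp_gt_zero[of "- \<alpha> * R\<^sup>2"] by linarith
  hence "c * (E y - exp (- \<alpha> * R\<^sup>2)) \<le> c * 1" using c(1) by (intro mult_left_mono)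
  hence "c * (E y - exp (- \<alpha> * R\<^sup>2)) \<le> 1" using c(2) by linarith
  thus ?thesis unfolding b_def using M0 by simp
 qed
 have bR: "b y \<ge> M" if "norm (y - a) \<ge> R" "R \<ge> 0" for y
 proof -
  have "R\<^sup>2 \<le> (norm (y - a))\<^sup>2" using that by (intro power_mono) auto
  hence "E y \<le> exp (- \<alpha> * R\<^sup>2)" using al by (simp add: E_def)
  hence "c * (E y - exp (- \<alpha> * R\<^sup>2)) \<le> 0" using c by (simp add: mult_nonneg_nonpos)
  thus ?thesis unfolding b_def using M0 by simp
 qed
 have R0: "R \<ge> 0" using x(2) norm_ge_zero[of "x - a"] by linarith
 show ?thesis
 proof (rule ccontr)
  assume "\<not> ?thesis"
  hence neg: "w x - b x > 0" by (simp add: b_def E_def)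
  define g where "g y = w y - b y" for y
  have "Max (g ` X) \<in> g ` X" using X x by (intro Max_in) auto
  then obtain z where z: "z \<in> X" "Max (g ` X) = g z" by auto
  hence zm: "g y \<le> g z" if "y \<in> X" for y using that X by (metis Max_ge finite_imageI imageI)
  have gz: "g z > 0" using zm[OF x(1)] neg by (simp add: g_def)
  have zR: "norm (z - a) < R"
  proof (rule ccontr)
   assume "\<not> ?thesis"
   hence "b z \<ge> M" using bR R0 by simp
   with M(2)[OF z(1)] gz show False by (simp add: g_def)
  qed
  have zs: "norm (z - a) \<ge> s"
  proof (rule ccontr)
   assume "\<not> ?thesis"
   hence "w z \<le> (1 - c) * M" using inner z(1) by simp
   also have "... \<le> b z"
   proof -
    have "E z - exp (- \<alpha> * R\<^sup>2) \<le> 1" using E1[of z] exp_gt_zero[of "- \<alpha> * R\<^sup>2"] by linarith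
    hence "c * (E z - exp (- \<alpha> * R\<^sup>2)) \<le> c" using c(1) mult_left_mono by fastforce
    hence "M * (1 - c) \<le> b z" unfolding b_def using M0 by (intro mult_left_mono) auto
    thus ?thesis by (simp add: mult.commute)
   qed
   finally show False using gz by (simp add: g_def)
  qed
  have U: "up i z \<le> b (z + h *\<^sub>R axis i 1) + g z" for i
   using up[OF z(1) zR, of i] b0[of "z + h *\<^sub>R axis i 1"] gz zm[of "z + h *\<^sub>R axis i 1"] by (auto simp: g_def)
  have D: "dn i z \<le> b (z - h *\<^sub>R axis i 1) + g z" for i
   using dn[OF z(1) zR, of i] b0[of "z - h *\<^sub>R axis i 1"] gz zm[of "z - h *\<^sub>R axis i 1"] by (auto simp: g_def)
  have "(\<Sum>i\<in>UNIV. up i z + dn i z) \<le> (\<Sum>i\<in>(UNIV::'n set). (b (z + h *\<^sub>R axis i 1) + g z) + (b (z - h *\<^sub>R axis i 1) + g z))"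
   by (intro sum_mono add_mono U D)
  also have "... = lattice_laplacian h b z + 2 * real CARD('n) * (b z + g z)"
   unfolding lattice_laplacian_def by (simp add: sum.distrib sum_subtractf algebra_simps)
  also have "b z + g z = w z" by (simp add: g_def)
  finally have "lattice_laplacian h b z \<ge> - (h\<^sup>2 * (\<Lambda> * M))" using eq[OF z(1) zR] by linarith
  moreover have "lattice_laplacian h b z = - (M * c) * lattice_laplacian h E z"
   unfolding lattice_laplacian_def sum_distrib_left b_def by (intro sum.cong) (auto simp: algebra_simps)
  ultimately have 1: "M * c * lattice_laplacian h E z \<le> h\<^sup>2 * (\<Lambda> * M)" by simp
  have "s\<^sup>2 \<le> (norm (z - a))\<^sup>2" using zs al(4) by (intro power_mono) auto
  hence "\<alpha> * s\<^sup>2 \<le> \<alpha> * (norm (z - a))\<^sup>2" using al(1) by simp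
  hence "lattice_laplacian h E z \<ge> E z * (h\<^sup>2 * (2 * real CARD('n) * \<alpha>))"
   unfolding E_def[abs_def] using lattice_laplacian_gaussian[OF al(1,2), of z a] al(3) by linarith
  moreover have "E z \<ge> exp (- \<alpha> * R\<^sup>2)"
  proof -
   have "(norm (z - a))\<^sup>2 \<le> R\<^sup>2" using zR by (intro power_mono) auto
   thus ?thesis using al(1) by (simp add: E_def)
  qed
  hence "E z * (h\<^sup>2 * (2 * real CARD('n) * \<alpha>)) \<ge> exp (- \<alpha> * R\<^sup>2) * (h\<^sup>2 * (2 * real CARD('n) * \<alpha>))"
   using al(1) by (intro mult_right_mono) auto
  ultimately have "lattice_laplacian h E z \<ge> exp (- \<alpha> * R\<^sup>2) * (h\<^sup>2 * (2 * real CARD('n) * \<alpha>))" by linarith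
  hence 2: "M * c * lattice_laplacian h E z \<ge> M * c * (exp (- \<alpha> * R\<^sup>2) * (h\<^sup>2 * (2 * real CARD('n) * \<alpha>)))"
   using M0 c by (intro mult_left_mono) auto
  have 3: "M * c * (exp (- \<alpha> * R\<^sup>2) * (h\<^sup>2 * (2 * real CARD('n) * \<alpha>))) = M * h\<^sup>2 * (c * (exp (- \<alpha> * R\<^sup>2) * (2 * real CARD('n) * \<alpha>)))"
   by (simp add: mult_ac)
  have "M * h\<^sup>2 * (c * (exp (- \<alpha> * R\<^sup>2) * (2 * real CARD('n) * \<alpha>))) > M * h\<^sup>2 * \<Lambda>"
   using M0 h strict by (intro mult_strict_left_mono) auto
  moreover have "M * h\<^sup>2 * \<Lambda> = h\<^sup>2 * (\<Lambda> * M)" by (simp add: mult_ac)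
  ultimately show False using 1 2 3 by linarith
 qed
qed

section \<open>Decay of lattice ground states at the boundary\<close>

text \<open>Two annuli improve the bound M near a boundary point \<xi> by a fixed factor. The flat
piece of radius \<open>\<rho> = \<kappa> * r\<close> about p lies outside \<Omega> and has a point
a' behind it and a point a in front of it. The first annulus has centre a' and takes into account
only lattice points in front of the flat piece: no edge leads through it, and none of these points
is closer to a' than \<open>\<rho> / 4\<close>, so there is no inner condition. This gives
\<open>v \<le> (1 - c1) * M\<close> in a small ball about a. That ball is the hole of the second
annulus, with centre a, which contains all x close to \<xi>. For the Gaussians \<alpha> is
\<open>32 * n / \<rho>\<^sup>2\<close> and then \<open>512 * n / \<rho>\<^sup>2\<close>, the
smallest values for which the barriers work outside the holes; the exponents in the constants are
the values of \<open>\<alpha> * s\<^sup>2\<close> at the outer radii \<open>\<rho> / 2\<close> and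
\<open>r / 2\<close> and at \<open>7/8\<close> of them.\<close>

lemma lattice_decay_step:
 fixes \<Omega> :: "(real^'n) set"
 defines "n \<equiv> real CARD('n)"
 defines "c1 \<equiv> exp (- 49 / 8 * n) - exp (- 8 * n)"
 assumes eig: "lattice_eigenfunction \<Omega> h l v" and l: "0 \<le> l" "l \<le> \<Lambda>" and fin: "finite (\<Omega> \<inter> lattice h)"
  and \<kappa>: "0 < \<kappa>" "\<kappa> \<le> 1 / 2" and r: "r > 0" and \<nu>: "norm \<nu> = 1" and p: "dist p \<xi> < r / 4"
  and flat: "\<And>x. dist p x < \<kappa> * r ==> \<nu> \<bullet> (x - p) = 0 ==> x \<notin> \<Omega>"
  and h: "0 < h" "h \<le> \<kappa> * r / (32 * n)"
  and M: "0 \<le> M" "\<And>x. dist \<xi> x < r ==> v x \<le> M"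
  and small1: "\<Lambda> * r\<^sup>2 < exp (- 8 * n) * (64 * n\<^sup>2)"
  and small2: "\<Lambda> * r\<^sup>2 < c1 * (exp (- 128 * n / \<kappa>\<^sup>2) * (1024 * n\<^sup>2))"
  and x: "dist \<xi> x < r / 16"
 shows "v x \<le> M * (1 - c1 * (exp (- 98 * n / \<kappa>\<^sup>2) - exp (- 128 * n / \<kappa>\<^sup>2)))"
proof -
 have n1: "n \<ge> 1" by (simp add: n_def Suc_le_eq)
 define \<rho> where "\<rho> = \<kappa> * r"
 have \<rho>: "\<rho> > 0" "\<rho> \<le> r / 2" using \<kappa> r by (auto simp: \<rho>_def)
 have hn: "h * (32 * n) \<le> \<rho>" using h(2) n1 by (simp add: \<rho>_def pos_le_divide_eq)
 have h32: "h \<le> \<rho> / 32"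
 proof -
  have "h * 32 * 1 \<le> h * 32 * n" using n1 h by (intro mult_left_mono) auto
  thus ?thesis using hn by (simp add: mult_ac)
 qed
 have v0: "v y = 0" if "y \<notin> \<Omega> \<inter> lattice h" for y using eig that by (simp add: lattice_eigenfunction_def)
 have v01: "v y \<ge> 0" for y using eig by (simp add: lattice_eigenfunction_def)
 have eq: "(\<Sum>i\<in>UNIV. uncut \<Omega> v y (y + h *\<^sub>R axis i 1) + uncut \<Omega> v y (y - h *\<^sub>R axis i 1))
   \<ge> 2 * real CARD('n) * v y - h\<^sup>2 * (\<Lambda> * M)" if "y \<in> \<Omega> \<inter> lattice h" "dist \<xi> y < r" for y
 proof -
  have "l * v y \<le> \<Lambda> * M" using l v01 M that by (intro mult_mono) auto
  hence "h\<^sup>2 * (l * v y) \<le> h\<^sup>2 * (\<Lambda> * M)" by (intro mult_left_mono) auto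
  moreover have "neighbour_sum \<Omega> h v y = (2 * n - h\<^sup>2 * l) * v y"
   using eig that by (simp add: lattice_eigenfunction_def n_def)
  ultimately show ?thesis unfolding neighbour_sum_def n_def by (simp add: algebra_simps)
 qed
 have L\<rho>: "\<Lambda> * \<rho>\<^sup>2 \<le> \<Lambda> * r\<^sup>2"
  using l \<rho> r by (intro mult_left_mono power_mono) auto
 have c1: "0 < c1" "c1 \<le> 1"
 proof -
  show "0 < c1" using n1 by (simp add: c1_def)
  have "exp (- 49 / 8 * n) \<le> 1" using n1 by simp
  thus "c1 \<le> 1" using exp_gt_zero[of "- 8 * n"] unfolding c1_def by linarith
 qed
 have annulus: "v y \<le> M * (1 - c * (exp (- \<alpha> * (norm (y - a))\<^sup>2) - exp (- \<alpha> * R\<^sup>2)))"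
  if X: "\<And>x. x \<in> X ==> x \<in> \<Omega> \<inter> lattice h \<and> dist \<xi> x < r" and c: "0 \<le> c" "c \<le> 1"
  and edge: "\<And>x z. x \<in> X ==> norm (x - a) < R ==> dist x z \<le> h ==> z \<in> lattice h ==>
   closed_segment x z \<subseteq> \<Omega> ==> z \<in> X"
  and inner: "\<And>x. x \<in> X ==> norm (x - a) < s ==> v x \<le> (1 - c) * M"
  and \<alpha>: "0 < \<alpha>" "\<alpha> * \<rho>\<^sup>2 \<le> 512 * n" "2 * n \<le> \<alpha> * s\<^sup>2" "0 < s"
  and strict: "\<Lambda> < c * (exp (- \<alpha> * R\<^sup>2) * (2 * n * \<alpha>))" and y: "y \<in> X" "norm (y - a) < R"
  for X c \<alpha> a R s y
 proof (rule lattice_annulus_estimate[where X = X and h = h and w = v and s = s and R = R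
    and up = "\<lambda>i x. uncut \<Omega> v x (x + h *\<^sub>R axis i 1)" and dn = "\<lambda>i x. uncut \<Omega> v x (x - h *\<^sub>R axis i 1)" and \<Lambda> = \<Lambda>])
  have unc: "uncut \<Omega> v x z \<le> 0 \<or> z \<in> X \<and> uncut \<Omega> v x z \<le> v z"
   if "x \<in> X" "norm (x - a) < R" "dist x z \<le> h" "z \<in> lattice h" for x z
   using edge[OF that] by (simp add: uncut_def)
  show "finite X" using fin by (rule finite_subset[rotated]) (use X in blast)
  show "v x \<le> M" if "x \<in> X" for x using M(2) X[OF that] by blast
  show "2 * real CARD('n) * v x - h\<^sup>2 * (\<Lambda> * M) \<le> (\<Sum>i\<in>UNIV. uncut \<Omega> v x (x + h *\<^sub>R axis i 1) + uncut \<Omega> v x (x - h *\<^sub>R axis i 1))"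
   if "x \<in> X" "norm (x - a) < R" for x
   using eq X[OF that(1)] by blast
  show "uncut \<Omega> v x (x + h *\<^sub>R axis i 1) \<le> 0 \<or> x + h *\<^sub>R axis i 1 \<in> X \<and> uncut \<Omega> v x (x + h *\<^sub>R axis i 1) \<le> v (x + h *\<^sub>R axis i 1)"
   "uncut \<Omega> v x (x - h *\<^sub>R axis i 1) \<le> 0 \<or> x - h *\<^sub>R axis i 1 \<in> X \<and> uncut \<Omega> v x (x - h *\<^sub>R axis i 1) \<le> v (x - h *\<^sub>R axis i 1)"
   if "x \<in> X" "norm (x - a) < R" for x i
   using that h lattice_step[of x h i] X by (intro unc; force simp: dist_norm)+
  show "\<alpha> * h\<^sup>2 \<le> 1 / 2"
  proof -
   have "(h * (32 * n))\<^sup>2 \<le> \<rho>\<^sup>2" using hn h n1 by (intro power_mono) auto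
   hence "1024 * (n * (n * h\<^sup>2)) \<le> \<rho>\<^sup>2" by (simp add: power2_eq_square mult_ac)
   moreover have "1 * (n * h\<^sup>2) \<le> n * (n * h\<^sup>2)" using n1 by (intro mult_right_mono) auto
   ultimately have "1024 * (n * h\<^sup>2) \<le> \<rho>\<^sup>2" by linarith
   hence "\<alpha> * (1024 * (n * h\<^sup>2)) \<le> 512 * n" using \<alpha>(1,2) by (meson mult_left_mono less_imp_le order_trans)
   hence "n * (\<alpha> * h\<^sup>2) \<le> n * (1 / 2)" by (simp add: mult_ac)
   thus ?thesis using n1 by simp
  qed
 qed (use h M c \<alpha> inner strict y in "auto simp: n_def")
 define a' where "a' = p - (\<rho> / 4) *\<^sub>R \<nu>"
 define a where "a = p + (\<rho> / 8) *\<^sub>R \<nu>"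
 have \<nu>\<nu>: "\<nu> \<bullet> \<nu> = 1" using \<nu> by (simp add: dot_square_norm)
 have \<nu>le: "\<bar>\<nu> \<bullet> y\<bar> \<le> norm y" for y using Cauchy_Schwarz_ineq2[of \<nu> y] \<nu> by simp
 have da': "dist p a' = \<rho> / 4" "dist p a = \<rho> / 8" "dist a' a = 3 / 8 * \<rho>"
 proof -
  show "dist p a' = \<rho> / 4" "dist p a = \<rho> / 8" using \<nu> \<rho> by (auto simp: a'_def a_def dist_norm)
  have "a - a' = (3 / 8 * \<rho>) *\<^sub>R \<nu>" by (simp add: a_def a'_def scaleR_left_distrib[symmetric])
  thus "dist a' a = 3 / 8 * \<rho>" using \<nu> \<rho> by (simp add: dist_norm norm_minus_commute[of a'])
 qed
 have near: "v y \<le> (1 - c1) * M" if y: "norm (y - a) < \<rho> / 16" for y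
 proof (cases "y \<in> \<Omega> \<inter> lattice h")
  case False
  hence "v y = 0" by (rule v0)
  thus ?thesis using c1 M by simp
 next
  case True
  define X where "X = {x \<in> \<Omega> \<inter> lattice h. dist p x < \<rho> \<and> \<nu> \<bullet> (x - p) > 0}"
  define \<alpha> where "\<alpha> = 32 * n / \<rho>\<^sup>2"
  have edge: "z \<in> X"
   if x: "x \<in> X" "norm (x - a') < \<rho> / 2" and z: "dist x z \<le> h" "z \<in> lattice h" and True: "closed_segment x z \<subseteq> \<Omega>" for x z
  proof -
   have "dist p x < 3 / 4 * \<rho>"
    using dist_triangle[of p x a'] x(2) da'(1) by (simp add: dist_norm norm_minus_commute)
   hence pz: "dist p z < \<rho>" "dist p x < \<rho>"
    using dist_triangle[of p z x] z(1) h32 \<rho> by (simp_all add: dist_commute)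
   have sub: "closed_segment x z \<subseteq> ball p \<rho>" using pz by (intro closed_segment_subset) auto
   have "\<nu> \<bullet> (z - p) > 0"
   proof (rule ccontr)
    assume "\<not> ?thesis"
    hence "\<nu> \<bullet> z \<le> \<nu> \<bullet> p" "\<nu> \<bullet> p \<le> \<nu> \<bullet> x" using x(1) by (auto simp: X_def inner_diff_right)
    then obtain y where y: "y \<in> closed_segment x z" "\<nu> \<bullet> y = \<nu> \<bullet> p"
     using connected_ivt_hyperplane[of "closed_segment x z" z x \<nu> "\<nu> \<bullet> p"] by auto
    hence "y \<notin> \<Omega>" using flat[of y] sub by (auto simp: \<rho>_def inner_diff_right)
    thus False using y(1) True by auto
   qed
   thus ?thesis using True z(2) pz by (auto simp: X_def)
  qed
  have yX: "y \<in> X" and ya': "norm (y - a') < \<rho> / 2" "norm (y - a') \<le> 7 / 16 * \<rho>"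
  proof -
   have "\<nu> \<bullet> (y - p) = \<rho> / 8 + \<nu> \<bullet> (y - a)" using \<nu>\<nu> by (simp add: a_def inner_diff_right inner_add_right)
   hence "\<nu> \<bullet> (y - p) > 0" using \<nu>le[of "y - a"] y by linarith
   moreover have "dist p y < \<rho>" using dist_triangle[of p y a] y da'(2) \<rho> by (simp add: dist_norm norm_minus_commute)
   ultimately show "y \<in> X" using True by (simp add: X_def)
   have "dist y a' \<le> 3 / 8 * \<rho> + dist y a" using dist_triangle[of y a' a] da'(3) by (simp add: dist_commute)
   thus "norm (y - a') \<le> 7 / 16 * \<rho>" "norm (y - a') < \<rho> / 2" using y \<rho> by (auto simp: dist_norm)
  qed
  have al0: "\<alpha> > 0" using n1 \<rho> by (simp add: \<alpha>_def)
  have "v y \<le> M * (1 - 1 * (exp (- \<alpha> * (norm (y - a'))\<^sup>2) - exp (- \<alpha> * (\<rho> / 2)\<^sup>2)))"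
  proof (rule annulus[where X = X and s = "\<rho> / 4" and R = "\<rho> / 2"])
   show "x \<in> \<Omega> \<inter> lattice h \<and> dist \<xi> x < r" if "x \<in> X" for x
    using that dist_triangle[of \<xi> x p] p \<rho> by (auto simp: X_def dist_commute)
   \<comment> \<open>There is no such x: it would not be in front of the flat piece.\<close>
   show "v x \<le> (1 - 1) * M" if "x \<in> X" "norm (x - a') < \<rho> / 4" for x
   proof -
    have "\<nu> \<bullet> (x - a') = \<nu> \<bullet> (x - p) + \<rho> / 4" using \<nu>\<nu> by (simp add: a'_def inner_diff_right)
    hence False using that \<nu>le[of "x - a'"] by (auto simp: X_def)
    thus ?thesis ..
   qed
   have "\<Lambda> * \<rho>\<^sup>2 < exp (- 8 * n) * (64 * n\<^sup>2)" using L\<rho> small1 by linarith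
   hence "\<Lambda> < exp (- 8 * n) * (64 * n\<^sup>2) / \<rho>\<^sup>2" using \<rho> by (simp add: pos_less_divide_eq)
   also have "... = 1 * (exp (- \<alpha> * (\<rho> / 2)\<^sup>2) * (2 * n * \<alpha>))"
   proof -
    have "- \<alpha> * (\<rho> / 2)\<^sup>2 = - 8 * n" using \<rho> by (simp add: \<alpha>_def power_divide)
    thus ?thesis by (simp only:) (simp add: \<alpha>_def power2_eq_square)
   qed
   finally show "\<Lambda> < 1 * (exp (- \<alpha> * (\<rho> / 2)\<^sup>2) * (2 * n * \<alpha>))" .
   show "2 * n \<le> \<alpha> * (\<rho> / 4)\<^sup>2" "\<alpha> * \<rho>\<^sup>2 \<le> 512 * n" using \<rho> n1 by (simp_all add: \<alpha>_def power_divide)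
   show "z \<in> X" if "x \<in> X" "norm (x - a') < \<rho> / 2" "dist x z \<le> h" "z \<in> lattice h" "closed_segment x z \<subseteq> \<Omega>" for x z
    by (rule edge[OF that])
  qed (use al0 \<rho> yX ya' in auto)
  also have "... \<le> M * (1 - c1)"
  proof (rule mult_left_mono[OF _ M(1)])
   have "(norm (y - a'))\<^sup>2 \<le> (7 / 16 * \<rho>)\<^sup>2" using ya' by (intro power_mono) auto
   hence "\<alpha> * (norm (y - a'))\<^sup>2 \<le> \<alpha> * (7 / 16 * \<rho>)\<^sup>2" using al0 by (intro mult_left_mono) auto
   also have "\<alpha> * (7 / 16 * \<rho>)\<^sup>2 = 49 / 8 * n" using \<rho> by (simp add: \<alpha>_def power_divide power_mult_distrib)
   finally have "exp (- 49 / 8 * n) \<le> exp (- \<alpha> * (norm (y - a'))\<^sup>2)" by simp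
   moreover have "\<alpha> * (\<rho> / 2)\<^sup>2 = 8 * n" using \<rho> by (simp add: \<alpha>_def power_divide)
   ultimately show "1 - 1 * (exp (- \<alpha> * (norm (y - a'))\<^sup>2) - exp (- \<alpha> * (\<rho> / 2)\<^sup>2)) \<le> 1 - c1"
    by (simp add: c1_def)
  qed
  finally show ?thesis by (simp add: mult.commute)
 qed
 have dxa: "norm (x - a) < 7 / 16 * r"
 proof -
  have "dist x a \<le> dist x \<xi> + (dist \<xi> p + dist p a)"
   using dist_triangle[of x a \<xi>] dist_triangle[of \<xi> a p] by linarith
  thus ?thesis using x p da'(2) \<rho> by (simp add: dist_commute dist_norm[symmetric])
 qed
 define c2 where "c2 = exp (- 98 * n / \<kappa>\<^sup>2) - exp (- 128 * n / \<kappa>\<^sup>2)"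
 have c2: "c2 \<le> 1" "0 \<le> c2"
 proof -
  have "exp (- 98 * n / \<kappa>\<^sup>2) \<le> 1" using n1 \<kappa> by (simp add: divide_nonneg_pos)
  thus "c2 \<le> 1" using exp_gt_zero[of "- 128 * n / \<kappa>\<^sup>2"] unfolding c2_def by linarith
  show "0 \<le> c2" unfolding c2_def using n1 \<kappa> by (simp add: divide_right_mono)
 qed
 show ?thesis
 proof (cases "x \<in> \<Omega> \<inter> lattice h")
  case False
  hence "v x = 0" by (rule v0)
  moreover have "c1 * c2 \<le> 1 * 1" using c1 c2 by (intro mult_mono) auto
  ultimately show ?thesis using M by (simp add: c2_def)
 next
  case True
  define X where "X = {x \<in> \<Omega> \<inter> lattice h. dist \<xi> x < r}"
  define \<alpha> where "\<alpha> = 512 * n / \<rho>\<^sup>2"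
  have al0: "\<alpha> > 0" using n1 \<rho> by (simp add: \<alpha>_def)
  have alr: "\<alpha> * r\<^sup>2 = 512 * n / \<kappa>\<^sup>2" using r \<kappa> by (simp add: \<alpha>_def \<rho>_def power_mult_distrib)
  have "v x \<le> M * (1 - c1 * (exp (- \<alpha> * (norm (x - a))\<^sup>2) - exp (- \<alpha> * (r / 2)\<^sup>2)))"
  proof (rule annulus[where X = X and s = "\<rho> / 16" and R = "r / 2"])
   show "z \<in> X" if x: "x \<in> X" "norm (x - a) < r / 2" and z: "dist x z \<le> h" "z \<in> lattice h" and s: "closed_segment x z \<subseteq> \<Omega>" for x z
   proof -
    have "dist \<xi> z \<le> dist \<xi> p + (dist p a + (dist a x + dist x z))"
     using dist_triangle[of \<xi> z p] dist_triangle[of p z a] dist_triangle[of a z x] by linarith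
    also have "dist a x < r / 2" using x(2) by (simp add: dist_norm norm_minus_commute)
    finally have "dist \<xi> z < r" using p da'(2) z(1) h32 \<rho> by (simp add: dist_commute)
    thus ?thesis using s z(2) by (auto simp: X_def)
   qed
   show "v x \<le> (1 - c1) * M" if "x \<in> X" "norm (x - a) < \<rho> / 16" for x
    using near that(2) .
   have "\<Lambda> * \<rho>\<^sup>2 < c1 * (exp (- 128 * n / \<kappa>\<^sup>2) * (1024 * n\<^sup>2))" using L\<rho> small2 by linarith
   hence "\<Lambda> < c1 * (exp (- 128 * n / \<kappa>\<^sup>2) * (1024 * n\<^sup>2)) / \<rho>\<^sup>2" using \<rho> by (simp add: pos_less_divide_eq)
   also have "... = c1 * (exp (- \<alpha> * (r / 2)\<^sup>2) * (2 * n * \<alpha>))"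
   proof -
    have "- \<alpha> * (r / 2)\<^sup>2 = - 128 * n / \<kappa>\<^sup>2" using alr by (simp add: power_divide)
    thus ?thesis by (simp only:) (simp add: \<alpha>_def power2_eq_square)
   qed
   finally show "\<Lambda> < c1 * (exp (- \<alpha> * (r / 2)\<^sup>2) * (2 * n * \<alpha>))" .
   show "norm (x - a) < r / 2" using dxa r by linarith
   show "x \<in> X" using True x r by (simp add: X_def)
   show "2 * n \<le> \<alpha> * (\<rho> / 16)\<^sup>2" "\<alpha> * \<rho>\<^sup>2 \<le> 512 * n" using \<rho> by (simp_all add: \<alpha>_def power_divide)
  qed (use al0 \<rho> c1 in "auto simp: X_def")
  also have "... \<le> M * (1 - c1 * c2)"
  proof (rule mult_left_mono[OF _ M(1)])
   have "(norm (x - a))\<^sup>2 \<le> (7 / 16 * r)\<^sup>2" using dxa by (intro power_mono) auto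
   hence "\<alpha> * (norm (x - a))\<^sup>2 \<le> \<alpha> * (7 / 16 * r)\<^sup>2" using al0 by (intro mult_left_mono) auto
   also have "\<alpha> * (7 / 16 * r)\<^sup>2 = 98 * n / \<kappa>\<^sup>2" using alr by (simp add: power_divide power_mult_distrib)
   finally have "exp (- 98 * n / \<kappa>\<^sup>2) \<le> exp (- \<alpha> * (norm (x - a))\<^sup>2)" by simp
   moreover have "\<alpha> * (r / 2)\<^sup>2 = 128 * n / \<kappa>\<^sup>2" using alr by (simp add: power_divide)
   ultimately have "c2 \<le> exp (- \<alpha> * (norm (x - a))\<^sup>2) - exp (- \<alpha> * (r / 2)\<^sup>2)"
    by (simp add: c2_def)
   hence "c1 * c2 \<le> c1 * (exp (- \<alpha> * (norm (x - a))\<^sup>2) - exp (- \<alpha> * (r / 2)\<^sup>2))"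
    using c1 by (intro mult_left_mono) auto
   thus "1 - c1 * (exp (- \<alpha> * (norm (x - a))\<^sup>2) - exp (- \<alpha> * (r / 2)\<^sup>2)) \<le> 1 - c1 * c2" by simp
  qed
  finally show ?thesis by (simp add: c2_def)
 qed
qed

text \<open>At all small scales r a flat disc of codimension one and of radius proportional to r
lies near \<xi> and misses \<Omega>. This replaces the exterior cone condition, which fails where
\<Omega> lies on both sides of a face. The discs are parallel to each other.\<close>

definition flat_cone_condition :: "(real^'n) set => real^'n => bool" where
 "flat_cone_condition \<Omega> \<xi> \<longleftrightarrow>
   (\<exists>\<nu> \<kappa> r0. norm \<nu> = 1 \<and> \<kappa> > 0 \<and> r0 > 0 \<and>
    (\<forall>r. 0 < r \<and> r < r0 -->
      (\<exists>p. dist p \<xi> < r \<and> (\<forall>x. dist p x < \<kappa> * r \<and> \<nu> \<bullet> (x - p) = 0 --> x \<notin> \<Omega>))))"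

text \<open>Repeated use of the decay step: each passage to a smaller neighbourhood gains the same
factor \<open>\<theta> < 1\<close>. The small radius r1 makes the term with \<Lambda>
harmless.\<close>

lemma uniform_boundary_decay:
 fixes \<Omega> :: "(real^'n) set"
 assumes b: "bounded \<Omega>" and fc: "flat_cone_condition \<Omega> \<xi>" and \<Lambda>: "\<Lambda> \<ge> 0" and e: "\<epsilon> > 0"
 obtains \<delta> h0 where "\<delta> > 0" "h0 > 0"
  "\<And>h l v x. 0 < h ==> h < h0 ==> 0 \<le> l ==> l \<le> \<Lambda> ==> lattice_eigenfunction \<Omega> h l v ==>
    dist \<xi> x < \<delta> ==> v x \<le> \<epsilon>"
proof -
 obtain \<nu> \<kappa>0 r0 where \<nu>: "norm \<nu> = 1" and \<kappa>0: "\<kappa>0 > 0" and r0: "r0 > 0"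
  and cone: "\<And>r. 0 < r ==> r < r0 ==> \<exists>p. dist p \<xi> < r \<and> (\<forall>x. dist p x < \<kappa>0 * r \<and> \<nu> \<bullet> (x - p) = 0 --> x \<notin> \<Omega>)"
  using fc unfolding flat_cone_condition_def by metis
 define \<kappa> where "\<kappa> = min (\<kappa>0 / 4) (1 / 2)"
 have \<kappa>: "0 < \<kappa>" "\<kappa> \<le> 1 / 2" "\<kappa> \<le> \<kappa>0 / 4" using \<kappa>0 by (auto simp: \<kappa>_def)
 define n where "n = real CARD('n)"
 have n1: "n \<ge> 1" by (simp add: n_def Suc_le_eq)
 define c1 where "c1 = exp (- 49 / 8 * n) - exp (- 8 * n)"
 define c2 where "c2 = exp (- 98 * n / \<kappa>\<^sup>2) - exp (- 128 * n / \<kappa>\<^sup>2)"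
 have c1: "0 < c1" "c1 < 1"
 proof -
  show "0 < c1" using n1 by (simp add: c1_def)
  have "exp (- 49 / 8 * n) \<le> 1" using n1 by simp
  thus "c1 < 1" using exp_gt_zero[of "- 8 * n"] unfolding c1_def by linarith
 qed
 have c2: "0 < c2" "c2 < 1"
 proof -
  have "exp (- 98 * n / \<kappa>\<^sup>2) \<le> 1" using n1 \<kappa> by (simp add: divide_nonneg_pos)
  thus "c2 < 1" using exp_gt_zero[of "- 128 * n / \<kappa>\<^sup>2"] unfolding c2_def by linarith
  show "0 < c2" unfolding c2_def using n1 \<kappa> by (simp add: divide_strict_right_mono)
 qed
 define \<theta> where "\<theta> = 1 - c1 * c2"
 have "c1 * c2 < 1 * 1" using c1 c2 by (intro mult_strict_mono) auto
 hence \<theta>: "0 < \<theta>" "\<theta> < 1" using c1 c2 by (auto simp: \<theta>_def)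
 define m where "m = min (exp (- 8 * n) * (64 * n\<^sup>2)) (c1 * (exp (- 128 * n / \<kappa>\<^sup>2) * (1024 * n\<^sup>2)))"
 have m: "m > 0" using n1 c1 by (simp add: m_def)
 define r1 where "r1 = min r0 (min 1 (m / (\<Lambda> + 1)))"
 have r1: "r1 > 0" using r0 m \<Lambda> by (simp add: r1_def)
 have small: "\<Lambda> * r\<^sup>2 < m" if "0 < r" "r \<le> r1" for r
 proof -
  have "r\<^sup>2 \<le> r * 1" unfolding power2_eq_square using that by (intro mult_left_mono) (auto simp: r1_def)
  hence "r\<^sup>2 \<le> m / (\<Lambda> + 1)" using that by (simp add: r1_def)
  hence "\<Lambda> * r\<^sup>2 \<le> \<Lambda> * (m / (\<Lambda> + 1))" using \<Lambda> by (intro mult_left_mono)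
  also have "... < m" using \<Lambda> m by (simp add: divide_less_eq algebra_simps)
  finally show ?thesis .
 qed
 have "\<exists>\<delta>>0. \<exists>h0>0. \<forall>h l v x. 0 < h --> h < h0 --> 0 \<le> l --> l \<le> \<Lambda> --> lattice_eigenfunction \<Omega> h l v -->
    dist \<xi> x < \<delta> --> v x \<le> \<theta> ^ k" for k
 proof (induction k)
  case 0
  show ?case by (rule exI[of _ 1], simp, rule exI[of _ 1]) (auto simp: lattice_eigenfunction_def)
 next
  case (Suc k)
  then obtain \<delta> h0 where d: "\<delta> > 0" "h0 > 0"
   and IH: "\<forall>h l v x. 0 < h --> h < h0 --> 0 \<le> l --> l \<le> \<Lambda> --> lattice_eigenfunction \<Omega> h l v -->
    dist \<xi> x < \<delta> --> v x \<le> \<theta> ^ k" by (elim exE conjE)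
  define r where "r = min \<delta> r1"
  have r: "r > 0" "r \<le> r1" "r \<le> \<delta>" "r \<le> r0" using d r1 by (auto simp: r_def r1_def)
  obtain p where p: "dist p \<xi> < r / 4" "\<And>x. dist p x < \<kappa>0 * (r / 4) ==> \<nu> \<bullet> (x - p) = 0 ==> x \<notin> \<Omega>"
   using cone[of "r / 4"] r r0 by auto
  define h1 where "h1 = min h0 (\<kappa> * r / (32 * n))"
  have h1: "h1 > 0" using d r \<kappa> n1 by (simp add: h1_def)
  have step: "v x \<le> \<theta> ^ Suc k" if h: "0 < h" "h < h1" and l: "0 \<le> l" "l \<le> \<Lambda>" and v: "lattice_eigenfunction \<Omega> h l v"
   and x: "dist \<xi> x < r / 16" for h l v x
  proof -
   have "v x \<le> \<theta> ^ k * (1 - (exp (- 49 / 8 * real CARD('n)) - exp (- 8 * real CARD('n))) *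
    (exp (- 98 * real CARD('n) / \<kappa>\<^sup>2) - exp (- 128 * real CARD('n) / \<kappa>\<^sup>2)))"
   proof (rule lattice_decay_step[OF v l _ \<kappa>(1,2) r(1) \<nu> p(1) _ h(1) _ _ _ _ _ x])
    show "finite (\<Omega> \<inter> lattice h)"
    proof (rule finite_if_separated[OF _ h(1)])
     show "bounded (\<Omega> \<inter> lattice h)" using b by (meson bounded_Int)
    qed (use lattice_separated h in auto)
    fix y assume y: "dist p y < \<kappa> * r" "\<nu> \<bullet> (y - p) = 0"
    have "\<kappa> * r \<le> \<kappa>0 / 4 * r" using \<kappa> r by (intro mult_right_mono) auto
    thus "y \<notin> \<Omega>" using p(2)[of y] y by simp
   next
    show "v y \<le> \<theta> ^ k" if "dist \<xi> y < r" for y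
     by (rule IH[rule_format, OF h(1) _ l v]) (use h that r in "auto simp: h1_def")
   qed (use h small[OF r(1,2)] \<theta> in "auto simp: h1_def n_def m_def c1_def")
   thus ?thesis by (simp add: \<theta>_def c1_def c2_def n_def mult.commute)
  qed
  have r16: "r / 16 > 0" using r by simp
  show ?case
   by (rule exI[of _ "r / 16"], rule conjI[OF r16], rule exI[of _ h1], rule conjI[OF h1], intro allI impI, rule step)
 qed
 note main = this
 obtain k where k: "\<theta> ^ k < \<epsilon>" using real_arch_pow_inv[OF e \<theta>(2)] by blast
 from main[of k] obtain \<delta> h0 where d: "\<delta> > 0" "h0 > 0"
  and D: "\<forall>h l v x. 0 < h --> h < h0 --> 0 \<le> l --> l \<le> \<Lambda> --> lattice_eigenfunction \<Omega> h l v -->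
    dist \<xi> x < \<delta> --> v x \<le> \<theta> ^ k" by (elim exE conjE)
 show ?thesis
 proof (rule that[OF d])
  fix h l v x
  assume "0 < h" "h < h0" "0 \<le> l" "l \<le> \<Lambda>" "lattice_eigenfunction \<Omega> h l v" "dist \<xi> x < \<delta>"
  hence "v x \<le> \<theta> ^ k" by (intro D[rule_format])
  with k show "v x \<le> \<epsilon>" by simp
 qed
qed

section \<open>Interior gradient estimates on the lattice\<close>

definition reflect_coord :: "'n => real^'n => real^'n => real^'n" where
 "reflect_coord i c y = (\<chi> j. if j = i then 2 * c $ i - y $ i else y $ j)"

lemma lattice_laplacian_reflect:
 "lattice_laplacian h (\<lambda>y. v (reflect_coord i c y)) y = lattice_laplacian h v (reflect_coord i c y)"
proof -
 have "reflect_coord i c (y + s *\<^sub>R axis j 1) = reflect_coord i c y + (if j = i then - s else s) *\<^sub>R axis j 1" for s j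
  by (auto simp: reflect_coord_def vec_eq_iff axis_def)
 from this[of h] this[of "- h"] show ?thesis
  unfolding lattice_laplacian_def by (intro sum.cong) auto
qed

lemma lattice_laplacian_lincomb:
 "lattice_laplacian h (\<lambda>y. a * u y + b * v y) x = a * lattice_laplacian h u x + b * lattice_laplacian h v x"
 unfolding lattice_laplacian_def sum_distrib_left sum.distrib[symmetric]
 by (intro sum.cong) (auto simp: algebra_simps)

text \<open>Let R be the reflection that exchanges the ends of the edge from x0, and let \<open>w
= v - v \<circ> R\<close>. On the half ball X, where \<open>s > 0\<close>, the odd function w is
compared with the quadratic polynomial b, whose Laplacian is too negative for a positive maximum
of \<open>w - b\<close> inside. At the round part of the boundary \<open>b \<ge> 2 * M\<close>.
The flat part is handled by oddness: a neighbour u of z beyond it is \<open>R z\<close>, and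
\<open>w u - b u \<le> - (w z - b z)\<close>.\<close>

lemma lattice_gradient_estimate_aux:
 fixes v :: "real^'n => real"
 assumes h: "0 < h" "h \<le> d" and x0: "x0 \<in> lattice h" and c: "c = x0 + (h / 2) *\<^sub>R axis i 1"
  and M: "M > 0" "\<And>y. y \<in> lattice h ==> dist c y < d + 2 * h ==> \<bar>v y\<bar> \<le> M"
  and N: "N \<ge> 0" "\<And>y. y \<in> lattice h ==> dist c y < d ==> \<bar>lattice_laplacian h v y\<bar> \<le> h\<^sup>2 * N"
 shows "v (x0 + h *\<^sub>R axis i 1) - v x0 \<le> h * (2 * (real CARD('n) + 2) * M / d + N * d)"
proof -
 define n where "n = real CARD('n)"
 have n1: "n \<ge> 1" by (simp add: n_def Suc_le_eq)
 have d: "d > 0" using h by simp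
 define R where "R = reflect_coord i c"
 define w where "w y = v y - v (R y)" for y
 define s where "s y = y $ i - c $ i" for y :: "real^'n"
 define A where "A = 2 * M / d\<^sup>2"
 define C where "C = N + n * A + A"
 define B where "B = C * (d + h)"
 \<comment> \<open>The term \<open>h\<^sup>2 / 4\<close> is the value of \<open>(s
 y)\<^sup>2\<close> at the lattice points next to the mirror; there b is odd up to the first
 summand.\<close>
 define b where "b y = A * (norm (y - c))\<^sup>2 + B * s y - C * ((s y)\<^sup>2 - h\<^sup>2 / 4)" for y
 have A0: "A > 0" using M d by (simp add: A_def)
 have C0: "C > 0" unfolding C_def using N A0 n1 by (intro add_nonneg_pos add_nonneg_nonneg) auto
 have B0: "B > 0" using C0 d h by (simp add: B_def)
 have ci: "c $ j = x0 $ j + (if j = i then h / 2 else 0)" for j by (simp add: c axis_def)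
 have Rl: "R y \<in> lattice h" if "y \<in> lattice h" for y
 proof -
  have "(2 * c $ i - y $ i) / h = 2 * (x0 $ i / h) + 1 - y $ i / h" using h by (simp add: ci field_simps)
  moreover have "2 * (x0 $ i / h) + 1 - y $ i / h \<in> \<int>" using x0 that by (intro Ints_diff Ints_add Ints_mult) (auto simp: lattice_def)
  ultimately show ?thesis using that by (auto simp: R_def reflect_coord_def lattice_def)
 qed
 have Rc: "norm (R y - c) = norm (y - c)" for y
 proof -
  have "\<bar>(R y - c) $ j\<bar> = \<bar>(y - c) $ j\<bar>" for j by (simp add: R_def reflect_coord_def abs_minus_commute)
  thus ?thesis by (simp add: norm_vec_def)
 qed
 have RR: "R (R y) = y" for y by (simp add: R_def reflect_coord_def vec_eq_iff)
 have sR: "s (R y) = - s y" for y by (simp add: s_def R_def reflect_coord_def)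
 have half: "\<exists>k::int. s y = h * (k + 1 / 2)" if "y \<in> lattice h" for y
 proof -
  have "(y $ i - x0 $ i) / h \<in> \<int>" using that x0 by (simp add: lattice_def diff_divide_distrib)
  then obtain k :: int where "(y $ i - x0 $ i) / h = k" by (auto elim: Ints_cases)
  hence "s y = h * (real_of_int (k - 1) + 1 / 2)" using h by (simp add: s_def ci field_simps)
  thus ?thesis by blast
 qed
 define X where "X = {y \<in> lattice h. dist c y < d \<and> s y > 0}"
 have X: "finite X"
 proof (rule finite_if_separated[OF _ h(1)])
  show "bounded X" by (rule bounded_subset[of "ball c d"]) (auto simp: X_def)
 qed (use lattice_separated h in "auto simp: X_def")
 have w2: "w y \<le> 2 * M" if "y \<in> lattice h" "dist c y < d + 2 * h" for y
 proof -
  have "dist c (R y) < d + 2 * h" using that Rc[of y] by (simp add: dist_norm norm_minus_commute)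
  hence "\<bar>v (R y)\<bar> \<le> M" using M(2) Rl that by blast
  thus ?thesis using M(2)[OF that] by (simp add: w_def)
 qed
 have Lb: "lattice_laplacian h b y = h\<^sup>2 * (2 * n * A - 2 * C)" for y
 proof -
  have "b (y + h *\<^sub>R axis j 1) + b (y - h *\<^sub>R axis j 1) - 2 * b y = h\<^sup>2 * (2 * A) - (if j = i then h\<^sup>2 * (2 * C) else 0)" for j
  proof -
   have "(norm (y + t *\<^sub>R axis j 1 - c))\<^sup>2 = (norm (y - c))\<^sup>2 + 2 * t * (y - c) $ j + t\<^sup>2" for t
    unfolding power2_norm_eq_inner
    by (simp add: inner_diff inner_add inner_axis inner_commute[of "axis j 1"] power2_eq_square algebra_simps)
   from this[of h] this[of "- h"] have sq: "(norm (y + h *\<^sub>R axis j 1 - c))\<^sup>2 + (norm (y - h *\<^sub>R axis j 1 - c))\<^sup>2 = 2 * (norm (y - c))\<^sup>2 + 2 * h\<^sup>2"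
    by simp
   have s1: "s (y + h *\<^sub>R axis j 1) = s y + (if j = i then h else 0)" "s (y - h *\<^sub>R axis j 1) = s y - (if j = i then h else 0)"
    by (auto simp: s_def axis_def)
   have "b (y + h *\<^sub>R axis j 1) + b (y - h *\<^sub>R axis j 1) - 2 * b y
    = A * ((norm (y + h *\<^sub>R axis j 1 - c))\<^sup>2 + (norm (y - h *\<^sub>R axis j 1 - c))\<^sup>2 - 2 * (norm (y - c))\<^sup>2)
     - (if j = i then 2 * C * h\<^sup>2 else 0)"
    unfolding b_def s1 by (auto simp: algebra_simps power2_eq_square)
   thus ?thesis unfolding sq by (cases "j = i") (simp_all add: algebra_simps)
  qed
  hence "lattice_laplacian h b y = (\<Sum>j\<in>(UNIV::'n set). h\<^sup>2 * (2 * A) - (if j = i then h\<^sup>2 * (2 * C) else 0))"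
   unfolding lattice_laplacian_def by (simp only:)
  thus ?thesis by (simp add: sum_subtractf n_def algebra_simps)
 qed
 have Lw: "lattice_laplacian h w y \<ge> - (2 * h\<^sup>2 * N)" if y: "y \<in> X" for y
 proof -
  have "lattice_laplacian h (\<lambda>y. 1 * v y + (-1) * v (R y)) y = lattice_laplacian h v y - lattice_laplacian h v (R y)"
   unfolding lattice_laplacian_lincomb unfolding R_def lattice_laplacian_reflect by simp
  moreover have "\<bar>lattice_laplacian h v y\<bar> \<le> h\<^sup>2 * N" using N(2) y by (simp add: X_def)
  moreover have "dist c (R y) < d" using y Rc[of y] by (simp add: X_def dist_norm norm_minus_commute)
  hence "\<bar>lattice_laplacian h v (R y)\<bar> \<le> h\<^sup>2 * N" using N(2) Rl y by (simp add: X_def)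
  moreover have "(\<lambda>y. 1 * v y + (-1) * v (R y)) = w" by (auto simp: w_def)
  ultimately show ?thesis by simp
 qed
 have wb: "w y \<le> b y" if "y \<in> X" for y
 proof (rule ccontr)
  assume neg: "\<not> w y \<le> b y"
  define g where "g y = w y - b y" for y
  have "Max (g ` X) \<in> g ` X" using X that by (intro Max_in) auto
  then obtain z where z: "z \<in> X" "Max (g ` X) = g z" by auto
  hence zm: "g u \<le> g z" if "u \<in> X" for u using that X by (metis Max_ge finite_imageI imageI)
  have gz: "g z > 0" using zm[OF that] neg by (simp add: g_def)
  have zl: "z \<in> lattice h" "dist c z < d" "s z > 0" using z by (auto simp: X_def)
  have nb: "g u \<le> g z" if u: "u = z + t *\<^sub>R axis j 1" "t = h \<or> t = - h" for u j t
  proof (cases "u \<in> X")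
   case True thus ?thesis by (rule zm)
  next
   case False
   have ul: "u \<in> lattice h" using u lattice_step[OF zl(1) h(1), of j] by auto
   have du: "dist c u < d + h" using u zl(2) dist_triangle[of c u z] h by (auto simp: dist_norm)
   show ?thesis
   proof (cases "s u > 0")
    case True
    hence far: "dist c u \<ge> d" using False ul by (simp add: X_def)
    have "d\<^sup>2 \<le> (norm (u - c))\<^sup>2" using far d by (intro power_mono) (auto simp: dist_norm norm_minus_commute)
    hence "A * d\<^sup>2 \<le> A * (norm (u - c))\<^sup>2" using A0 by (intro mult_left_mono) auto
    moreover have "A * d\<^sup>2 = 2 * M" using d by (simp add: A_def)
    moreover have "s u \<le> d + h"
     using component_le_norm_cart[of "u - c" i] du by (simp add: s_def dist_norm norm_minus_commute)
    hence "C * s u * s u \<le> C * s u * (d + h)" using C0 True by (intro mult_left_mono) auto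
    hence "B * s u - C * (s u)\<^sup>2 \<ge> 0" by (simp add: B_def power2_eq_square mult_ac)
    moreover have "C * h\<^sup>2 / 4 \<ge> 0" using C0 by simp
    moreover have "w u \<le> 2 * M" using w2 ul du h by simp
    ultimately have "g u \<le> 0" unfolding g_def b_def by (simp add: right_diff_distrib)
    thus ?thesis using gz by simp
   next
    case False
    obtain k k' :: int where k: "s z = h * (k + 1 / 2)" "s u = h * (k' + 1 / 2)"
     using half zl(1) ul by metis
    have su: "s u = s z + (if j = i then t else 0)" using u by (simp add: s_def axis_def)
    hence ji: "j = i" using False zl(3) by (cases "j = i") auto
    have th: "t = - h" using su ji False zl(3) u(2) h by auto
    have "real_of_int k + 1 / 2 > 0" using k(1) zl(3) h by (simp add: zero_less_mult_iff)
    moreover have "real_of_int k' + 1 / 2 \<le> 0"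
     using k(2) False h by (metis mult_pos_pos not_le)
    moreover have "real_of_int k' = real_of_int k - 1"
    proof -
     have "h * (k' + 1 / 2) = h * (k - 1 + 1 / 2)" using k su ji th by (simp add: algebra_simps)
     thus ?thesis using h by simp
    qed
    ultimately have "k = 0" by linarith
    hence sz: "s z = h / 2" using k by simp
    have uR: "u = R z"
     using u(1) ji th sz by (simp add: R_def reflect_coord_def vec_eq_iff axis_def s_def)
    have "w u = - w z" unfolding w_def uR RR by simp
    moreover have "b u + b z = 2 * A * (norm (z - c))\<^sup>2"
     unfolding b_def uR Rc sR sz by (simp add: power_divide)
    hence "b u + b z \<ge> 0" using A0 by simp
    ultimately have "g u \<le> - g z" by (simp add: g_def)
    thus ?thesis using gz by simp
   qed
  qed
  have "lattice_laplacian h g z \<le> (\<Sum>i\<in>(UNIV::'n set). 0)"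
   unfolding lattice_laplacian_def
  proof (rule sum_mono)
   fix j :: 'n
   have "g (z + h *\<^sub>R axis j 1) \<le> g z" by (rule nb) auto
   moreover have "g (z - h *\<^sub>R axis j 1) \<le> g z" by (rule nb[of _ "- h" j]) auto
   ultimately show "g (z + h *\<^sub>R axis j 1) + g (z - h *\<^sub>R axis j 1) - 2 * g z \<le> 0" by simp
  qed
  moreover have "lattice_laplacian h g z = lattice_laplacian h w z - lattice_laplacian h b z"
   using lattice_laplacian_lincomb[of h 1 w "-1" b z] by (simp add: g_def[abs_def])
  ultimately have "- (2 * h\<^sup>2 * N) \<le> h\<^sup>2 * (2 * n * A - 2 * C)" using Lw[OF z(1)] Lb[of z] by simp
  hence "h\<^sup>2 * (2 * C) \<le> h\<^sup>2 * (2 * n * A + 2 * N)" by (simp add: algebra_simps)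
  hence "2 * C \<le> 2 * n * A + 2 * N" using h by simp
  thus False using A0 by (simp add: C_def)
 qed
 define y0 where "y0 = x0 + h *\<^sub>R axis i 1"
 have y0c: "y0 - c = (h / 2) *\<^sub>R axis i 1" by (simp add: y0_def c scaleR_left_distrib[symmetric] algebra_simps flip: scaleR_left.diff)
 have sy0: "s y0 = h / 2" by (simp add: s_def y0_def c axis_def)
 have "y0 \<in> X"
  using lattice_step(1)[OF x0 h(1), of i] y0c sy0 h by (simp add: X_def y0_def[symmetric] dist_norm norm_minus_commute)
 hence "w y0 \<le> b y0" by (rule wb)
 moreover have "R y0 = x0" by (simp add: R_def reflect_coord_def y0_def vec_eq_iff ci axis_def)
 moreover have "b y0 = A * (h\<^sup>2 / 4) + B * (h / 2)"
  unfolding b_def y0c sy0 using h by (simp add: power_divide)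
 moreover have "A * (h\<^sup>2 / 4) \<le> h * (A * d)"
 proof -
  have "h * h \<le> h * d" using h by (intro mult_left_mono) auto
  hence "A * (h * h) \<le> A * (h * d)" using A0 mult_left_mono[of "h * h" "h * d" A] by simp
  moreover have "A * (h * h) \<ge> 0" using A0 by simp
  ultimately show ?thesis by (simp add: power2_eq_square mult_ac)
 qed
 moreover have "B * (h / 2) \<le> h * (C * d)"
 proof -
  have "C * (d + h) \<le> C * (2 * d)" using C0 h by (intro mult_left_mono) auto
  hence "C * (d + h) * (h / 2) \<le> C * (2 * d) * (h / 2)" using h by (intro mult_right_mono) auto
  thus ?thesis by (simp add: B_def mult_ac)
 qed
 ultimately have "v y0 - v x0 \<le> h * (A * d + C * d)" by (simp add: w_def distrib_left)
 also have "A * d + C * d = 2 * (n + 2) * M / d + N * d"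
  using d by (simp add: A_def C_def field_simps power2_eq_square)
 finally show ?thesis by (simp add: y0_def n_def)
qed

lemma lattice_gradient_estimate:
 fixes v :: "real^'n => real"
 assumes h: "0 < h" "h \<le> d" and x0: "x0 \<in> lattice h" and c: "c = x0 + (h / 2) *\<^sub>R axis i 1"
  and M: "M > 0" "\<And>y. y \<in> lattice h ==> dist c y < d + 2 * h ==> \<bar>v y\<bar> \<le> M"
  and N: "N \<ge> 0" "\<And>y. y \<in> lattice h ==> dist c y < d ==> \<bar>lattice_laplacian h v y\<bar> \<le> h\<^sup>2 * N"
 shows "\<bar>v (x0 + h *\<^sub>R axis i 1) - v x0\<bar> \<le> h * (2 * (real CARD('n) + 2) * M / d + N * d)"
proof -
 have m: "lattice_laplacian h (\<lambda>y. - v y) y = - lattice_laplacian h v y" for y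
  using lattice_laplacian_lincomb[of h "-1" v 0 v y] by simp
 have "- v (x0 + h *\<^sub>R axis i 1) - (- v x0) \<le> h * (2 * (real CARD('n) + 2) * M / d + N * d)"
  by (rule lattice_gradient_estimate_aux[OF h x0 c M(1) _ N(1)]) (use M N m in auto)
 with lattice_gradient_estimate_aux[OF assms] show ?thesis by linarith
qed

definition lattice_diff :: "real => 'n => (real^'n => real) => real^'n => real" where
 "lattice_diff h i v x = (v (x + h *\<^sub>R axis i 1) - v x) / h"

text \<open>Differences of solutions solve the same equation, so that the gradient estimate can be
repeated at the price of a distance \<rho> to the boundary.\<close>

lemma lattice_diff_interior_bound:
 fixes v :: "real^'n => real"
 assumes h: "0 < h" "h \<le> \<rho> / 4" and l: "0 \<le> l" "l \<le> \<Lambda>" and M: "M > 0"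
  and A: "\<And>x. x \<in> lattice h ==> cball x r \<subseteq> \<Omega> ==>
       lattice_laplacian h v x = - (h\<^sup>2 * l) * v x \<and> \<bar>v x\<bar> \<le> M"
  and x: "x \<in> lattice h" "cball x (r + \<rho>) \<subseteq> \<Omega>"
 shows "lattice_laplacian h (lattice_diff h i v) x = - (h\<^sup>2 * l) * lattice_diff h i v x"
  and "\<bar>lattice_diff h i v x\<bar> \<le> M * (8 * (real CARD('n) + 2) / \<rho> + \<Lambda> * \<rho>)"
proof -
 have \<rho>: "\<rho> > 0" using h by simp
 have sub: "cball y r \<subseteq> \<Omega>" if "dist x y \<le> \<rho>" for y
 proof -
  have "cball y r \<subseteq> cball x (r + \<rho>)" using that by (simp add: cball_subset_cball_iff dist_commute)
  thus ?thesis using x(2) by blast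
 qed
 have x': "x + h *\<^sub>R axis i 1 \<in> lattice h" by (rule lattice_step[OF x(1) h(1)])
 have "lattice_laplacian h (lattice_diff h i v) x
   = (lattice_laplacian h v (x + h *\<^sub>R axis i 1) - lattice_laplacian h v x) / h"
  unfolding lattice_laplacian_def lattice_diff_def sum_subtractf[symmetric] sum_divide_distrib
  by (intro sum.cong) (auto simp: algebra_simps diff_divide_distrib add_divide_distrib)
 also have "lattice_laplacian h v (x + h *\<^sub>R axis i 1) = - (h\<^sup>2 * l) * v (x + h *\<^sub>R axis i 1)"
  using A[OF x' sub] h \<rho> by (simp add: dist_norm)
 also have "lattice_laplacian h v x = - (h\<^sup>2 * l) * v x" using A[OF x(1) sub] \<rho> by simp
 finally show "lattice_laplacian h (lattice_diff h i v) x = - (h\<^sup>2 * l) * lattice_diff h i v x"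
  unfolding lattice_diff_def[of h i v x] by (simp add: algebra_simps diff_divide_distrib)
 define c where "c = x + (h / 2) *\<^sub>R axis i 1"
 have xc: "dist x c = h / 2" using h by (simp add: c_def dist_norm)
 have near: "dist x y \<le> \<rho>" if "dist c y < \<rho> / 4 + 2 * h" for y
  using dist_triangle[of x y c] xc that h by simp
 have "\<bar>v (x + h *\<^sub>R axis i 1) - v x\<bar> \<le> h * (2 * (real CARD('n) + 2) * M / (\<rho> / 4) + \<Lambda> * M * (\<rho> / 4))"
 proof (rule lattice_gradient_estimate[OF h x(1) c_def M])
  show "\<bar>v y\<bar> \<le> M" if "y \<in> lattice h" "dist c y < \<rho> / 4 + 2 * h" for y
   using A[OF that(1) sub[OF near[OF that(2)]]] by simp
  show "0 \<le> \<Lambda> * M" using l M by simp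
  fix y assume y: "y \<in> lattice h" "dist c y < \<rho> / 4"
  hence "dist c y < \<rho> / 4 + 2 * h" using h by simp
  from A[OF y(1) sub[OF near[OF this]]]
  have v: "lattice_laplacian h v y = - (h\<^sup>2 * l) * v y" "\<bar>v y\<bar> \<le> M" by auto
  have "l * \<bar>v y\<bar> \<le> \<Lambda> * M" using l v M by (intro mult_mono) auto
  hence "h\<^sup>2 * (l * \<bar>v y\<bar>) \<le> h\<^sup>2 * (\<Lambda> * M)" by (intro mult_left_mono) auto
  thus "\<bar>lattice_laplacian h v y\<bar> \<le> h\<^sup>2 * (\<Lambda> * M)" using l unfolding v(1) by (simp add: abs_mult mult.assoc)
 qed
 also have "... \<le> h * (M * (8 * (real CARD('n) + 2) / \<rho> + \<Lambda> * \<rho>))"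
 proof (intro mult_left_mono)
  have "\<Lambda> * M * (\<rho> / 4) \<le> \<Lambda> * M * \<rho>" using l M \<rho> by simp
  thus "2 * (real CARD('n) + 2) * M / (\<rho> / 4) + \<Lambda> * M * (\<rho> / 4) \<le> M * (8 * (real CARD('n) + 2) / \<rho> + \<Lambda> * \<rho>)"
   by (simp add: distrib_left mult_ac)
 qed (use h in simp)
 finally show "\<bar>lattice_diff h i v x\<bar> \<le> M * (8 * (real CARD('n) + 2) / \<rho> + \<Lambda> * \<rho>)"
  using h by (simp add: lattice_diff_def divide_le_eq mult.commute)
qed

text \<open>Induction on the number of steps of a shortest lattice path; a step towards x in one
coordinate stays within distance D of x.\<close>

lemma lattice_path_bound_aux:
 fixes F :: "real^'n => real"
 assumes h: "h > 0" and x: "x \<in> lattice h"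
  and step: "\<And>z i. z \<in> lattice h ==> dist x z \<le> D ==> \<bar>F (z + h *\<^sub>R axis i 1) - F z\<bar> \<le> C * h"
 shows "y \<in> lattice h ==> dist x y \<le> D ==> (\<Sum>i\<in>UNIV. \<bar>y $ i - x $ i\<bar>) = h * real k ==> \<bar>F y - F x\<bar> \<le> C * (h * real k)"
proof (induction k arbitrary: y)
 case 0
 hence "y $ i = x $ i" for i by (simp add: sum_nonneg_eq_0_iff)
 hence "y = x" by (simp add: vec_eq_iff)
 thus ?case by simp
next
 case (Suc k)
 have "\<exists>i. y $ i \<noteq> x $ i"
 proof (rule ccontr)
  assume "\<not> ?thesis"
  thus False using Suc.prems(3) h by simp
 qed
 then obtain i where i: "y $ i \<noteq> x $ i" by blast
 have "y $ i / h - x $ i / h \<in> \<int>" using Suc.prems(1) x by (intro Ints_diff) (auto simp: lattice_def)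
 then obtain m :: int where "y $ i / h - x $ i / h = m" by (auto elim: Ints_cases)
 hence m: "y $ i - x $ i = h * m" using h by (simp add: field_simps)
 hence m0: "m \<noteq> 0" using i by auto
 define t where "t = (if m > 0 then - h else h)"
 define y' where "y' = y + t *\<^sub>R axis i 1"
 have y'l: "y' \<in> lattice h" using lattice_step[OF Suc.prems(1) h, of i] by (simp add: y'_def t_def)
 have y'c: "y' $ j = y $ j + (if j = i then t else 0)" for j by (simp add: y'_def axis_def)
 have red: "\<bar>y' $ i - x $ i\<bar> = \<bar>y $ i - x $ i\<bar> - h"
 proof (cases "m > 0")
  case True
  hence "h * real_of_int m \<ge> h * 1" using h by (intro mult_left_mono) auto
  moreover have "y' $ i = y $ i - h" using True by (simp add: y'c t_def)
  ultimately show ?thesis using m h by linarith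
 next
  case False
  hence "m \<le> - 1" using m0 by simp
  hence "real_of_int m \<le> - 1" by linarith
  hence "h * real_of_int m \<le> h * (- 1)" using h by (intro mult_left_mono) auto
  moreover have "y' $ i = y $ i + h" using False by (simp add: y'c t_def)
  ultimately show ?thesis using m h by linarith
 qed
 have "\<bar>y' $ j - x $ j\<bar> = \<bar>y $ j - x $ j\<bar> - (if j = i then h else 0)" for j
  using red by (cases "j = i") (auto simp: y'c)
 hence "(\<Sum>j\<in>UNIV. \<bar>y' $ j - x $ j\<bar>) = (\<Sum>j\<in>UNIV. \<bar>y $ j - x $ j\<bar>) - h"
  by (simp add: sum_subtractf)
 hence S': "(\<Sum>j\<in>UNIV. \<bar>y' $ j - x $ j\<bar>) = h * real k" using Suc.prems(3) by (simp add: algebra_simps)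
 have "norm (y' - x) \<le> norm (y - x)"
  by (rule norm_le_componentwise_cart) (use red h in "auto simp: y'c")
 hence D': "dist x y' \<le> D" using Suc.prems(2) by (simp add: dist_norm norm_minus_commute)
 have IH: "\<bar>F y' - F x\<bar> \<le> C * (h * real k)" by (rule Suc.IH[OF y'l D' S'])
 have "\<bar>F y - F y'\<bar> \<le> C * h"
 proof (cases "m > 0")
  case True
  hence "y = y' + h *\<^sub>R axis i 1" by (simp add: y'_def t_def)
  thus ?thesis using step[OF y'l D', of i] by simp
 next
  case False
  hence "y' = y + h *\<^sub>R axis i 1" by (simp add: y'_def t_def)
  thus ?thesis using step[OF Suc.prems(1,2), of i] by simp
 qed
 hence "\<bar>F y - F x\<bar> \<le> C * (h * real k) + C * h" using IH by linarith
 thus ?case by (simp add: algebra_simps)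
qed

lemma lattice_path_bound:
 fixes F :: "real^'n => real"
 assumes h: "h > 0" and x: "x \<in> lattice h" and C: "C \<ge> 0"
  and step: "\<And>z i. z \<in> lattice h ==> dist x z \<le> dist x y ==> \<bar>F (z + h *\<^sub>R axis i 1) - F z\<bar> \<le> C * h"
  and y: "y \<in> lattice h"
 shows "\<bar>F y - F x\<bar> \<le> C * (real CARD('n) * dist x y)"
proof -
 have "(\<Sum>i\<in>UNIV. \<bar>y $ i / h - x $ i / h\<bar>) \<in> \<int>"
  using x y by (intro Ints_sum) (auto simp: lattice_def intro!: Ints_abs Ints_diff)
 then obtain m :: int where m: "(\<Sum>i\<in>UNIV. \<bar>y $ i / h - x $ i / h\<bar>) = m" by (auto elim: Ints_cases)
 have "(\<Sum>i\<in>UNIV. \<bar>y $ i / h - x $ i / h\<bar>) \<ge> 0" by (intro sum_nonneg) auto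
 hence m0: "m \<ge> 0" using m by simp
 have S: "(\<Sum>i\<in>UNIV. \<bar>y $ i - x $ i\<bar>) = h * real (nat m)"
 proof -
  have "\<bar>y $ i - x $ i\<bar> = h * \<bar>y $ i / h - x $ i / h\<bar>" for i
  proof -
   have "y $ i - x $ i = h * (y $ i / h - x $ i / h)" using h by (simp add: right_diff_distrib)
   thus ?thesis using h by (metis abs_mult abs_of_pos)
  qed
  hence "(\<Sum>i\<in>UNIV. \<bar>y $ i - x $ i\<bar>) = h * (\<Sum>i\<in>UNIV. \<bar>y $ i / h - x $ i / h\<bar>)"
   by (simp add: sum_distrib_left)
  thus ?thesis using m m0 by simp
 qed
 have "\<bar>F y - F x\<bar> \<le> C * (\<Sum>i\<in>UNIV. \<bar>y $ i - x $ i\<bar>)"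
  unfolding S by (rule lattice_path_bound_aux[OF h x step y order_refl S])
 also have "(\<Sum>i\<in>UNIV. \<bar>y $ i - x $ i\<bar>) \<le> (\<Sum>i\<in>(UNIV::'n set). dist x y)"
  using component_le_norm_cart[of "y - x"] by (intro sum_mono) (auto simp: dist_norm norm_minus_commute)
 hence "C * (\<Sum>i\<in>UNIV. \<bar>y $ i - x $ i\<bar>) \<le> C * (real CARD('n) * dist x y)" using C by (intro mult_left_mono) auto
 finally show ?thesis .
qed

section \<open>Subsequences that converge with all difference quotients\<close>

fun lattice_diffs :: "real => 'n list => (real^'n => real) => real^'n => real" where
 "lattice_diffs h [] v = v"
| "lattice_diffs h (i # l) v = lattice_diff h i (lattice_diffs h l v)"

text \<open>The arctangent turns sequences that are bounded only eventually into bounded ones, as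
is needed for a diagonal argument.\<close>

lemma tendsto_if_arctan_tendsto:
 fixes b :: "nat => real"
 assumes L: "(\<lambda>k. arctan (b k)) \<longlonglongrightarrow> L" and B: "\<forall>\<^sub>F k in sequentially. \<bar>b k\<bar> \<le> C"
 shows "b \<longlonglongrightarrow> tan L"
proof -
 have u: "L \<le> arctan C"
  by (rule tendsto_upperbound[OF L]) (use B in "auto elim!: eventually_mono simp: arctan_le_iff")
 have l: "arctan (- C) \<le> L"
  by (rule tendsto_lowerbound[OF L]) (use B in "auto elim!: eventually_mono simp: arctan_le_iff abs_le_iff simp del: arctan_minus")
 have "- (pi / 2) < L" "L < pi / 2" using u l arctan_ubound[of C] arctan_lbound[of "- C"] by linarith+
 hence "cos L \<noteq> 0" using cos_gt_zero_pi by force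
 hence "(\<lambda>k. tan (arctan (b k))) \<longlonglongrightarrow> tan L" by (intro isCont_tendsto_compose[OF isCont_tan L])
 thus ?thesis by (simp add: tan_arctan)
qed

lemma convergent_if_approx:
 fixes a :: "nat => real"
 assumes "\<And>e. e > 0 ==> \<exists>b. convergent b \<and> (\<forall>\<^sub>F k in sequentially. \<bar>a k - b k\<bar> \<le> e)"
 shows "convergent a"
proof (rule Cauchy_convergent, rule CauchyI)
 fix e :: real assume e: "0 < e"
 obtain b where b: "convergent b" "\<forall>\<^sub>F k in sequentially. \<bar>a k - b k\<bar> \<le> e / 4"
  using assms[of "e / 4"] e by auto
 obtain N1 where N1: "\<And>k. k \<ge> N1 ==> \<bar>a k - b k\<bar> \<le> e / 4" using b(2) by (auto simp: eventually_sequentially)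
 obtain N2 where N2: "\<And>m n. m \<ge> N2 ==> n \<ge> N2 ==> norm (b m - b n) < e / 4"
  using CauchyD[OF convergent_Cauchy[OF b(1)], of "e / 4"] e by auto
 show "\<exists>M. \<forall>m\<ge>M. \<forall>n\<ge>M. norm (a m - a n) < e"
 proof (intro exI allI impI)
  fix m n assume "max N1 N2 \<le> m" "max N1 N2 \<le> n"
  thus "norm (a m - a n) < e" using N1[of m] N1[of n] N2[of m n] e by (simp add: abs_if split: if_splits)
 qed
qed

text \<open>Lattice eigenfunctions with mesh tending to 0 and bounded eigenvalues. Below, \<open>D
l k\<close> is the iterated difference quotient of the k-th eigenfunction in the directions l, and
\<open>R k x\<close> is a point of the k-th lattice near x.\<close>

locale lattice_sequence =
 fixes \<Omega> :: "(real^'n) set" and hs ls :: "nat => real" and vs :: "nat => real^'n => real" and \<Lambda> :: real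
 assumes open_\<Omega>: "open \<Omega>"
  and hs_pos: "\<And>k. hs k > 0" and hs_lim: "hs \<longlonglongrightarrow> 0"
  and ls: "\<And>k. 0 \<le> ls k" "\<And>k. ls k \<le> \<Lambda>"
  and eig: "\<And>k. lattice_eigenfunction \<Omega> (hs k) (ls k) (vs k)"
begin

abbreviation D :: "'n list => nat => real^'n => real" where
 "D l k \<equiv> lattice_diffs (hs k) l (vs k)"

abbreviation R :: "nat => real^'n => real^'n" where
 "R k \<equiv> lattice_floor (hs k)"

lemma hs_small: "e > 0 ==> \<forall>\<^sub>F k in sequentially. hs k < e"
 using order_tendstoD(2)[OF hs_lim] .

text \<open>By induction on l; every further difference uses up half of the distance to the
boundary.\<close>

lemma diffs_bound:
 "r > 0 ==> \<exists>C>0. \<forall>\<^sub>F k in sequentially. \<forall>x\<in>lattice (hs k). cball x r \<subseteq> \<Omega> -->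
   lattice_laplacian (hs k) (D l k) x = - ((hs k)\<^sup>2 * ls k) * D l k x \<and> \<bar>D l k x\<bar> \<le> C"
proof (induction l arbitrary: r)
 case Nil
 have "lattice_laplacian (hs k) (vs k) x = - ((hs k)\<^sup>2 * ls k) * vs k x \<and> \<bar>vs k x\<bar> \<le> 1"
  if k: "hs k < r" and x: "x \<in> lattice (hs k)" "cball x r \<subseteq> \<Omega>" for k x
 proof -
  have "uncut \<Omega> (vs k) x z = vs k z" if "dist x z \<le> hs k" for z
  proof -
   have "closed_segment x z \<subseteq> cball x r" using that k Nil by (intro closed_segment_subset) auto
   thus ?thesis using x(2) by (auto simp: uncut_def)
  qed
  hence "neighbour_sum \<Omega> (hs k) (vs k) x = (\<Sum>i\<in>UNIV. vs k (x + hs k *\<^sub>R axis i 1) + vs k (x - hs k *\<^sub>R axis i 1))"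
   unfolding neighbour_sum_def using hs_pos[of k] by (intro sum.cong) (auto simp: dist_norm)
  moreover have "x \<in> \<Omega>" using x(2) Nil by (meson centre_in_cball less_imp_le subsetD)
  hence ev: "neighbour_sum \<Omega> (hs k) (vs k) x = (2 * real CARD('n) - (hs k)\<^sup>2 * ls k) * vs k x"
   "0 \<le> vs k x" "vs k x \<le> 1"
   using eig[of k] x(1) by (auto simp: lattice_eigenfunction_def)
  ultimately show ?thesis using ev
   by (simp add: lattice_laplacian_def sum_subtractf left_diff_distrib)
 qed
 thus ?case using hs_small[OF Nil] by (intro exI[of _ 1]) (auto elim!: eventually_mono)
next
 case (Cons i l)
 define \<rho> where "\<rho> = r / 2"
 have \<rho>: "\<rho> > 0" "\<rho> + \<rho> = r" using Cons.prems by (auto simp: \<rho>_def)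
 hence \<rho>4: "\<rho> / 4 > 0" by simp
 obtain M where M: "M > 0" and ev: "\<forall>\<^sub>F k in sequentially. \<forall>x\<in>lattice (hs k). cball x \<rho> \<subseteq> \<Omega> -->
   lattice_laplacian (hs k) (D l k) x = - ((hs k)\<^sup>2 * ls k) * D l k x \<and> \<bar>D l k x\<bar> \<le> M"
  using Cons.IH[OF \<rho>(1)] by blast
 define C where "C = M * (8 * (real CARD('n) + 2) / \<rho> + \<Lambda> * \<rho>)"
 have "\<Lambda> \<ge> 0" using ls[of 0] by linarith
 hence C0: "C > 0" unfolding C_def using M \<rho> by (intro mult_pos_pos add_pos_nonneg) auto
 have "\<forall>\<^sub>F k in sequentially. \<forall>x\<in>lattice (hs k). cball x r \<subseteq> \<Omega> -->
   lattice_laplacian (hs k) (D (i # l) k) x = - ((hs k)\<^sup>2 * ls k) * D (i # l) k x \<and> \<bar>D (i # l) k x\<bar> \<le> C"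
  using ev hs_small[OF \<rho>4]
 proof eventually_elim
  case (elim k)
  have A: "lattice_laplacian (hs k) (D l k) x = - ((hs k)\<^sup>2 * ls k) * D l k x \<and> \<bar>D l k x\<bar> \<le> M"
   if "x \<in> lattice (hs k)" "cball x \<rho> \<subseteq> \<Omega>" for x using elim(1) that by blast
  have hk: "hs k \<le> \<rho> / 4" using elim(2) \<rho> by auto
  show ?case
  proof (intro ballI impI)
   fix x assume x: "x \<in> lattice (hs k)" "cball x r \<subseteq> \<Omega>"
   have x2: "cball x (\<rho> + \<rho>) \<subseteq> \<Omega>" using x(2) \<rho> by simp
   show "lattice_laplacian (hs k) (D (i # l) k) x = - ((hs k)\<^sup>2 * ls k) * D (i # l) k x \<and> \<bar>D (i # l) k x\<bar> \<le> C"
    using lattice_diff_interior_bound[OF hs_pos hk ls M A x(1) x2] by (simp add: C_def)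
  qed
 qed
 with C0 show ?case by blast
qed

lemma diffs_lipschitz:
 assumes r: "r > 0"
 shows "\<exists>C\<ge>0. \<forall>\<^sub>F k in sequentially. \<forall>x\<in>lattice (hs k). \<forall>y\<in>lattice (hs k). cball x (r + dist x y) \<subseteq> \<Omega> -->
   \<bar>D l k y - D l k x\<bar> \<le> C * dist x y"
proof -
 have "\<exists>C. C > 0 \<and> (\<forall>\<^sub>F k in sequentially. \<forall>x\<in>lattice (hs k). cball x r \<subseteq> \<Omega> --> \<bar>D (i # l) k x\<bar> \<le> C)" for i
 proof -
  obtain C where "C > 0" and ev: "\<forall>\<^sub>F k in sequentially. \<forall>x\<in>lattice (hs k). cball x r \<subseteq> \<Omega> -->
   lattice_laplacian (hs k) (D (i # l) k) x = - ((hs k)\<^sup>2 * ls k) * D (i # l) k x \<and> \<bar>D (i # l) k x\<bar> \<le> C"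
   using diffs_bound[OF r, of "i # l"] by blast
  from ev have "\<forall>\<^sub>F k in sequentially. \<forall>x\<in>lattice (hs k). cball x r \<subseteq> \<Omega> --> \<bar>D (i # l) k x\<bar> \<le> C"
   by (rule eventually_mono) blast
  with \<open>C > 0\<close> show ?thesis by blast
 qed
 from choice[OF allI[OF this]] obtain C where
  *: "\<forall>i. C i > 0 \<and> (\<forall>\<^sub>F k in sequentially. \<forall>x\<in>lattice (hs k). cball x r \<subseteq> \<Omega> --> \<bar>D (i # l) k x\<bar> \<le> C i)" ..
 have C: "C i > 0" for i using *[THEN spec, of i] by (rule conjunct1)
 have ev: "\<forall>\<^sub>F k in sequentially. \<forall>x\<in>lattice (hs k). cball x r \<subseteq> \<Omega> --> \<bar>D (i # l) k x\<bar> \<le> C i" for i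
  using *[THEN spec, of i] by (rule conjunct2)
 define C' where "C' = (\<Sum>i\<in>UNIV. C i)"
 have CC: "C i \<le> C'" for i unfolding C'_def by (rule member_le_sum) (auto intro: less_imp_le C)
 have C'0: "C' \<ge> 0" unfolding C'_def by (intro sum_nonneg) (auto intro: less_imp_le C)
 have "\<forall>\<^sub>F k in sequentially. \<forall>i\<in>UNIV. \<forall>x\<in>lattice (hs k). cball x r \<subseteq> \<Omega> --> \<bar>D (i # l) k x\<bar> \<le> C i"
  by (intro eventually_ball_finite ballI ev finite)
 hence "\<forall>\<^sub>F k in sequentially. \<forall>x\<in>lattice (hs k). \<forall>y\<in>lattice (hs k). cball x (r + dist x y) \<subseteq> \<Omega> -->
   \<bar>D l k y - D l k x\<bar> \<le> (C' * real CARD('n)) * dist x y"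
 proof eventually_elim
  case (elim k)
  show ?case
  proof (intro ballI impI)
   fix x y assume x: "x \<in> lattice (hs k)" and y: "y \<in> lattice (hs k)" and sub: "cball x (r + dist x y) \<subseteq> \<Omega>"
   have "\<bar>D l k y - D l k x\<bar> \<le> C' * (real CARD('n) * dist x y)"
   proof (rule lattice_path_bound[OF hs_pos x C'0 _ y])
    fix z i assume z: "z \<in> lattice (hs k)" "dist x z \<le> dist x y"
    have "cball z r \<subseteq> cball x (r + dist x y)" using z(2) by (simp add: cball_subset_cball_iff dist_commute)
    hence "\<bar>D (i # l) k z\<bar> \<le> C'" using elim z(1) sub CC[of i] by (meson order_trans subset_trans UNIV_I)
    hence "hs k * \<bar>D (i # l) k z\<bar> \<le> hs k * C'" using hs_pos[of k] by (intro mult_left_mono) auto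
    moreover have "D l k (z + hs k *\<^sub>R axis i 1) - D l k z = hs k * D (i # l) k z"
     using hs_pos[of k] by (simp add: lattice_diff_def)
    ultimately show "\<bar>D l k (z + hs k *\<^sub>R axis i 1) - D l k z\<bar> \<le> C' * hs k"
     using hs_pos[of k] by (simp add: abs_mult mult.commute)
   qed
   thus "\<bar>D l k y - D l k x\<bar> \<le> (C' * real CARD('n)) * dist x y" by (simp add: mult.assoc)
  qed
 qed
 moreover have "C' * real CARD('n) \<ge> 0" using C'0 by simp
 ultimately show ?thesis by blast
qed

text \<open>The steps of the remainder along a lattice path are differences of the quotients of
the next order, which are Lipschitz.\<close>

lemma diffs_taylor:
 assumes r: "r > 0"
 shows "\<exists>C\<ge>0. \<forall>\<^sub>F k in sequentially. \<forall>x\<in>lattice (hs k). \<forall>y\<in>lattice (hs k). cball x (r + dist x y) \<subseteq> \<Omega> -->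
   \<bar>D l k y - D l k x - (\<Sum>i\<in>UNIV. (y - x) $ i * D (i # l) k x)\<bar> \<le> C * (dist x y)\<^sup>2"
proof -
 have "\<exists>C. C \<ge> 0 \<and> (\<forall>\<^sub>F k in sequentially. \<forall>x\<in>lattice (hs k). \<forall>y\<in>lattice (hs k). cball x (r + dist x y) \<subseteq> \<Omega> -->
   \<bar>D (i # l) k y - D (i # l) k x\<bar> \<le> C * dist x y)" for i
  using diffs_lipschitz[OF r, of "i # l"] by blast
 from choice[OF allI[OF this]] obtain C where
  *: "\<forall>i. C i \<ge> 0 \<and> (\<forall>\<^sub>F k in sequentially. \<forall>x\<in>lattice (hs k). \<forall>y\<in>lattice (hs k). cball x (r + dist x y) \<subseteq> \<Omega> -->
   \<bar>D (i # l) k y - D (i # l) k x\<bar> \<le> C i * dist x y)" ..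
 have C: "C i \<ge> 0" for i using *[THEN spec, of i] by (rule conjunct1)
 have ev: "\<forall>\<^sub>F k in sequentially. \<forall>x\<in>lattice (hs k). \<forall>y\<in>lattice (hs k). cball x (r + dist x y) \<subseteq> \<Omega> -->
   \<bar>D (i # l) k y - D (i # l) k x\<bar> \<le> C i * dist x y" for i
  using *[THEN spec, of i] by (rule conjunct2)
 define C' where "C' = (\<Sum>i\<in>UNIV. C i)"
 have CC: "C i \<le> C'" for i unfolding C'_def by (rule member_le_sum) (auto intro: C)
 have C'0: "C' \<ge> 0" unfolding C'_def by (intro sum_nonneg) (auto intro: C)
 have "\<forall>\<^sub>F k in sequentially. \<forall>i\<in>UNIV. \<forall>x\<in>lattice (hs k). \<forall>y\<in>lattice (hs k). cball x (r + dist x y) \<subseteq> \<Omega> -->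
   \<bar>D (i # l) k y - D (i # l) k x\<bar> \<le> C i * dist x y"
  by (intro eventually_ball_finite ballI ev finite)
 hence "\<forall>\<^sub>F k in sequentially. \<forall>x\<in>lattice (hs k). \<forall>y\<in>lattice (hs k). cball x (r + dist x y) \<subseteq> \<Omega> -->
   \<bar>D l k y - D l k x - (\<Sum>i\<in>UNIV. (y - x) $ i * D (i # l) k x)\<bar> \<le> (C' * real CARD('n)) * (dist x y)\<^sup>2"
 proof eventually_elim
  case (elim k)
  show ?case
  proof (intro ballI impI)
   fix x y assume x: "x \<in> lattice (hs k)" and y: "y \<in> lattice (hs k)" and sub: "cball x (r + dist x y) \<subseteq> \<Omega>"
   define F where "F w = D l k w - (\<Sum>i\<in>UNIV. (w - x) $ i * D (i # l) k x)" for w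
   have "\<bar>F y - F x\<bar> \<le> (C' * dist x y) * (real CARD('n) * dist x y)"
   proof (rule lattice_path_bound[OF hs_pos x _ _ y])
    fix z j assume z: "z \<in> lattice (hs k)" "dist x z \<le> dist x y"
    have "cball x (r + dist x z) \<subseteq> \<Omega>" using sub z(2) by (meson add_left_mono subset_cball subset_trans)
    hence "\<bar>D (j # l) k z - D (j # l) k x\<bar> \<le> C j * dist x z" using elim x z(1) by blast
    also have "... \<le> C' * dist x y" using CC[of j] z(2) C C'0 by (intro mult_mono) auto
    finally have b: "hs k * \<bar>D (j # l) k z - D (j # l) k x\<bar> \<le> hs k * (C' * dist x y)" using hs_pos[of k] by (intro mult_left_mono) auto
    have "(\<Sum>i\<in>UNIV. (z + hs k *\<^sub>R axis j 1 - x) $ i * D (i # l) k x)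
     = (\<Sum>i\<in>UNIV. (z - x) $ i * D (i # l) k x + (if i = j then hs k * D (j # l) k x else 0))"
     by (intro sum.cong) (auto simp: axis_def algebra_simps)
    hence "F (z + hs k *\<^sub>R axis j 1) - F z = (D l k (z + hs k *\<^sub>R axis j 1) - D l k z) - hs k * D (j # l) k x"
     by (simp add: F_def sum.distrib)
    also have "D l k (z + hs k *\<^sub>R axis j 1) - D l k z = hs k * D (j # l) k z"
     using hs_pos[of k] by (simp add: lattice_diff_def)
    finally have "F (z + hs k *\<^sub>R axis j 1) - F z = hs k * (D (j # l) k z - D (j # l) k x)" by (simp add: right_diff_distrib)
    thus "\<bar>F (z + hs k *\<^sub>R axis j 1) - F z\<bar> \<le> (C' * dist x y) * hs k"
     using b hs_pos[of k] by (simp add: abs_mult mult_ac)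
   qed (use C'0 in simp)
   moreover have "F y - F x = D l k y - D l k x - (\<Sum>i\<in>UNIV. (y - x) $ i * D (i # l) k x)" by (simp add: F_def)
   ultimately show "\<bar>D l k y - D l k x - (\<Sum>i\<in>UNIV. (y - x) $ i * D (i # l) k x)\<bar> \<le> (C' * real CARD('n)) * (dist x y)\<^sup>2"
    by (simp add: power2_eq_square mult_ac)
  qed
 qed
 moreover have "C' * real CARD('n) \<ge> 0" using C'0 by simp
 ultimately show ?thesis by blast
qed

lemma floor_in_lattice: "R k x \<in> lattice (hs k)"
 by (rule lattice_floor_in[OF hs_pos])

lemma floor_near:
 assumes "e > 0" shows "\<forall>\<^sub>F k in sequentially. \<forall>x. dist x (R k x) < e"
proof -
 have "\<forall>\<^sub>F k in sequentially. hs k < e / real CARD('n)" using assms by (intro hs_small) simp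
 thus ?thesis
 proof eventually_elim
  case (elim k)
  show ?case
  proof
   fix x :: "real^'n"
   have "dist x (R k x) \<le> real CARD('n) * hs k" by (rule dist_lattice_floor[OF hs_pos])
   also have "... < e" using elim by (simp add: pos_less_divide_eq mult.commute)
   finally show "dist x (R k x) < e" .
  qed
 qed
qed

lemma floor_tendsto: "(\<lambda>k. R k x) \<longlonglongrightarrow> x"
proof (rule tendstoI)
 fix e :: real assume "e > 0"
 from floor_near[OF this] show "\<forall>\<^sub>F k in sequentially. dist (R k x) x < e"
  by (rule eventually_mono) (simp add: dist_commute)
qed

lemma room:
 assumes "x \<in> \<Omega>"
 obtains r where "r > 0" "cball x (4 * r) \<subseteq> \<Omega>"
proof -
 obtain e where "e > 0" "cball x e \<subseteq> \<Omega>" using open_\<Omega> assms open_contains_cball by blast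
 thus ?thesis using that[of "e / 4"] by simp
qed

lemma floor_room:
 assumes r: "r > 0" "cball x (4 * r) \<subseteq> \<Omega>"
 shows "\<forall>\<^sub>F k in sequentially. \<forall>y. dist x y \<le> r / 2 --> cball (R k x) (r + dist (R k x) (R k y)) \<subseteq> \<Omega>"
proof -
 have "r / 4 > 0" using r by simp
 from floor_near[OF this] show ?thesis
proof eventually_elim
 case (elim k)
 show ?case
 proof (intro allI impI)
  fix y assume y: "dist x y \<le> r / 2"
  have "dist (R k x) (R k y) \<le> dist (R k x) x + (dist x y + dist y (R k y))"
   using dist_triangle[of "R k x" "R k y" x] dist_triangle[of x "R k y" y] by linarith
  hence "dist (R k x) (R k y) \<le> r" using y elim[rule_format, of x] elim[rule_format, of y] by (simp add: dist_commute)
  hence "cball (R k x) (r + dist (R k x) (R k y)) \<subseteq> cball x (4 * r)"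
   using elim[rule_format, of x] r by (simp add: cball_subset_cball_iff dist_commute)
  thus "cball (R k x) (r + dist (R k x) (R k y)) \<subseteq> \<Omega>" using r by blast
 qed
qed
qed

text \<open>The argument of Arzela and Ascoli for all orders at once: a diagonal subsequence
converges at the points of a countable dense set, and the Lipschitz bounds carry the convergence
to all points.\<close>

lemma convergent_subsequence:
 obtains s where "strict_mono (s :: nat => nat)" "convergent (\<lambda>k. ls (s k))"
  "\<And>l x. x \<in> \<Omega> ==> convergent (\<lambda>k. D l (s k) (R (s k) x))"
proof -
 obtain Q :: "(real^'n) set" where Q: "countable Q" "\<And>S. open S ==> S \<noteq> {} ==> \<exists>q\<in>Q. q \<in> S"
  using countable_dense_setE by metis
 define S where "S = insert None (Some ` ((UNIV :: 'n list set) \<times> Q))"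
 have "countable (UNIV :: 'n list set)"
  using countable_lists[of "UNIV :: 'n set"] by (simp add: countable_finite)
 hence S: "countable S" unfolding S_def using Q by auto
 define f where "f k z = (case z of None => arctan (ls k) | Some (l, x) => arctan (D l k (R k x)))" for k z
 have "\<bar>arctan y\<bar> \<le> pi" for y using arctan_ubound[of y] arctan_lbound[of y] pi_gt_zero by linarith
 hence fb: "norm (f k z) \<le> pi" for k z
  unfolding f_def by (simp split: option.splits prod.splits)
 obtain s where s: "strict_mono (s :: nat => nat)" "\<And>z. z \<in> S ==> \<exists>L. (\<lambda>k. f (s k) z) \<longlonglongrightarrow> L"
  using function_convergent_subsequence[OF S, of f pi] fb by metis
 have sub: "\<forall>\<^sub>F k in sequentially. P (s k)" if "\<forall>\<^sub>F k in sequentially. P k" for P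
  using that s(1) eventually_subseq by blast
 have 1: "convergent (\<lambda>k. ls (s k))"
 proof -
  obtain L where "(\<lambda>k. f (s k) None) \<longlonglongrightarrow> L" using s(2)[of None] by (auto simp: S_def)
  hence "(\<lambda>k. arctan (ls (s k))) \<longlonglongrightarrow> L" by (simp add: f_def)
  moreover have "\<bar>ls (s k)\<bar> \<le> \<Lambda>" for k using ls[of "s k"] by simp
  ultimately show ?thesis using tendsto_if_arctan_tendsto[of "\<lambda>k. ls (s k)" L \<Lambda>] by (auto simp: convergent_def)
 qed
 have 2: "convergent (\<lambda>k. D l (s k) (R (s k) x))" if x: "x \<in> Q" "x \<in> \<Omega>" for l x
 proof -
  obtain L where "(\<lambda>k. f (s k) (Some (l, x))) \<longlonglongrightarrow> L" using s(2)[of "Some (l, x)"] x by (auto simp: S_def)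
  hence L: "(\<lambda>k. arctan (D l (s k) (R (s k) x))) \<longlonglongrightarrow> L" by (simp add: f_def)
  obtain r where r: "r > 0" "cball x (4 * r) \<subseteq> \<Omega>" using room[OF x(2)] .
  obtain C where "\<forall>\<^sub>F k in sequentially. \<forall>x\<in>lattice (hs k). cball x r \<subseteq> \<Omega> -->
   lattice_laplacian (hs k) (D l k) x = - ((hs k)\<^sup>2 * ls k) * D l k x \<and> \<bar>D l k x\<bar> \<le> C"
   using diffs_bound[OF r(1)] by blast
  hence "\<forall>\<^sub>F k in sequentially. \<bar>D l k (R k x)\<bar> \<le> C"
   using floor_room[OF r]
  proof eventually_elim
   case (elim k)
   have "cball (R k x) r \<subseteq> \<Omega>" using elim(2)[rule_format, of x] r by simp
   thus ?case using elim(1) floor_in_lattice by blast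
  qed
  from sub[OF this] show ?thesis using tendsto_if_arctan_tendsto[OF L] by (auto simp: convergent_def)
 qed
 have 3: "convergent (\<lambda>k. D l (s k) (R (s k) x))" if x: "x \<in> \<Omega>" for l x
 proof (rule convergent_if_approx)
  fix e :: real assume e: "e > 0"
  obtain r where r: "r > 0" "cball x (4 * r) \<subseteq> \<Omega>" using room[OF x] .
  obtain C where C: "C \<ge> 0" and ev: "\<forall>\<^sub>F k in sequentially. \<forall>x\<in>lattice (hs k). \<forall>y\<in>lattice (hs k). cball x (r + dist x y) \<subseteq> \<Omega> -->
   \<bar>D l k y - D l k x\<bar> \<le> C * dist x y" using diffs_lipschitz[OF r(1), of l] by blast
  define d where "d = min (r / 2) (e / (3 * (C + 1)))"
  have d: "d > 0" using r e C by (simp add: d_def)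
  obtain y where y: "y \<in> Q" "dist x y < d" using Q(2)[of "ball x d"] d by auto
  have "y \<in> cball x (4 * r)" using y(2) r(1) unfolding d_def by simp
  hence y\<Omega>: "y \<in> \<Omega>" using r by blast
  have "\<forall>\<^sub>F k in sequentially. \<bar>D l k (R k x) - D l k (R k y)\<bar> \<le> e"
   using ev floor_room[OF r] floor_near[OF d]
  proof eventually_elim
   case (elim k)
   have "cball (R k x) (r + dist (R k x) (R k y)) \<subseteq> \<Omega>" using elim(2) y by (simp add: d_def)
   hence "\<bar>D l k (R k y) - D l k (R k x)\<bar> \<le> C * dist (R k x) (R k y)"
    using elim(1) floor_in_lattice by blast
   also have "dist (R k x) (R k y) \<le> dist (R k x) x + (dist x y + dist y (R k y))"
    using dist_triangle[of "R k x" "R k y" x] dist_triangle[of x "R k y" y] by linarith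
   hence "dist (R k x) (R k y) \<le> 3 * d" using y elim(3)[rule_format, of x] elim(3)[rule_format, of y] by (simp add: dist_commute)
   hence "C * dist (R k x) (R k y) \<le> C * (3 * (e / (3 * (C + 1))))"
    using C by (intro mult_left_mono) (auto simp: d_def)
   also have "... = C * e / (C + 1)" using C by (simp add: field_simps)
   also have "... \<le> e" using C e by (simp add: divide_le_eq algebra_simps)
   finally show ?case by (simp add: abs_minus_commute)
  qed
  from sub[OF this] 2[OF y(1) y\<Omega>] show "\<exists>b. convergent b \<and> (\<forall>\<^sub>F k in sequentially. \<bar>D l (s k) (R (s k) x) - b k\<bar> \<le> e)"
   by blast
 qed
 show ?thesis using that[OF s(1) 1 3] .
qed

end

section \<open>The limit of the lattice ground states\<close>

lemma has_derivative_if_quadratic_error: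
 fixes f :: "'a::real_normed_vector => real"
 assumes L: "bounded_linear L" and r: "r > 0"
  and q: "\<And>y. dist x y \<le> r ==> \<bar>f y - f x - L (y - x)\<bar> \<le> C * (dist x y)\<^sup>2"
 shows "(f has_derivative L) (at x)"
 unfolding has_derivative_at_alt
proof (intro conjI L allI impI)
 fix e :: real assume e: "0 < e"
 define d where "d = min r (e / (\<bar>C\<bar> + 1))"
 have d: "d > 0" using r e by (simp add: d_def)
 have "norm (f y - f x - L (y - x)) \<le> e * norm (y - x)" if y: "norm (y - x) < d" for y
 proof -
  have dy: "dist x y = norm (y - x)" by (simp add: dist_norm norm_minus_commute)
  have "\<bar>f y - f x - L (y - x)\<bar> \<le> C * (norm (y - x))\<^sup>2" using q[of y] y by (simp add: dy d_def)
  also have "... \<le> (\<bar>C\<bar> * norm (y - x)) * norm (y - x)"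
   unfolding power2_eq_square mult.assoc by (intro mult_right_mono) auto
  also have "... \<le> e * norm (y - x)"
  proof (rule mult_right_mono)
   have "\<bar>C\<bar> * norm (y - x) \<le> \<bar>C\<bar> * (e / (\<bar>C\<bar> + 1))" using y by (intro mult_left_mono) (auto simp: d_def)
   also have "... \<le> e" using e by (simp add: divide_le_eq algebra_simps)
   finally show "\<bar>C\<bar> * norm (y - x) \<le> e" .
  qed simp
  finally show ?thesis by simp
 qed
 with d show "\<exists>d>0. \<forall>y. norm (y - x) < d --> norm (f y - f x - L (y - x)) \<le> e * norm (y - x)" by blast
qed

text \<open>The limits \<open>U l\<close> turn out to be the iterated partial derivatives of
\<open>U []\<close>.\<close>

locale convergent_lattice_sequence = lattice_sequence +
 fixes lam :: real and U :: "'a list => real ^ 'a => real"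
 assumes ls_lim: "ls \<longlonglongrightarrow> lam"
  and U_lim: "\<And>l x. x \<in> \<Omega> ==> (\<lambda>k. D l k (R k x)) \<longlonglongrightarrow> U l x"
begin

lemma U_has_derivative:
 assumes x: "x \<in> \<Omega>"
 shows "(U l has_derivative (\<lambda>h. \<Sum>i\<in>UNIV. h $ i * U (i # l) x)) (at x)"
proof -
 obtain r where r: "r > 0" "cball x (4 * r) \<subseteq> \<Omega>" using room[OF x] .
 obtain C where C: "C \<ge> 0" and ev: "\<forall>\<^sub>F k in sequentially. \<forall>x\<in>lattice (hs k). \<forall>y\<in>lattice (hs k). cball x (r + dist x y) \<subseteq> \<Omega> -->
   \<bar>D l k y - D l k x - (\<Sum>i\<in>UNIV. (y - x) $ i * D (i # l) k x)\<bar> \<le> C * (dist x y)\<^sup>2"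
  using diffs_taylor[OF r(1), of l] by blast
 have "\<bar>U l y - U l x - (\<Sum>i\<in>UNIV. (y - x) $ i * U (i # l) x)\<bar> \<le> C * (dist x y)\<^sup>2" if y: "dist x y \<le> r / 2" for y
 proof (rule tendsto_le[OF trivial_limit_sequentially])
  have "y \<in> cball x (4 * r)" using y r by simp
  hence y\<Omega>: "y \<in> \<Omega>" using r by blast
  show "(\<lambda>k. C * (dist (R k x) (R k y))\<^sup>2) \<longlonglongrightarrow> C * (dist x y)\<^sup>2"
   by (intro tendsto_intros floor_tendsto)
  show "(\<lambda>k. \<bar>D l k (R k y) - D l k (R k x) - (\<Sum>i\<in>UNIV. (R k y - R k x) $ i * D (i # l) k (R k x))\<bar>)
    \<longlonglongrightarrow> \<bar>U l y - U l x - (\<Sum>i\<in>UNIV. (y - x) $ i * U (i # l) x)\<bar>"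
   by (intro tendsto_intros floor_tendsto U_lim x y\<Omega>)
  show "\<forall>\<^sub>F k in sequentially. \<bar>D l k (R k y) - D l k (R k x) - (\<Sum>i\<in>UNIV. (R k y - R k x) $ i * D (i # l) k (R k x))\<bar>
    \<le> C * (dist (R k x) (R k y))\<^sup>2"
   using ev floor_room[OF r]
  proof eventually_elim
   case (elim k)
   show ?case using elim(1) elim(2)[rule_format, OF y] floor_in_lattice by blast
  qed
 qed
 moreover have "bounded_linear (\<lambda>h::real^'a. \<Sum>i\<in>UNIV. h $ i * U (i # l) x)"
  by (intro bounded_linear_sum bounded_linear_mult_const bounded_linear_vec_nth)
 ultimately show ?thesis using r(1) by (intro has_derivative_if_quadratic_error[of _ "r / 2"]) auto
qed

text \<open>The difference quotients are forward differences. A shift by one step makes the second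
one central, as in the lattice equation, and does not change the limit.\<close>

lemma U_laplacian:
 assumes x: "x \<in> \<Omega>"
 shows "(\<Sum>i\<in>UNIV. U [i, i] x) = - lam * U [] x"
proof -
 obtain r where r: "r > 0" "cball x (4 * r) \<subseteq> \<Omega>" using room[OF x] .
 have shift: "(\<lambda>k. D [i, i] k (R k x - hs k *\<^sub>R axis i 1)) \<longlonglongrightarrow> U [i, i] x" for i
 proof -
  obtain C where C: "C \<ge> 0" and ev: "\<forall>\<^sub>F k in sequentially. \<forall>x\<in>lattice (hs k). \<forall>y\<in>lattice (hs k). cball x (r + dist x y) \<subseteq> \<Omega> -->
   \<bar>D [i, i] k y - D [i, i] k x\<bar> \<le> C * dist x y" using diffs_lipschitz[OF r(1), of "[i, i]"] by blast
  have "(\<lambda>k. D [i, i] k (R k x - hs k *\<^sub>R axis i 1) - D [i, i] k (R k x)) \<longlonglongrightarrow> 0"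
  proof (rule Lim_null_comparison)
   show "\<forall>\<^sub>F k in sequentially. norm (D [i, i] k (R k x - hs k *\<^sub>R axis i 1) - D [i, i] k (R k x)) \<le> C * hs k"
    using ev floor_near[OF r(1)] hs_small[OF r(1)]
   proof eventually_elim
    case (elim k)
    define y where "y = R k x - hs k *\<^sub>R axis i 1"
    have d: "dist (R k x) y = hs k" using hs_pos[of k] by (simp add: y_def dist_norm)
    have "dist x (R k x) < r" using elim(2) by blast
    hence "cball (R k x) (r + dist (R k x) y) \<subseteq> cball x (4 * r)"
     using elim(3) r(1) d by (simp add: cball_subset_cball_iff dist_commute)
    hence "cball (R k x) (r + dist (R k x) y) \<subseteq> \<Omega>" using r(2) by blast
    moreover have "y \<in> lattice (hs k)" unfolding y_def by (rule lattice_step(2)[OF floor_in_lattice hs_pos])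
    ultimately have "\<bar>D [i, i] k y - D [i, i] k (R k x)\<bar> \<le> C * dist (R k x) y"
     using elim(1) floor_in_lattice by blast
    thus ?case by (simp only: d) (simp add: y_def)
   qed
   have "(\<lambda>k. C * hs k) \<longlonglongrightarrow> C * 0" by (intro tendsto_intros hs_lim)
   thus "(\<lambda>k. C * hs k) \<longlonglongrightarrow> 0" by simp
  qed
  from tendsto_add[OF this U_lim[OF x, of "[i, i]"]] show ?thesis by simp
 qed
 have 1: "(\<lambda>k. \<Sum>i\<in>UNIV. D [i, i] k (R k x - hs k *\<^sub>R axis i 1)) \<longlonglongrightarrow> (\<Sum>i\<in>UNIV. U [i, i] x)"
  by (intro tendsto_sum shift)
 have 2: "(\<lambda>k. - ls k * D [] k (R k x)) \<longlonglongrightarrow> - lam * U [] x"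
  by (intro tendsto_intros ls_lim U_lim x)
 obtain C where "\<forall>\<^sub>F k in sequentially. \<forall>x\<in>lattice (hs k). cball x r \<subseteq> \<Omega> -->
   lattice_laplacian (hs k) (D [] k) x = - ((hs k)\<^sup>2 * ls k) * D [] k x \<and> \<bar>D [] k x\<bar> \<le> C"
  using diffs_bound[OF r(1), of "[]"] by blast
 hence "\<forall>\<^sub>F k in sequentially. (\<Sum>i\<in>UNIV. D [i, i] k (R k x - hs k *\<^sub>R axis i 1)) = - ls k * D [] k (R k x)"
  using floor_near[OF r(1)]
 proof eventually_elim
  case (elim k)
  define h where "h = hs k"
  have h: "h > 0" using hs_pos[of k] by (simp add: h_def)
  have "dist x (R k x) < r" using elim(2) by blast
  hence "cball (R k x) r \<subseteq> cball x (4 * r)" using r(1) by (simp add: cball_subset_cball_iff dist_commute)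
  hence "cball (R k x) r \<subseteq> \<Omega>" using r(2) by blast
  hence L: "lattice_laplacian h (D [] k) (R k x) = - (h\<^sup>2 * ls k) * D [] k (R k x)"
   using elim(1) floor_in_lattice unfolding h_def by blast
  have "D [i, i] k (R k x - h *\<^sub>R axis i 1) =
   (D [] k (R k x + h *\<^sub>R axis i 1) + D [] k (R k x - h *\<^sub>R axis i 1) - 2 * D [] k (R k x)) / h\<^sup>2" for i
   using h by (simp add: lattice_diff_def h_def[symmetric] field_simps power2_eq_square)
  hence "(\<Sum>i\<in>UNIV. D [i, i] k (R k x - h *\<^sub>R axis i 1)) = lattice_laplacian h (D [] k) (R k x) / h\<^sup>2"
   by (simp only: lattice_laplacian_def sum_divide_distrib)
  thus ?case unfolding L using h by (simp add: h_def[symmetric])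
 qed
 hence "(\<lambda>k. \<Sum>i\<in>UNIV. D [i, i] k (R k x - hs k *\<^sub>R axis i 1)) \<longlonglongrightarrow> - lam * U [] x"
  using 2 by (simp only: tendsto_cong)
 with 1 show ?thesis using LIMSEQ_unique by blast
qed

lemma U_nonneg: "x \<in> \<Omega> ==> U [] x \<ge> 0"
 by (rule tendsto_lowerbound[OF U_lim[of x "[]"]]) (use eig in "auto simp: lattice_eigenfunction_def")

lemma U_boundary:
 assumes b: "bounded \<Omega>" and fc: "flat_cone_condition \<Omega> \<xi>" and e: "e > 0"
 shows "\<exists>d>0. \<forall>x\<in>\<Omega>. dist \<xi> x < d --> U [] x \<le> e"
proof -
 have \<Lambda>: "\<Lambda> \<ge> 0" using ls[of 0] by linarith
 obtain d h0 where d: "d > 0" "h0 > 0"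
  and dec: "\<And>h l v x. 0 < h ==> h < h0 ==> 0 \<le> l ==> l \<le> \<Lambda> ==> lattice_eigenfunction \<Omega> h l v ==>
    dist \<xi> x < d ==> v x \<le> e"
  using uniform_boundary_decay[OF b fc \<Lambda> e] by blast
 have "U [] x \<le> e" if x: "x \<in> \<Omega>" "dist \<xi> x < d / 2" for x
 proof (rule tendsto_upperbound[OF U_lim[OF x(1)]])
  have d2: "d / 2 > 0" using d by simp
  show "\<forall>\<^sub>F k in sequentially. D [] k (R k x) \<le> e"
   using hs_small[OF d(2)] floor_near[OF d2]
  proof eventually_elim
   case (elim k)
   have "dist \<xi> (R k x) < d" using elim(2)[rule_format, of x] x(2) dist_triangle[of \<xi> "R k x" x] by simp
   thus ?case using dec[OF hs_pos elim(1) ls eig] by simp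
  qed
 qed simp
 with d show ?thesis by (intro exI[of _ "d / 2"]) auto
qed

text \<open>The points where the value 1 is attained have a limit point, which is not on the
frontier because of the decay there.\<close>

lemma U_nontrivial:
 assumes b: "bounded \<Omega>" and fc: "\<And>\<xi>. \<xi> \<in> frontier \<Omega> ==> flat_cone_condition \<Omega> \<xi>"
  and xs: "\<And>k. xs k \<in> \<Omega> \<inter> lattice (hs k)" "\<And>k. vs k (xs k) = 1"
 shows "\<exists>x\<in>\<Omega>. U [] x > 0"
proof -
 have "compact (closure \<Omega>)" using b by simp
 moreover have "\<forall>k. xs k \<in> closure \<Omega>" using xs(1) closure_subset by blast
 ultimately obtain y t where t: "y \<in> closure \<Omega>" "strict_mono (t :: nat => nat)" "(xs \<circ> t) \<longlonglongrightarrow> y"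
  unfolding compact_def by metis
 have sub: "\<forall>\<^sub>F k in sequentially. P (t k)" if "\<forall>\<^sub>F k in sequentially. P k" for P
  using that t(2) eventually_subseq by blast
 have near: "\<forall>\<^sub>F k in sequentially. dist (xs (t k)) y < d" if "d > 0" for d
  using tendstoD[OF t(3) that] by simp
 have y: "y \<in> \<Omega>"
 proof (rule ccontr)
  assume "y \<notin> \<Omega>"
  hence "y \<in> frontier \<Omega>" using t(1) open_\<Omega> by (simp add: frontier_def interior_open)
  hence f: "flat_cone_condition \<Omega> y" by (rule fc)
  have \<Lambda>: "\<Lambda> \<ge> 0" using ls[of 0] by linarith
  have half: "(1/2::real) > 0" by simp
  obtain d h0 where d: "d > 0" "h0 > 0"
   and dec: "\<And>h l v x. 0 < h ==> h < h0 ==> 0 \<le> l ==> l \<le> \<Lambda> ==> lattice_eigenfunction \<Omega> h l v ==>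
     dist y x < d ==> v x \<le> 1 / 2"
   using uniform_boundary_decay[OF b f \<Lambda> half] by blast
  have "\<forall>\<^sub>F k in sequentially. False"
   using sub[OF hs_small[OF d(2)]] near[OF d(1)]
  proof eventually_elim
   case (elim k)
   hence "vs (t k) (xs (t k)) \<le> 1 / 2" using dec[OF hs_pos elim(1) ls eig] by (simp add: dist_commute)
   thus False using xs(2) by simp
  qed
  thus False by simp
 qed
 obtain r where r: "r > 0" "cball y (4 * r) \<subseteq> \<Omega>" using room[OF y] .
 obtain C where C: "C \<ge> 0" and ev: "\<forall>\<^sub>F k in sequentially. \<forall>x\<in>lattice (hs k). \<forall>y\<in>lattice (hs k). cball x (r + dist x y) \<subseteq> \<Omega> -->
   \<bar>D [] k y - D [] k x\<bar> \<le> C * dist x y" using diffs_lipschitz[OF r(1), of "[]"] by blast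
 have "(\<lambda>k. C * dist (R (t k) y) (xs (t k))) \<longlonglongrightarrow> C * dist y y"
  using LIMSEQ_subseq_LIMSEQ[OF floor_tendsto t(2), of y] t(3) by (intro tendsto_intros) (auto simp: o_def)
 hence lim0: "(\<lambda>k. C * dist (R (t k) y) (xs (t k))) \<longlonglongrightarrow> 0" by simp
 have r2: "r / 2 > 0" using r by simp
 have "(\<lambda>k. 1 - vs (t k) (R (t k) y)) \<longlonglongrightarrow> 0"
 proof (rule Lim_null_comparison[OF _ lim0])
  show "\<forall>\<^sub>F k in sequentially. norm (1 - vs (t k) (R (t k) y)) \<le> C * dist (R (t k) y) (xs (t k))"
   using sub[OF ev] sub[OF floor_near[OF r2]] near[OF r2]
  proof eventually_elim
   case (elim k)
   define z where "z = R (t k) y"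
   have z: "z \<in> lattice (hs (t k))" "dist y z < r / 2" using elim(2) floor_in_lattice by (auto simp: z_def)
   have "dist z (xs (t k)) < r" using z(2) elim(3) dist_triangle[of z "xs (t k)" y] by (simp add: dist_commute)
   hence "cball z (r + dist z (xs (t k))) \<subseteq> cball y (4 * r)"
    using z(2) r by (simp add: cball_subset_cball_iff dist_commute)
   hence "cball z (r + dist z (xs (t k))) \<subseteq> \<Omega>" using r(2) by blast
   hence "\<bar>D [] (t k) (xs (t k)) - D [] (t k) z\<bar> \<le> C * dist z (xs (t k))"
    using elim(1) z(1) xs(1) by blast
   thus ?case using xs(2) by (simp add: z_def)
  qed
 qed
 from tendsto_diff[OF tendsto_const[of 1] this] have "(\<lambda>k. vs (t k) (R (t k) y)) \<longlonglongrightarrow> 1" by simp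
 moreover have "(\<lambda>k. vs (t k) (R (t k) y)) \<longlonglongrightarrow> U [] y"
  using LIMSEQ_subseq_LIMSEQ[OF U_lim[OF y, of "[]"] t(2)] by (simp add: o_def)
 ultimately have "U [] y = 1" by (metis LIMSEQ_unique)
 with y show ?thesis by (intro bexI[of _ y]) auto
qed

end

theorem positive_eigenfunction_exists:
 fixes \<Omega> :: "(real^'n) set"
 assumes op: "open \<Omega>" and b: "bounded \<Omega>" and ne: "\<Omega> \<noteq> {}"
  and fc: "\<And>\<xi>. \<xi> \<in> frontier \<Omega> ==> flat_cone_condition \<Omega> \<xi>"
 obtains \<phi> p q lam where "continuous_on (closure \<Omega>) \<phi>" "C2_with \<Omega> \<phi> p q" "\<And>i. continuous_on \<Omega> (q i)"
  "\<And>x. x \<in> \<Omega> ==> (\<Sum>i\<in>UNIV. q i x $ i) = - lam * \<phi> x"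
  "\<And>x. x \<in> frontier \<Omega> ==> \<phi> x = 0" "\<And>x. x \<in> \<Omega> ==> \<phi> x \<ge> 0" "\<exists>x\<in>\<Omega>. \<phi> x > 0"
proof -
 obtain a \<rho> where a: "\<rho> > 0" "ball a \<rho> \<subseteq> \<Omega>" using ne op open_contains_ball by blast
 define n where "n = real CARD('n)"
 have n1: "n \<ge> 1" by (simp add: n_def Suc_le_eq)
 define r where "r = \<rho> / n"
 have r: "r > 0" using a n1 by (simp add: r_def)
 have cube: "x \<in> \<Omega>" if x: "\<And>i. \<bar>x $ i - a $ i\<bar> < r" for x
 proof -
  have "dist a x \<le> (\<Sum>i\<in>UNIV. \<bar>(x - a) $ i\<bar>)"
   unfolding dist_norm norm_minus_commute[of a] by (rule norm_le_l1_cart)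
  also have "... < (\<Sum>i\<in>(UNIV :: 'n set). r)"
   using x by (intro sum_strict_mono) auto
  also have "... = \<rho>" using n1 by (simp add: r_def n_def)
  finally show ?thesis using a by auto
 qed
 define h where "h k = r * inverse (real (Suc (Suc k)))" for k :: nat
 have h: "h k > 0" "h k < r" for k using r by (auto simp: h_def field_simps intro: add_pos_nonneg)
 have hlim: "h \<longlonglongrightarrow> 0"
  unfolding h_def by (rule tendsto_mult_right_zero[OF LIMSEQ_Suc[OF LIMSEQ_inverse_real_of_nat]])
 define \<Lambda> where "\<Lambda> = n * (pi / (2 * r))\<^sup>2"
 have "\<exists>l v. lattice_eigenfunction \<Omega> (h k) l v \<and> (\<exists>x\<in>\<Omega> \<inter> lattice (h k). v x = 1) \<and> 0 \<le> l \<and> l \<le> \<Lambda>" for k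
 proof -
  have "lattice_floor (h k) a \<in> \<Omega>"
   by (rule cube) (use lattice_floor_component[OF h(1), of a] h(2) in "fastforce simp: abs_minus_commute intro: le_less_trans")
  hence ne: "\<Omega> \<inter> lattice (h k) \<noteq> {}" using lattice_floor_in[OF h(1)] by blast
  have fin: "finite (\<Omega> \<inter> lattice (h k))"
  proof (rule finite_if_separated[OF _ h(1)])
   show "bounded (\<Omega> \<inter> lattice (h k))" using b by (meson bounded_Int)
  qed (use lattice_separated h in auto)
  show ?thesis
  proof (rule lattice_eigenfunction_exists[OF b h(1) ne])
   fix l v
   assume 1: "lattice_eigenfunction \<Omega> (h k) l v" "\<exists>x\<in>\<Omega> \<inter> lattice (h k). v x = 1" "0 \<le> l"
    and R: "\<And>w. (\<And>x. x \<notin> \<Omega> \<inter> lattice (h k) ==> w x = 0) ==>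
    (\<Sum>x\<in>\<Omega> \<inter> lattice (h k). w x * neighbour_sum \<Omega> (h k) w x) \<le>
    (2 * real CARD('n) - (h k)\<^sup>2 * l) * (\<Sum>x\<in>\<Omega> \<inter> lattice (h k). (w x)\<^sup>2)"
   have "l \<le> \<Lambda>" unfolding \<Lambda>_def n_def by (rule lattice_eigenvalue_bound[OF r cube h fin R])
   with 1 show ?thesis by blast
  qed
 qed
 hence "\<forall>k. \<exists>lv. lattice_eigenfunction \<Omega> (h k) (fst lv) (snd lv) \<and> (\<exists>x\<in>\<Omega> \<inter> lattice (h k). snd lv x = 1) \<and> 0 \<le> fst lv \<and> fst lv \<le> \<Lambda>"
  by auto
 from choice[OF this] obtain lv where lv: "\<And>k. lattice_eigenfunction \<Omega> (h k) (fst (lv k)) (snd (lv k))"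
  "\<And>k. \<exists>x\<in>\<Omega> \<inter> lattice (h k). snd (lv k) x = 1" "\<And>k. 0 \<le> fst (lv k)" "\<And>k. fst (lv k) \<le> \<Lambda>" by blast
 define ls where "ls k = fst (lv k)" for k
 define vs where "vs k = snd (lv k)" for k
 interpret L: lattice_sequence \<Omega> h ls vs \<Lambda>
  by unfold_locales (use op h hlim lv in "auto simp: ls_def vs_def")
 obtain s where s: "strict_mono (s :: nat => nat)" "convergent (\<lambda>k. ls (s k))"
  "\<And>l x. x \<in> \<Omega> ==> convergent (\<lambda>k. lattice_diffs (h (s k)) l (vs (s k)) (lattice_floor (h (s k)) x))"
  using L.convergent_subsequence by blast
 define U where "U l x = lim (\<lambda>k. lattice_diffs (h (s k)) l (vs (s k)) (lattice_floor (h (s k)) x))" for l x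
 define lam where "lam = lim (\<lambda>k. ls (s k))"
 interpret C: convergent_lattice_sequence \<Omega> "\<lambda>k. h (s k)" "\<lambda>k. ls (s k)" "\<lambda>k. vs (s k)" \<Lambda> lam U
 proof unfold_locales
  show "(\<lambda>k. h (s k)) \<longlonglongrightarrow> 0" using LIMSEQ_subseq_LIMSEQ[OF hlim s(1)] by (simp add: o_def)
  show "(\<lambda>k. ls (s k)) \<longlonglongrightarrow> lam" unfolding lam_def using s(2) by (simp add: convergent_LIMSEQ_iff)
  show "(\<lambda>k. lattice_diffs (h (s k)) l (vs (s k)) (lattice_floor (h (s k)) x)) \<longlonglongrightarrow> U l x" if "x \<in> \<Omega>" for l x
   unfolding U_def using s(3)[OF that] by (simp add: convergent_LIMSEQ_iff)
 qed (use op h lv in "auto simp: ls_def vs_def")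
 define \<phi> where "\<phi> x = (if x \<in> \<Omega> then U [] x else 0)" for x
 define p where "p x = (\<chi> i. U [i] x)" for x
 define q where "q i x = (\<chi> j. U [j, i] x)" for i x
 have "C2_with \<Omega> (U []) p q"
  unfolding C2_with_def
 proof (intro ballI conjI allI)
  fix x i assume x: "x \<in> \<Omega>"
  have "(\<lambda>h. \<Sum>i\<in>UNIV. h $ i * U [i] x) = (\<bullet>) (p x)"
   by (simp add: fun_eq_iff p_def inner_vec_def mult.commute)
  thus "(U [] has_derivative (\<bullet>) (p x)) (at x)" using C.U_has_derivative[OF x, of "[]"] by simp
  have "(\<lambda>h. \<Sum>j\<in>UNIV. h $ j * U [j, i] x) = (\<bullet>) (q i x)"
   by (simp add: fun_eq_iff q_def inner_vec_def mult.commute)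
  thus "((\<lambda>y. p y $ i) has_derivative (\<bullet>) (q i x)) (at x)"
   using C.U_has_derivative[OF x, of "[i]"] by (simp add: p_def)
 qed
 hence C2: "C2_with \<Omega> \<phi> p q" by (rule C2_with_cong_on[OF op]) (simp add: \<phi>_def)
 have contq: "continuous_on \<Omega> (q i)" for i
 proof -
  have "continuous_on \<Omega> (U [j, i])" for j
   by (intro continuous_at_imp_continuous_on ballI has_derivative_continuous[OF C.U_has_derivative])
  thus ?thesis unfolding q_def by (intro continuous_on_vec_lambda) auto
 qed
 have "continuous (at x within closure \<Omega>) \<phi>" if x: "x \<in> closure \<Omega>" for x
 proof (cases "x \<in> \<Omega>")
  case True
  hence "isCont \<phi> x" by (rule has_derivative_continuous[OF C2_withD(1)[OF C2]])
  thus ?thesis by (rule continuous_at_imp_continuous_at_within)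
 next
  case False
  hence "x \<in> frontier \<Omega>" using x op by (simp add: frontier_def interior_open)
  hence f: "flat_cone_condition \<Omega> x" by (rule fc)
  show ?thesis
   unfolding continuous_within_eps_delta
  proof (intro allI impI)
   fix e :: real assume e: "e > 0"
   have e2: "e / 2 > 0" using e by simp
   obtain d where d: "d > 0" "\<forall>y\<in>\<Omega>. dist x y < d --> U [] y \<le> e / 2" using C.U_boundary[OF b f e2] by blast
   have "dist (\<phi> y) (\<phi> x) < e" if "dist y x < d" for y
    using d(2) that C.U_nonneg[of y] e False by (force simp: \<phi>_def dist_commute dist_real_def)
   with d(1) show "\<exists>d>0. \<forall>x'\<in>closure \<Omega>. dist x' x < d --> dist (\<phi> x') (\<phi> x) < e" by blast
  qed
 qed
 hence cont: "continuous_on (closure \<Omega>) \<phi>" by (simp add: continuous_on_eq_continuous_within)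
 show ?thesis
 proof (rule that[OF cont C2 contq])
  show "(\<Sum>i\<in>UNIV. q i x $ i) = - lam * \<phi> x" if "x \<in> \<Omega>" for x
   using C.U_laplacian[OF that] that by (simp add: q_def \<phi>_def)
  show "\<phi> x = 0" if "x \<in> frontier \<Omega>" for x using that op by (simp add: \<phi>_def frontier_def interior_open)
  show "\<phi> x \<ge> 0" if "x \<in> \<Omega>" for x using C.U_nonneg[OF that] that by (simp add: \<phi>_def)
  have "\<forall>k. \<exists>x. x \<in> \<Omega> \<inter> lattice (h (s k)) \<and> vs (s k) x = 1" using lv(2) by (auto simp: vs_def)
  from choice[OF this] obtain xs where xs: "\<And>k. xs k \<in> \<Omega> \<inter> lattice (h (s k))" "\<And>k. vs (s k) (xs k) = 1" by blast
  have "\<exists>x\<in>\<Omega>. U [] x > 0" by (rule C.U_nontrivial[OF b fc xs])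
  thus "\<exists>x\<in>\<Omega>. \<phi> x > 0" by (auto simp: \<phi>_def)
 qed
qed

section \<open>Power series in several variables\<close>

definition multi_power :: "real^'n => ('n => nat) => real" where
 "multi_power h \<alpha> = (\<Prod>i\<in>UNIV. (h $ i) ^ \<alpha> i)"

definition has_power_series ::
 "(real^'n => real) => real^'n => (('n => nat) => real) => real => bool" where
 "has_power_series f x a r \<longleftrightarrow>
   r > 0 \<and> (\<forall>y\<in>ball x r. ((\<lambda>\<alpha>. a \<alpha> * multi_power (y - x) \<alpha>) has_sum f y) UNIV)"

lemma real_analytic_on_iff:
 "real_analytic_on S f \<longleftrightarrow> (\<forall>x\<in>S. \<exists>a r. has_power_series f x a r)"
 unfolding real_analytic_on_def has_power_series_def multi_power_def vector_minus_component ..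

definition partial_coeff :: "'n => (('n => nat) => real) => ('n => nat) => real" where
 "partial_coeff i a \<alpha> = real (Suc (\<alpha> i)) * a (\<alpha>(i := Suc (\<alpha> i)))"

text \<open>The recursion for E shows by induction that \<open>E z s k\<close> is at most
\<open>(s / \<sigma>)\<^sup>2\<close> times its value at \<open>\<bar>z\<bar>\<close> and
\<sigma>, where the binomial expansion has nonnegative terms only.\<close>

lemma power_remainder_bounds:
 fixes z s \<sigma> :: real
 defines "E \<equiv> \<lambda>z s k. (z + s) ^ k - z ^ k - real k * z ^ (k - 1) * s"
 assumes s: "\<bar>s\<bar> \<le> \<sigma>" "\<sigma> > 0"
 shows "\<bar>E z s k\<bar> \<le> (s / \<sigma>)\<^sup>2 * (\<bar>z\<bar> + \<sigma>) ^ k" "real k * \<bar>z\<bar> ^ (k - 1) * \<sigma> \<le> (\<bar>z\<bar> + \<sigma>) ^ k"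
proof -
 have E_Suc: "E z s (Suc k) = (z + s) * E z s k + real k * z ^ (k - 1) * s\<^sup>2" for z s k
  unfolding E_def by (cases k) (simp_all add: algebra_simps power2_eq_square)
 have main: "\<bar>E z s k\<bar> \<le> (s / \<sigma>)\<^sup>2 * E \<bar>z\<bar> \<sigma> k" if "\<bar>s\<bar> \<le> \<sigma>" for s
 proof (induction k)
  case (Suc k)
  have "\<bar>E z s (Suc k)\<bar> \<le> \<bar>z + s\<bar> * \<bar>E z s k\<bar> + real k * \<bar>z\<bar> ^ (k - 1) * s\<^sup>2"
   unfolding E_Suc by (rule order_trans[OF abs_triangle_ineq]) (simp add: abs_mult power_abs)
  also have "\<bar>z + s\<bar> * \<bar>E z s k\<bar> \<le> (\<bar>z\<bar> + \<sigma>) * ((s / \<sigma>)\<^sup>2 * E \<bar>z\<bar> \<sigma> k)"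
   using Suc that by (intro mult_mono) auto
  also have "(\<bar>z\<bar> + \<sigma>) * ((s / \<sigma>)\<^sup>2 * E \<bar>z\<bar> \<sigma> k) + real k * \<bar>z\<bar> ^ (k - 1) * s\<^sup>2 = (s / \<sigma>)\<^sup>2 * E \<bar>z\<bar> \<sigma> (Suc k)"
   using s(2) unfolding E_Suc by (simp add: field_simps)
  finally show ?case by simp
 qed (simp add: E_def)
 have "0 \<le> E \<bar>z\<bar> \<sigma> k" using main[of \<sigma>] s by simp
 thus "real k * \<bar>z\<bar> ^ (k - 1) * \<sigma> \<le> (\<bar>z\<bar> + \<sigma>) ^ k"
  using zero_le_power[of "\<bar>z\<bar>" k] unfolding E_def by linarith
 have "0 \<le> \<bar>z\<bar> ^ k + real k * \<bar>z\<bar> ^ (k - 1) * \<sigma>" using s(2) by simp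
 hence "E \<bar>z\<bar> \<sigma> k \<le> (\<bar>z\<bar> + \<sigma>) ^ k" unfolding E_def by linarith
 hence "(s / \<sigma>)\<^sup>2 * E \<bar>z\<bar> \<sigma> k \<le> (s / \<sigma>)\<^sup>2 * (\<bar>z\<bar> + \<sigma>) ^ k" by (intro mult_left_mono) auto
 thus "\<bar>E z s k\<bar> \<le> (s / \<sigma>)\<^sup>2 * (\<bar>z\<bar> + \<sigma>) ^ k" using main[OF s(1)] by linarith
qed

text \<open>Termwise differentiation: the series still converges absolutely with \<open>\<bar>z $
i\<bar> + \<sigma>\<close> in place of \<open>z $ i\<close>, and the sum \<open>infsum A
UNIV\<close> of absolute values bounds the error of the linear approximation by a multiple of
\<open>s\<^sup>2\<close>.\<close>

lemma power_series_partial_derivative: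
 fixes f :: "real^'n => real"
 assumes f: "has_power_series f x a r" and y: "y \<in> ball x r"
 shows "\<exists>g. ((\<lambda>t. f (y + t *\<^sub>R axis i 1)) has_real_derivative g) (at 0) \<and>
   ((\<lambda>\<alpha>. partial_coeff i a \<alpha> * multi_power (y - x) \<alpha>) has_sum g) UNIV"
proof -
 define z where "z = y - x"
 define P where "P \<beta> = (\<Prod>j\<in>UNIV - {i}. (z $ j) ^ \<beta> j)" for \<beta>
 have mp: "multi_power (z + s *\<^sub>R axis i 1) \<alpha> = (z $ i + s) ^ \<alpha> i * P \<alpha>" for s \<alpha>
 proof -
  have "multi_power (z + s *\<^sub>R axis i 1) \<alpha> = ((z + s *\<^sub>R axis i 1) $ i) ^ \<alpha> i * (\<Prod>j\<in>UNIV - {i}. ((z + s *\<^sub>R axis i 1) $ j) ^ \<alpha> j)"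
   unfolding multi_power_def by (rule prod.remove) auto
  also have "(\<Prod>j\<in>UNIV - {i}. ((z + s *\<^sub>R axis i 1) $ j) ^ \<alpha> j) = P \<alpha>"
   unfolding P_def by (intro prod.cong) (auto simp: axis_def)
  finally show ?thesis by simp
 qed
 have nz: "norm z < r" using y by (simp add: z_def dist_norm norm_minus_commute)
 define \<sigma> where "\<sigma> = (r - norm z) / 2"
 have \<sigma>: "\<sigma> > 0" "norm z + \<sigma> < r" using nz by (auto simp: \<sigma>_def field_simps)
 have series: "((\<lambda>\<alpha>. a \<alpha> * ((z $ i + s) ^ \<alpha> i * P \<alpha>)) has_sum f (y + s *\<^sub>R axis i 1)) UNIV" if s: "\<bar>s\<bar> \<le> \<sigma>" for s
 proof -
  have "norm (z + s *\<^sub>R axis i 1) < r" using norm_triangle_ineq[of z "s *\<^sub>R axis i 1"] s \<sigma> by simp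
  hence "x + (z + s *\<^sub>R axis i 1) \<in> ball x r" unfolding mem_ball dist_commute[of x] by (simp add: dist_norm)
  hence "((\<lambda>\<alpha>. a \<alpha> * multi_power (x + (z + s *\<^sub>R axis i 1) - x) \<alpha>) has_sum f (x + (z + s *\<^sub>R axis i 1))) UNIV"
   using f unfolding has_power_series_def by blast
  thus ?thesis by (simp add: mp) (simp add: z_def)
 qed
 define A where "A \<alpha> = \<bar>a \<alpha>\<bar> * ((\<bar>z $ i\<bar> + \<sigma>) ^ \<alpha> i * \<bar>P \<alpha>\<bar>)" for \<alpha>
 have sA: "A summable_on UNIV"
 proof -
  define s where "s = (if z $ i \<ge> 0 then \<sigma> else - \<sigma>)"
  have "\<bar>s\<bar> \<le> \<sigma>" using \<sigma> by (simp add: s_def)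
  from has_sum_imp_summable[OF series[OF this]]
  have "(\<lambda>\<alpha>. norm (a \<alpha> * ((z $ i + s) ^ \<alpha> i * P \<alpha>))) summable_on UNIV"
   by (rule summable_on_iff_abs_summable_on_real[THEN iffD1])
  moreover have "\<bar>z $ i + s\<bar> = \<bar>z $ i\<bar> + \<sigma>" using \<sigma> by (simp add: s_def)
  ultimately show ?thesis by (simp add: A_def[abs_def] abs_mult power_abs)
 qed
 define d where "d \<alpha> = a \<alpha> * (real (\<alpha> i) * (z $ i) ^ (\<alpha> i - 1) * P \<alpha>)" for \<alpha>
 have "d summable_on UNIV"
 proof (rule Infinite_Sum.abs_summable_summable, rule Infinite_Sum.abs_summable_on_comparison_test'[OF summable_on_cmult_right[OF sA]])
  fix \<alpha>
  have "real (\<alpha> i) * \<bar>z $ i\<bar> ^ (\<alpha> i - 1) \<le> (\<bar>z $ i\<bar> + \<sigma>) ^ \<alpha> i / \<sigma>"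
   using power_remainder_bounds(2)[of \<sigma> \<sigma> "\<alpha> i" "z $ i"] \<sigma> by (simp add: pos_le_divide_eq)
  hence "(real (\<alpha> i) * \<bar>z $ i\<bar> ^ (\<alpha> i - 1)) * \<bar>a \<alpha> * P \<alpha>\<bar> \<le> ((\<bar>z $ i\<bar> + \<sigma>) ^ \<alpha> i / \<sigma>) * \<bar>a \<alpha> * P \<alpha>\<bar>"
   by (rule mult_right_mono) simp
  thus "norm (d \<alpha>) \<le> (1 / \<sigma>) * A \<alpha>"
   using \<sigma> by (simp add: d_def A_def abs_mult power_abs mult_ac)
 qed
 then obtain g where g: "(d has_sum g) UNIV" by (auto simp: summable_on_def)
 have err: "\<bar>f (y + s *\<^sub>R axis i 1) - f (y + 0 *\<^sub>R axis i 1) - g * (s - 0)\<bar> \<le> (infsum A UNIV / \<sigma>\<^sup>2) * (dist 0 s)\<^sup>2"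
  if "dist 0 s \<le> \<sigma>" for s
 proof -
  have s: "\<bar>s\<bar> \<le> \<sigma>" using that by simp
  have "((\<lambda>\<alpha>. a \<alpha> * ((z $ i + s) ^ \<alpha> i * P \<alpha>) + (-1) * (a \<alpha> * ((z $ i + 0) ^ \<alpha> i * P \<alpha>)) + (- s) * d \<alpha>)
    has_sum f (y + s *\<^sub>R axis i 1) + (-1) * f (y + 0 *\<^sub>R axis i 1) + (- s) * g) UNIV"
   by (intro has_sum_add has_sum_cmult_right series g) (use s \<sigma> in auto)
  moreover have "((\<lambda>\<alpha>. (s / \<sigma>)\<^sup>2 * A \<alpha>) has_sum (s / \<sigma>)\<^sup>2 * infsum A UNIV) UNIV"
   by (intro has_sum_cmult_right has_sum_infsum sA)
  ultimately have "norm (f (y + s *\<^sub>R axis i 1) + (-1) * f (y + 0 *\<^sub>R axis i 1) + (- s) * g) \<le> (s / \<sigma>)\<^sup>2 * infsum A UNIV"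
  proof (rule norm_infsum_le)
   fix \<alpha>
   have "a \<alpha> * ((z $ i + s) ^ \<alpha> i * P \<alpha>) + (-1) * (a \<alpha> * ((z $ i + 0) ^ \<alpha> i * P \<alpha>)) + (- s) * d \<alpha>
    = (a \<alpha> * P \<alpha>) * ((z $ i + s) ^ \<alpha> i - (z $ i) ^ \<alpha> i - real (\<alpha> i) * (z $ i) ^ (\<alpha> i - 1) * s)"
    by (simp add: d_def algebra_simps)
   moreover have "\<bar>a \<alpha> * P \<alpha>\<bar> * \<bar>(z $ i + s) ^ \<alpha> i - (z $ i) ^ \<alpha> i - real (\<alpha> i) * (z $ i) ^ (\<alpha> i - 1) * s\<bar>
    \<le> \<bar>a \<alpha> * P \<alpha>\<bar> * ((s / \<sigma>)\<^sup>2 * (\<bar>z $ i\<bar> + \<sigma>) ^ \<alpha> i)"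
    by (intro mult_left_mono power_remainder_bounds(1) s \<sigma>) simp
   ultimately show "norm (a \<alpha> * ((z $ i + s) ^ \<alpha> i * P \<alpha>) + (-1) * (a \<alpha> * ((z $ i + 0) ^ \<alpha> i * P \<alpha>)) + (- s) * d \<alpha>)
    \<le> (s / \<sigma>)\<^sup>2 * A \<alpha>"
    by (simp add: A_def abs_mult mult_ac)
  qed
  thus ?thesis by (simp add: power_divide algebra_simps)
 qed
 have 1: "((\<lambda>t. f (y + t *\<^sub>R axis i 1)) has_real_derivative g) (at 0)"
  unfolding has_field_derivative_def by (rule has_derivative_if_quadratic_error[OF bounded_linear_mult_right \<sigma>(1) err])
 define up where "up \<beta> = \<beta>(i := Suc (\<beta> i))" for \<beta> :: "'n => nat"
 have inj: "inj up" by (rule inj_on_inverseI[of _ "\<lambda>\<alpha>. \<alpha>(i := \<alpha> i - 1)"]) (simp add: up_def)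
 have "(d has_sum g) (range up)"
 proof (rule has_sum_cong_neutral[THEN iffD1, OF _ _ _ g])
  fix \<alpha> assume "\<alpha> \<in> UNIV - range up"
  hence "\<alpha> \<noteq> up (\<alpha>(i := \<alpha> i - 1))" by blast
  hence "\<alpha> i = 0" by (auto simp: up_def)
  thus "d \<alpha> = 0" by (simp add: d_def)
 qed auto
 hence "(d \<circ> up has_sum g) UNIV" by (simp add: has_sum_reindex[OF inj])
 moreover have "d (up \<beta>) = partial_coeff i a \<beta> * multi_power (y - x) \<beta>" for \<beta>
 proof -
  have "P (up \<beta>) = P \<beta>" unfolding P_def up_def by (intro prod.cong) auto
  thus ?thesis using mp[of 0 \<beta>] by (simp add: d_def up_def partial_coeff_def z_def)
 qed
 ultimately show ?thesis using 1 by (auto simp: o_def)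
qed

definition pd :: "'n => (real^'n => real) => real^'n => real" where
 "pd i f x = deriv (\<lambda>t. f (x + t *\<^sub>R axis i 1)) 0"

lemma power_series_pd:
 assumes "has_power_series f x a r"
 shows "has_power_series (pd i f) x (partial_coeff i a) r"
 unfolding has_power_series_def
proof (intro conjI ballI)
 show "r > 0" using assms by (simp add: has_power_series_def)
 fix y assume "y \<in> ball x r"
 thus "((\<lambda>\<alpha>. partial_coeff i a \<alpha> * multi_power (y - x) \<alpha>) has_sum pd i f y) UNIV"
  using power_series_partial_derivative[OF assms, of y i] DERIV_imp_deriv unfolding pd_def by metis
qed

lemma multi_power_0: "multi_power 0 \<alpha> = (if \<alpha> = (\<lambda>_. 0) then 1 else 0)"
proof (cases "\<alpha> = (\<lambda>_. 0)")
 case False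
 then obtain i where "\<alpha> i \<noteq> 0" by (auto simp: fun_eq_iff)
 hence "multi_power 0 \<alpha> = 0" unfolding multi_power_def by (intro prod_zero) (auto intro!: bexI[of _ i])
 thus ?thesis using False by simp
qed (simp add: multi_power_def)

lemma power_series_at_centre:
 assumes "has_power_series f x a r" shows "f x = a (\<lambda>_. 0)"
proof -
 have "((\<lambda>\<alpha>. a \<alpha> * multi_power (x - x) \<alpha>) has_sum f x) UNIV"
 proof -
  have "x \<in> ball x r" using assms by (simp add: has_power_series_def)
  thus ?thesis using assms unfolding has_power_series_def by blast
 qed
 moreover have "((\<lambda>\<alpha>. a \<alpha> * multi_power (x - x) \<alpha>) has_sum a (\<lambda>_. 0)) UNIV"
  by (rule has_sum_finite_neutralI[of "{\<lambda>_. 0}"]) (auto simp: multi_power_0)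
 ultimately show ?thesis by (rule has_sum_unique)
qed

lemma pd_commute:
 assumes "real_analytic_on UNIV f" shows "pd i (pd j f) = pd j (pd i f)"
proof
 fix x
 obtain a r where a: "has_power_series f x a r" using assms unfolding real_analytic_on_iff by blast
 have "partial_coeff i (partial_coeff j a) (\<lambda>_. 0) = partial_coeff j (partial_coeff i a) (\<lambda>_. 0)"
  by (cases "i = j") (auto simp: partial_coeff_def fun_upd_twist)
 thus "pd i (pd j f) x = pd j (pd i f) x"
  using power_series_at_centre[OF power_series_pd[OF power_series_pd[OF a]]] by metis
qed

lemma analytic_pd: "real_analytic_on UNIV f ==> real_analytic_on UNIV (pd i f)"
 unfolding real_analytic_on_iff using power_series_pd by blast

lemma power_series_lincomb:
 assumes "has_power_series f x a r" "has_power_series g x b s"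
 shows "has_power_series (\<lambda>y. c * f y + d * g y) x (\<lambda>\<alpha>. c * a \<alpha> + d * b \<alpha>) (min r s)"
 unfolding has_power_series_def
proof (intro conjI ballI)
 show "min r s > 0" using assms by (simp add: has_power_series_def)
 fix y assume y: "y \<in> ball x (min r s)"
 have "((\<lambda>\<alpha>. c * (a \<alpha> * multi_power (y - x) \<alpha>) + d * (b \<alpha> * multi_power (y - x) \<alpha>)) has_sum c * f y + d * g y) UNIV"
  using assms y unfolding has_power_series_def by (intro has_sum_add has_sum_cmult_right) auto
 thus "((\<lambda>\<alpha>. (c * a \<alpha> + d * b \<alpha>) * multi_power (y - x) \<alpha>) has_sum c * f y + d * g y) UNIV"
  by (simp add: algebra_simps)
qed

lemma analytic_lincomb:
 assumes "real_analytic_on S f" "real_analytic_on S g"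
 shows "real_analytic_on S (\<lambda>y. c * f y + d * g y)"
 using assms power_series_lincomb unfolding real_analytic_on_iff by blast

lemma analytic_const: "real_analytic_on S (\<lambda>y. c)"
proof -
 have "has_power_series (\<lambda>y. c) x (\<lambda>\<alpha>. if \<alpha> = (\<lambda>_. 0) then c else 0) 1" for x :: "real^'n"
  unfolding has_power_series_def
 proof (intro conjI ballI)
  fix y
  show "((\<lambda>\<alpha>. (if \<alpha> = (\<lambda>_. 0) then c else 0) * multi_power (y - x) \<alpha>) has_sum c) UNIV"
   by (rule has_sum_finite_neutralI[of "{\<lambda>_. 0}"]) (simp_all add: multi_power_def)
 qed simp
 thus ?thesis unfolding real_analytic_on_iff by blast
qed

lemma analytic_sum:
 assumes "finite I" "\<And>k. k \<in> I ==> real_analytic_on S (f k)"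
 shows "real_analytic_on S (\<lambda>y. \<Sum>k\<in>I. f k y)"
 using assms
proof (induction I rule: finite_induct)
 case (insert k I)
 hence "real_analytic_on S (\<lambda>y. 1 * f k y + 1 * (\<Sum>k\<in>I. f k y))" by (intro analytic_lincomb) auto
 with insert show ?case by simp
qed (simp add: analytic_const)

lemma finite_multi_index_degree: "finite {\<alpha> :: 'n::finite => nat. (\<Sum>i\<in>UNIV. \<alpha> i) \<le> k}"
proof (rule finite_subset)
 show "{\<alpha> :: 'n => nat. (\<Sum>i\<in>UNIV. \<alpha> i) \<le> k} \<subseteq> PiE UNIV (\<lambda>_. {..k})"
 proof
  fix \<alpha> :: "'n => nat" assume "\<alpha> \<in> {\<alpha>. (\<Sum>i\<in>UNIV. \<alpha> i) \<le> k}"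
  hence "\<alpha> i \<le> k" for i using member_le_sum[of i UNIV \<alpha>] by simp
  thus "\<alpha> \<in> PiE UNIV (\<lambda>_. {..k})" by auto
 qed
qed (intro finite_PiE, auto)

text \<open>Monomials are collected by total degree; those of degree one give the directional
derivative.\<close>

lemma power_series_on_line:
 fixes f :: "real^'n => real"
 assumes f: "has_power_series f x a r"
 obtains c \<rho> where "\<rho> > 0" "\<And>t. \<bar>t\<bar> < \<rho> ==> (\<lambda>k. c k * t ^ k) sums f (x + t *\<^sub>R v)"
  "c 1 = (\<Sum>i\<in>UNIV. v $ i * pd i f x)"
proof -
 define A where "A k = {\<alpha> :: 'n => nat. (\<Sum>i\<in>UNIV. \<alpha> i) = k}" for k
 have A: "finite (A k)" for k
  by (rule finite_subset[OF _ finite_multi_index_degree[of k]]) (auto simp: A_def)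
 define c where "c k = (\<Sum>\<alpha>\<in>A k. a \<alpha> * multi_power v \<alpha>)" for k
 define \<rho> where "\<rho> = r / (norm v + 1)"
 have r: "r > 0" using f by (simp add: has_power_series_def)
 have "0 < norm v + 1" by (simp add: add_nonneg_pos)
 hence \<rho>: "\<rho> > 0" using r by (simp add: \<rho>_def)
 have "(\<lambda>k. c k * t ^ k) sums f (x + t *\<^sub>R v)" if t: "\<bar>t\<bar> < \<rho>" for t
 proof -
  have "\<bar>t\<bar> * norm v \<le> \<bar>t\<bar> * (norm v + 1)" by (intro mult_left_mono) auto
  also have "... < r" using t \<open>0 < norm v + 1\<close> by (simp add: \<rho>_def pos_less_divide_eq)
  finally have "x + t *\<^sub>R v \<in> ball x r" by (simp add: dist_norm)
  hence s: "((\<lambda>\<alpha>. a \<alpha> * multi_power (x + t *\<^sub>R v - x) \<alpha>) has_sum f (x + t *\<^sub>R v)) UNIV"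
   using f unfolding has_power_series_def by blast
  have mp: "multi_power (x + t *\<^sub>R v - x) \<alpha> = t ^ (\<Sum>i\<in>UNIV. \<alpha> i) * multi_power v \<alpha>" for \<alpha>
   by (simp add: multi_power_def power_mult_distrib prod.distrib power_sum)
  have bij: "bij_betw snd (Sigma UNIV A) UNIV"
   by (rule bij_betwI[where g = "\<lambda>\<alpha>. (\<Sum>i\<in>UNIV. \<alpha> i, \<alpha>)"]) (auto simp: A_def)
  have "((\<lambda>z. a (snd z) * (t ^ (\<Sum>i\<in>UNIV. snd z i) * multi_power v (snd z))) has_sum f (x + t *\<^sub>R v)) (Sigma UNIV A)"
   using s unfolding mp has_sum_reindex_bij_betw[OF bij, symmetric] .
  hence "((\<lambda>k. c k * t ^ k) has_sum f (x + t *\<^sub>R v)) UNIV"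
  proof (rule has_sum_SigmaD)
   fix k :: nat
   have "(\<Sum>\<alpha>\<in>A k. a \<alpha> * (t ^ (\<Sum>i\<in>UNIV. \<alpha> i) * multi_power v \<alpha>)) = c k * t ^ k"
    unfolding c_def sum_distrib_right by (intro sum.cong) (auto simp: A_def)
   thus "((\<lambda>\<alpha>. a (snd (k, \<alpha>)) * (t ^ (\<Sum>i\<in>UNIV. snd (k, \<alpha>) i) * multi_power v (snd (k, \<alpha>)))) has_sum c k * t ^ k) (A k)"
    using has_sum_finite[OF A[of k], of "\<lambda>\<alpha>. a \<alpha> * (t ^ (\<Sum>i\<in>UNIV. \<alpha> i) * multi_power v \<alpha>)"] by simp
  qed
  thus ?thesis by (rule has_sum_imp_sums)
 qed
 moreover have "c 1 = (\<Sum>i\<in>UNIV. v $ i * pd i f x)"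
 proof -
  define e :: "'n => 'n => nat" where "e i = (\<lambda>_. 0)(i := 1)" for i
  have "\<alpha> \<in> A 1 \<longleftrightarrow> (\<exists>i. \<alpha> = e i)" for \<alpha> by (auto simp: A_def e_def sum_eq_Suc0_iff fun_eq_iff)
  hence "A 1 = range e" by blast
  moreover have "inj e" by (auto simp: inj_def e_def fun_eq_iff split: if_splits)
  ultimately have "c 1 = (\<Sum>i\<in>UNIV. a (e i) * multi_power v (e i))" by (simp add: c_def sum.reindex)
  moreover have "multi_power v (e i) = v $ i" for i
   unfolding multi_power_def e_def by (subst prod.remove[of UNIV i]) (auto intro!: prod.neutral)
  moreover have "pd i f x = a (e i)" for i
   using power_series_at_centre[OF power_series_pd[OF f, of i]] by (simp add: partial_coeff_def e_def)
  ultimately show ?thesis by (simp add: mult.commute)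
 qed
 ultimately show ?thesis using that \<rho> by blast
qed

lemma abs_multi_power_le:
 assumes "norm h \<le> m" shows "\<bar>multi_power h \<alpha>\<bar> \<le> m ^ (\<Sum>i\<in>UNIV. \<alpha> i)"
proof -
 have "\<bar>multi_power h \<alpha>\<bar> = (\<Prod>i\<in>UNIV. \<bar>h $ i\<bar> ^ \<alpha> i)"
  by (simp add: multi_power_def abs_prod power_abs)
 also have "... \<le> (\<Prod>i\<in>UNIV. m ^ \<alpha> i)"
 proof (rule prod_mono)
  fix i
  have "\<bar>h $ i\<bar> \<le> m" using component_le_norm_cart[of h i] assms by linarith
  thus "0 \<le> \<bar>h $ i\<bar> ^ \<alpha> i \<and> \<bar>h $ i\<bar> ^ \<alpha> i \<le> m ^ \<alpha> i" by (auto intro: power_mono)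
 qed
 finally show ?thesis by (simp add: power_sum)
qed

text \<open>The series converges absolutely at the corner w of a cube, and this dominates it
uniformly on a ball.\<close>

lemma analytic_continuous_on:
 fixes f :: "real^'n => real"
 assumes "real_analytic_on UNIV f" shows "continuous_on S f"
proof (rule continuous_at_imp_continuous_on, rule ballI)
 fix x
 obtain a r where f: "has_power_series f x a r" using assms unfolding real_analytic_on_iff by blast
 define n where "n = real CARD('n)"
 have n1: "n \<ge> 1" by (simp add: n_def Suc_le_eq)
 have r: "r > 0" using f by (simp add: has_power_series_def)
 define \<rho> where "\<rho> = r / (2 * n)"
 have \<rho>: "\<rho> > 0" "n * \<rho> < r" using r n1 by (auto simp: \<rho>_def)
 have series: "((\<lambda>\<alpha>. a \<alpha> * multi_power (y - x) \<alpha>) has_sum f y) UNIV" if "dist x y < r" for y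
  using f that unfolding has_power_series_def by simp
 define w :: "real^'n" where "w = (\<chi> i. \<rho>)"
 have "norm w \<le> (\<Sum>i\<in>UNIV. \<bar>w $ i\<bar>)" by (rule norm_le_l1_cart)
 also have "... < r" using \<rho> by (simp add: w_def n_def)
 finally have "(\<lambda>\<alpha>. a \<alpha> * multi_power w \<alpha>) summable_on UNIV"
  using series[of "x + w"] by (intro has_sum_imp_summable) (auto simp: dist_norm)
 hence "(\<lambda>\<alpha>. norm (a \<alpha> * multi_power w \<alpha>)) summable_on UNIV" by (rule summable_on_iff_abs_summable_on_real[THEN iffD1])
 moreover have "norm (a \<alpha> * multi_power w \<alpha>) = \<bar>a \<alpha>\<bar> * \<rho> ^ (\<Sum>i\<in>UNIV. \<alpha> i)" for \<alpha>
  using \<rho> by (simp add: multi_power_def w_def power_sum abs_mult abs_prod)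
 ultimately have sm: "(\<lambda>\<alpha>. \<bar>a \<alpha>\<bar> * \<rho> ^ (\<Sum>i\<in>UNIV. \<alpha> i)) summable_on UNIV" by simp
 have "uniform_limit (cball x \<rho>) (\<lambda>F y. \<Sum>\<alpha>\<in>F. a \<alpha> * multi_power (y - x) \<alpha>) f (finite_subsets_at_top UNIV)"
 proof (rule Weierstrass_m_test_general'[OF _ _ sm])
  fix \<alpha> y assume y: "y \<in> cball x \<rho>"
  thus "norm (a \<alpha> * multi_power (y - x) \<alpha>) \<le> \<bar>a \<alpha>\<bar> * \<rho> ^ (\<Sum>i\<in>UNIV. \<alpha> i)"
   using abs_multi_power_le[of "y - x" \<rho> \<alpha>] by (simp add: abs_mult mult_left_mono dist_norm norm_minus_commute)
  have "\<rho> \<le> n * \<rho>" using n1 \<rho> by simp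
  hence "dist x y < r" using y \<rho>(2) unfolding mem_cball by linarith
  thus "((\<lambda>\<alpha>. a \<alpha> * multi_power (y - x) \<alpha>) has_sum f y) UNIV" by (rule series)
 qed
 hence "continuous_on (cball x \<rho>) f"
  by (rule uniform_limit_theorem[rotated]) (auto simp: multi_power_def intro!: always_eventually continuous_intros)
 thus "isCont f x" using \<rho>(1) by (intro continuous_on_interior) auto
qed

lemma powser_has_derivative_at_0:
 fixes c :: "nat => real"
 assumes \<rho>: "\<rho> > 0" and c: "\<And>t. \<bar>t\<bar> < \<rho> ==> (\<lambda>k. c k * t ^ k) sums g t"
 shows "(g has_real_derivative c 1) (at 0)"
proof (rule has_field_derivative_transform_within_open)
 have "summable (\<lambda>k. c k * (\<rho> / 2) ^ k)" using c[of "\<rho> / 2"] \<rho> by (simp add: sums_iff)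
 from termdiffs_strong[OF this, of 0] show "((\<lambda>t. \<Sum>k. c k * t ^ k) has_real_derivative c 1) (at 0)"
  using \<rho> by (simp add: powser_zero diffs_def)
 show "(\<Sum>k. c k * t ^ k) = g t" if "t \<in> {-\<rho><..<\<rho>}" for t using c[of t] that by (auto simp: sums_iff)
qed (use \<rho> in auto)

definition dir_deriv :: "real^'n => (real^'n => real) => real^'n => real" where
 "dir_deriv v f x = (\<Sum>i\<in>UNIV. v $ i * pd i f x)"

lemma analytic_line_derivative:
 assumes "real_analytic_on UNIV f"
 shows "((\<lambda>t. f (x + t *\<^sub>R v)) has_real_derivative dir_deriv v f (x + t *\<^sub>R v)) (at t)"
proof -
 obtain a r where a: "has_power_series f (x + t *\<^sub>R v) a r" using assms unfolding real_analytic_on_iff by blast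
 obtain c \<rho> where "\<rho> > 0" "\<And>s. \<bar>s\<bar> < \<rho> ==> (\<lambda>k. c k * s ^ k) sums f (x + t *\<^sub>R v + s *\<^sub>R v)"
  "c 1 = dir_deriv v f (x + t *\<^sub>R v)"
  using power_series_on_line[OF a, of v] unfolding dir_deriv_def by blast
 hence "((\<lambda>s. f (x + (s + t) *\<^sub>R v)) has_real_derivative dir_deriv v f (x + t *\<^sub>R v)) (at 0)"
  using powser_has_derivative_at_0[of \<rho> c] by (simp add: algebra_simps)
 thus ?thesis using DERIV_shift[of "\<lambda>t. f (x + t *\<^sub>R v)" _ 0 t] by simp
qed

lemma analytic_cmult: "real_analytic_on S f ==> real_analytic_on S (\<lambda>y. c * f y)"
 using analytic_lincomb[of S f "\<lambda>_. 0" c 0] analytic_const[of S 0] by simp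

lemma analytic_dir_deriv: "real_analytic_on UNIV f ==> real_analytic_on UNIV (dir_deriv v f)"
 unfolding dir_deriv_def[abs_def] by (intro analytic_sum analytic_cmult analytic_pd) auto

lemma pd_lincomb:
 assumes "real_analytic_on UNIV f" "real_analytic_on UNIV g"
 shows "pd i (\<lambda>y. c * f y + d * g y) x = c * pd i f x + d * pd i g x"
proof -
 obtain a r b s where ab: "has_power_series f x a r" "has_power_series g x b s"
  using assms unfolding real_analytic_on_iff by blast
 have "pd i (\<lambda>y. c * f y + d * g y) x = partial_coeff i (\<lambda>\<alpha>. c * a \<alpha> + d * b \<alpha>) (\<lambda>_. 0)"
  by (rule power_series_at_centre[OF power_series_pd[OF power_series_lincomb[OF ab]]])
 moreover have "pd i f x = partial_coeff i a (\<lambda>_. 0)" "pd i g x = partial_coeff i b (\<lambda>_. 0)"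
  using power_series_at_centre[OF power_series_pd] ab by blast+
 ultimately show ?thesis by (simp add: partial_coeff_def)
qed

lemma pd_const: "pd i (\<lambda>y. c) x = 0"
 by (simp add: pd_def)

lemma pd_cmult:
 assumes "real_analytic_on UNIV f" shows "pd i (\<lambda>y. c * f y) x = c * pd i f x"
proof -
 have "pd i (\<lambda>y. c * f y + 0 * 0) x = c * pd i f x + 0 * pd i (\<lambda>_. 0) x"
  by (rule pd_lincomb[OF assms analytic_const])
 thus ?thesis by simp
qed

lemma pd_sum:
 assumes "finite I" "\<And>k. k \<in> I ==> real_analytic_on UNIV (f k)"
 shows "pd i (\<lambda>y. \<Sum>k\<in>I. f k y) x = (\<Sum>k\<in>I. pd i (f k) x)"
 using assms
proof (induction I rule: finite_induct)
 case (insert k I)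
 have "pd i (\<lambda>y. 1 * f k y + 1 * (\<Sum>k\<in>I. f k y)) x = 1 * pd i (f k) x + 1 * pd i (\<lambda>y. \<Sum>k\<in>I. f k y) x"
  by (rule pd_lincomb) (use insert in "auto intro!: analytic_sum")
 with insert show ?case by simp
qed (simp add: pd_const)

lemma pd_dir_deriv:
 assumes f: "real_analytic_on UNIV f" shows "pd i (dir_deriv v f) = dir_deriv v (pd i f)"
proof
 fix x
 have "pd i (dir_deriv v f) x = (\<Sum>j\<in>UNIV. v $ j * pd i (pd j f) x)"
  unfolding dir_deriv_def[abs_def]
  by (subst pd_sum) (auto intro!: analytic_cmult analytic_pd f sum.cong pd_cmult)
 thus "pd i (dir_deriv v f) x = dir_deriv v (pd i f) x"
  unfolding dir_deriv_def using pd_commute[OF f, of i] by simp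
qed

lemma dir_deriv_cmult: "real_analytic_on UNIV f ==> dir_deriv v (\<lambda>y. c * f y) x = c * dir_deriv v f x"
 by (simp add: dir_deriv_def pd_cmult sum_distrib_left mult.left_commute)

lemma dir_deriv_sum:
 "finite I ==> (\<And>k. k \<in> I ==> real_analytic_on UNIV (f k)) ==>
  dir_deriv v (\<lambda>y. \<Sum>k\<in>I. f k y) x = (\<Sum>k\<in>I. dir_deriv v (f k) x)"
 unfolding dir_deriv_def by (simp add: pd_sum sum_distrib_left) (rule sum.swap)

section \<open>Identity theorems\<close>

lemma powser_nonzero_near:
 fixes c :: "nat => real"
 assumes \<rho>: "\<rho> > 0" and s: "\<And>s. \<bar>s\<bar> < \<rho> ==> (\<lambda>k. c k * s ^ k) sums g s" and m: "c m \<noteq> 0"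
 obtains d where "d > 0" "\<And>s. 0 < \<bar>s\<bar> ==> \<bar>s\<bar> < d ==> g s \<noteq> 0"
proof -
 \<comment> \<open>The coefficients of \<open>s * g s\<close>, which vanishes at 0 whatever the
 value \<open>g 0\<close> is.\<close>
 define a where "a k = (case k of 0 => 0 | Suc j => c j)" for k
 have 1: "(\<lambda>n. a n * (s - 0) ^ n) sums (s * g s)" if "norm (s - 0) < \<rho>" for s
 proof -
  have "(\<lambda>k. s * (c k * s ^ k)) sums (s * g s)" using s[of s] that by (intro sums_mult) auto
  hence "(\<lambda>k. a (Suc k) * s ^ Suc k) sums (s * g s)" by (simp add: a_def mult_ac)
  thus ?thesis using sums_Suc[of "\<lambda>n. a n * s ^ n"] by (simp add: a_def)
 qed
 obtain d where d: "0 < d" "\<And>z. z \<in> cball 0 d - {0} ==> z * g z \<noteq> 0"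
  by (rule powser_0_nonzero[OF \<rho> 1, of "Suc m"]) (use m in "auto simp: a_def")
 show ?thesis
 proof (rule that[OF d(1)])
  fix s :: real assume "0 < \<bar>s\<bar>" "\<bar>s\<bar> < d"
  thus "g s \<noteq> 0" using d(2)[of s] by auto
 qed
qed

text \<open>The set of points near which g vanishes is open, and its complement is open because
the zeros of a power series with a nonzero coefficient are isolated.\<close>

lemma locally_power_series_eq_0:
 fixes g :: "real => real"
 assumes ps: "\<And>t0. \<exists>c \<rho>. \<rho> > 0 \<and> (\<forall>s. \<bar>s\<bar> < \<rho> --> (\<lambda>k. c k * s ^ k) sums g (t0 + s))"
  and z: "e > 0" "\<And>s. \<bar>s\<bar> < e ==> g (t1 + s) = 0"
 shows "g t = 0"
proof -
 define Z where "Z = {t0. \<exists>e>0. \<forall>s. \<bar>s\<bar> < e --> g (t0 + s) = 0}"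
 have "open Z"
  unfolding open_dist
 proof
  fix t0 assume "t0 \<in> Z"
  then obtain e where e: "e > 0" "\<And>s. \<bar>s\<bar> < e ==> g (t0 + s) = 0" by (auto simp: Z_def)
  have "y \<in> Z" if "dist y t0 < e / 2" for y
  proof -
   have "g (y + s) = 0" if "\<bar>s\<bar> < e / 2" for s
   proof -
    have "\<bar>y - t0 + s\<bar> < e" using that \<open>dist y t0 < e / 2\<close> unfolding dist_real_def by linarith
    from e(2)[OF this] show ?thesis by simp
   qed
   thus ?thesis using e(1) by (auto simp: Z_def intro!: exI[of _ "e / 2"])
  qed
  thus "\<exists>e>0. \<forall>y. dist y t0 < e --> y \<in> Z" using e(1) by (intro exI[of _ "e / 2"]) auto
 qed
 moreover have "open (- Z)"
  unfolding open_dist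
 proof
  fix t0 assume t0: "t0 \<in> - Z"
  obtain c \<rho> where c: "\<rho> > 0" "\<And>s. \<bar>s\<bar> < \<rho> ==> (\<lambda>k. c k * s ^ k) sums g (t0 + s)" using ps[of t0] by blast
  have "\<exists>m. c m \<noteq> 0"
  proof (rule ccontr)
   assume "\<not> ?thesis"
   hence "g (t0 + s) = 0" if "\<bar>s\<bar> < \<rho>" for s using c(2)[OF that] by (simp add: sums_iff)
   hence "t0 \<in> Z" using c(1) by (auto simp: Z_def)
   with t0 show False by simp
  qed
  then obtain m where "c m \<noteq> 0" by blast
  then obtain d where d: "d > 0" "\<And>s. 0 < \<bar>s\<bar> ==> \<bar>s\<bar> < d ==> g (t0 + s) \<noteq> 0"
   using powser_nonzero_near[OF c, of m] by blast
  have "y \<notin> Z" if "dist y t0 < d" for y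
  proof (cases "y = t0")
   case False
   hence "g y \<noteq> 0" using d(2)[of "y - t0"] that by (auto simp: dist_real_def)
   thus ?thesis by (force simp: Z_def dest: spec[of _ 0])
  qed (use t0 in simp)
  thus "\<exists>e>0. \<forall>y. dist y t0 < e --> y \<in> - Z" using d(1) by (intro exI[of _ d]) auto
 qed
 moreover have "t1 \<in> Z" using z by (auto simp: Z_def)
 ultimately have "Z = UNIV" using connected_UNIV[where 'a = real] unfolding connected_clopen
  by (auto simp: closed_def)
 hence "t \<in> Z" by simp
 then obtain e' where "e' > 0" "\<And>s. \<bar>s\<bar> < e' ==> g (t + s) = 0" by (auto simp: Z_def)
 from this(2)[of 0] this(1) show ?thesis by simp
qed

lemma analytic_line_power_series:
 assumes "real_analytic_on UNIV f"
 shows "\<exists>c \<rho>. \<rho> > 0 \<and> (\<forall>s. \<bar>s\<bar> < \<rho> --> (\<lambda>k. c k * s ^ k) sums f (x + (t0 + s) *\<^sub>R v))"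
proof -
 obtain a r where a: "has_power_series f (x + t0 *\<^sub>R v) a r" using assms unfolding real_analytic_on_iff by blast
 obtain c \<rho> where "\<rho> > 0" "\<And>s. \<bar>s\<bar> < \<rho> ==> (\<lambda>k. c k * s ^ k) sums f (x + t0 *\<^sub>R v + s *\<^sub>R v)"
  using power_series_on_line[OF a] by blast
 thus ?thesis by (metis add.assoc scaleR_left_distrib)
qed

lemma analytic_vanishes_on_star:
 assumes f: "real_analytic_on UNIV f" and e: "e > 0"
  and z: "\<And>t. norm (t *\<^sub>R v) < e ==> f (p + t *\<^sub>R v) = 0"
 shows "f (p + v) = 0"
proof -
 have "f (p + (1::real) *\<^sub>R v) = 0"
 proof (rule locally_power_series_eq_0[of "\<lambda>t. f (p + t *\<^sub>R v)" "e / (norm v + 1)" 0 1])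
  show "\<exists>c \<rho>. 0 < \<rho> \<and> (\<forall>s. \<bar>s\<bar> < \<rho> --> (\<lambda>k. c k * s ^ k) sums f (p + (t0 + s) *\<^sub>R v))" for t0
   by (rule analytic_line_power_series[OF f])
  have n: "0 < norm v + 1" by (simp add: add_nonneg_pos)
  thus "0 < e / (norm v + 1)" using e by simp
  fix s :: real assume "\<bar>s\<bar> < e / (norm v + 1)"
  hence "\<bar>s\<bar> * (norm v + 1) < e" using n by (simp add: pos_less_divide_eq)
  hence "norm (s *\<^sub>R v) < e" by (simp add: algebra_simps)
  thus "f (p + (0 + s) *\<^sub>R v) = 0" using z by simp
 qed
 thus ?thesis by simp
qed

lemma analytic_zero_if_zero_on_open:
 assumes f: "real_analytic_on UNIV f" and S: "open S" "S \<noteq> {}" "\<And>x. x \<in> S ==> f x = 0"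
 shows "f x = 0"
proof -
 obtain p e where p: "e > 0" "ball p e \<subseteq> S" using S open_contains_ball by blast
 have "f (p + (x - p)) = 0"
  by (rule analytic_vanishes_on_star[OF f p(1)]) (use S(3) p(2) in "force simp: dist_norm")
 thus ?thesis by simp
qed

lemma analytic_zero_on_hyperplane:
 assumes f: "real_analytic_on UNIV f" and p: "M \<bullet> p = b" and e: "e > 0"
  and z: "\<And>x. dist p x < e ==> M \<bullet> x = b ==> f x = 0" and x: "M \<bullet> x = b"
 shows "f x = 0"
proof -
 have "f (p + (x - p)) = 0"
  by (rule analytic_vanishes_on_star[OF f e]) (use p x in "auto intro!: z simp: dist_norm inner_simps")
 thus ?thesis by simp
qed

section \<open>Oddness across hyperplanes of zeros\<close>

definition lap :: "(real^'n => real) => real^'n => real" where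
 "lap f x = (\<Sum>i\<in>UNIV. pd i (pd i f) x)"

lemma analytic_lap: "real_analytic_on UNIV f ==> real_analytic_on UNIV (lap f)"
 unfolding lap_def[abs_def] by (intro analytic_sum analytic_pd) auto

lemma lap_dir_deriv:
 assumes f: "real_analytic_on UNIV f" shows "lap (dir_deriv v f) = dir_deriv v (lap f)"
proof
 fix x
 have "lap (dir_deriv v f) x = (\<Sum>i\<in>UNIV. dir_deriv v (pd i (pd i f)) x)"
  unfolding lap_def by (simp add: pd_dir_deriv f analytic_pd)
 also have "... = dir_deriv v (lap f) x"
  unfolding lap_def[abs_def] by (subst dir_deriv_sum) (auto intro!: analytic_pd f)
 finally show "lap (dir_deriv v f) x = dir_deriv v (lap f) x" .
qed

lemma analytic_eigenfunction_extends:
 fixes f u :: "real^'n => real"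
 assumes S: "open S" "S \<noteq> {}" and f: "real_analytic_on UNIV f" and u: "C2_with S u p q"
  and eq: "\<And>x. x \<in> S ==> f x = u x" and eig: "\<And>x. x \<in> S ==> (\<Sum>i\<in>UNIV. q i x $ i) = - \<mu> * u x"
 shows "lap f x = - \<mu> * f x"
proof -
 have pd_unique: "pd i g y = D $ i" if "(g has_derivative (\<lambda>h. D \<bullet> h)) (at y)" for g :: "real^'n => real" and D y i
 proof -
  have "((\<lambda>t. y + t *\<^sub>R axis i (1::real)) has_derivative (\<lambda>h. h *\<^sub>R axis i 1)) (at 0)"
   by (rule derivative_eq_intros refl)+ auto
  from has_derivative_compose[OF this, of g "\<lambda>h. D \<bullet> h"] that
  have "((\<lambda>t. g (y + t *\<^sub>R axis i 1)) has_real_derivative D $ i) (at 0)"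
   by (simp add: has_field_derivative_def inner_axis mult_commute_abs)
  thus ?thesis unfolding pd_def by (rule DERIV_imp_deriv)
 qed
 have 1: "pd i f y = p y $ i" if "y \<in> S" for y i
 proof (rule pd_unique)
  show "(f has_derivative (\<bullet>) (p y)) (at y)"
   using has_derivative_transform_within_open[OF C2_withD(1)[OF u that] S(1) that] eq by auto
 qed
 have 2: "pd i (pd i f) y = q i y $ i" if "y \<in> S" for y i
 proof (rule pd_unique)
  show "(pd i f has_derivative (\<bullet>) (q i y)) (at y)"
   using has_derivative_transform_within_open[OF C2_withD(2)[OF u that, of i] S(1) that] 1 by auto
 qed
 have "1 * lap f x + \<mu> * f x = 0"
 proof (rule analytic_zero_if_zero_on_open[OF _ S])
  show "real_analytic_on UNIV (\<lambda>x. 1 * lap f x + \<mu> * f x)" by (intro analytic_lincomb analytic_lap f)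
  show "1 * lap f y + \<mu> * f y = 0" if "y \<in> S" for y
   using eig[OF that] eq[OF that] 2[OF that] by (simp add: lap_def)
 qed
 thus ?thesis by simp
qed

lemma power_series_coeff_derivative:
 fixes G :: "nat => real => real"
 assumes "\<And>n t. (G n has_real_derivative G (Suc n) t) (at t)" "\<rho> > 0"
  "\<And>t. \<bar>t\<bar> < \<rho> ==> (\<lambda>k. c k * t ^ k) sums G 0 t"
 shows "c n = G n 0 / fact n"
 using assms
proof (induction n arbitrary: G c)
 case 0
 have "(\<lambda>k. c k * 0 ^ k) sums c 0" by (rule powser_sums_zero)
 with 0(3)[of 0] 0(2) show ?case by (simp add: sums_iff)
next
 case (Suc n)
 have "(\<lambda>k. diffs c k * t ^ k) sums G (Suc 0) t" if t: "\<bar>t\<bar> < \<rho>" for t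
 proof -
  define K where "K = (\<bar>t\<bar> + \<rho>) / 2"
  have K: "\<bar>t\<bar> < K" "K < \<rho>" "K > 0" using t by (auto simp: K_def)
  have sK: "summable (\<lambda>k. c k * K ^ k)" using Suc.prems(3)[of K] K by (auto simp: sums_iff)
  have "((\<lambda>t. \<Sum>k. c k * t ^ k) has_real_derivative (\<Sum>k. diffs c k * t ^ k)) (at t)"
   by (rule termdiffs_strong[OF sK]) (use K in auto)
  hence "(G 0 has_real_derivative (\<Sum>k. diffs c k * t ^ k)) (at t)"
  proof (rule has_field_derivative_transform_within_open)
   show "open {-\<rho><..<\<rho>}" "t \<in> {-\<rho><..<\<rho>}" using t by auto
   show "(\<Sum>k. c k * s ^ k) = G 0 s" if "s \<in> {-\<rho><..<\<rho>}" for s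
    using Suc.prems(3)[of s] that by (auto simp: sums_iff)
  qed
  hence "(\<Sum>k. diffs c k * t ^ k) = G (Suc 0) t" using Suc.prems(1)[of 0 t] DERIV_unique by blast
  moreover have "summable (\<lambda>k. diffs c k * t ^ k)"
  proof (rule termdiff_converges[of _ \<rho>])
   show "norm t < \<rho>" using t by simp
   show "summable (\<lambda>k. c k * s ^ k)" if "norm s < \<rho>" for s using Suc.prems(3)[of s] that by (auto simp: sums_iff)
  qed
  ultimately show ?thesis by (simp add: sums_iff)
 qed
 hence "diffs c n = G (Suc n) 0 / fact n"
  using Suc.IH[of "\<lambda>n. G (Suc n)" "diffs c"] Suc.prems(1,2) by blast
 hence "c (Suc n) * real (Suc n) = G (Suc n) 0 / fact n" by (simp add: diffs_def mult.commute)
 hence "c (Suc n) = G (Suc n) 0 / fact n / real (Suc n)" by (simp only: eq_divide_eq) simp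
 thus ?case by (simp only: fact_Suc divide_divide_eq_left mult.commute)
qed

text \<open>If a function vanishes on the hyperplane, so do its tangential derivatives, and its
gradient there is normal. This is applied to F and then to \<open>G i\<close>, the difference
between the i-th partial derivative of F and the expression for it in terms of the normal
derivative, which vanishes on the hyperplane as well.\<close>

lemma lap_eq_second_normal_derivative:
 fixes F :: "real^'n => real"
 assumes F: "real_analytic_on UNIV F" and M: "M \<noteq> 0" and z: "\<And>x. M \<bullet> x = b ==> F x = 0" and x: "M \<bullet> x = b"
 shows "dir_deriv M (dir_deriv M F) x = (norm M)\<^sup>2 * lap F x"
proof -
 define c where "c = 1 / (norm M)\<^sup>2"
 have c: "c * (M \<bullet> M) = 1" using M by (simp add: c_def power2_norm_eq_inner)
 have tang: "dir_deriv w G x = 0" if G: "real_analytic_on UNIV G" "\<And>x. M \<bullet> x = b ==> G x = 0" and w: "M \<bullet> w = 0" and x: "M \<bullet> x = b" for G w x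
 proof -
  have "((\<lambda>t. G (x + t *\<^sub>R w)) has_real_derivative dir_deriv w G (x + 0 *\<^sub>R w)) (at 0)"
   by (rule analytic_line_derivative[OF G(1)])
  moreover have "(\<lambda>t. G (x + t *\<^sub>R w)) = (\<lambda>t. 0)" using G(2) w x by (auto simp: inner_simps)
  ultimately show ?thesis using DERIV_unique[OF _ DERIV_const] by fastforce
 qed
 have normal: "pd i G x = c * M $ i * dir_deriv M G x" if G: "real_analytic_on UNIV G" "\<And>x. M \<bullet> x = b ==> G x = 0" and x: "M \<bullet> x = b" for G i x
 proof -
  define w where "w = axis i 1 - (c * M $ i) *\<^sub>R M"
  have "M \<bullet> w = 0" using c by (simp add: w_def inner_simps inner_axis mult_ac)
  hence "dir_deriv w G x = 0" by (intro tang[OF G(1)] G(2) x)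
  moreover have "dir_deriv w G x = (\<Sum>j\<in>UNIV. (axis i 1 $ j) * pd j G x - c * M $ i * (M $ j * pd j G x))"
   unfolding dir_deriv_def w_def by (intro sum.cong) (auto simp: algebra_simps)
  moreover have "(\<Sum>j\<in>UNIV. axis i 1 $ j * pd j G x) = pd i G x"
   by (simp add: axis_def if_distrib[of "\<lambda>z. z * _"] cong: if_cong)
  ultimately show ?thesis by (simp add: sum_subtractf dir_deriv_def sum_distrib_left)
 qed
 define DF where "DF = dir_deriv M F"
 have DFa: "real_analytic_on UNIV DF" unfolding DF_def by (rule analytic_dir_deriv[OF F])
 define G where "G i y = 1 * pd i F y + (- (c * M $ i)) * DF y" for i y
 have Ga: "real_analytic_on UNIV (G i)" for i
  unfolding G_def[abs_def] by (intro analytic_lincomb analytic_pd F DFa)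
 have G0: "G i y = 0" if "M \<bullet> y = b" for i y using normal[OF F z that, of i] by (simp add: G_def DF_def)
 have "pd i (G i) x = c * M $ i * dir_deriv M (G i) x" for i by (rule normal[OF Ga G0 x])
 moreover have "pd i (G i) x = pd i (pd i F) x - c * (M $ i * pd i DF x)" for i
  unfolding G_def[abs_def] by (subst pd_lincomb[OF analytic_pd[OF F] DFa]) simp
 moreover have "dir_deriv M (G i) x = dir_deriv M (pd i F) x - c * M $ i * dir_deriv M DF x" for i
  unfolding G_def[abs_def] dir_deriv_def
  by (simp only: pd_lincomb[OF analytic_pd[OF F] DFa]) (simp add: sum_distrib_left algebra_simps sum_subtractf)
 ultimately have e: "pd i (pd i F) x - c * (M $ i * pd i DF x) = c * (M $ i * dir_deriv M (pd i F) x) - (c * c * dir_deriv M DF x) * (M $ i * M $ i)" for i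
  by (simp add: algebra_simps)
 have "lap F x - c * dir_deriv M DF x = c * (\<Sum>i\<in>UNIV. M $ i * dir_deriv M (pd i F) x) - (c * c * dir_deriv M DF x) * (M \<bullet> M)"
 proof -
  have "(\<Sum>i\<in>UNIV. pd i (pd i F) x - c * (M $ i * pd i DF x)) = (\<Sum>i\<in>UNIV. c * (M $ i * dir_deriv M (pd i F) x) - (c * c * dir_deriv M DF x) * (M $ i * M $ i))"
   using e by simp
  thus ?thesis by (simp add: sum_subtractf lap_def dir_deriv_def[of M DF] sum_distrib_left inner_vec_def)
 qed
 also have "(\<Sum>i\<in>UNIV. M $ i * dir_deriv M (pd i F) x) = dir_deriv M DF x"
  unfolding pd_dir_deriv[OF F, symmetric] DF_def[symmetric] dir_deriv_def[of M DF] ..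
 also have "(c * c * dir_deriv M DF x) * (M \<bullet> M) = c * dir_deriv M DF x * (c * (M \<bullet> M))" by (simp only: mult_ac)
 also have "... = c * dir_deriv M DF x" unfolding c by simp
 finally have "lap F x = c * dir_deriv M DF x" by simp
 thus ?thesis using M by (simp add: c_def DF_def)
qed

text \<open>By induction all normal derivatives \<open>F (2 * k)\<close> vanish on the hyperplane:
they solve the same equation, which expresses the next one by a multiple of the previous one. So
the Taylor series of f along a normal line is odd, and the identity theorem extends the oddness to
the whole line.\<close>

theorem analytic_eigenfunction_odd:
 fixes f :: "real^'n => real"
 assumes f: "real_analytic_on UNIV f" and eig: "\<And>x. lap f x = - \<mu> * f x"
  and M: "M \<noteq> 0" and z: "\<And>x. M \<bullet> x = b ==> f x = 0"
 shows "f (reflection M b x) = - f x"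
proof -
 define F where "F k = (dir_deriv M ^^ k) f" for k
 have Fa: "real_analytic_on UNIV (F k)" for k
  unfolding F_def by (induction k) (auto simp: f analytic_dir_deriv)
 have FS: "F (Suc k) = dir_deriv M (F k)" for k by (simp add: F_def)
 have Fe: "lap (F k) = (\<lambda>x. - \<mu> * F k x)" for k
 proof (induction k)
  case 0 show ?case using eig by (auto simp: F_def)
 next
  case (Suc k)
  have "lap (F (Suc k)) = dir_deriv M (\<lambda>x. - \<mu> * F k x)" unfolding FS lap_dir_deriv[OF Fa] Suc.IH ..
  also have "... = (\<lambda>x. - \<mu> * F (Suc k) x)" unfolding FS by (rule ext, rule dir_deriv_cmult[OF Fa])
  finally show ?case .
 qed
 have even0: "F (2 * k) y = 0" if "M \<bullet> y = b" for k y
  using that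
 proof (induction k arbitrary: y)
  case 0 thus ?case using z by (simp add: F_def)
 next
  case (Suc k)
  have "F (2 * Suc k) y = dir_deriv M (dir_deriv M (F (2 * k))) y" by (simp add: FS)
  also have "... = (norm M)\<^sup>2 * lap (F (2 * k)) y"
   by (rule lap_eq_second_normal_derivative[OF Fa M Suc.IH Suc.prems])
  also have "... = 0" using Suc by (simp add: Fe)
  finally show ?case .
 qed
 define t where "t = (M \<bullet> x - b) / (norm M)\<^sup>2"
 define p where "p = x - t *\<^sub>R M"
 have pH: "M \<bullet> p = b" using M by (simp add: p_def t_def inner_simps power2_norm_eq_inner)
 define g where "g s = f (p + s *\<^sub>R M)" for s
 obtain c \<rho> where c: "\<rho> > 0" "\<And>s. \<bar>s\<bar> < \<rho> ==> (\<lambda>k. c k * s ^ k) sums g s"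
  using analytic_line_power_series[OF f, of p 0 M] unfolding g_def by auto
 have "c n = F n (p + 0 *\<^sub>R M) / fact n" for n
 proof (rule power_series_coeff_derivative[OF _ c(1), of "\<lambda>n s. F n (p + s *\<^sub>R M)"])
  show "((\<lambda>s. F n (p + s *\<^sub>R M)) has_real_derivative F (Suc n) (p + s *\<^sub>R M)) (at s)" for n s
   unfolding FS by (rule analytic_line_derivative[OF Fa])
  show "(\<lambda>k. c k * s ^ k) sums F 0 (p + s *\<^sub>R M)" if "\<bar>s\<bar> < \<rho>" for s
   using c(2)[OF that] by (simp add: F_def g_def)
 qed
 hence ceven: "c n = 0" if "even n" for n using that even0[OF pH] by (auto elim!: evenE)
 have odd: "g (- s) = - g s" if s: "\<bar>s\<bar> < \<rho>" for s
 proof -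
  have "(\<lambda>k. - (c k * s ^ k)) sums - g s" using c(2)[OF s] by (rule sums_minus)
  moreover have "- (c k * s ^ k) = c k * (- s) ^ k" for k using ceven[of k] by (cases "even k") auto
  ultimately have "(\<lambda>k. c k * (- s) ^ k) sums - g s" by simp
  thus ?thesis using c(2)[of "- s"] s by (auto simp: sums_iff)
 qed
 have "g t + g (- t) = 0"
 proof (rule locally_power_series_eq_0[of "\<lambda>t. g t + g (- t)" \<rho> 0 t])
  fix t0
  obtain c1 \<rho>1 where 1: "\<rho>1 > 0" "\<And>s. \<bar>s\<bar> < \<rho>1 ==> (\<lambda>k. c1 k * s ^ k) sums g (t0 + s)"
   using analytic_line_power_series[OF f, of p t0 M] unfolding g_def by auto
  obtain c2 \<rho>2 where 2: "\<rho>2 > 0" "\<And>s. \<bar>s\<bar> < \<rho>2 ==> (\<lambda>k. c2 k * s ^ k) sums g (- t0 + s)"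
   using analytic_line_power_series[OF f, of p "- t0" M] unfolding g_def by auto
  have "(\<lambda>k. (c1 k + c2 k * (-1) ^ k) * s ^ k) sums (g (t0 + s) + g (- (t0 + s)))" if "\<bar>s\<bar> < min \<rho>1 \<rho>2" for s
  proof -
   have "(\<lambda>k. c1 k * s ^ k + c2 k * (- s) ^ k) sums (g (t0 + s) + g (- t0 + - s))"
    using that by (intro sums_add 1 2) auto
   moreover have "c1 k * s ^ k + c2 k * (- s) ^ k = (c1 k + c2 k * (-1) ^ k) * s ^ k" for k
    by (simp add: power_minus[of s] algebra_simps)
   ultimately show ?thesis by simp
  qed
  thus "\<exists>c \<rho>. 0 < \<rho> \<and> (\<forall>s. \<bar>s\<bar> < \<rho> --> (\<lambda>k. c k * s ^ k) sums (g (t0 + s) + g (- (t0 + s))))"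
   using 1(1) 2(1) by (intro exI[of _ "\<lambda>k. c1 k + c2 k * (-1) ^ k"] exI[of _ "min \<rho>1 \<rho>2"]) auto
 qed (use c(1) odd in auto)
 moreover have "g t = f x" by (simp add: g_def p_def)
 moreover have "p + (- t) *\<^sub>R M = reflection M b x"
  by (simp add: p_def reflection_def t_def algebra_simps flip: scaleR_left_distrib)
 hence "g (- t) = f (reflection M b x)" by (simp add: g_def)
 ultimately show ?thesis by simp
qed

section \<open>The boundary of a polytope\<close>

lemma wp_structure:
 fixes P :: "'a::euclidean_space set"
 assumes "P \<in> wp k"
 shows "aff_dim P = int k" "rel_interior P = P" "P \<noteq> {}"
  "\<exists>\<H>. finite \<H> \<and> (\<forall>K\<in>\<H>. hyperplane_in (affine hull P) K) \<and> rel_frontier P \<subseteq> \<Union>\<H>"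
proof -
 consider "k = 0" | "k = Suc 0" | j where "k = Suc (Suc j)" by (metis not0_implies_Suc)
 hence "aff_dim P = int k \<and> rel_interior P = P \<and> P \<noteq> {} \<and>
  (\<exists>\<H>. finite \<H> \<and> (\<forall>K\<in>\<H>. hyperplane_in (affine hull P) K) \<and> rel_frontier P \<subseteq> \<Union>\<H>)"
 proof cases
  case 1
  then obtain x where "P = {x}" using assms by auto
  thus ?thesis using 1 by (auto intro!: exI[of _ "{}"])
 next
  case 2
  then obtain a b where ab: "P = open_segment a b" "a \<noteq> b" using assms by auto
  have hull: "affine hull P = affine hull {a, b}" using ab by (simp add: affine_hull_open_segment)
  have dim: "aff_dim P = 1" using ab hull aff_dim_affine_hull by (metis aff_dim_2)
  have pt: "hyperplane_in (affine hull P) {x}" if x: "x \<in> {a, b}" for x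
  proof -
   have "{x} = {y \<in> affine hull P. (b - a) \<bullet> y = (b - a) \<bullet> x}"
   proof (intro equalityI subsetI)
    fix y assume y: "y \<in> {y \<in> affine hull P. (b - a) \<bullet> y = (b - a) \<bullet> x}"
    then obtain u where u: "y = a + u *\<^sub>R (b - a)" unfolding hull affine_hull_2_alt by auto
    obtain t where t: "x = a + t *\<^sub>R (b - a)" using x by (metis add.right_neutral add_diff_cancel_left' diff_add_cancel insertE pth_4(1) real_vector_affinity_eq scaleR_one singletonD add.commute)
    have "(u - t) * ((b - a) \<bullet> (b - a)) = 0" using y u t by (simp add: inner_simps algebra_simps)
    hence "u = t" using ab(2) by simp
    thus "y \<in> {x}" using u t by simp
   qed (use x in "auto simp: hull hull_inc")
   moreover have "aff_dim {x} = aff_dim (affine hull P) - 1" by (simp add: dim)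
   ultimately show ?thesis unfolding hyperplane_in_def by blast
  qed
  have "rel_frontier P = closed_segment a b - open_segment a b"
   using ab by (simp add: rel_frontier_def rel_interior_open_segment)
  hence "rel_frontier P \<subseteq> {a, b}" by (auto simp: open_segment_def)
  moreover have "rel_interior P = P" "P \<noteq> {}" using ab by (auto simp: rel_interior_open_segment)
  ultimately show ?thesis using 2 dim pt by (intro conjI exI[of _ "{{a}, {b}}"]) auto
 next
  case (3 j)
  hence P: "aff_dim P = int k" "rel_interior P = P" and "\<exists>\<P>. face_decomposition (wp (Suc j)) P \<P>"
   using assms by auto
  then obtain \<P> where fd: "finite \<P>" "\<forall>Q\<in>\<P>. Q \<in> wp (Suc j) \<and> (\<exists>H. hyperplane_in (affine hull P) H \<and> Q \<subseteq> H)"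
   "rel_frontier P = (\<Union>Q\<in>\<P>. closure Q)" unfolding face_decomposition_def by blast
  hence "\<forall>Q. \<exists>H. Q \<in> \<P> --> hyperplane_in (affine hull P) H \<and> Q \<subseteq> H" by blast
  from choice[OF this] obtain h where h: "\<And>Q. Q \<in> \<P> ==> hyperplane_in (affine hull P) (h Q) \<and> Q \<subseteq> h Q" by blast
  have cl: "closed (h Q)" if Q: "Q \<in> \<P>" for Q
  proof -
   obtain M b where "h Q = {x \<in> affine hull P. M \<bullet> x = b}" using h[OF Q] by (auto simp: hyperplane_in_def)
   hence "h Q = affine hull P \<inter> {x. M \<bullet> x = b}" by auto
   thus ?thesis by (simp add: closed_Int closed_hyperplane)
  qed
  have "rel_frontier P \<subseteq> \<Union> (h ` \<P>)"
   unfolding fd(3)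
  proof (intro UN_least)
   fix Q assume Q: "Q \<in> \<P>"
   have "closure Q \<subseteq> h Q" using h[OF Q] cl[OF Q] by (intro closure_minimal) auto
   thus "closure Q \<subseteq> \<Union> (h ` \<P>)" using Q by blast
  qed
  moreover have "P \<noteq> {}" using P 3 by auto
  ultimately show ?thesis using P fd(1) h by (intro conjI exI[of _ "h ` \<P>"]) auto
 qed
 thus "aff_dim P = int k" "rel_interior P = P" "P \<noteq> {}"
  "\<exists>\<H>. finite \<H> \<and> (\<forall>K\<in>\<H>. hyperplane_in (affine hull P) K) \<and> rel_frontier P \<subseteq> \<Union>\<H>" by blast+
qed

lemma avoid_finite_hyperplanes:
 fixes H :: "'a::euclidean_space set"
 assumes H: "affine H" and F: "finite \<H>" "\<And>K. K \<in> \<H> ==> hyperplane_in H K"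
  and y: "y \<in> H" "e > 0"
 shows "\<exists>z\<in>H. \<exists>\<eta>>0. ball z \<eta> \<subseteq> ball y e \<and> ball z \<eta> \<inter> H \<inter> \<Union>\<H> = {}"
 using F
proof (induction \<H> rule: finite_induct)
 case empty
 thus ?case using y by (intro bexI[of _ y] exI[of _ e]) auto
next
 case (insert K \<H>)
 then obtain z \<eta> where z: "z \<in> H" "\<eta> > 0" "ball z \<eta> \<subseteq> ball y e" "ball z \<eta> \<inter> H \<inter> \<Union>\<H> = {}" by auto
 obtain M b where K: "K = {x \<in> H. M \<bullet> x = b}" and dim: "aff_dim K = aff_dim H - 1"
  using insert.prems[of K] by (auto simp: hyperplane_in_def)
 have "\<exists>w\<in>H. dist z w < \<eta> \<and> M \<bullet> w \<noteq> b"
 proof (rule ccontr)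
  assume n: "\<not> ?thesis"
  have "H \<subseteq> K"
  proof
   fix x assume x: "x \<in> H"
   define t where "t = \<eta> / (2 * (norm (x - z) + 1))"
   have nn: "norm (x - z) + 1 > 0" by (simp add: add_nonneg_pos)
   have t: "t > 0" using z(2) nn by (simp add: t_def)
   define w where "w = z + t *\<^sub>R (x - z)"
   have "w = (1 - t) *\<^sub>R z + t *\<^sub>R x" by (simp add: w_def algebra_simps)
   hence wH: "w \<in> H" using H z(1) x by (simp add: mem_affine)
   have "t * norm (x - z) < \<eta>"
   proof -
    have "t * norm (x - z) \<le> t * (norm (x - z) + 1)" using t by (intro mult_left_mono) auto
    also have "... = \<eta> / 2" using nn by (simp add: t_def field_simps)
    finally show ?thesis using z(2) by simp
   qed
   hence "dist z w < \<eta>" using t by (simp add: w_def dist_norm)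
   hence "M \<bullet> w = b" "M \<bullet> z = b" using n wH z(1,2) by auto
   hence "t * (M \<bullet> x - M \<bullet> z) = 0" by (simp add: w_def inner_simps)
   thus "x \<in> K" using t \<open>M \<bullet> z = b\<close> x K by auto
  qed
  hence "H = K" using K by auto
  thus False using dim by simp
 qed
 then obtain w where w: "w \<in> H" "dist z w < \<eta>" "M \<bullet> w \<noteq> b" by blast
 have "open (ball z \<eta> \<inter> {x. M \<bullet> x \<noteq> b})"
  by (intro open_Int open_ball open_Collect_neq continuous_intros)
 moreover have "w \<in> ball z \<eta> \<inter> {x. M \<bullet> x \<noteq> b}" using w by simp
 ultimately obtain d where d: "d > 0" "ball w d \<subseteq> ball z \<eta> \<inter> {x. M \<bullet> x \<noteq> b}" by (meson open_contains_ball)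
 hence "ball w d \<inter> H \<inter> \<Union>(insert K \<H>) = {}" using z(4) K by auto
 moreover have "ball w d \<subseteq> ball y e" using d z(3) by blast
 ultimately show ?case using w(1) d(1) by blast
qed

lemma rel_open_segment_inside:
 fixes P :: "'a::euclidean_space set"
 assumes P: "rel_interior P = P" and x: "x \<in> P" and sub: "closed_segment x y \<subseteq> affine hull P"
  and av: "closed_segment x y \<inter> rel_frontier P = {}"
 shows "y \<in> P"
proof (rule ccontr)
 assume y: "y \<notin> P"
 define S where "S = closed_segment x y"
 obtain T where T: "open T" "P = affine hull P \<inter> T"
  using openin_rel_interior[of P] P by (auto simp: openin_open)
 have rf: "rel_frontier P = closure P - P" using P by (simp add: rel_frontier_def)
 have "openin (top_of_set S) (S \<inter> T)" "openin (top_of_set S) (S \<inter> - closure P)"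
  using T(1) by (auto intro!: openin_open_Int)
 moreover have "S \<subseteq> (S \<inter> T) \<union> (S \<inter> - closure P)" using av rf T(2) by (auto simp: S_def)
 moreover have "(S \<inter> T) \<inter> (S \<inter> - closure P) = {}"
  using T(2) sub closure_subset[of P] by (auto simp: S_def)
 moreover have "x \<in> S \<inter> T" using x T(2) by (auto simp: S_def)
 moreover have "y \<in> S \<inter> - closure P" using y av rf by (auto simp: S_def)
 moreover have "connected S" by (simp add: S_def)
 ultimately show False unfolding connected_openin by blast
qed

text \<open>Close to \<xi> only the hyperplanes through \<xi> matter, and these are invariant
under scaling with centre \<xi>. A ball in P that avoids all the hyperplanes shrinks towards \<xi>
without meeting the relative frontier, so its shrunken copies stay in P.\<close>

lemma wp_cone:
 fixes P :: "'a::euclidean_space set"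
 assumes P: "P \<in> wp k" and \<xi>: "\<xi> \<in> closure P"
 shows "\<exists>\<kappa>>0. \<forall>r. 0 < r \<and> r < 1 --> (\<exists>p\<in>affine hull P. dist p \<xi> < r \<and> ball p (\<kappa> * r) \<inter> affine hull P \<subseteq> P)"
proof -
 define H where "H = affine hull P"
 have aff: "affine H" by (simp add: H_def)
 obtain \<H> where \<H>: "finite \<H>" "\<And>K. K \<in> \<H> ==> hyperplane_in H K" "rel_frontier P \<subseteq> \<Union>\<H>"
  using wp_structure(4)[OF P] unfolding H_def by blast
 have ri: "rel_interior P = P" by (rule wp_structure(2)[OF P])
 have \<xi>H: "\<xi> \<in> H" using \<xi> closure_affine_hull[of P] unfolding H_def by blast
 have clK: "closed K" if K: "K \<in> \<H>" for K
 proof -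
  obtain M b where "K = {x \<in> H. M \<bullet> x = b}" using \<H>(2)[OF K] by (auto simp: hyperplane_in_def)
  hence "K = H \<inter> {x. M \<bullet> x = b}" by auto
  thus ?thesis by (simp add: H_def closed_Int closed_hyperplane)
 qed
 have "open (- \<Union>{K \<in> \<H>. \<xi> \<notin> K})" using clK \<H>(1) by (intro open_Compl closed_Union) auto
 moreover have "\<xi> \<in> - \<Union>{K \<in> \<H>. \<xi> \<notin> K}" by auto
 ultimately obtain e where e: "e > 0" "ball \<xi> e \<subseteq> - \<Union>{K \<in> \<H>. \<xi> \<notin> K}" by (meson open_contains_ball)
 obtain y0 where y0: "y0 \<in> P" "dist y0 \<xi> < e" using \<xi> e(1) closure_approachable by blast
 obtain d where d: "d > 0" "ball y0 d \<inter> H \<subseteq> P" using y0(1) ri unfolding H_def by (metis mem_rel_interior_ball)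
 have m: "min d (e - dist y0 \<xi>) > 0" using d y0 by simp
 have y0H: "y0 \<in> H" using y0(1) hull_subset unfolding H_def by fast
 obtain z \<eta> where z: "z \<in> H" "\<eta> > 0" "ball z \<eta> \<subseteq> ball y0 (min d (e - dist y0 \<xi>))" "ball z \<eta> \<inter> H \<inter> \<Union>\<H> = {}"
  using avoid_finite_hyperplanes[OF aff \<H>(1,2) y0H m] by blast
 have "ball z \<eta> \<subseteq> ball y0 d" using z(3) subset_ball[of "min d (e - dist y0 \<xi>)" d y0] by auto
 hence zP: "ball z \<eta> \<inter> H \<subseteq> P" using d(2) by blast
 have ze: "dist \<xi> w < e" if "w \<in> ball z \<eta>" for w
 proof -
  have "dist y0 w < e - dist y0 \<xi>" using z(3) that by auto
  thus ?thesis using dist_triangle[of \<xi> w y0] by (simp add: dist_commute)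
 qed
 define L where "L = norm (z - \<xi>) + 1"
 have L: "L > 0" by (simp add: L_def add_nonneg_pos)
 have main: "\<exists>p\<in>H. dist p \<xi> < r \<and> ball p (\<eta> / L * r) \<inter> H \<subseteq> P" if r: "0 < r" "r < 1" for r
 proof -
  define t where "t = r / L"
  have t: "0 < t" "t \<le> 1" using r L by (auto simp: t_def L_def divide_le_eq add.commute intro: order_trans[of _ 1])
  define p where "p = \<xi> + t *\<^sub>R (z - \<xi>)"
  have "p = (1 - t) *\<^sub>R \<xi> + t *\<^sub>R z" by (simp add: p_def algebra_simps)
  hence pH: "p \<in> H" using aff \<xi>H z(1) by (simp add: mem_affine)
  have "dist p \<xi> = t * norm (z - \<xi>)" using t by (simp add: p_def dist_norm)
  also have "... < t * L" using t by (simp add: L_def)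
  also have "... = r" using L by (simp add: t_def)
  finally have 1: "dist p \<xi> < r" .
  have "x \<in> P" if x: "x \<in> ball p (\<eta> / L * r)" "x \<in> H" for x
  proof -
   define w where "w = \<xi> + (1 / t) *\<^sub>R (x - \<xi>)"
   have xw: "x = \<xi> + t *\<^sub>R (w - \<xi>)" using t by (simp add: w_def)
   have "w = (1 - 1 / t) *\<^sub>R \<xi> + (1 / t) *\<^sub>R x" by (simp add: w_def algebra_simps)
   hence wH: "w \<in> H" using aff \<xi>H x(2) by (simp add: mem_affine)
   have "x - p = t *\<^sub>R (w - z)" by (simp add: xw p_def algebra_simps)
   hence "dist p x = t * dist w z" using t by (simp add: dist_norm norm_minus_commute[of p])
   moreover have "\<eta> / L * r = \<eta> * t" by (simp add: t_def)
   ultimately have "t * dist w z < \<eta> * t" using x(1) by simp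
   hence "dist w z < \<eta>" using t by simp
   hence wb: "w \<in> ball z \<eta>" by (simp add: dist_commute)
   hence wP: "w \<in> P" using wH zP by blast
   have on: "s *\<^sub>R (w - \<xi>) + \<xi> \<in> H \<and> s *\<^sub>R (w - \<xi>) + \<xi> \<notin> \<Union>\<H>" if s: "0 < s" "s \<le> 1" for s
   proof -
    define v where "v = s *\<^sub>R (w - \<xi>) + \<xi>"
    have "v = (1 - s) *\<^sub>R \<xi> + s *\<^sub>R w" by (simp add: v_def algebra_simps)
    hence vH: "v \<in> H" using aff \<xi>H wH by (simp add: mem_affine)
    have "v \<notin> K" if K: "K \<in> \<H>" for K
    proof (cases "\<xi> \<in> K")
     case True
     obtain M b where Kd: "K = {x \<in> H. M \<bullet> x = b}" using \<H>(2)[OF K] by (auto simp: hyperplane_in_def)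
     have "w \<notin> K" using z(4) wb wH K by auto
     hence "M \<bullet> w \<noteq> M \<bullet> \<xi>" using Kd wH True by auto
     hence "s * (M \<bullet> w - M \<bullet> \<xi>) \<noteq> 0" using s by simp
     hence "M \<bullet> v \<noteq> M \<bullet> \<xi>" by (simp add: v_def inner_simps)
     thus ?thesis using Kd True by auto
    next
     case False
     have "norm (s *\<^sub>R (w - \<xi>)) \<le> 1 * norm (w - \<xi>)" using s unfolding norm_scaleR by (intro mult_right_mono) auto
     hence "dist \<xi> v < e" using ze[OF wb] by (simp add: v_def dist_norm norm_minus_commute)
     thus ?thesis using e(2) False K by auto
    qed
    thus ?thesis using vH by (auto simp: v_def)
   qed
   have seg: "\<exists>s. 0 < s \<and> s \<le> 1 \<and> v = s *\<^sub>R (w - \<xi>) + \<xi>" if v: "v \<in> closed_segment w x" for v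
   proof -
    obtain u where u: "0 \<le> u" "u \<le> 1" "v = (1 - u) *\<^sub>R w + u *\<^sub>R x" using v by (auto simp: in_segment)
    define s where "s = 1 - u + u * t"
    have "v = s *\<^sub>R (w - \<xi>) + \<xi>" unfolding u(3) s_def by (subst xw) (simp add: algebra_simps)
    moreover have "s \<le> 1" using u t by (simp add: s_def mult_left_le)
    moreover have "s > 0"
    proof (cases "u = 1")
     case False
     hence "1 - u > 0" "u * t \<ge> 0" using u t by auto
     thus ?thesis unfolding s_def by linarith
    qed (use t in "simp add: s_def")
    ultimately show ?thesis by blast
   qed
   show "x \<in> P"
   proof (rule rel_open_segment_inside[OF ri wP])
    show "closed_segment w x \<subseteq> affine hull P" using seg on unfolding H_def by fastforce
    show "closed_segment w x \<inter> rel_frontier P = {}" using seg on \<H>(3) by fastforce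
   qed
  qed
  thus ?thesis using pH 1 by blast
 qed
 show ?thesis using main z(2) L unfolding H_def by (intro exI[of _ "\<eta> / L"]) auto
qed

lemma wp_open:
 fixes \<Omega> :: "'a::euclidean_space set"
 assumes "\<Omega> \<in> wp DIM('a)"
 shows "open \<Omega>" "connected \<Omega>" "bounded \<Omega>" "\<Omega> \<noteq> {}" "\<exists>\<P>. face_decomposition (wp (DIM('a) - 1)) \<Omega> \<P>"
proof -
 have dim: "aff_dim \<Omega> = int DIM('a)" and ri: "rel_interior \<Omega> = \<Omega>" and ne: "\<Omega> \<noteq> {}"
  using wp_structure[OF assms] by auto
 have hull: "affine hull \<Omega> = UNIV" using dim by (simp add: aff_dim_eq_full)
 show "open \<Omega>" using rel_interior_interior[OF hull] ri by (metis open_interior)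
 show "\<Omega> \<noteq> {}" by (rule ne)
 consider "DIM('a) = Suc 0" | j where "DIM('a) = Suc (Suc j)"
  by (metis DIM_positive gr0_implies_Suc not0_implies_Suc)
 hence "connected \<Omega> \<and> bounded \<Omega> \<and> (\<exists>\<P>. face_decomposition (wp (DIM('a) - 1)) \<Omega> \<P>)"
 proof cases
  case 1
  then obtain a b where ab: "\<Omega> = open_segment a b" "a \<noteq> b" using assms by auto
  have "rel_frontier \<Omega> = closed_segment a b - open_segment a b"
   using ab by (simp add: rel_frontier_def rel_interior_open_segment)
  hence "rel_frontier \<Omega> = {a, b}" by (auto simp: open_segment_def)
  moreover have "\<exists>H. hyperplane_in (affine hull \<Omega>) H \<and> {x} \<subseteq> H" for x
   unfolding hull hyperplane_in_UNIV using nonzero_Basis SOME_Basis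
   by (intro exI[of _ "{y. (SOME i. i \<in> Basis) \<bullet> y = (SOME i. i \<in> Basis) \<bullet> x}"]) blast
  ultimately have "face_decomposition (wp (DIM('a) - 1)) \<Omega> {{a}, {b}}"
   using 1 by (auto simp: face_decomposition_def)
  moreover have "connected \<Omega>" using ab by (simp add: convex_connected)
  ultimately show ?thesis using ab by (auto simp: bounded_open_segment)
 next
  case (2 j)
  thus ?thesis using assms by auto
 qed
 thus "connected \<Omega>" "bounded \<Omega>" "\<exists>\<P>. face_decomposition (wp (DIM('a) - 1)) \<Omega> \<P>" by blast+
qed

lemma face_decomposition_open_iff:
 fixes \<Omega> :: "'a::euclidean_space set"
 assumes "open \<Omega>" "\<Omega> \<noteq> {}"
 shows "face_decomposition W \<Omega> \<P> \<longleftrightarrow>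
   finite \<P> \<and> (\<forall>P\<in>\<P>. P \<in> W \<and> (\<exists>M b. M \<noteq> 0 \<and> P \<subseteq> {x. M \<bullet> x = b})) \<and> frontier \<Omega> = (\<Union>P\<in>\<P>. closure P)"
proof -
 have hull: "affine hull \<Omega> = UNIV" using assms by (simp add: affine_hull_open)
 hence "rel_frontier \<Omega> = frontier \<Omega>" by (simp add: rel_frontier_frontier)
 moreover have "(\<exists>H. hyperplane_in UNIV H \<and> P \<subseteq> H) \<longleftrightarrow> (\<exists>M b. M \<noteq> 0 \<and> P \<subseteq> {x. M \<bullet> x = b})" for P :: "'a set"
  unfolding hyperplane_in_UNIV by blast
 ultimately show ?thesis unfolding face_decomposition_def hull by simp
qed

lemma face_hyperplanes_cover:
 fixes \<Omega> :: "'a::euclidean_space set"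
 assumes "open \<Omega>" "\<Omega> \<noteq> {}" "face_decomposition (wp (DIM('a) - 1)) \<Omega> \<P>"
 obtains \<H> where "finite \<H>" "\<H> \<subseteq> face_hyperplanes \<Omega>" "frontier \<Omega> \<subseteq> \<Union>\<H>"
proof -
 have fd: "finite \<P>" "\<forall>P\<in>\<P>. \<exists>M b. M \<noteq> 0 \<and> P \<subseteq> {x. M \<bullet> x = b}" "frontier \<Omega> = (\<Union>P\<in>\<P>. closure P)"
  using assms(3) unfolding face_decomposition_open_iff[OF assms(1,2)] by auto
 from fd(2) have "\<forall>P. \<exists>H. P \<in> \<P> --> hyperplane_in UNIV H \<and> P \<subseteq> H" unfolding hyperplane_in_UNIV by metis
 from choice[OF this] obtain h where h: "\<And>P. P \<in> \<P> ==> hyperplane_in UNIV (h P) \<and> P \<subseteq> h P" by blast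
 have "closure P \<subseteq> h P" if "P \<in> \<P>" for P
  using h[OF that] closed_hyperplane closure_minimal unfolding hyperplane_in_UNIV by metis
 hence "frontier \<Omega> \<subseteq> \<Union>(h ` \<P>)" unfolding fd(3) by blast
 moreover have "h ` \<P> \<subseteq> face_hyperplanes \<Omega>" unfolding face_hyperplanes_def using h assms(3) by blast
 ultimately show ?thesis using that[of "h ` \<P>"] fd(1) by blast
qed

lemma wp_hull_hyperplane:
 fixes P :: "'a::euclidean_space set"
 assumes P: "P \<in> wp (DIM('a) - 1)" and M: "M \<noteq> 0" "P \<subseteq> {x. M \<bullet> x = b}"
 shows "affine hull P = {x. M \<bullet> x = b}"
proof (rule affine_dim_equal)
 show "affine hull P \<subseteq> {x. M \<bullet> x = b}" using M(2) by (intro hull_minimal) (auto simp: affine_hyperplane)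
 show "affine hull P \<noteq> {}" using wp_structure(3)[OF P] by simp
 show "aff_dim (affine hull P) = aff_dim {x. M \<bullet> x = b}"
  using wp_structure(1)[OF P] M(1) by (simp add: aff_dim_affine_hull of_nat_diff DIM_positive Suc_leI)
qed (auto simp: affine_hyperplane)

lemma face_hyperplane_touches:
 fixes \<Omega> :: "'a::euclidean_space set"
 assumes \<Omega>: "open \<Omega>" "\<Omega> \<noteq> {}" and H: "H \<in> face_hyperplanes \<Omega>"
 obtains M b p e where "M \<noteq> 0" "H = {x. M \<bullet> x = b}" "p \<in> H" "e > 0" "ball p e \<inter> H \<subseteq> frontier \<Omega>"
proof -
 obtain \<P> P where P: "face_decomposition (wp (DIM('a) - 1)) \<Omega> \<P>" "P \<in> \<P>" "P \<subseteq> H" and "hyperplane_in UNIV H"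
  using H unfolding face_hyperplanes_def by blast
 then obtain M b where M: "M \<noteq> 0" "H = {x. M \<bullet> x = b}" unfolding hyperplane_in_UNIV by blast
 have Pw: "P \<in> wp (DIM('a) - 1)" and fr: "closure P \<subseteq> frontier \<Omega>"
  using P(1,2) unfolding face_decomposition_open_iff[OF \<Omega>] by auto
 have hull: "affine hull P = H" using wp_hull_hyperplane[OF Pw M(1)] P(3) M(2) by simp
 obtain p where p: "p \<in> P" using wp_structure(3)[OF Pw] by auto
 then obtain e where e: "e > 0" "ball p e \<inter> affine hull P \<subseteq> P"
  using wp_structure(2)[OF Pw] mem_rel_interior_ball by metis
 hence "ball p e \<inter> H \<subseteq> frontier \<Omega>" using hull fr closure_subset by blast
 thus ?thesis using that M p P(3) e(1) by blast
qed

lemma polytope_flat_cone_condition: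
 fixes \<Omega> :: "(real^'n) set"
 assumes \<Omega>: "\<Omega> \<in> wp CARD('n)" and \<xi>: "\<xi> \<in> frontier \<Omega>"
 shows "flat_cone_condition \<Omega> \<xi>"
proof -
 have w: "\<Omega> \<in> wp DIM(real^'n)" using \<Omega> by simp
 note o = wp_open[OF w]
 obtain \<P> where "face_decomposition (wp (DIM(real^'n) - 1)) \<Omega> \<P>" using o(5) by blast
 hence fd: "\<forall>P\<in>\<P>. P \<in> wp (DIM(real^'n) - 1) \<and> (\<exists>M b. M \<noteq> 0 \<and> P \<subseteq> {x. M \<bullet> x = b})" "frontier \<Omega> = (\<Union>P\<in>\<P>. closure P)"
  unfolding face_decomposition_open_iff[OF o(1,4)] by auto
 obtain P where P: "P \<in> \<P>" "\<xi> \<in> closure P" using \<xi> fd(2) by blast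
 obtain M b where Pw: "P \<in> wp (DIM(real^'n) - 1)" and M: "M \<noteq> 0" "P \<subseteq> {x. M \<bullet> x = b}" using fd(1) P(1) by blast
 have hull: "affine hull P = {x. M \<bullet> x = b}" by (rule wp_hull_hyperplane[OF Pw M])
 obtain \<kappa> where \<kappa>: "\<kappa> > 0" "\<And>r. 0 < r ==> r < 1 ==> \<exists>p\<in>affine hull P. dist p \<xi> < r \<and> ball p (\<kappa> * r) \<inter> affine hull P \<subseteq> P"
  using wp_cone[OF Pw P(2)] by blast
 define \<nu> where "\<nu> = (1 / norm M) *\<^sub>R M"
 have "P \<subseteq> frontier \<Omega>" using fd(2) P(1) closure_subset by blast
 hence Pn: "x \<notin> \<Omega>" if "x \<in> P" for x using that o(1) by (auto simp: frontier_def interior_open)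
 have n1: "norm \<nu> = 1" using M(1) by (simp add: \<nu>_def)
 have "\<exists>p. dist p \<xi> < r \<and> (\<forall>x. dist p x < \<kappa> * r \<and> \<nu> \<bullet> (x - p) = 0 --> x \<notin> \<Omega>)" if r: "0 < r" "r < 1" for r
 proof -
  obtain p where p: "p \<in> affine hull P" "dist p \<xi> < r" "ball p (\<kappa> * r) \<inter> affine hull P \<subseteq> P" using \<kappa>(2)[OF r] by blast
  have "x \<notin> \<Omega>" if "dist p x < \<kappa> * r" "\<nu> \<bullet> (x - p) = 0" for x
  proof (rule Pn)
   have "M \<bullet> x = b" using that(2) M(1) p(1) unfolding hull by (simp add: \<nu>_def inner_diff_right)
   thus "x \<in> P" using that(1) p(3) hull by auto
  qed
  thus ?thesis using p(2) by blast
 qed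
 thus ?thesis
  unfolding flat_cone_condition_def using n1 \<kappa>(1) by (meson zero_less_one)
qed

section \<open>Isometries and reflected copies\<close>

definition isometry_map :: "('a::euclidean_space => 'a) => bool" where
 "isometry_map g \<longleftrightarrow> (\<forall>x y. dist (g x) (g y) = dist x y)"

lemma isometry_map_form:
 assumes "isometry_map g"
 obtains L where "orthogonal_transformation L" "\<And>x. g x = g 0 + L x"
proof -
 have "orthogonal_transformation (\<lambda>x. g x - g 0)"
  unfolding orthogonal_transformation_isometry using assms by (auto simp: isometry_map_def dist_norm)
 thus ?thesis using that[of "\<lambda>x. g x - g 0"] by simp
qed

lemma isometry_map_compose: "isometry_map g ==> isometry_map h ==> isometry_map (g \<circ> h)"
 by (simp add: isometry_map_def)

lemma isometry_map_bij: assumes "isometry_map g" shows "bij g"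
proof -
 obtain L where L: "orthogonal_transformation L" "\<And>x. g x = g 0 + L x" using isometry_map_form[OF assms] by blast
 have "bij L" using L(1) by (simp add: orthogonal_transformation_bij)
 hence "bij ((+) (g 0) \<circ> L)" by (intro bij_comp) (auto simp: bij_plus_right)
 moreover have "(+) (g 0) \<circ> L = g" by (rule ext) (simp add: L(2)[symmetric])
 ultimately show ?thesis by simp
qed

lemma isometry_map_inv: assumes "isometry_map g" shows "isometry_map (inv g)"
 using assms isometry_map_bij[OF assms] unfolding isometry_map_def by (metis bij_inv_eq_iff)

lemma isometry_map_images:
 assumes "isometry_map g"
 shows "closure (g ` S) = g ` closure S" "interior (g ` S) = g ` interior S"
  "frontier (g ` S) = g ` frontier S" "open (g ` S) \<longleftrightarrow> open S" "connected S ==> connected (g ` S)"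
  "P \<in> wp k ==> g ` P \<in> wp k"
proof -
 obtain L where L: "orthogonal_transformation L" "\<And>x. g x = g 0 + L x" using isometry_map_form[OF assms] by blast
 have lin: "linear L" and inj: "inj L" and n: "\<And>x. norm (L x) = norm x"
  using L(1) by (auto simp: orthogonal_transformation_linear orthogonal_transformation_inj orthogonal_transformation_norm)
 have im: "g ` S = (+) (g 0) ` L ` S" for S by (simp add: image_image L(2)[symmetric])
 show c: "closure (g ` S) = g ` closure S"
  unfolding im using lin inj by (simp add: closure_translation closure_injective_linear_image)
 show i: "interior (g ` S) = g ` interior S"
  unfolding im using lin inj by (simp add: interior_translation interior_injective_linear_image)
 show "frontier (g ` S) = g ` frontier S"
  unfolding frontier_def c i using isometry_map_bij[OF assms] by (simp add: image_set_diff bij_is_inj)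
 show "open (g ` S) \<longleftrightarrow> open S"
  using i isometry_map_bij[OF assms] by (metis bij_is_inj inj_image_eq_iff interior_eq)
 have "continuous_on S g" using assms unfolding isometry_map_def continuous_on_iff by metis
 thus "connected S ==> connected (g ` S)" by (rule connected_continuous_image)
 have ge: "(\<lambda>x. g 0 + L x) = g" by (rule ext) (rule L(2)[symmetric])
 show "P \<in> wp k ==> g ` P \<in> wp k" using wp_isometric_image[OF lin n, of "g 0" P k] unfolding ge by simp
qed

lemma isometry_map_hyperplane:
 assumes "isometry_map g"
 obtains L where "orthogonal_transformation L" "\<And>x. g x = g 0 + L x"
  "\<And>M b. g ` {x. M \<bullet> x = b} = {y. L M \<bullet> y = b + L M \<bullet> g 0}"
  "\<And>M b x. g (reflection M b x) = reflection (L M) (b + L M \<bullet> g 0) (g x)"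
proof -
 obtain L where L: "orthogonal_transformation L" "\<And>x. g x = g 0 + L x" using isometry_map_form[OF assms] by blast
 have ip: "L v \<bullet> L w = v \<bullet> w" and lin: "linear L" and n: "norm (L v) = norm v" for v w
  using L(1) by (auto simp: orthogonal_transformation_def orthogonal_transformation_norm)
 have 1: "g ` {x. M \<bullet> x = b} = {y. L M \<bullet> y = b + L M \<bullet> g 0}" for M b
 proof (intro equalityI subsetI)
  fix y assume "y \<in> g ` {x. M \<bullet> x = b}"
  then obtain x where x: "y = g x" "M \<bullet> x = b" by auto
  hence "L M \<bullet> y = L M \<bullet> g 0 + b" unfolding x(1) L(2)[of x] by (simp add: inner_add_right ip)
  thus "y \<in> {y. L M \<bullet> y = b + L M \<bullet> g 0}" by simp
 next
  fix y assume y: "y \<in> {y. L M \<bullet> y = b + L M \<bullet> g 0}"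
  obtain x where x: "y = g x" using isometry_map_bij[OF assms] by (metis bij_pointE)
  have "L M \<bullet> y = L M \<bullet> g 0 + M \<bullet> x" unfolding x L(2)[of x] by (simp add: inner_add_right ip)
  thus "y \<in> g ` {x. M \<bullet> x = b}" using x y by auto
 qed
 have 2: "g (reflection M b x) = reflection (L M) (b + L M \<bullet> g 0) (g x)" for M b x
 proof -
  have "g (reflection M b x) = g 0 + L x - (2 * (M \<bullet> x - b) / (norm M)\<^sup>2) *\<^sub>R L M"
  proof -
   have "L (reflection M b x) = L x - (2 * (M \<bullet> x - b) / (norm M)\<^sup>2) *\<^sub>R L M"
    unfolding reflection_def using lin by (simp only: linear_diff linear_scale)
   thus ?thesis unfolding L(2)[of "reflection M b x"] by simp
  qed
  moreover have "L M \<bullet> g x - (b + L M \<bullet> g 0) = M \<bullet> x - b" unfolding L(2)[of x] by (simp add: inner_add_right ip)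
  ultimately show ?thesis unfolding reflection_def[of "L M"] n L(2)[of x] by simp
 qed
 show ?thesis using that[OF L 1 2] .
qed

lemma hyperplane_normals_parallel:
 assumes H: "{x. M \<bullet> x = b} = {x. M' \<bullet> x = b'}" and M: "M \<noteq> 0"
 obtains c where "M' = c *\<^sub>R M" "b' = c * b"
proof -
 define p where "p = (b / (M \<bullet> M)) *\<^sub>R M"
 have "M \<bullet> p = b" using M by (simp add: p_def)
 hence p': "M' \<bullet> p = b'" using H by blast
 define c where "c = (M' \<bullet> M) / (M \<bullet> M)"
 define w where "w = M' - c *\<^sub>R M"
 have Mw: "M \<bullet> w = 0" using M by (simp add: w_def c_def inner_diff_right inner_commute)
 hence "M \<bullet> (p + w) = b" using \<open>M \<bullet> p = b\<close> by (simp add: inner_add_right)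
 hence "M' \<bullet> (p + w) = b'" using H by blast
 hence "M' \<bullet> w = 0" using p' by (simp add: inner_add_right)
 hence "w \<bullet> w = 0" using Mw by (simp add: w_def inner_diff_left inner_diff_right inner_commute)
 hence M': "M' = c *\<^sub>R M" by (simp add: w_def)
 show ?thesis using that[OF M'] p' \<open>M \<bullet> p = b\<close> by (simp add: M')
qed

lemma reflection_cong:
 assumes H: "{x. M \<bullet> x = b} = {x. M' \<bullet> x = b'}" and M: "M \<noteq> 0" "M' \<noteq> 0"
 shows "reflection M b = reflection M' b'"
proof
 obtain c where c: "M' = c *\<^sub>R M" "b' = c * b" using hyperplane_normals_parallel[OF H M(1)] .
 hence "c \<noteq> 0" using M by auto
 hence "2 * (c * (M \<bullet> x) - c * b) / (c\<^sup>2 * (norm M)\<^sup>2) * c = 2 * (M \<bullet> x - b) / (norm M)\<^sup>2" for x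
  using M by (simp add: field_simps power2_eq_square)
 thus "reflection M b x = reflection M' b' x" for x
  by (simp add: reflection_def c power_mult_distrib)
qed

lemma isometry_reflection: "isometry_map (reflection M b)"
proof (cases "M = 0")
 case True thus ?thesis by (simp add: isometry_map_def reflection_def)
next
 case False
 have "(dist (reflection M b x) (reflection M b y))\<^sup>2 = (dist x y)\<^sup>2" for x y
 proof -
  define c where "c = 2 * (M \<bullet> (x - y)) / (norm M)\<^sup>2"
  have c: "c * (M \<bullet> M) = 2 * (M \<bullet> (x - y))" using False by (simp add: c_def power2_norm_eq_inner)
  have "reflection M b x - reflection M b y = (x - y) - c *\<^sub>R M"
   by (simp add: reflection_def c_def inner_diff_right algebra_simps diff_divide_distrib flip: scaleR_left_distrib scaleR_left_diff_distrib)
  moreover have "(norm ((x - y) - c *\<^sub>R M))\<^sup>2 = (norm (x - y))\<^sup>2 - 2 * c * (M \<bullet> (x - y)) + c * (c * (M \<bullet> M))"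
   unfolding power2_norm_eq_inner by (simp add: inner_diff_left inner_diff_right inner_commute algebra_simps)
  ultimately show ?thesis unfolding dist_norm c by simp
 qed
 thus ?thesis unfolding isometry_map_def by (metis power2_eq_imp_eq zero_le_dist)
qed

lemma reflection_involution:
 assumes "M \<noteq> 0" shows "reflection M b (reflection M b x) = x"
proof -
 define c where "c = 2 * (M \<bullet> x - b) / (norm M)\<^sup>2"
 have "M \<bullet> (x - c *\<^sub>R M) - b = - (M \<bullet> x - b)"
  using assms by (simp add: c_def inner_diff_right power2_norm_eq_inner)
 hence "2 * (M \<bullet> (x - c *\<^sub>R M) - b) / (norm M)\<^sup>2 = 2 * (- (M \<bullet> x - b)) / (norm M)\<^sup>2" by (simp only:)
 also have "... = - c" unfolding c_def by (simp only: mult_minus_right minus_divide_left)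
 finally have "2 * (M \<bullet> (x - c *\<^sub>R M) - b) / (norm M)\<^sup>2 = - c" .
 moreover have "reflection M b x = x - c *\<^sub>R M" by (simp add: reflection_def c_def)
 moreover have "reflection M b (x - c *\<^sub>R M) =
   x - c *\<^sub>R M - (2 * (M \<bullet> (x - c *\<^sub>R M) - b) / (norm M)\<^sup>2) *\<^sub>R M"
  by (simp only: reflection_def)
 ultimately show ?thesis by simp
qed

lemma reflection_fixes: "M \<bullet> x = b ==> reflection M b x = x"
 by (simp add: reflection_def)

lemma face_hyperplane_normal_nonzero:
 assumes "{x. M \<bullet> x = b} \<in> face_hyperplanes D" shows "M \<noteq> 0"
proof
 assume "M = 0"
 hence "{x. M \<bullet> x = b} = UNIV \<or> {x. M \<bullet> x = b} = {}" by auto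
 moreover have "hyperplane_in UNIV {x. M \<bullet> x = b}" using assms unfolding face_hyperplanes_def by blast
 ultimately show False unfolding hyperplane_in_def by auto
qed

lemma face_hyperplanes_image_sub:
 assumes g: "isometry_map g" and S: "open S" "S \<noteq> {}" and H: "H \<in> face_hyperplanes S"
 shows "g ` H \<in> face_hyperplanes (g ` S)"
proof -
 obtain L where L: "orthogonal_transformation L"
  "\<And>M b. g ` {x. M \<bullet> x = b} = {y. L M \<bullet> y = b + L M \<bullet> g 0}"
  using isometry_map_hyperplane[OF g] by metis
 have hyp: "\<exists>M' b'. M' \<noteq> 0 \<and> g ` {x. M \<bullet> x = b} = {x. M' \<bullet> x = b'}" if "M \<noteq> 0" for M b
  unfolding L(2) using that L(1) by (metis norm_eq_zero orthogonal_transformation_norm)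
 obtain \<P> P where P: "face_decomposition (wp (DIM('a) - 1)) S \<P>" "P \<in> \<P>" "P \<subseteq> H" and hH: "hyperplane_in UNIV H"
  using H unfolding face_hyperplanes_def by blast
 have fd: "finite \<P>" "\<And>P. P \<in> \<P> ==> P \<in> wp (DIM('a) - 1)" "\<And>P. P \<in> \<P> ==> \<exists>M b. M \<noteq> 0 \<and> P \<subseteq> {x. M \<bullet> x = b}"
  "frontier S = (\<Union>P\<in>\<P>. closure P)"
  using P(1) unfolding face_decomposition_open_iff[OF S] by auto
 have S': "open (g ` S)" "g ` S \<noteq> {}" using S isometry_map_images(4)[OF g] by auto
 have "face_decomposition (wp (DIM('a) - 1)) (g ` S) ((`) g ` \<P>)"
  unfolding face_decomposition_open_iff[OF S']
 proof (intro conjI ballI)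
  show "finite ((`) g ` \<P>)" using fd(1) by simp
  show "frontier (g ` S) = (\<Union>P\<in>(`) g ` \<P>. closure P)"
   unfolding isometry_map_images(3)[OF g] fd(4) using isometry_map_images(1)[OF g] by auto
  fix Q assume "Q \<in> (`) g ` \<P>"
  then obtain P' where P': "P' \<in> \<P>" "Q = g ` P'" by blast
  show "Q \<in> wp (DIM('a) - 1)" unfolding P'(2) by (rule isometry_map_images(6)[OF g fd(2)[OF P'(1)]])
  obtain M b where M: "M \<noteq> 0" "P' \<subseteq> {x. M \<bullet> x = b}" using fd(3)[OF P'(1)] by blast
  obtain M' b' where M': "M' \<noteq> 0" "g ` {x. M \<bullet> x = b} = {x. M' \<bullet> x = b'}" using hyp[OF M(1)] by blast
  have "Q \<subseteq> {x. M' \<bullet> x = b'}" unfolding M'(2)[symmetric] P'(2) using M(2) by (rule image_mono)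
  thus "\<exists>M b. M \<noteq> 0 \<and> Q \<subseteq> {x. M \<bullet> x = b}" using M'(1) by blast
 qed
 moreover have "hyperplane_in UNIV (g ` H)" using hH hyp unfolding hyperplane_in_UNIV by metis
 moreover have "g ` P \<in> (`) g ` \<P>" "g ` P \<subseteq> g ` H" using P by auto
 ultimately show ?thesis unfolding face_hyperplanes_def by blast
qed

lemma face_hyperplanes_image:
 assumes g: "isometry_map g" and S: "open S" "S \<noteq> {}"
 shows "face_hyperplanes (g ` S) = (`) g ` face_hyperplanes S"
proof (intro equalityI subsetI)
 fix H assume H: "H \<in> face_hyperplanes (g ` S)"
 have S': "open (g ` S)" "g ` S \<noteq> {}" using S isometry_map_images(4)[OF g] by auto
 have "inv g ` H \<in> face_hyperplanes (inv g ` g ` S)"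
  by (rule face_hyperplanes_image_sub[OF isometry_map_inv[OF g] S' H])
 moreover have "inv g ` g ` S = S" using isometry_map_bij[OF g] by (simp add: bij_is_inj image_inv_f_f)
 moreover have "H = g ` (inv g ` H)" using isometry_map_bij[OF g] by (simp add: bij_is_surj image_f_inv_f)
 ultimately show "H \<in> (`) g ` face_hyperplanes S" by auto
qed (use face_hyperplanes_image_sub[OF g S] in auto)

section \<open>Odd functions and tessellations\<close>

text \<open>The copies of a small ball in \<Omega> are disjoint, so their centres are
separated.\<close>

lemma finite_tiles_meeting_ball:
 fixes \<T> :: "'a::euclidean_space set set"
 assumes \<Omega>: "open \<Omega>" "bounded \<Omega>" "\<Omega> \<noteq> {}"
  and \<T>: "\<And>D. D \<in> \<T> ==> \<exists>g. isometry_map g \<and> D = g ` \<Omega>"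
  and disj: "\<And>D E. D \<in> \<T> ==> E \<in> \<T> ==> D \<inter> E \<noteq> {} ==> D = E"
 shows "finite {D \<in> \<T>. D \<inter> cball x r \<noteq> {}}"
proof -
 define \<S> where "\<S> = {D \<in> \<T>. D \<inter> cball x r \<noteq> {}}"
 obtain a \<epsilon> where a: "\<epsilon> > 0" "ball a \<epsilon> \<subseteq> \<Omega>" using \<Omega>(1,3) open_contains_ball by blast
 obtain \<delta> where \<delta>: "\<And>y. y \<in> \<Omega> ==> dist a y \<le> \<delta>" using \<Omega>(2) bounded_any_center by (metis dist_commute)
 have "\<forall>D. \<exists>g. D \<in> \<T> --> isometry_map g \<and> D = g ` \<Omega>" using \<T> by blast
 then obtain g where g: "\<And>D. D \<in> \<T> ==> isometry_map (g D)" "\<And>D. D \<in> \<T> ==> D = g D ` \<Omega>" by metis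
 define c where "c D = g D a" for D
 have sep: "dist (c D) (c E) \<ge> \<epsilon>" if T: "D \<in> \<T>" "E \<in> \<T>" "D \<noteq> E" for D E
 proof (rule ccontr)
  assume n: "\<not> ?thesis"
  obtain y where y: "c E = g D y" using isometry_map_bij[OF g(1)[OF T(1)]] by (metis bij_pointE)
  have "dist a y < \<epsilon>" using n g(1)[OF T(1)] y by (simp add: c_def isometry_map_def)
  hence y\<Omega>: "y \<in> \<Omega>" "a \<in> \<Omega>" using a by auto
  have "c E \<in> g D ` \<Omega>" unfolding y using y\<Omega>(1) by (rule imageI)
  moreover have "c E \<in> g E ` \<Omega>" unfolding c_def using y\<Omega>(2) by (rule imageI)
  ultimately have "c E \<in> D" "c E \<in> E" by (simp_all only: g(2)[OF T(1), symmetric] g(2)[OF T(2), symmetric])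
  thus False using disj T by blast
 qed
 have "finite (c ` \<S>)"
 proof (rule finite_if_separated[OF _ a(1)])
  show "bounded (c ` \<S>)"
  proof (rule bounded_subset[of "cball x (r + \<delta>)"])
   show "c ` \<S> \<subseteq> cball x (r + \<delta>)"
   proof
    fix z assume "z \<in> c ` \<S>"
    then obtain D where D: "D \<in> \<T>" "D \<inter> cball x r \<noteq> {}" "z = c D" by (auto simp: \<S>_def)
    have "g D ` \<Omega> \<inter> cball x r \<noteq> {}" using D(2) by (subst g(2)[OF D(1), symmetric])
    then obtain y where y: "g D y \<in> cball x r" "y \<in> \<Omega>" by blast
    have "dist z (g D y) \<le> \<delta>" using \<delta>[OF y(2)] g(1)[OF D(1)] by (simp add: D(3) c_def isometry_map_def)
    thus "z \<in> cball x (r + \<delta>)" using y(1) dist_triangle[of x z "g D y"] by (simp add: dist_commute)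
   qed
  qed simp
  show "dist y z \<ge> \<epsilon>" if "y \<in> c ` \<S>" "z \<in> c ` \<S>" "y \<noteq> z" for y z
   using that sep by (auto simp: \<S>_def)
 qed
 moreover have "inj_on c \<S>"
 proof (rule inj_onI)
  fix D E assume "D \<in> \<S>" "E \<in> \<S>" "c D = c E"
  thus "D = E" using sep[of D E] a(1) by (force simp: \<S>_def)
 qed
 ultimately show ?thesis unfolding \<S>_def[symmetric] by (rule finite_imageD)
qed

lemma open_connected_disjoint_or_equal:
 fixes D E :: "'a::euclidean_space set"
 assumes "connected D" "connected E" "D \<inter> E \<noteq> {}" "D \<inter> frontier E = {}" "E \<inter> frontier D = {}"
 shows "D = E"
proof -
 have "D \<subseteq> E" using connected_Int_frontier[of D E] assms by blast
 moreover have "E \<subseteq> D" using connected_Int_frontier[of E D] assms by blast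
 ultimately show ?thesis by blast
qed

text \<open>Every reflected copy is the image of \<Omega> under an isometry g such that \<open>f
\<circ> g\<close> equals f up to sign at each point. So f has no zero in a copy and vanishes on
its face hyperplanes. It follows that copies are equal or disjoint and that no face hyperplane
enters a copy. To reach a point x with \<open>f x \<noteq> 0\<close>, start with \<Omega>, which
contains a ball of radius \<epsilon> about a, and reflect repeatedly: as long as x is outside the
copy, the segment from the centre \<open>g a\<close> to x meets a face hyperplane. Both ends keep
a distance from it, the centre because of the ball, x by uniform continuity, since f vanishes on
the hyperplane; so the reflection decreases the squared distance from x to the centre by at least
\<open>4 * (\<epsilon> * \<delta>)\<close>. The remaining points are limits of these, and only
finitely many copies are near.\<close>

theorem odd_function_strictly_tessellates:
 fixes \<Omega> :: "'a::euclidean_space set" and f :: "'a => real"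
 assumes \<Omega>: "\<Omega> \<in> wp DIM('a)" and cont: "continuous_on UNIV f"
  and nz: "\<And>x. x \<in> \<Omega> ==> f x \<noteq> 0" and dense: "\<And>x e. e > 0 ==> \<exists>y. dist x y < e \<and> f y \<noteq> 0"
  and odd: "\<And>M b x. {x. M \<bullet> x = b} \<in> face_hyperplanes \<Omega> ==> f (reflection M b x) = - f x"
 shows "strictly_tessellates \<Omega>"
proof -
 note o = wp_open[OF \<Omega>]
 obtain a \<epsilon> where a: "\<epsilon> > 0" "ball a \<epsilon> \<subseteq> \<Omega>" using o(1,4) open_contains_ball by blast
 hence a\<Omega>: "a \<in> \<Omega>" by auto
 define G where "G g \<longleftrightarrow> isometry_map g \<and> (\<forall>x. f (g x) = f x \<or> f (g x) = - f x)" for g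
 have zeroH: "f x = 0" if "{x. M \<bullet> x = b} \<in> face_hyperplanes \<Omega>" "M \<bullet> x = b" for M b x
  using odd[OF that(1), of x] reflection_fixes[OF that(2)] by simp
 have fhM: "\<exists>M b. H = {x. M \<bullet> x = b} \<and> M \<noteq> 0" if "H \<in> face_hyperplanes \<Omega>" for H
  using that unfolding face_hyperplanes_def hyperplane_in_UNIV by blast
 have face: "\<exists>M b. {x. M \<bullet> x = b} \<in> face_hyperplanes \<Omega> \<and> H = g ` {x. M \<bullet> x = b} \<and> M \<noteq> 0"
  if H: "H \<in> face_hyperplanes (g ` \<Omega>)" and gi: "isometry_map g" for g H
 proof -
  obtain H0 where "H0 \<in> face_hyperplanes \<Omega>" "H = g ` H0"
   using H unfolding face_hyperplanes_image[OF gi o(1,4)] by blast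
  thus ?thesis using fhM[of H0] by auto
 qed
 have step: "G (g \<circ> reflection M b) \<and> (g \<circ> reflection M b) ` \<Omega> \<in> reflected_copies \<Omega>"
  if g: "G g" "g ` \<Omega> \<in> reflected_copies \<Omega>" and H: "{x. M \<bullet> x = b} \<in> face_hyperplanes \<Omega>" for g M b
 proof -
  have gi: "isometry_map g" using g by (simp add: G_def)
  obtain L where L: "\<And>M b. g ` {x. M \<bullet> x = b} = {y. L M \<bullet> y = b + L M \<bullet> g 0}"
   "\<And>M b x. g (reflection M b x) = reflection (L M) (b + L M \<bullet> g 0) (g x)"
   by (rule isometry_map_hyperplane[OF gi]) (rule that)
  have "{x. L M \<bullet> x = b + L M \<bullet> g 0} \<in> face_hyperplanes (g ` \<Omega>)"
   unfolding L(1)[symmetric] by (rule face_hyperplanes_image_sub[OF gi o(1,4) H])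
  from reflected_copies.reflect[OF g(2) this] have "(g \<circ> reflection M b) ` \<Omega> \<in> reflected_copies \<Omega>"
   by (simp add: image_image L(2))
  moreover have "f (g (reflection M b x)) = f x \<or> f (g (reflection M b x)) = - f x" for x
   using g(1) odd[OF H, of x] unfolding G_def by (metis minus_minus)
  ultimately show ?thesis using isometry_map_compose[OF gi isometry_reflection] by (simp add: G_def)
 qed
 have copy: "\<exists>g. G g \<and> D = g ` \<Omega>" if "D \<in> reflected_copies \<Omega>" for D
  using that
 proof (induction rule: reflected_copies.induct)
  case start
  show ?case by (rule exI[of _ id]) (simp add: G_def isometry_map_def)
 next
  case (reflect D M b)
  then obtain g where g: "G g" "D = g ` \<Omega>" by blast
  have gi: "isometry_map g" using g by (simp add: G_def)
  obtain L where L: "orthogonal_transformation L" "\<And>M b. g ` {x. M \<bullet> x = b} = {y. L M \<bullet> y = b + L M \<bullet> g 0}"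
   "\<And>M b x. g (reflection M b x) = reflection (L M) (b + L M \<bullet> g 0) (g x)"
   by (rule isometry_map_hyperplane[OF gi]) (rule that)
  obtain M0 b0 where H: "{x. M0 \<bullet> x = b0} \<in> face_hyperplanes \<Omega>" "{x. M \<bullet> x = b} = g ` {x. M0 \<bullet> x = b0}" "M0 \<noteq> 0"
   using face[OF reflect(2)[unfolded g(2)] gi] by blast
  have LM: "L M0 \<noteq> 0" using L(1) H(3) by (metis norm_eq_zero orthogonal_transformation_norm)
  have "reflection M b = reflection (L M0) (b0 + L M0 \<bullet> g 0)"
   using H(2) L(2) face_hyperplane_normal_nonzero[OF reflect(2)] by (intro reflection_cong LM) simp_all
  hence "reflection M b ` D = (g \<circ> reflection M0 b0) ` \<Omega>" by (simp add: g(2) image_image L(3))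
  moreover have "G (g \<circ> reflection M0 b0)" using step[OF g(1) _ H(1)] reflect(1) g(2) by blast
  ultimately show ?case by blast
 qed
 obtain \<P> where "face_decomposition (wp (DIM('a) - 1)) \<Omega> \<P>" using o(5) by blast
 then obtain \<H> where \<H>: "\<H> \<subseteq> face_hyperplanes \<Omega>" "frontier \<Omega> \<subseteq> \<Union>\<H>"
  using face_hyperplanes_cover[OF o(1,4)] by metis
 have frontier_face: "\<exists>M b. {x. M \<bullet> x = b} \<in> face_hyperplanes \<Omega> \<and> M \<bullet> x = b \<and> M \<noteq> 0" if x: "x \<in> frontier \<Omega>" for x
 proof -
  obtain H where "H \<in> face_hyperplanes \<Omega>" "x \<in> H" using x \<H> by blast
  thus ?thesis using fhM[of H] by auto
 qed
 have tile: "open D \<and> connected D \<and> D \<noteq> {} \<and> (\<forall>x\<in>D. f x \<noteq> 0) \<and> (\<forall>x\<in>frontier D. f x = 0) \<and> congruent_sets \<Omega> D"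
  "\<forall>H\<in>face_hyperplanes D. \<forall>x\<in>H. f x = 0"
  if D: "D \<in> reflected_copies \<Omega>" for D
 proof -
  obtain g where g: "G g" "D = g ` \<Omega>" using copy[OF D] by blast
  have gi: "isometry_map g" and gf: "f (g x) = 0 \<longleftrightarrow> f x = 0" for x using g(1)[unfolded G_def] by (auto dest: spec[of _ x])
  have "f (g x) = 0" if "x \<in> frontier \<Omega>" for x using frontier_face[OF that] zeroH gf by blast
  moreover have "congruent_sets \<Omega> D" unfolding congruent_sets_def using gi g(2) isometry_map_def by blast
  ultimately show "open D \<and> connected D \<and> D \<noteq> {} \<and> (\<forall>x\<in>D. f x \<noteq> 0) \<and> (\<forall>x\<in>frontier D. f x = 0) \<and> congruent_sets \<Omega> D"
   unfolding g(2) isometry_map_images(3)[OF gi] using o nz gf isometry_map_images(4,5)[OF gi] by auto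
  show "\<forall>H\<in>face_hyperplanes D. \<forall>x\<in>H. f x = 0"
   using face[OF _ gi] zeroH gf unfolding g(2) by blast
 qed
 have disj: "D = E" if "D \<in> reflected_copies \<Omega>" "E \<in> reflected_copies \<Omega>" "D \<inter> E \<noteq> {}" for D E
  using open_connected_disjoint_or_equal[OF _ _ that(3)] tile(1)[OF that(1)] tile(1)[OF that(2)] by (auto simp: disjoint_iff)
 have covered: "\<exists>D\<in>reflected_copies \<Omega>. x \<in> D" if fx: "f x \<noteq> 0" for x
 proof (rule ccontr)
  assume no: "\<not> ?thesis"
  define R where "R = dist x a"
  define K where "K = cball a (R + 1)"
  have "uniformly_continuous_on K f"
   unfolding K_def by (intro compact_uniformly_continuous continuous_on_subset[OF cont]) auto
  then obtain \<delta>0 where \<delta>0: "\<delta>0 > 0" "\<And>y z. y \<in> K ==> z \<in> K ==> dist z y < \<delta>0 ==> dist (f z) (f y) < \<bar>f x\<bar>"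
   using fx unfolding uniformly_continuous_on_def by (metis zero_less_abs_iff)
  define \<delta> where "\<delta> = min \<delta>0 1"
  have \<delta>: "\<delta> > 0" using \<delta>0 by (simp add: \<delta>_def)
  have reduce: "\<exists>g'. (G g' \<and> g' ` \<Omega> \<in> reflected_copies \<Omega>) \<and> (dist x (g' a))\<^sup>2 \<le> (dist x (g a))\<^sup>2 - 4 * (\<epsilon> * \<delta>)"
   if g: "G g \<and> g ` \<Omega> \<in> reflected_copies \<Omega>" and gR: "dist x (g a) \<le> R" for g
  proof -
   have gi: "isometry_map g" using g by (simp add: G_def)
   obtain y where y: "x = g y" using isometry_map_bij[OF gi] by (metis bij_pointE)
   have fy: "\<bar>f y\<bar> = \<bar>f x\<bar>" using g unfolding y G_def by (metis abs_minus_cancel)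
   have y\<Omega>: "y \<notin> \<Omega>" using no g y by auto
   have dg: "dist x (g z) = dist y z" for z using gi y by (simp add: isometry_map_def)
   have "closed_segment a y \<inter> frontier \<Omega> \<noteq> {}"
    using a\<Omega> y\<Omega> by (intro connected_Int_frontier) auto
   then obtain z M b where z: "z \<in> closed_segment a y" and H: "{x. M \<bullet> x = b} \<in> face_hyperplanes \<Omega>" "M \<bullet> z = b" and M: "M \<noteq> 0"
    using frontier_face by blast
   define s where "s u = (M \<bullet> u - b) / norm M" for u
   define \<nu> where "\<nu> = (1 / norm M) *\<^sub>R M"
   have \<nu>: "norm \<nu> = 1" "\<nu> \<bullet> \<nu> = 1" using M by (auto simp: \<nu>_def dot_square_norm)
   have proj: "f (u - s u *\<^sub>R \<nu>) = 0" for u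
   proof (rule zeroH[OF H(1)])
    have "M \<bullet> \<nu> = norm M" using M by (simp add: \<nu>_def dot_square_norm power2_eq_square)
    thus "M \<bullet> (u - s u *\<^sub>R \<nu>) = b" using M by (simp add: s_def inner_diff_right)
   qed
   have sa: "\<bar>s a\<bar> \<ge> \<epsilon>"
   proof (rule ccontr)
    assume "\<not> ?thesis"
    hence "a - s a *\<^sub>R \<nu> \<in> \<Omega>" using a \<nu> by (auto simp: dist_norm)
    thus False using proj nz by blast
   qed
   have sy: "\<bar>s y\<bar> \<ge> \<delta>"
   proof (rule ccontr)
    assume n: "\<not> ?thesis"
    define y' where "y' = y - s y *\<^sub>R \<nu>"
    have d: "dist y' y = \<bar>s y\<bar>" using \<nu> by (simp add: y'_def dist_norm)
    have "dist a y' \<le> R + 1" using dist_triangle[of a y' y] gR d n by (simp add: dg \<delta>_def dist_commute)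
    hence "y' \<in> K" "y \<in> K" using gR by (auto simp: K_def dg dist_commute)
    hence "dist (f y') (f y) < \<bar>f x\<bar>" using \<delta>0(2) d n by (simp add: \<delta>_def)
    thus False using fy proj by (simp add: y'_def dist_real_def)
   qed
   have opp: "s a * s y \<le> - (\<epsilon> * \<delta>)"
   proof -
    obtain u where u: "0 \<le> u" "u \<le> 1" "z = (1 - u) *\<^sub>R a + u *\<^sub>R y" using z by (auto simp: in_segment)
    have "(1 - u) * (M \<bullet> a - b) + u * (M \<bullet> y - b) = 0" using H(2) by (simp add: u(3) inner_add_right algebra_simps)
    hence e: "(1 - u) * s a + u * s y = 0" using M by (simp add: s_def add_divide_distrib[symmetric])
    have u0: "u \<noteq> 0" using e sa a(1) by auto
    have "u * (s a * s y) = s a * ((1 - u) * s a + u * s y) - (1 - u) * (s a * s a)"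
     by (simp add: algebra_simps)
    also have "... \<le> 0" unfolding e using u by simp
    finally have "s a * s y \<le> 0" using u u0 by (simp add: mult_le_0_iff)
    hence "\<bar>s a\<bar> * \<bar>s y\<bar> = - (s a * s y)" by (simp add: abs_mult[symmetric])
    moreover have "\<epsilon> * \<delta> \<le> \<bar>s a\<bar> * \<bar>s y\<bar>" using sa sy a(1) \<delta> by (intro mult_mono) auto
    ultimately show ?thesis by simp
   qed
   have yr: "y - reflection M b a = (y - a) + (2 * s a) *\<^sub>R \<nu>"
    using M by (simp add: reflection_def s_def \<nu>_def power2_eq_square)
   have "(dist y (reflection M b a))\<^sup>2 = (y - a) \<bullet> (y - a) + 4 * s a * (\<nu> \<bullet> (y - a)) + (2 * s a) * (2 * s a) * (\<nu> \<bullet> \<nu>)"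
    unfolding dist_norm power2_norm_eq_inner yr inner_add_left inner_add_right inner_scaleR_left inner_scaleR_right
     inner_commute[of "y - a" \<nu>] by (simp only: algebra_simps)
   also have "\<nu> \<bullet> (y - a) = s y - s a" by (simp add: s_def \<nu>_def inner_diff_right diff_divide_distrib)
   also have "(y - a) \<bullet> (y - a) = (dist y a)\<^sup>2" unfolding dist_norm power2_norm_eq_inner ..
   finally have "(dist y (reflection M b a))\<^sup>2 = (dist y a)\<^sup>2 + 4 * (s a * s y)" unfolding \<nu>(2) by (simp add: algebra_simps)
   hence "(dist x ((g \<circ> reflection M b) a))\<^sup>2 \<le> (dist x (g a))\<^sup>2 - 4 * (\<epsilon> * \<delta>)" using opp by (simp add: dg mult.commute[of \<delta>])
   thus ?thesis using step[OF _ _ H(1)] g by blast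
  qed
  have "\<exists>g. (G g \<and> g ` \<Omega> \<in> reflected_copies \<Omega>) \<and> (dist x (g a))\<^sup>2 \<le> R\<^sup>2 - real n * (4 * (\<epsilon> * \<delta>))" for n
  proof (induction n)
   case 0
   have "G id" by (auto simp: G_def isometry_map_def)
   moreover have "id ` \<Omega> \<in> reflected_copies \<Omega>" by (simp add: reflected_copies.start)
   moreover have "(dist x (id a))\<^sup>2 \<le> R\<^sup>2 - real 0 * (4 * (\<epsilon> * \<delta>))" by (simp add: R_def)
   ultimately show ?case by blast
  next
   case (Suc n)
   then obtain g where g: "G g \<and> g ` \<Omega> \<in> reflected_copies \<Omega>" "(dist x (g a))\<^sup>2 \<le> R\<^sup>2 - real n * (4 * (\<epsilon> * \<delta>))" by blast
   have "real n * (4 * (\<epsilon> * \<delta>)) \<ge> 0" using a(1) \<delta> by simp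
   hence "(dist x (g a))\<^sup>2 \<le> R\<^sup>2" using g(2) by linarith
   hence "dist x (g a) \<le> R" by (rule power2_le_imp_le) (simp add: R_def)
   from reduce[OF g(1) this] obtain g' where "G g' \<and> g' ` \<Omega> \<in> reflected_copies \<Omega>"
    "(dist x (g' a))\<^sup>2 \<le> (dist x (g a))\<^sup>2 - 4 * (\<epsilon> * \<delta>)" by blast
   thus ?case using g(2) by (intro exI[of _ g']) (auto simp: algebra_simps)
  qed
  moreover obtain n where "real n * (4 * (\<epsilon> * \<delta>)) > R\<^sup>2" using reals_Archimedean3[of "4 * (\<epsilon> * \<delta>)"] a(1) \<delta> by auto
  ultimately show False by (smt (verit) zero_le_power2)
 qed
 have cover: "\<exists>D\<in>reflected_copies \<Omega>. x \<in> closure D" for x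
 proof (rule ccontr)
  assume no: "\<not> ?thesis"
  define \<F> where "\<F> = {D \<in> reflected_copies \<Omega>. D \<inter> cball x 1 \<noteq> {}}"
  have "finite \<F>" unfolding \<F>_def
   by (rule finite_tiles_meeting_ball[OF o(1,3,4) _ disj]) (use copy in "unfold G_def, blast")
  hence "open (- (\<Union>D\<in>\<F>. closure D))" by (intro open_Compl closed_UN) auto
  moreover have "x \<in> - (\<Union>D\<in>\<F>. closure D)" using no by (auto simp: \<F>_def)
  ultimately obtain e where e: "e > 0" "ball x e \<subseteq> - (\<Union>D\<in>\<F>. closure D)" by (meson open_contains_ball)
  obtain y where y: "dist x y < min e 1" "f y \<noteq> 0" using dense[of "min e 1" x] e(1) by auto
  obtain D where D: "D \<in> reflected_copies \<Omega>" "y \<in> D" using covered[OF y(2)] by blast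
  have "D \<in> \<F>" using D y(1) by (auto simp: \<F>_def)
  moreover have "y \<in> closure D" using D(2) closure_subset by blast
  ultimately show False using e(2) y(1) by auto
 qed
 have cnt: "countable (reflected_copies \<Omega>)"
  by (rule countable_disjoint_open_subsets) (use tile(1) in blast, unfold pairwise_def disjnt_def, use disj in blast)
 have ne: "reflected_copies \<Omega> \<noteq> {}" using reflected_copies.start by blast
 define E where "E = from_nat_into (reflected_copies \<Omega>) \<circ> nat"
 have rE: "range E = reflected_copies \<Omega>"
  unfolding E_def image_comp[symmetric] surjI[of nat int, simplified] by (rule range_from_nat_into[OF ne cnt])
 have Ej: "E j \<in> reflected_copies \<Omega>" for j using rE by blast
 show ?thesis
  unfolding strictly_tessellates_def
 proof (intro exI[of _ E] conjI allI ballI)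
  show "(\<Union>j. closure (E j)) = UNIV"
  proof -
   have "x \<in> (\<Union>D\<in>range E. closure D)" for x using cover unfolding rE by blast
   thus ?thesis by blast
  qed
  show "congruent_sets \<Omega> (E j)" for j using tile(1)[OF Ej] by blast
  show "H \<inter> interior (E k) = {}" if "H \<in> face_hyperplanes (E j)" for j k H
   using tile(2)[OF Ej] tile(1)[OF Ej[of k]] that interior_subset by blast
 qed (rule rE)
qed

section \<open>First eigenfunctions of polytopes\<close>

lemma normalize_hyperplane:
 fixes M :: "'a::euclidean_space"
 assumes "M \<noteq> 0"
 shows "norm ((1 / norm M) *\<^sub>R M) = 1" "{x. M \<bullet> x = b} = {x. ((1 / norm M) *\<^sub>R M) \<bullet> x = b / norm M}"
 using assms by (auto simp: divide_simps)

text \<open>The eigenvalue of u is at most that of the nonnegative eigenfunction \<phi>, so the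
comparison with \<phi> applies to u or to \<open>- u\<close>.\<close>

lemma first_eigenfunction_nonzero:
 fixes \<Omega> :: "(real^'n) set"
 assumes \<Omega>: "\<Omega> \<in> wp CARD('n)" and u: "first_eigenfunction \<Omega> u" and x: "x \<in> \<Omega>"
 shows "u x \<noteq> 0"
proof -
 have \<Omega>': "\<Omega> \<in> wp DIM(real^'n)" using \<Omega> by simp
 note o = wp_open[OF \<Omega>']
 obtain \<P> where P: "face_decomposition (wp (DIM(real^'n) - 1)) \<Omega> \<P>" using o(5) by blast
 obtain \<H> where \<H>: "finite \<H>" "\<H> \<subseteq> face_hyperplanes \<Omega>" "frontier \<Omega> \<subseteq> \<Union>\<H>"
  by (rule face_hyperplanes_cover[OF o(1,4) P])
 have "\<forall>H. \<exists>m b. H \<in> \<H> --> norm m = 1 \<and> H = {x. m \<bullet> x = b}"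
 proof
  fix H
  show "\<exists>m b. H \<in> \<H> --> norm m = 1 \<and> H = {x. m \<bullet> x = b}"
  proof (cases "H \<in> \<H>")
   case True
   then obtain M b where M: "M \<noteq> 0" "H = {x. M \<bullet> x = b}"
    using \<H>(2) unfolding face_hyperplanes_def hyperplane_in_UNIV by blast
   thus ?thesis using normalize_hyperplane[OF M(1)] by blast
  qed blast
 qed
 then obtain m b where mb: "\<And>H. H \<in> \<H> ==> norm (m H) = 1 \<and> H = {x. m H \<bullet> x = b H}"
  by (metis (no_types))
 define F where "F = (\<lambda>H. (m H, b H)) ` \<H>"
 have F: "finite F" "\<And>m b. (m, b) \<in> F ==> norm m = 1" using \<H>(1) mb by (auto simp: F_def)
 have fr: "frontier \<Omega> \<subseteq> (\<Union>(m, b)\<in>F. {x. m \<bullet> x = b})"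
 proof
  fix z assume "z \<in> frontier \<Omega>"
  then obtain H where H: "H \<in> \<H>" "z \<in> H" using \<H>(3) by blast
  hence "m H \<bullet> z = b H" using mb by blast
  thus "z \<in> (\<Union>(m, b)\<in>F. {x. m \<bullet> x = b})" using H(1) by (auto simp: F_def)
 qed
 obtain \<phi> p q \<theta> where \<phi>: "continuous_on (closure \<Omega>) \<phi>" "C2_with \<Omega> \<phi> p q" "\<And>i. continuous_on \<Omega> (q i)"
  "\<And>x. x \<in> \<Omega> ==> (\<Sum>i\<in>UNIV. q i x $ i) = - \<theta> * \<phi> x"
  "\<And>x. x \<in> frontier \<Omega> ==> \<phi> x = 0" "\<And>x. x \<in> \<Omega> ==> \<phi> x \<ge> 0" "\<exists>x\<in>\<Omega>. \<phi> x > 0"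
  by (rule positive_eigenfunction_exists[OF o(1,3,4) polytope_flat_cone_condition[OF \<Omega>]], assumption, rule that)
 obtain x1 where x1: "x1 \<in> \<Omega>" "\<phi> x1 > 0" using \<phi>(7) by blast
 obtain \<mu> where \<mu>: "dirichlet_eigenfunction \<Omega> \<mu> u"
  "\<And>\<nu> v. dirichlet_eigenfunction \<Omega> \<nu> v ==> \<mu> \<le> \<nu>" using u unfolding first_eigenfunction_def by blast
 have "dirichlet_eigenfunction \<Omega> \<theta> \<phi>"
  unfolding dirichlet_eigenfunction_def
  using \<phi>(1,4,5) bexI[of "\<lambda>x. \<phi> x \<noteq> 0" x1 \<Omega>] x1 C2_with_imp_C2_on[OF \<phi>(2,3)] laplacian_C2_with[OF o(1) \<phi>(2)] by auto
 hence le: "\<mu> \<le> \<theta>" by (rule \<mu>(2))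
 have uf: "continuous_on (closure \<Omega>) u" "C2_on \<Omega> u" "\<exists>x\<in>\<Omega>. u x \<noteq> 0" "\<And>x. x \<in> frontier \<Omega> ==> u x = 0"
  "\<And>x. x \<in> \<Omega> ==> laplacian u x = \<mu> * u x"
  using \<mu>(1) unfolding dirichlet_eigenfunction_def by auto
 obtain p' q' where C: "C2_with \<Omega> u p' q'" using C2_on_imp_C2_with[OF uf(2)] .
 have eig: "(\<Sum>i\<in>UNIV. q' i x $ i) = - \<mu> * u x" if "x \<in> \<Omega>" for x
  using uf(5)[OF that] laplacian_C2_with[OF o(1) C that] by simp
 obtain x0 where x0: "x0 \<in> \<Omega>" "u x0 \<noteq> 0" using uf(3) by blast
 have pos: "v x > 0" if v: "continuous_on (closure \<Omega>) v" "C2_with \<Omega> v p' q'"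
  "\<And>x. x \<in> \<Omega> ==> (\<Sum>i\<in>UNIV. q' i x $ i) = - \<mu> * v x"
  "\<And>x. x \<in> frontier \<Omega> ==> v x = 0" "v x0 > 0" for v p' q'
  by (rule eigenfunction_positive_if_le[where F = F and \<phi> = \<phi> and p = p and q = q and \<theta> = \<theta> and \<mu> = \<mu> and S = \<Omega>
     and u = v and p' = p' and q' = q'])
   (fact o F fr \<phi> x1 v x0 le x)+
 show ?thesis
 proof (cases "u x0 > 0")
  case True
  show ?thesis using pos[OF uf(1) C eig uf(4) True] by simp
 next
  case False
  have C': "C2_with \<Omega> (\<lambda>x. - u x) (\<lambda>x. - p' x) (\<lambda>i x. - q' i x)"
   using C2_with_lincomb[OF C C, of "-1" 0] by simp
  have c': "continuous_on (closure \<Omega>) (\<lambda>x. - u x)" using uf(1) by (rule continuous_on_minus)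
  have eig': "(\<Sum>i\<in>UNIV. (- q' i x) $ i) = - \<mu> * - u x" if "x \<in> \<Omega>" for x
   using eig[OF that] by (simp add: sum_negf)
  have "- u x > 0"
   by (rule pos[OF c' C' eig']) (use uf(4) False x0 in auto)
  thus ?thesis by simp
 qed
qed

theorem strictly_tessellates_if_analytic:
 fixes \<Omega> :: "(real^'n) set"
 assumes \<Omega>: "\<Omega> \<in> wp CARD('n)" and fe: "first_eigenfunction_extends_analytically \<Omega>"
 shows "strictly_tessellates \<Omega>"
proof -
 have \<Omega>': "\<Omega> \<in> wp DIM(real^'n)" using \<Omega> by simp
 note o = wp_open[OF \<Omega>']
 obtain u f where u: "first_eigenfunction \<Omega> u" and f: "real_analytic_on UNIV f" and fu: "\<And>x. x \<in> closure \<Omega> ==> f x = u x"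
  using fe unfolding first_eigenfunction_extends_analytically_def by blast
 have fu': "f x = u x" if "x \<in> \<Omega>" for x using fu closure_subset that by blast
 have nz: "f x \<noteq> 0" if "x \<in> \<Omega>" for x
  using first_eigenfunction_nonzero[OF \<Omega> u that] fu'[OF that] by simp
 obtain \<mu> where \<mu>: "dirichlet_eigenfunction \<Omega> \<mu> u" using u unfolding first_eigenfunction_def by blast
 obtain p q where C: "C2_with \<Omega> u p q"
  using \<mu> C2_on_imp_C2_with unfolding dirichlet_eigenfunction_def by metis
 have eig: "(\<Sum>i\<in>UNIV. q i x $ i) = - \<mu> * u x" if "x \<in> \<Omega>" for x
  using \<mu> that laplacian_C2_with[OF o(1) C that] unfolding dirichlet_eigenfunction_def by force
 have lap: "lap f x = - \<mu> * f x" for x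
  by (rule analytic_eigenfunction_extends[OF o(1,4) f C fu' eig])
 have fr: "f x = 0" if "x \<in> frontier \<Omega>" for x
  using fu[of x] that \<mu> unfolding dirichlet_eigenfunction_def frontier_def by auto
 show ?thesis
 proof (rule odd_function_strictly_tessellates[OF \<Omega>' _ nz])
  show "continuous_on UNIV f" by (rule analytic_continuous_on[OF f])
  show "\<exists>y. dist x y < e \<and> f y \<noteq> 0" if e: "e > 0" for x e
  proof (rule ccontr)
   assume n: "\<not> ?thesis"
   have "f y = 0" for y
    by (rule analytic_zero_if_zero_on_open[OF f, of "ball x e"]) (use e n in auto)
   thus False using nz o(4) by blast
  qed
  fix M b x assume H: "{x. M \<bullet> x = b} \<in> face_hyperplanes \<Omega>"
  obtain M' b' p e where M': "M' \<noteq> 0" "{x. M \<bullet> x = b} = {x. M' \<bullet> x = b'}" "p \<in> {x. M \<bullet> x = b}" "e > 0"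
   "ball p e \<inter> {x. M \<bullet> x = b} \<subseteq> frontier \<Omega>"
   by (rule face_hyperplane_touches[OF o(1,4) H])
  have M: "M \<noteq> 0" by (rule face_hyperplane_normal_nonzero[OF H])
  have "f y = 0" if "M \<bullet> y = b" for y
  proof (rule analytic_zero_on_hyperplane[OF f _ M'(4) _ that])
   show "M \<bullet> p = b" using M'(3) by simp
   show "f y = 0" if "dist p y < e" "M \<bullet> y = b" for y
    by (rule fr) (use that M'(5) in auto)
  qed
  thus "f (reflection M b x) = - f x" by (rule analytic_eigenfunction_odd[OF f lap M])
 qed simp_all
qed

section \<open>Positive and simple roots\<close>

lemma root_systemD:
 assumes "root_system R"
 shows "finite R" "0 \<notin> R" "span R = UNIV" "\<And>v. v \<in> R ==> - v \<in> R"
  "\<And>u v. u \<in> R ==> v \<in> R ==> reflection u 0 v \<in> R"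
  "\<And>u v. u \<in> R ==> v \<in> R ==> 2 * (u \<bullet> v) / (u \<bullet> u) \<in> \<int>"
  "\<And>c v. v \<in> R ==> c *\<^sub>R v \<in> R ==> c = 1 \<or> c = - 1"
proof -
 have r: "finite R" "0 \<notin> R" "span R = UNIV" "\<And>v. v \<in> R ==> {c *\<^sub>R v |c. True} \<inter> R = {v, - v}"
  "\<And>u v. u \<in> R ==> v \<in> R ==> v - (2 * (u \<bullet> v) / (norm u)\<^sup>2) *\<^sub>R u \<in> R"
  "\<And>u v. u \<in> R ==> v \<in> R ==> 2 * (u \<bullet> v) / (norm v)\<^sup>2 \<in> \<int>"
  using assms unfolding root_system_def by blast+
 show "finite R" "0 \<notin> R" "span R = UNIV" by fact+
 show "- v \<in> R" if "v \<in> R" for v using r(4)[OF that] by blast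
 show "reflection u 0 v \<in> R" if "u \<in> R" "v \<in> R" for u v using r(5)[OF that] by (simp add: reflection_def)
 show "2 * (u \<bullet> v) / (u \<bullet> u) \<in> \<int>" if "u \<in> R" "v \<in> R" for u v
  using r(6)[OF that(2,1)] by (simp add: power2_norm_eq_inner inner_commute)
 show "c = 1 \<or> c = - 1" if v: "v \<in> R" "c *\<^sub>R v \<in> R" for c v
 proof -
  have "c *\<^sub>R v \<in> {v, - v}" using r(4)[OF v(1)] v(2) by blast
  hence "(c - 1) *\<^sub>R v = 0 \<or> (c + 1) *\<^sub>R v = 0" by (auto simp: algebra_simps)
  thus ?thesis using r(2) v(1) by auto
 qed
qed

text \<open>The integers m and n are positive, and their product is less than 4 by the
Cauchy-Schwarz inequality; so one of them is 1.\<close>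

lemma acute_roots:
 assumes R: "root_system R" and u: "u \<in> R" and v: "v \<in> R" and ne: "u \<noteq> v" and pos: "u \<bullet> v > 0"
 shows "reflection v 0 u = u - v \<or> reflection u 0 v = v - u" "u - v \<in> R"
proof -
 note r = root_systemD[OF R]
 have uv: "u \<bullet> u > 0" "v \<bullet> v > 0" using u v r(2) by (metis inner_gt_zero_iff)+
 obtain m n where mn: "2 * (u \<bullet> v) / (u \<bullet> u) = of_int m" "2 * (v \<bullet> u) / (v \<bullet> v) = of_int n"
  using r(6)[OF u v] r(6)[OF v u] by (metis Ints_cases)
 have "0 < (of_int m :: real)" "0 < (of_int n :: real)" unfolding mn[symmetric] using pos uv by (auto simp: inner_commute)
 hence p: "m > 0" "n > 0" by auto
 have strict: "u \<bullet> v < norm u * norm v"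
 proof (rule ccontr)
  assume "\<not> ?thesis"
  hence "u \<bullet> v = norm u * norm v" using norm_cauchy_schwarz[of u v] by linarith
  hence e: "norm u *\<^sub>R v = norm v *\<^sub>R u" by (simp add: norm_cauchy_schwarz_eq)
  have nu: "norm u > 0" "norm v > 0" using uv by auto
  have v': "v = (norm v / norm u) *\<^sub>R u"
  proof -
   have "v = (1 / norm u) *\<^sub>R (norm u *\<^sub>R v)" using nu by simp
   thus ?thesis unfolding e by simp
  qed
  hence "norm v / norm u = 1 \<or> norm v / norm u = -1" using r(7)[OF u] v by metis
  moreover have "norm v / norm u > 0" using nu by simp
  ultimately have "norm v / norm u = 1" by linarith
  thus False using v' ne by (metis scaleR_one)
 qed
 have "of_int m * (of_int n :: real) = 4 * (u \<bullet> v)\<^sup>2 / ((u \<bullet> u) * (v \<bullet> v))"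
  unfolding mn[symmetric] by (simp add: inner_commute power2_eq_square)
 also have "... < 4"
 proof -
  have "(u \<bullet> v)\<^sup>2 < (norm u * norm v)\<^sup>2" using strict pos by (intro power_strict_mono) auto
  hence "(u \<bullet> v)\<^sup>2 < (u \<bullet> u) * (v \<bullet> v)" by (simp add: power_mult_distrib power2_norm_eq_inner)
  thus ?thesis using uv by (simp add: divide_less_eq)
 qed
 finally have mn4: "m * n < 4" by (metis of_int_less_numeral_iff of_int_mult)
 have "m = 1 \<or> n = 1"
 proof (rule ccontr)
  assume "\<not> ?thesis"
  hence "2 * 2 \<le> m * n" using p by (intro mult_mono) auto
  thus False using mn4 by simp
 qed
 thus *: "reflection v 0 u = u - v \<or> reflection u 0 v = v - u"
  using mn by (auto simp: reflection_def power2_norm_eq_inner)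
 hence "u - v \<in> R \<or> v - u \<in> R" using r(5)[OF u v] r(5)[OF v u] by metis
 thus "u - v \<in> R" using r(4)[of "v - u"] by auto
qed

definition positive_roots :: "'a::euclidean_space => 'a set => 'a set" where
 "positive_roots \<phi> R = {v \<in> R. \<phi> \<bullet> v > 0}"

definition simple_roots :: "'a::euclidean_space => 'a set => 'a set" where
 "simple_roots \<phi> R = positive_roots \<phi> R - {x + y |x y. x \<in> positive_roots \<phi> R \<and> y \<in> positive_roots \<phi> R}"

definition generic_for :: "'a::euclidean_space => 'a set => bool" where
 "generic_for \<phi> R \<longleftrightarrow> (\<forall>v\<in>R. \<phi> \<bullet> v \<noteq> 0)"

lemma ex_generic:
 fixes R :: "'a::euclidean_space set"
 assumes "finite R" "0 \<notin> R"
 obtains \<phi> where "generic_for \<phi> R"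
proof -
 have "negligible (\<Union>v\<in>R. {x. v \<bullet> x = 0})"
  using assms by (intro negligible_Union) (auto intro!: negligible_hyperplane)
 hence "(\<Union>v\<in>R. {x. v \<bullet> x = 0}) \<noteq> UNIV" using non_negligible_UNIV by metis
 then obtain \<phi> where "\<phi> \<notin> (\<Union>v\<in>R. {x. v \<bullet> x = 0})" by blast
 thus ?thesis by (intro that[of \<phi>]) (auto simp: generic_for_def inner_commute)
qed

text \<open>A positive root that is not simple is the sum of two positive roots with smaller value
of \<phi>.\<close>

lemma positive_root_induct [consumes 2, case_names simple add]:
 assumes "root_system R" and v: "v \<in> positive_roots \<phi> R"
  and s: "\<And>v. v \<in> simple_roots \<phi> R ==> P v"
  and a: "\<And>x y. x \<in> positive_roots \<phi> R ==> y \<in> positive_roots \<phi> R ==> x + y \<in> positive_roots \<phi> R ==>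
   P x ==> P y ==> P (x + y)"
 shows "P v"
 using v
proof (induction "card {w \<in> R. \<phi> \<bullet> w < \<phi> \<bullet> v}" arbitrary: v rule: less_induct)
 case less
 show ?case
 proof (cases "v \<in> simple_roots \<phi> R")
  case False
  then obtain x y where xy: "v = x + y" "x \<in> positive_roots \<phi> R" "y \<in> positive_roots \<phi> R"
   using less.prems unfolding simple_roots_def by blast
  have sm: "\<phi> \<bullet> x < \<phi> \<bullet> v" "\<phi> \<bullet> y < \<phi> \<bullet> v" and R: "x \<in> R" "y \<in> R"
   using xy by (auto simp: positive_roots_def inner_add_right)
  have "card {w \<in> R. \<phi> \<bullet> w < \<phi> \<bullet> z} < card {w \<in> R. \<phi> \<bullet> w < \<phi> \<bullet> v}" if "z \<in> R" "\<phi> \<bullet> z < \<phi> \<bullet> v" for z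
  proof (rule psubset_card_mono)
   show "finite {w \<in> R. \<phi> \<bullet> w < \<phi> \<bullet> v}" using root_systemD(1)[OF assms(1)] by simp
   show "{w \<in> R. \<phi> \<bullet> w < \<phi> \<bullet> z} \<subset> {w \<in> R. \<phi> \<bullet> w < \<phi> \<bullet> v}" using that by auto
  qed
  hence "P x" "P y" using less.hyps xy(2,3) sm R by blast+
  thus ?thesis unfolding xy(1) using a xy less.prems by blast
 qed (rule s)
qed

text \<open>Otherwise \<open>a - b\<close> is a root, and one of a and b is the sum of the other
one and a positive root.\<close>

lemma simple_roots_obtuse:
 assumes R: "root_system R" and g: "generic_for \<phi> R"
  and a: "a \<in> simple_roots \<phi> R" and b: "b \<in> simple_roots \<phi> R" and ne: "a \<noteq> b"
 shows "a \<bullet> b \<le> 0"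
proof (rule ccontr)
 assume n: "\<not> a \<bullet> b \<le> 0"
 have ab: "a \<in> positive_roots \<phi> R" "b \<in> positive_roots \<phi> R" using a b by (auto simp: simple_roots_def)
 hence d: "a - b \<in> R" using acute_roots(2)[OF R _ _ ne] n by (auto simp: positive_roots_def)
 have sum_notin: "x + y \<notin> simple_roots \<phi> R" if "x \<in> positive_roots \<phi> R" "y \<in> positive_roots \<phi> R" for x y
  using that unfolding simple_roots_def by blast
 have "a - b \<in> positive_roots \<phi> R \<or> b - a \<in> positive_roots \<phi> R"
  using d root_systemD(4)[OF R d] g by (auto simp: positive_roots_def generic_for_def inner_diff_right)
 thus False
 proof
  assume "a - b \<in> positive_roots \<phi> R"
  hence "a \<notin> simple_roots \<phi> R" using ab sum_notin[of "a - b" b] by simp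
  thus False using a by simp
 next
  assume "b - a \<in> positive_roots \<phi> R"
  hence "b \<notin> simple_roots \<phi> R" using ab sum_notin[of "b - a" a] by simp
  thus False using b by simp
 qed
qed

text \<open>In a linear relation separate the positive coefficients from the negative ones. The
two parts represent the same vector x, and \<open>x \<bullet> x \<le> 0\<close> because the
vectors are obtuse; then \<open>\<phi> \<bullet> x = 0\<close> forces all coefficients to
vanish.\<close>

lemma obtuse_half_space_independent:
 fixes S :: "'a::euclidean_space set"
 assumes fin: "finite S" and pos: "\<And>v. v \<in> S ==> \<phi> \<bullet> v > 0"
  and obt: "\<And>v w. v \<in> S ==> w \<in> S ==> v \<noteq> w ==> v \<bullet> w \<le> 0"
 shows "independent S"
proof (rule independent_if_scalars_zero[OF fin])
 fix u :: "'a => real" and v0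
 assume z: "(\<Sum>v\<in>S. u v *\<^sub>R v) = 0" and v0: "v0 \<in> S"
 define x where "x = (\<Sum>v\<in>S. max (u v) 0 *\<^sub>R v)"
 have x': "x = (\<Sum>v\<in>S. max (- u v) 0 *\<^sub>R v)"
 proof -
  have "x - (\<Sum>v\<in>S. max (- u v) 0 *\<^sub>R v) = (\<Sum>v\<in>S. u v *\<^sub>R v)"
   unfolding x_def sum_subtractf[symmetric] by (intro sum.cong) (auto simp: max_def simp flip: scaleR_left_diff_distrib)
  thus ?thesis using z by simp
 qed
 have "x \<bullet> x = (\<Sum>v\<in>S. max (u v) 0 *\<^sub>R v) \<bullet> (\<Sum>w\<in>S. max (- u w) 0 *\<^sub>R w)"
  unfolding x'[symmetric] x_def[symmetric] ..
 also have "... = (\<Sum>v\<in>S. \<Sum>w\<in>S. (max (u v) 0 * max (- u w) 0) * (v \<bullet> w))"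
  by (subst inner_sum_left, rule sum.cong, simp, subst inner_sum_right, simp add: ac_simps)
 also have "... \<le> 0"
 proof (intro sum_nonpos)
  fix v w assume vw: "v \<in> S" "w \<in> S"
  show "(max (u v) 0 * max (- u w) 0) * (v \<bullet> w) \<le> 0"
  proof (cases "v = w")
   case True thus ?thesis by (simp add: max_def)
  next
   case False
   thus ?thesis using obt[OF vw] by (intro mult_nonneg_nonpos) auto
  qed
 qed
 finally have "x \<bullet> x \<le> 0" .
 hence "\<phi> \<bullet> x = 0" by (metis inner_ge_zero inner_eq_zero_iff antisym inner_zero_right)
 moreover have "\<phi> \<bullet> x = (\<Sum>v\<in>S. max (u v) 0 * (\<phi> \<bullet> v))" by (simp add: x_def inner_sum_right)
 moreover have "\<phi> \<bullet> x = (\<Sum>v\<in>S. max (- u v) 0 * (\<phi> \<bullet> v))" by (simp add: x' inner_sum_right)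
 ultimately have "(\<Sum>v\<in>S. max (u v) 0 * (\<phi> \<bullet> v)) = 0" "(\<Sum>v\<in>S. max (- u v) 0 * (\<phi> \<bullet> v)) = 0" by simp_all
 hence "max (u v0) 0 * (\<phi> \<bullet> v0) = 0" "max (- u v0) 0 * (\<phi> \<bullet> v0) = 0"
  using v0 pos fin by (auto simp: sum_nonneg_eq_0_iff less_imp_le)
 thus "u v0 = 0" using pos[OF v0] by (auto simp: max_def split: if_splits)
qed

text \<open>A positive root is a multiple \<open>c \<ge> 0\<close> of a plus a combination y of
other simple roots, and \<open>y \<bullet> a \<le> 0\<close>. If the reflection made v negative,
both v and the negative of its image would have this form, and their parts z and y would add up to
a multiple of a, which is possible only if \<open>z = 0\<close> and v is a multiple of a.\<close>

lemma simple_reflection_positive: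
 assumes R: "root_system R" and g: "generic_for \<phi> R" and a: "a \<in> simple_roots \<phi> R"
  and v: "v \<in> positive_roots \<phi> R" and ne: "v \<noteq> a"
 shows "reflection a 0 v \<in> positive_roots \<phi> R - {a}"
proof -
 note r = root_systemD[OF R]
 have ap: "a \<in> R" "\<phi> \<bullet> a > 0" using a by (auto simp: simple_roots_def positive_roots_def)
 have decomp: "\<exists>c y. w = c *\<^sub>R a + y \<and> c \<ge> 0 \<and> y \<bullet> a \<le> 0 \<and> (y = 0 \<or> \<phi> \<bullet> y > 0)"
  if "w \<in> positive_roots \<phi> R" for w
  using R that
 proof (induction rule: positive_root_induct)
  case (simple w)
  show ?case
  proof (cases "w = a")
   case True
   thus ?thesis by (intro exI[of _ 1] exI[of _ 0]) simp
  next
   case False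
   thus ?thesis using simple simple_roots_obtuse[OF R g simple a]
    by (intro exI[of _ 0] exI[of _ w]) (auto simp: simple_roots_def positive_roots_def)
  qed
 next
  case (add x y)
  then obtain c1 y1 c2 y2 where "x = c1 *\<^sub>R a + y1" "c1 \<ge> 0" "y1 \<bullet> a \<le> 0" "y1 = 0 \<or> \<phi> \<bullet> y1 > 0"
   "y = c2 *\<^sub>R a + y2" "c2 \<ge> 0" "y2 \<bullet> a \<le> 0" "y2 = 0 \<or> \<phi> \<bullet> y2 > 0" by blast
  thus ?case
   by (intro exI[of _ "c1 + c2"] exI[of _ "y1 + y2"]) (auto simp: algebra_simps inner_add_left inner_add_right)
 qed
 define n where "n = 2 * (a \<bullet> v) / (norm a)\<^sup>2"
 have s: "reflection a 0 v = v - n *\<^sub>R a" by (simp add: reflection_def n_def)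
 have vR: "v \<in> R" using v by (simp add: positive_roots_def)
 have sR: "reflection a 0 v \<in> R" by (rule r(5)[OF ap(1) vR])
 have "\<phi> \<bullet> reflection a 0 v > 0"
 proof (rule ccontr)
  assume "\<not> ?thesis"
  hence "- reflection a 0 v \<in> positive_roots \<phi> R"
   using g sR r(4)[OF sR] by (force simp: positive_roots_def generic_for_def)
  from decomp[OF this] decomp[OF v] obtain c y d z where
   e: "- reflection a 0 v = c *\<^sub>R a + y" "y \<bullet> a \<le> 0" "y = 0 \<or> \<phi> \<bullet> y > 0"
     "v = d *\<^sub>R a + z" "d \<ge> 0" "z \<bullet> a \<le> 0" "z = 0 \<or> \<phi> \<bullet> z > 0" by blast
  have yz: "y + z = (n - c - d) *\<^sub>R a"
   using e(1,4) unfolding s by (simp add: algebra_simps)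
  have "z = 0"
  proof (rule ccontr)
   assume "z \<noteq> 0"
   hence "\<phi> \<bullet> (y + z) > 0" using e(3,7) by (auto simp: inner_add_right)
   hence "n - c - d > 0" using ap(2) unfolding yz by (simp add: zero_less_mult_iff)
   moreover have "a \<bullet> a > 0" using ap r(2) by auto
   ultimately have "(y + z) \<bullet> a > 0" unfolding yz by simp
   thus False using e(2,6) by (simp add: inner_add_left)
  qed
  hence "v = d *\<^sub>R a" using e(4) by simp
  thus False using r(7)[OF ap(1), of d] vR ne e(5) by auto
 qed
 moreover have "reflection a 0 v \<noteq> a"
 proof
  assume "reflection a 0 v = a"
  hence "v = (1 + n) *\<^sub>R a" unfolding s by (simp add: algebra_simps)
  hence "v = a \<or> v = - a" using r(7)[OF ap(1), of "1 + n"] vR by (metis scaleR_one scaleR_minus1_left)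
  thus False using ne v ap(2) by (auto simp: positive_roots_def)
 qed
 ultimately show ?thesis using sR by (simp add: positive_roots_def)
qed

section \<open>Arrangements that are invariant under reflections\<close>

text \<open>The step \<delta> is the smallest distance of another point of B from b0; two
reflections compose to a translation by \<open>2 * \<delta>\<close>.\<close>

lemma reflection_closed_progression:
 fixes B :: "real set"
 assumes fin: "\<And>r. finite (B \<inter> {-r..r})" and cl: "\<And>b b'. b \<in> B ==> b' \<in> B ==> 2 * b - b' \<in> B"
  and two: "b0 \<in> B" "b1 \<in> B" "b1 \<noteq> b0"
 obtains c \<delta> where "\<delta> > 0" "B = {c + of_int k * \<delta> |k. True}"
proof -
 define D where "D = {\<bar>b - b0\<bar> |b. b \<in> B \<and> b \<noteq> b0 \<and> \<bar>b - b0\<bar> \<le> \<bar>b1 - b0\<bar>}"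
 have D: "finite D" "D \<noteq> {}"
 proof -
  have "D \<subseteq> (\<lambda>b. \<bar>b - b0\<bar>) ` (B \<inter> {-(\<bar>b0\<bar> + \<bar>b1 - b0\<bar>)..\<bar>b0\<bar> + \<bar>b1 - b0\<bar>})"
  proof
   fix d assume "d \<in> D"
   then obtain b where "b \<in> B" "\<bar>b - b0\<bar> \<le> \<bar>b1 - b0\<bar>" "d = \<bar>b - b0\<bar>" by (auto simp: D_def)
   hence "b \<in> B \<inter> {-(\<bar>b0\<bar> + \<bar>b1 - b0\<bar>)..\<bar>b0\<bar> + \<bar>b1 - b0\<bar>}" "d = \<bar>b - b0\<bar>" by auto
   thus "d \<in> (\<lambda>b. \<bar>b - b0\<bar>) ` (B \<inter> {-(\<bar>b0\<bar> + \<bar>b1 - b0\<bar>)..\<bar>b0\<bar> + \<bar>b1 - b0\<bar>})" by blast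
  qed
  thus "finite D" using fin finite_surj by blast
  show "D \<noteq> {}" using two by (auto simp: D_def)
 qed
 define \<delta> where "\<delta> = Min D"
 have "\<delta> \<in> D" using D by (simp add: \<delta>_def)
 then obtain e where e: "e \<in> B" "e \<noteq> b0" "\<bar>e - b0\<bar> = \<delta>" "\<delta> \<le> \<bar>b1 - b0\<bar>" by (auto simp: D_def)
 have \<delta>: "\<delta> > 0" using e by auto
 have near: "b = b0" if "b \<in> B" "\<bar>b - b0\<bar> < \<delta>" for b
 proof (rule ccontr)
  assume "b \<noteq> b0"
  hence "\<bar>b - b0\<bar> \<in> D" using that e(4) by (auto simp: D_def)
  hence "\<delta> \<le> \<bar>b - b0\<bar>" unfolding \<delta>_def by (rule Min_le[OF D(1)])
  thus False using that(2) by simp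
 qed
 have up: "b0 + \<delta> \<in> B"
 proof (cases "e - b0 = \<delta>")
  case False
  hence "2 * b0 - e = b0 + \<delta>" using e(3) by (simp add: abs_if split: if_splits)
  thus ?thesis using cl[OF two(1) e(1)] by metis
 qed (use e(1) in "simp add: algebra_simps")
 have shift: "b + 2 * \<delta> \<in> B" "b - 2 * \<delta> \<in> B" if "b \<in> B" for b
  using cl[OF up cl[OF two(1) that]] cl[OF two(1) cl[OF up that]] by (simp_all add: algebra_simps)
 have shifts: "b + of_int k * (2 * \<delta>) \<in> B" if "b \<in> B" for b k
 proof (induction k rule: int_induct[where k = 0])
  case (step1 i) thus ?case using shift(1)[OF step1(2)] by (simp add: algebra_simps)
 next
  case (step2 i) thus ?case using shift(2)[OF step2(2)] by (simp add: algebra_simps)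
 qed (use that in simp)
 have "b0 + of_int k * \<delta> \<in> B" for k
 proof (cases "even k")
  case True
  then obtain j where "k = 2 * j" by blast
  thus ?thesis using shifts[OF two(1), of j] by (simp add: algebra_simps)
 next
  case False
  then obtain j where "k = 2 * j + 1" by (metis oddE)
  thus ?thesis using shifts[OF up, of j] by (simp add: algebra_simps)
 qed
 moreover have "\<exists>k. b = b0 + of_int k * \<delta>" if b: "b \<in> B" for b
 proof -
  define j where "j = \<lfloor>(b - b0 + \<delta>) / (2 * \<delta>)\<rfloor>"
  define b' where "b' = b + of_int (- j) * (2 * \<delta>)"
  have b': "b' \<in> B" unfolding b'_def by (rule shifts[OF b])
  have "of_int j \<le> (b - b0 + \<delta>) / (2 * \<delta>)" "(b - b0 + \<delta>) / (2 * \<delta>) < of_int j + 1" unfolding j_def by linarith+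
  hence "of_int j * (2 * \<delta>) \<le> b - b0 + \<delta>" "b - b0 + \<delta> < (of_int j + 1) * (2 * \<delta>)"
   using \<delta> by (simp_all add: field_simps)
  hence "- \<delta> \<le> b' - b0" "b' - b0 < \<delta>" by (simp_all add: b'_def algebra_simps)
  hence "b' = b0 \<or> b' = b0 - \<delta>" using near[OF b'] by (cases "b' - b0 = - \<delta>") auto
  hence "b = b0 + of_int (2 * j) * \<delta> \<or> b = b0 + of_int (2 * j - 1) * \<delta>" by (auto simp: b'_def algebra_simps)
  thus ?thesis by blast
 qed
 ultimately have "B = {b0 + of_int k * \<delta> |k. True}" by auto
 thus ?thesis using that \<delta> by blast
qed

text \<open>The set K meets every orbit of the group of symmetries of the arrangement, and
\<Omega> is a bounded chamber.\<close>

locale cocompact_arrangement =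
 fixes \<H> :: "'a::euclidean_space set set" and K \<Omega> :: "'a set"
 assumes hyp: "H \<in> \<H> ==> hyperplane_in UNIV H"
  and fin: "finite {H \<in> \<H>. H \<inter> cball x r \<noteq> {}}"
  and refl: "M \<noteq> 0 ==> {x. M \<bullet> x = b} \<in> \<H> ==> H \<in> \<H> ==> reflection M b ` H \<in> \<H>"
  and bK: "bounded K" and K: "\<exists>g. isometry_map g \<and> g x \<in> K \<and> (\<forall>H. g ` H \<in> \<H> \<longleftrightarrow> H \<in> \<H>)"
  and \<Omega>: "\<Omega> \<in> components (- \<Union>\<H>)" "bounded \<Omega>"
begin

definition levels :: "'a => real set" where "levels a = {b. {x. a \<bullet> x = b} \<in> \<H>}"

lemma levels_scale: "c \<noteq> 0 ==> c * b \<in> levels (c *\<^sub>R a) \<longleftrightarrow> b \<in> levels a"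
 by (simp add: levels_def)

lemma hyperplane_levels:
 assumes "H \<in> \<H>" obtains u b where "norm u = 1" "H = {x. u \<bullet> x = b}" "b \<in> levels u"
proof -
 obtain M b where M: "M \<noteq> 0" "H = {x. M \<bullet> x = b}" using hyp[OF assms] unfolding hyperplane_in_UNIV by blast
 show ?thesis using normalize_hyperplane(1)[OF M(1)] normalize_hyperplane(2)[OF M(1), of b] M(2) assms by (intro that[of "(1 / norm M) *\<^sub>R M" "b / norm M"]) (simp_all add: levels_def)
qed

lemma levels_reflection:
 assumes a: "a \<noteq> 0" "b \<in> levels a" and c: "c \<in> levels v"
 shows "c - 2 * (a \<bullet> v) / (a \<bullet> a) * b \<in> levels (reflection a 0 v)"
proof -
 define n where "n = 2 * (a \<bullet> v) / (a \<bullet> a)"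
 have key: "v \<bullet> reflection a b y = reflection a 0 v \<bullet> y + n * b" for y
  by (simp add: reflection_def n_def inner_diff_left inner_diff_right power2_norm_eq_inner inner_commute algebra_simps diff_divide_distrib)
 have "reflection a b ` {x. v \<bullet> x = c} = {y. reflection a 0 v \<bullet> y = c - n * b}"
 proof (intro equalityI subsetI)
  fix y assume "y \<in> reflection a b ` {x. v \<bullet> x = c}"
  hence "v \<bullet> reflection a b y = c" using reflection_involution[OF a(1)] by auto
  thus "y \<in> {y. reflection a 0 v \<bullet> y = c - n * b}" using key[of y] by simp
 next
  fix y assume "y \<in> {y. reflection a 0 v \<bullet> y = c - n * b}"
  hence "v \<bullet> reflection a b y = c" using key[of y] by simp
  moreover have "y = reflection a b (reflection a b y)" using reflection_involution[OF a(1)] by simp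
  ultimately show "y \<in> reflection a b ` {x. v \<bullet> x = c}" by blast
 qed
 moreover have "reflection a b ` {x. v \<bullet> x = c} \<in> \<H>" using refl[OF a(1)] a(2) c by (simp add: levels_def)
 ultimately show ?thesis by (simp add: levels_def n_def)
qed

lemma levels_minus: "b \<in> levels a ==> - b \<in> levels (- a)"
 using levels_scale[of "-1" b a] by simp

lemma levels_reflection_closed:
 assumes a: "a \<noteq> 0" "b \<in> levels a" "b' \<in> levels a"
 shows "2 * b - b' \<in> levels a"
proof -
 have "reflection a 0 a = - a" using a(1) by (simp add: reflection_def power2_norm_eq_inner scaleR_2)
 hence "b' - 2 * b \<in> levels (- a)" using levels_reflection[OF a(1,2,3)] a(1) by simp
 from levels_minus[OF this] show ?thesis by simp
qed

lemma finite_levels: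
 assumes a: "a \<noteq> 0" shows "finite (levels a \<inter> {- r..r})"
proof (rule finite_imageD)
 let ?h = "\<lambda>b. {x. a \<bullet> x = b}"
 show "finite (?h ` (levels a \<inter> {- r..r}))"
 proof (rule finite_subset[OF _ fin[of 0 "r / norm a"]], clarify)
  fix b assume b: "b \<in> levels a" "b \<in> {- r..r}"
  have "(b / (a \<bullet> a)) *\<^sub>R a \<in> ?h b" using a by simp
  moreover have "(b / (a \<bullet> a)) *\<^sub>R a \<in> cball 0 (r / norm a)"
  proof -
   have "norm ((b / (a \<bullet> a)) *\<^sub>R a) = \<bar>b\<bar> / norm a"
    using a by (simp add: dot_square_norm power2_eq_square)
   also have "... \<le> r / norm a" using b(2) by (intro divide_right_mono) auto
   finally show ?thesis by simp
  qed
  moreover have "?h b \<in> \<H>" using b(1) by (simp add: levels_def)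
  ultimately show "?h b \<in> \<H> \<and> ?h b \<inter> cball 0 (r / norm a) \<noteq> {}" by blast
 qed
 show "inj_on ?h (levels a \<inter> {- r..r})"
 proof (rule inj_onI)
  fix b b' assume "?h b = ?h b'"
  moreover have "(b / (a \<bullet> a)) *\<^sub>R a \<in> ?h b" using a by simp
  ultimately have "(b / (a \<bullet> a)) *\<^sub>R a \<in> ?h b'" by blast
  thus "b = b'" using a by simp
 qed
qed

lemma levels_isometry:
 obtains g L where "orthogonal_transformation L" "\<And>y. g y = g 0 + L y" "g x \<in> K"
  "\<And>v b. b \<in> levels v \<longleftrightarrow> b + L v \<bullet> g 0 \<in> levels (L v)"
  "\<And>H. H \<in> \<H> ==> g ` H \<in> \<H>"
proof -
 obtain g where g: "isometry_map g" "g x \<in> K" "\<And>H. g ` H \<in> \<H> \<longleftrightarrow> H \<in> \<H>" using K by blast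
 obtain L where L: "orthogonal_transformation L" "\<And>x. g x = g 0 + L x"
  "\<And>M b. g ` {x. M \<bullet> x = b} = {y. L M \<bullet> y = b + L M \<bullet> g 0}" by (rule isometry_map_hyperplane[OF g(1)]) (rule that)
 show ?thesis
  by (rule that[OF L(1,2) g(2)]) (simp_all add: levels_def g(3) flip: L(3))
qed

definition normals :: "'a set" where "normals = {u. norm u = 1 \<and> levels u \<noteq> {}}"

text \<open>Hyperplanes with normals u and v that are not parallel meet in a point, which a
symmetry moves into K without changing \<open>u \<bullet> v\<close>. Only finitely many
hyperplanes meet K, so the inner products of normals take finitely many values; hence distinct
normals are separated on the unit sphere.\<close>

lemma finite_normals: "finite normals"
proof -
 define N where "N = {n. norm n = 1 \<and> (\<exists>b. {x. n \<bullet> x = b} \<in> \<H> \<and> {x. n \<bullet> x = b} \<inter> K \<noteq> {})}"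
 obtain r where r: "K \<subseteq> cball 0 r" using bK by (auto simp: bounded_iff subset_iff)
 have fN: "finite N"
 proof (rule finite_subset)
  let ?F = "{H \<in> \<H>. H \<inter> cball 0 r \<noteq> {}}"
  show "N \<subseteq> (\<Union>H\<in>?F. {n. norm n = 1 \<and> (\<exists>b. H = {x. n \<bullet> x = b})})" using r by (force simp: N_def)
  have "finite {n. norm n = 1 \<and> (\<exists>b. H = {x. n \<bullet> x = b})}" for H
  proof (cases "\<exists>n0 b0. norm n0 = 1 \<and> H = {x. n0 \<bullet> x = b0}")
   case True
   then obtain n0 b0 where n0: "norm n0 = 1" "H = {x. n0 \<bullet> x = b0}" by blast
   have "{n. norm n = 1 \<and> (\<exists>b. H = {x. n \<bullet> x = b})} \<subseteq> {n0, - n0}"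
   proof
    fix n assume "n \<in> {n. norm n = 1 \<and> (\<exists>b. H = {x. n \<bullet> x = b})}"
    then obtain b where n: "norm n = 1" "H = {x. n \<bullet> x = b}" by blast
    have "n0 \<noteq> 0" using n0(1) by auto
    with n0(2) n(2) obtain c where c: "n = c *\<^sub>R n0" using hyperplane_normals_parallel by metis
    hence "\<bar>c\<bar> = 1" using n(1) n0(1) by simp
    hence "c = 1 \<or> c = -1" by linarith
    thus "n \<in> {n0, - n0}" using c by auto
   qed
   thus ?thesis by (rule finite_subset) simp
  next
   case False
   hence e: "{n. norm n = 1 \<and> (\<exists>b. H = {x. n \<bullet> x = b})} = {}" by blast
   show ?thesis unfolding e by simp
  qed
  thus "finite (\<Union>H\<in>?F. {n. norm n = 1 \<and> (\<exists>b. H = {x. n \<bullet> x = b})})" using fin[of 0 r] by blast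
 qed
 define S where "S = insert 1 (insert (-1) ((\<lambda>(m, n). m \<bullet> n) ` (N \<times> N)))"
 have inS: "u \<bullet> v \<in> S" if u: "u \<in> normals" and v: "v \<in> normals" for u v
 proof (cases "(u \<bullet> v)\<^sup>2 = 1")
  case True thus ?thesis by (auto simp: S_def power2_eq_1_iff)
 next
  case False
  obtain b c where bc: "b \<in> levels u" "c \<in> levels v" using u v by (auto simp: normals_def)
  have n: "u \<bullet> u = 1" "v \<bullet> v = 1" using u v by (auto simp: normals_def dot_square_norm)
  define t where "t = u \<bullet> v"
  have t: "1 - t\<^sup>2 \<noteq> 0" using False by (simp add: t_def)
  define z where "z = ((b - t * c) / (1 - t\<^sup>2)) *\<^sub>R u + ((c - t * b) / (1 - t\<^sup>2)) *\<^sub>R v"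
  have "u \<bullet> z = ((b - t * c) + (c - t * b) * t) / (1 - t\<^sup>2)"
   by (simp add: z_def inner_add_right n add_divide_distrib flip: t_def)
  also have "... = b * (1 - t\<^sup>2) / (1 - t\<^sup>2)" by (simp add: algebra_simps power2_eq_square)
  finally have z1: "u \<bullet> z = b" using t by simp
  have "v \<bullet> z = ((b - t * c) * t + (c - t * b)) / (1 - t\<^sup>2)"
   by (simp add: z_def inner_add_right n add_divide_distrib inner_commute[of v u] flip: t_def)
  also have "... = c * (1 - t\<^sup>2) / (1 - t\<^sup>2)" by (simp add: algebra_simps power2_eq_square)
  finally have z2: "v \<bullet> z = c" using t by simp
  obtain g L where g: "orthogonal_transformation L" "\<And>y. g y = g 0 + L y" "g z \<in> K"
   "\<And>v b. b \<in> levels v \<longleftrightarrow> b + L v \<bullet> g 0 \<in> levels (L v)" "\<And>H. H \<in> \<H> ==> g ` H \<in> \<H>"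
   by (rule levels_isometry[of z]) (rule that)
  have ip: "L x \<bullet> L y = x \<bullet> y" for x y using g(1) by (simp add: orthogonal_transformation_def)
  have "L w \<in> N" if w: "norm w = 1" "w \<bullet> z \<in> levels w" for w
  proof -
   have "L w \<bullet> g z = w \<bullet> z + L w \<bullet> g 0" unfolding g(2)[of z] by (simp add: inner_add_right ip)
   hence "L w \<bullet> g z \<in> levels (L w)" using g(4)[of "w \<bullet> z" w] w(2) by simp
   moreover have "norm (L w) = 1" using w(1) g(1) by (simp add: orthogonal_transformation_norm)
   ultimately show ?thesis using g(3) unfolding N_def levels_def by blast
  qed
  hence "L u \<in> N" "L v \<in> N" using u v bc z1 z2 by (auto simp: normals_def)
  hence "L u \<bullet> L v \<in> S" by (force simp: S_def)
  thus ?thesis by (simp add: ip)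
 qed
 have fS: "finite S" using fN by (simp add: S_def)
 define E where "E = insert 1 ((\<lambda>s. sqrt (2 - 2 * s)) ` {s \<in> S. s < 1})"
 have E: "finite E" "E \<noteq> {}" "\<And>e. e \<in> E ==> e > 0" using fS by (auto simp: E_def)
 show ?thesis
 proof (rule finite_if_separated)
  show "bounded normals" by (rule bounded_subset[of "cball 0 1"]) (auto simp: normals_def)
  show "Min E > 0" using E by simp
  fix u v assume u: "u \<in> normals" and v: "v \<in> normals" and ne: "u \<noteq> v"
  have n: "u \<bullet> u = 1" "v \<bullet> v = 1" using u v by (auto simp: normals_def dot_square_norm)
  have "(dist u v)\<^sup>2 = 2 - 2 * (u \<bullet> v)"
   unfolding dist_norm power2_norm_eq_inner by (simp add: inner_diff_left inner_diff_right n inner_commute)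
  hence d: "dist u v = sqrt (2 - 2 * (u \<bullet> v))" by (metis real_sqrt_abs abs_of_nonneg zero_le_dist)
  hence "u \<bullet> v < 1" using ne by (smt (verit) real_sqrt_le_0_iff zero_less_dist_iff)
  hence "dist u v \<in> E" using inS[OF u v] d by (auto simp: E_def)
  thus "Min E \<le> dist u v" using E(1) by simp
 qed
qed

text \<open>Symmetries move the points \<open>(real k * (2 * r + 1)) *\<^sub>R u\<close> into K.
Two of them turn u into the same normal, and they shift the levels differently, so that the levels
of u are invariant under a translation. The distance \<open>2 * r + 1\<close> of the points
exceeds the diameter of K.\<close>

lemma two_levels:
 assumes u: "u \<in> normals"
 obtains b b' where "b \<in> levels u" "b' \<in> levels u" "b' \<noteq> b"
proof -
 obtain b where b: "b \<in> levels u" using u by (auto simp: normals_def)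
 have nu: "norm u = 1" "u \<bullet> u = 1" using u by (auto simp: normals_def dot_square_norm)
 obtain r where r: "\<And>x. x \<in> K ==> norm x \<le> r" using bK by (auto simp: bounded_iff)
 have "\<forall>k::nat. \<exists>n s. n \<in> normals \<and> \<bar>s + real k * (2 * r + 1)\<bar> \<le> r \<and> (\<forall>b. b \<in> levels u \<longleftrightarrow> b + s \<in> levels n)"
 proof
  fix k :: nat
  define x where "x = (real k * (2 * r + 1)) *\<^sub>R u"
  obtain g L where g: "orthogonal_transformation L" "\<And>y. g y = g 0 + L y" "g x \<in> K"
   "\<And>v b. b \<in> levels v \<longleftrightarrow> b + L v \<bullet> g 0 \<in> levels (L v)"
   by (rule levels_isometry[of x]) (rule that)
  have Lu: "norm (L u) = 1" using nu g(1) by (simp add: orthogonal_transformation_norm)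
  have "L u \<bullet> L x = real k * (2 * r + 1)" using g(1) nu by (simp add: orthogonal_transformation_def x_def)
  hence "L u \<bullet> g 0 + real k * (2 * r + 1) = L u \<bullet> g x" unfolding g(2)[of x] by (simp add: inner_add_right)
  moreover have "\<bar>L u \<bullet> g x\<bar> \<le> r" using Cauchy_Schwarz_ineq2[of "L u" "g x"] Lu r[OF g(3)] by simp
  moreover have "L u \<in> normals" using Lu b g(4)[of b u] by (auto simp: normals_def)
  ultimately show "\<exists>n s. n \<in> normals \<and> \<bar>s + real k * (2 * r + 1)\<bar> \<le> r \<and> (\<forall>b. b \<in> levels u \<longleftrightarrow> b + s \<in> levels n)"
   using g(4)[of _ u] by (intro exI[of _ "L u"] exI[of _ "L u \<bullet> g 0"]) auto
 qed
 then obtain n s where ns: "\<And>k. n k \<in> normals" "\<And>k. \<bar>s k + real k * (2 * r + 1)\<bar> \<le> r"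
  "\<And>k b. b \<in> levels u \<longleftrightarrow> b + s k \<in> levels (n k)" by metis
 have "\<not> inj n"
 proof
  assume "inj n"
  moreover have "finite (range n)" using ns(1) finite_normals by (meson finite_subset image_subsetI)
  ultimately show False using finite_imageD infinite_UNIV_nat by blast
 qed
 then obtain j k where jk: "n j = n k" "j < k" unfolding inj_def by (metis linorder_less_linear)
 have r0: "r \<ge> 0" using ns(2)[of 0] by linarith
 have "real j * (2 * r + 1) + (2 * r + 1) \<le> real k * (2 * r + 1)"
 proof -
  have "real j + 1 \<le> real k" using jk(2) by linarith
  hence "(real j + 1) * (2 * r + 1) \<le> real k * (2 * r + 1)" using r0 by (intro mult_right_mono) auto
  thus ?thesis by (simp add: algebra_simps)
 qed
 hence "s j \<noteq> s k" using ns(2)[of j] ns(2)[of k] by linarith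
 moreover have "b + (s j - s k) \<in> levels u" using ns(3)[of b j] ns(3)[of "b + (s j - s k)" k] b jk(1) by simp
 ultimately show ?thesis using that[OF b, of "b + (s j - s k)"] by simp
qed

text \<open>A line orthogonal to all normals stays in its chamber, but \<Omega> is
bounded.\<close>

lemma normals_span:
 assumes "\<And>u. u \<in> normals ==> u \<bullet> w = 0" shows "w = 0"
proof (rule ccontr)
 assume w: "w \<noteq> 0"
 obtain x where x: "x \<in> \<Omega>" using in_components_nonempty[OF \<Omega>(1)] by blast
 define l where "l = range (\<lambda>t. x + t *\<^sub>R w)"
 have "l \<subseteq> - \<Union>\<H>"
 proof
  fix y assume "y \<in> l"
  then obtain t where t: "y = x + t *\<^sub>R w" by (auto simp: l_def)
  show "y \<in> - \<Union>\<H>"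
  proof
   assume "y \<in> \<Union>\<H>"
   then obtain H where H: "H \<in> \<H>" "y \<in> H" by blast
   obtain u b where u: "norm u = 1" "H = {x. u \<bullet> x = b}" "b \<in> levels u" by (rule hyperplane_levels[OF H(1)])
   hence "u \<bullet> w = 0" using assms[of u] by (auto simp: normals_def)
   hence "x \<in> H" using H(2) by (simp add: u(2) t inner_add_right)
   thus False using x H(1) in_components_subset[OF \<Omega>(1)] by blast
  qed
 qed
 moreover have "connected l" unfolding l_def by (intro connected_continuous_image continuous_intros connected_UNIV)
 moreover have "x \<in> l" using range_eqI[of x "\<lambda>t. x + t *\<^sub>R w" 0] by (simp add: l_def)
 ultimately have "l \<subseteq> \<Omega>" using components_maximal[OF \<Omega>(1)] x by blast
 then obtain B where B: "\<And>t. norm (x + t *\<^sub>R w) \<le> B" using \<Omega>(2) unfolding bounded_iff l_def by blast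
 have "\<bar>t\<bar> * norm w \<le> B + norm x" for t using norm_triangle_ineq4[of "x + t *\<^sub>R w" x] B[of t] by simp
 from this[of "(B + norm x + 1) / norm w"] have "\<bar>B + norm x + 1\<bar> \<le> B + norm x" using w by simp
 thus False by linarith
qed

end

section \<open>The root system of an arrangement\<close>

context cocompact_arrangement
begin

text \<open>Normals scaled so that neighbouring parallel hyperplanes differ by one in
level.\<close>

definition roots :: "'a set" where
 "roots = {a. a \<noteq> 0 \<and> (\<exists>c. levels a = {c + of_int k |k. True})}"

lemma rootsD:
 assumes "a \<in> roots"
 shows "a \<noteq> 0" "levels a \<noteq> {}" "\<And>b b'. b \<in> levels a ==> b' \<in> levels a \<longleftrightarrow> b' - b \<in> \<int>"
proof -
 obtain c where c: "a \<noteq> 0" "levels a = {c + of_int k |k. True}" using assms by (auto simp: roots_def)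
 show "a \<noteq> 0" "levels a \<noteq> {}" using c by auto
 show "b' \<in> levels a \<longleftrightarrow> b' - b \<in> \<int>" if bl: "b \<in> levels a" for b b'
 proof -
  obtain k where k: "b = c + of_int k" using bl unfolding c(2) by blast
  show ?thesis
  proof
   assume "b' \<in> levels a"
   then obtain j where j: "b' = c + of_int j" unfolding c(2) by blast
   have "b' - b = of_int (j - k)" using k j by simp
   thus "b' - b \<in> \<int>" by (metis Ints_of_int)
  next
   assume "b' - b \<in> \<int>"
   then obtain j where "b' - b = of_int j" by (rule Ints_cases)
   hence "b' = c + of_int (k + j)" using k by simp
   thus "b' \<in> levels a" unfolding c(2) by blast
  qed
 qed
qed

lemma rootsI:
 assumes "a \<noteq> 0" "b \<in> levels a" "\<And>b'. b' \<in> levels a \<longleftrightarrow> b' - b \<in> \<int>"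
 shows "a \<in> roots"
proof -
 have "levels a = {b + of_int k |k. True}"
 proof (intro equalityI subsetI)
  fix x assume "x \<in> levels a"
  then obtain k where "x - b = of_int k" using assms(3) by (blast elim: Ints_cases)
  hence "x = b + of_int k" by simp
  thus "x \<in> {b + of_int k |k. True}" by blast
 next
  fix x assume "x \<in> {b + of_int k |k. True}"
  hence "x - b \<in> \<int>" by auto
  thus "x \<in> levels a" using assms(3)[of x] by blast
 qed
 thus ?thesis using assms(1) by (auto simp: roots_def)
qed

lemma root_of_normal:
 assumes u: "u \<in> normals" obtains d where "d > 0" "d *\<^sub>R u \<in> roots"
proof -
 have u0: "u \<noteq> 0" using u by (auto simp: normals_def)
 obtain b b' where b: "b \<in> levels u" "b' \<in> levels u" "b' \<noteq> b" by (rule two_levels[OF u])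
 obtain c \<delta> where d: "\<delta> > 0" "levels u = {c + of_int k * \<delta> |k. True}"
  by (rule reflection_closed_progression[OF finite_levels[OF u0] levels_reflection_closed[OF u0] b])
 have "levels ((1 / \<delta>) *\<^sub>R u) = {c / \<delta> + of_int k |k. True}"
 proof -
  have "x \<in> levels ((1 / \<delta>) *\<^sub>R u) \<longleftrightarrow> \<delta> * x \<in> levels u" for x
   using levels_scale[of "1 / \<delta>" "\<delta> * x" u] d(1) by simp
  moreover have "\<delta> * x = c + of_int k * \<delta> \<longleftrightarrow> x = c / \<delta> + of_int k" for x k using d(1) by (simp add: field_simps)
  ultimately show ?thesis unfolding d(2) by blast
 qed
 hence "(1 / \<delta>) *\<^sub>R u \<in> roots" using u0 d(1) by (auto simp: roots_def)
 thus ?thesis using that d(1) by (meson zero_less_divide_1_iff)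
qed

lemma roots_scale:
 assumes a: "a \<in> roots" "c *\<^sub>R a \<in> roots"
 shows "c = 1 \<or> c = - 1"
proof -
 note r = rootsD[OF a(1)] rootsD[OF a(2)]
 have c0: "c \<noteq> 0" using r(4) by auto
 obtain b where b: "b \<in> levels a" using r(2) by blast
 hence b1: "b + 1 \<in> levels a" using r(3)[OF b] by simp
 have cb: "c * b \<in> levels (c *\<^sub>R a)" "c * (b + 1) \<in> levels (c *\<^sub>R a)" using levels_scale[OF c0] b b1 by blast+
 hence "c \<in> \<int>" using r(6)[OF cb(1), of "c * (b + 1)"] by (simp add: algebra_simps)
 then obtain m where m: "c = of_int m" by (rule Ints_cases)
 have "c * b + 1 \<in> levels (c *\<^sub>R a)" using r(6)[OF cb(1)] by simp
 moreover have "c * b + 1 = c * (b + 1 / c)" using c0 by (simp add: algebra_simps)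
 ultimately have "b + 1 / c \<in> levels a" using levels_scale[OF c0] by metis
 hence "1 / c \<in> \<int>" using r(3)[OF b] by simp
 then obtain n where n: "1 / c = of_int n" by (rule Ints_cases)
 have "of_int (m * n) = (1::real)" using m n c0 by (simp add: field_simps)
 hence "m * n = 1" by linarith
 hence "m = 1 \<or> m = -1" by (auto simp: zmult_eq_1_iff)
 thus ?thesis using m by auto
qed

text \<open>The reflection in the hyperplane of level b maps the levels of v to those of the
reflected vector, up to a shift by \<open>n * b\<close>. The levels b and \<open>b + 1\<close>
together show that the levels of v are invariant under translation by n, so n is an
integer.\<close>

lemma roots_reflection:
 assumes a: "a \<in> roots" and v: "v \<in> roots"
 shows "reflection a 0 v \<in> roots" "2 * (a \<bullet> v) / (a \<bullet> a) \<in> \<int>"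
proof -
 note ra = rootsD[OF a] and rv = rootsD[OF v]
 define n where "n = 2 * (a \<bullet> v) / (a \<bullet> a)"
 define w where "w = reflection a 0 v"
 have aa: "a \<bullet> a > 0" using ra(1) by simp
 have vw: "reflection a 0 w = v" unfolding w_def by (rule reflection_involution[OF ra(1)])
 have w0: "w \<noteq> 0" using vw rv(1) by (auto simp: reflection_def)
 have n': "2 * (a \<bullet> w) / (a \<bullet> a) = - n"
  using aa by (simp add: w_def n_def reflection_def inner_diff_right power2_norm_eq_inner)
 have lev: "c \<in> levels w \<longleftrightarrow> c + n * b \<in> levels v" if b: "b \<in> levels a" for b c
  using levels_reflection[OF ra(1) b, of c w] levels_reflection[OF ra(1) b, of "c + n * b" v]
  unfolding n' vw unfolding w_def[symmetric] n_def[symmetric] by auto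
 obtain b where b: "b \<in> levels a" using ra(2) by blast
 obtain c where c: "c \<in> levels v" using rv(2) by blast
 show "reflection a 0 v \<in> roots"
  unfolding w_def[symmetric]
 proof (rule rootsI[OF w0])
  show "c - n * b \<in> levels w" using lev[OF b] c by simp
  show "c' \<in> levels w \<longleftrightarrow> c' - (c - n * b) \<in> \<int>" for c'
   unfolding lev[OF b] using rv(3)[OF c, of "c' + n * b"] by (simp add: algebra_simps)
 qed
 have "b + 1 \<in> levels a" using ra(3)[OF b] by simp
 hence "c - n * b + n * (b + 1) \<in> levels v" using lev[of "b + 1" "c - n * b"] lev[OF b, of "c - n * b"] c by simp
 hence "c - n * b + n * (b + 1) - c \<in> \<int>" using rv(3)[OF c] by blast
 moreover have "c - n * b + n * (b + 1) - c = n" by (simp add: algebra_simps)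
 ultimately show "2 * (a \<bullet> v) / (a \<bullet> a) \<in> \<int>" unfolding n_def[symmetric] by simp
qed

lemma roots_minus: "a \<in> roots ==> - a \<in> roots"
 using roots_reflection(1)[of a a] rootsD(1)[of a] by (simp add: reflection_def power2_norm_eq_inner scaleR_2)

lemma root_system_roots: "root_system roots"
proof -
 have "finite roots"
 proof (rule finite_imageD)
  let ?h = "\<lambda>a::'a. (1 / norm a) *\<^sub>R a"
  have "?h a \<in> normals" if a: "a \<in> roots" for a
  proof -
   obtain b where "b \<in> levels a" using rootsD(2)[OF a] by blast
   hence "(1 / norm a) * b \<in> levels (?h a)" using rootsD(1)[OF a] by (subst levels_scale) auto
   thus ?thesis using rootsD(1)[OF a] by (auto simp: normals_def)
  qed
  thus "finite (?h ` roots)" using finite_normals by (meson finite_subset image_subsetI)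
  show "inj_on ?h roots"
  proof (rule inj_onI)
   fix a a' assume a: "a \<in> roots" "a' \<in> roots" "?h a = ?h a'"
   have n: "norm a > 0" "norm a' > 0" using a rootsD(1) by auto
   have "a' = norm a' *\<^sub>R ?h a" using a(3) n by simp
   hence e: "a' = (norm a' / norm a) *\<^sub>R a" by simp
   hence "norm a' / norm a = 1 \<or> norm a' / norm a = -1" using roots_scale[OF a(1)] a(2) by metis
   moreover have "norm a' / norm a > 0" using n by simp
   ultimately have "norm a' / norm a = 1" by linarith
   thus "a = a'" using e by (metis scaleR_one)
  qed
 qed
 moreover have "span roots = UNIV"
 proof (rule ccontr)
  assume "\<not> ?thesis"
  then obtain w where w: "w \<noteq> 0" "\<And>x. x \<in> span roots ==> w \<bullet> x = 0" using span_not_UNIV_orthogonal by blast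
  have "u \<bullet> w = 0" if u: "u \<in> normals" for u
  proof -
   obtain d where "d > 0" "d *\<^sub>R u \<in> roots" by (rule root_of_normal[OF u])
   thus ?thesis using w(2)[OF span_base, of "d *\<^sub>R u"] by (simp add: inner_commute)
  qed
  thus False using normals_span w(1) by blast
 qed
 moreover have "{c *\<^sub>R v |c. True} \<inter> roots = {v, - v}" if v: "v \<in> roots" for v
 proof (intro equalityI subsetI)
  fix x assume "x \<in> {c *\<^sub>R v |c. True} \<inter> roots"
  then obtain c where "x = c *\<^sub>R v" "c *\<^sub>R v \<in> roots" by blast
  thus "x \<in> {v, - v}" using roots_scale[OF v] by fastforce
 next
  fix x assume "x \<in> {v, - v}"
  moreover have "v = 1 *\<^sub>R v" "- v = (- 1) *\<^sub>R v" by simp_all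
  ultimately show "x \<in> {c *\<^sub>R v |c. True} \<inter> roots" using v roots_minus[OF v] by blast
 qed
 moreover have "v - (2 * (u \<bullet> v) / (norm u)\<^sup>2) *\<^sub>R u \<in> roots" "2 * (u \<bullet> v) / (norm v)\<^sup>2 \<in> \<int>"
  if "u \<in> roots" "v \<in> roots" for u v
  using roots_reflection(1)[OF that] roots_reflection(2)[OF that(2,1)]
  by (simp_all add: reflection_def power2_norm_eq_inner inner_commute)
 ultimately show ?thesis unfolding root_system_def using rootsD(1) by blast
qed

text \<open>The simple roots are linearly independent, so some p lies on a hyperplane for each of
them. This carries over to sums: a root \<open>x + y\<close> has a positive inner product with one
of x and y, say x. By \<open>acute_roots\<close> it is the image of y under the reflection given
by x, or its own reflection takes x to \<open>- y\<close>; in the latter case a comparison of the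
levels of x and y shows that its value at p is a level.\<close>

lemma special_point: obtains p where "\<And>a. a \<in> roots ==> a \<bullet> p \<in> levels a"
proof -
 note R = root_system_roots
 note r = root_systemD[OF R]
 obtain \<phi> where g: "generic_for \<phi> roots" by (rule ex_generic[OF r(1,2)])
 let ?S = "simple_roots \<phi> roots"
 have "independent ?S"
 proof (rule obtuse_half_space_independent)
  show "finite ?S" by (rule finite_subset[OF _ r(1)]) (auto simp: simple_roots_def positive_roots_def)
  show "\<phi> \<bullet> v > 0" if "v \<in> ?S" for v using that by (simp add: simple_roots_def positive_roots_def)
 qed (rule simple_roots_obtuse[OF R g])
 then obtain h where h: "linear h" "\<And>a. a \<in> ?S ==> h a = (SOME b. b \<in> levels a)"
  using linear_independent_extend[of ?S "\<lambda>a. SOME b. b \<in> levels a"] by blast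
 define p where "p = adjoint h 1"
 have p: "a \<bullet> p = h a" for a using adjoint_works[OF h(1), of a 1] by (simp add: p_def)
 define good where "good a \<longleftrightarrow> a \<in> roots \<and> a \<bullet> p \<in> levels a" for a
 have gm: "good (- a)" if "good a" for a using that roots_minus[of a] levels_minus[of "a \<bullet> p" a] by (simp add: good_def)
 have gr: "good (reflection a 0 v)" if "good a" "good v" for a v
 proof -
  have "reflection a 0 v \<bullet> p = v \<bullet> p - 2 * (a \<bullet> v) / (a \<bullet> a) * (a \<bullet> p)"
   by (simp add: reflection_def inner_diff_left power2_norm_eq_inner)
  thus ?thesis
   using that levels_reflection[of a "a \<bullet> p" "v \<bullet> p" v] rootsD(1)[of a] roots_reflection(1)[of a v] by (simp add: good_def)
 qed
 have acute: "good (x + y)" if x: "good x" and y: "good y" and xy: "x + y \<in> roots" and p0: "(x + y) \<bullet> x > 0" for x y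
 proof -
  have R': "x \<in> roots" "y \<in> roots" using x y by (auto simp: good_def)
  have "x + y \<noteq> x" using R' r(2) by auto
  from acute_roots(1)[OF R xy R'(1) this p0] show ?thesis
  proof
   assume "reflection x 0 (x + y) = x + y - x"
   hence "reflection x 0 y = x + y" using reflection_involution[of x 0 "x + y"] rootsD(1)[OF R'(1)] by simp
   thus ?thesis using gr[OF x y] by simp
  next
   define v where "v = x + y"
   assume "reflection (x + y) 0 x = x - (x + y)"
   hence e: "reflection v 0 x = - y" unfolding v_def by simp
   have v0: "v \<noteq> 0" using rootsD(1)[OF xy] by (simp add: v_def)
   have "(2 * (v \<bullet> x) / (v \<bullet> v)) *\<^sub>R v = x - reflection v 0 x" by (simp add: reflection_def power2_norm_eq_inner)
   also have "... = 1 *\<^sub>R v" unfolding e by (simp add: v_def)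
   finally have "(2 * (v \<bullet> x) / (v \<bullet> v)) *\<^sub>R v = 1 *\<^sub>R v" .
   hence n: "2 * (v \<bullet> x) / (v \<bullet> v) = 1" using v0 scaleR_cancel_right by blast
   obtain b where b: "b \<in> levels v" using rootsD(2)[OF xy] by (auto simp: v_def)
   have "x \<bullet> p - b \<in> levels (- y)" using levels_reflection[OF v0 b, of "x \<bullet> p" x] x unfolding n e by (simp add: good_def)
   moreover have "(- y) \<bullet> p \<in> levels (- y)" "- y \<in> roots" using gm[OF y] by (auto simp: good_def)
   ultimately have "x \<bullet> p - b - (- y) \<bullet> p \<in> \<int>" using rootsD(3) by blast
   hence "v \<bullet> p - b \<in> \<int>" by (simp add: v_def inner_add_left algebra_simps)
   hence "v \<bullet> p \<in> levels v" using rootsD(3)[OF xy] b by (simp add: v_def)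
   thus ?thesis using xy by (simp add: good_def v_def)
  qed
 qed
 have pos: "good v" if "v \<in> positive_roots \<phi> roots" for v
  using R that
 proof (induction rule: positive_root_induct)
  case (simple v)
  hence "v \<in> roots" by (simp add: simple_roots_def positive_roots_def)
  moreover have "(SOME b. b \<in> levels v) \<in> levels v" using rootsD(2)[OF \<open>v \<in> roots\<close>] some_in_eq by blast
  ultimately show ?case using h(2)[OF simple] by (simp add: good_def p)
 next
  case (add x y)
  hence xy: "x + y \<in> roots" by (simp add: positive_roots_def)
  have "(x + y) \<bullet> x + (x + y) \<bullet> y > 0" using rootsD(1)[OF xy] by (simp flip: inner_add_right)
  hence "(x + y) \<bullet> x > 0 \<or> (y + x) \<bullet> y > 0" by (simp add: add.commute) linarith
  thus ?case using acute[OF add(4,5) xy] acute[of y x] add(4,5) xy by (auto simp: add.commute)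
 qed
 have "good v" if v: "v \<in> roots" for v
 proof (cases "\<phi> \<bullet> v > 0")
  case True thus ?thesis using pos v by (simp add: positive_roots_def)
 next
  case False
  hence "good (- v)" using pos[of "- v"] v roots_minus[OF v] g by (force simp: positive_roots_def generic_for_def)
  thus ?thesis using gm by fastforce
 qed
 thus ?thesis using that by (auto simp: good_def)
qed

theorem congruent_to_alcove: "\<exists>R A. root_system R \<and> A \<in> alcoves R \<and> congruent_sets A \<Omega>"
proof -
 obtain p where p: "\<And>a. a \<in> roots ==> a \<bullet> p \<in> levels a" by (rule special_point) (rule that)
 let ?W = "UNIV - (\<Union>v\<in>roots. \<Union>k::int. {x. v \<bullet> x = of_int k})"
 have W: "x + p \<in> - \<Union>\<H> \<longleftrightarrow> x \<in> ?W" for x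
 proof -
  have "x + p \<in> \<Union>\<H> \<longleftrightarrow> (\<exists>v\<in>roots. v \<bullet> x \<in> \<int>)"
  proof
   assume "x + p \<in> \<Union>\<H>"
   then obtain H where H: "H \<in> \<H>" "x + p \<in> H" by blast
   obtain u b where u: "norm u = 1" "H = {x. u \<bullet> x = b}" "b \<in> levels u" by (rule hyperplane_levels[OF H(1)])
   hence "u \<in> normals" by (auto simp: normals_def)
   then obtain d where d: "d > 0" "d *\<^sub>R u \<in> roots" by (rule root_of_normal)
   have "d * b \<in> levels (d *\<^sub>R u)" using levels_scale[of d b u] d(1) u(3) by simp
   hence "d * b - (d *\<^sub>R u) \<bullet> p \<in> \<int>" using rootsD(3)[OF d(2) p[OF d(2)]] by blast
   moreover have "b - u \<bullet> p = u \<bullet> x" using H(2) u(2) by (simp add: inner_add_right)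
   hence "d * b - (d *\<^sub>R u) \<bullet> p = (d *\<^sub>R u) \<bullet> x" by (simp add: right_diff_distrib[symmetric])
   ultimately have "(d *\<^sub>R u) \<bullet> x \<in> \<int>" by simp
   thus "\<exists>v\<in>roots. v \<bullet> x \<in> \<int>" using d(2) by blast
  next
   assume "\<exists>v\<in>roots. v \<bullet> x \<in> \<int>"
   then obtain v where v: "v \<in> roots" "v \<bullet> x \<in> \<int>" by blast
   hence "v \<bullet> (x + p) \<in> levels v" using rootsD(3)[OF v(1) p[OF v(1)]] by (simp add: inner_add_right)
   thus "x + p \<in> \<Union>\<H>" by (auto simp: levels_def)
  qed
  thus ?thesis by (auto elim: Ints_cases)
 qed
 define A where "A = (\<lambda>x. x - p) ` \<Omega>"
 have \<Omega>A: "\<Omega> = (\<lambda>x. x + p) ` A" by (auto simp: A_def image_image)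
 have inA: "x \<in> A \<longleftrightarrow> x + p \<in> \<Omega>" for x by (force simp: A_def image_iff)
 have "A \<in> components ?W"
  unfolding in_components_maximal
 proof (intro conjI allI impI)
  show ne: "A \<noteq> {}" using in_components_nonempty[OF \<Omega>(1)] by (simp add: A_def)
  show "A \<subseteq> ?W" using inA W in_components_subset[OF \<Omega>(1)] by blast
  show "connected A" unfolding A_def by (intro connected_continuous_image continuous_intros in_components_connected[OF \<Omega>(1)])
  fix D assume D: "D \<noteq> {} \<and> A \<subseteq> D \<and> D \<subseteq> ?W \<and> connected D"
  have "(\<lambda>x. x + p) ` D \<subseteq> \<Omega>"
  proof (rule components_maximal[OF \<Omega>(1)])
   show "connected ((\<lambda>x. x + p) ` D)" using D by (intro connected_continuous_image continuous_intros) blast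
   show "(\<lambda>x. x + p) ` D \<subseteq> - \<Union>\<H>" using D W by blast
   show "\<Omega> \<inter> (\<lambda>x. x + p) ` D \<noteq> {}" using D ne inA by blast
  qed
  thus "D = A" using D inA by blast
 qed
 hence "A \<in> alcoves roots" by (simp add: alcoves_def)
 moreover have "congruent_sets A \<Omega>" unfolding congruent_sets_def by (intro exI[of _ "\<lambda>x. x + p"] conjI \<Omega>A) simp
 ultimately show ?thesis using root_system_roots by blast
qed

end

section \<open>The arrangement of a tessellation\<close>

lemma reflected_copies_trans:
 assumes "E \<in> reflected_copies D" "D \<in> reflected_copies \<Omega>"
 shows "E \<in> reflected_copies \<Omega>"
 using assms by (induction rule: reflected_copies.induct) (auto intro: reflected_copies.reflect)

lemma reflected_copies_image:
 assumes g: "isometry_map g" and D: "open D" "D \<noteq> {}" and E: "E \<in> reflected_copies D"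
 shows "g ` E \<in> reflected_copies (g ` D)"
proof -
 have "open E \<and> E \<noteq> {} \<and> g ` E \<in> reflected_copies (g ` D)"
  using E
 proof (induction rule: reflected_copies.induct)
  case start
  thus ?case using D reflected_copies.start by blast
 next
  case (reflect E M b)
  obtain L where L: "\<And>M b. g ` {x. M \<bullet> x = b} = {y. L M \<bullet> y = b + L M \<bullet> g 0}"
   "\<And>M b x. g (reflection M b x) = reflection (L M) (b + L M \<bullet> g 0) (g x)"
   by (rule isometry_map_hyperplane[OF g]) (rule that)
  have "g ` reflection M b ` E = reflection (L M) (b + L M \<bullet> g 0) ` g ` E" using L(2) by (auto simp: image_iff)
  moreover have "{x. L M \<bullet> x = b + L M \<bullet> g 0} \<in> face_hyperplanes (g ` E)"
   unfolding L(1)[symmetric] using reflect(2,3) by (intro face_hyperplanes_image_sub[OF g]) auto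
  ultimately have "g ` reflection M b ` E \<in> reflected_copies (g ` D)"
   using reflect(3) reflected_copies.reflect by metis
  thus ?case using reflect(3) isometry_map_images(4)[OF isometry_reflection] by blast
 qed
 thus ?thesis by blast
qed

lemma reflection_image_image: "M \<noteq> 0 ==> reflection M b ` reflection M b ` S = S"
 by (simp add: image_image reflection_involution)

text \<open>A reflection fixes its hyperplane, so that each step can be undone.\<close>

lemma reflected_copies_sym:
 assumes \<Omega>: "open \<Omega>" "\<Omega> \<noteq> {}" and D: "D \<in> reflected_copies \<Omega>"
 shows "\<Omega> \<in> reflected_copies D"
proof -
 have "open D \<and> D \<noteq> {} \<and> \<Omega> \<in> reflected_copies D"
  using D
 proof (induction rule: reflected_copies.induct)
  case start
  thus ?case using \<Omega> reflected_copies.start by blast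
 next
  case (reflect D M b)
  have M: "M \<noteq> 0" by (rule face_hyperplane_normal_nonzero[OF reflect(2)])
  have "reflection M b ` {x. M \<bullet> x = b} = {x. M \<bullet> x = b}" by (force simp: reflection_fixes image_iff)
  hence "{x. M \<bullet> x = b} \<in> face_hyperplanes (reflection M b ` D)"
   using face_hyperplanes_image_sub[OF isometry_reflection _ _ reflect(2), of M b] reflect(3) by simp
  from reflected_copies.reflect[OF reflected_copies.start this]
  have "D \<in> reflected_copies (reflection M b ` D)" by (simp only: reflection_image_image[OF M])
  thus ?case using reflect(3) reflected_copies_trans isometry_map_images(4)[OF isometry_reflection] by blast
 qed
 thus ?thesis by blast
qed

text \<open>Otherwise the members of \<G> cut H in hyperplanes of H, and finitely many of these do
not cover an open piece of H.\<close>

lemma hyperplane_eq_if_locally_covered: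
 fixes H :: "'a::euclidean_space set"
 assumes H: "hyperplane_in UNIV H" and z: "z \<in> H" "e > 0"
  and G: "finite \<G>" "\<And>K. K \<in> \<G> ==> hyperplane_in UNIV K" and cov: "H \<inter> ball z e \<subseteq> \<Union>\<G>"
 shows "H \<in> \<G>"
proof (rule ccontr)
 assume n: "H \<notin> \<G>"
 have aff: "affine K" "aff_dim K = DIM('a) - 1" if "hyperplane_in UNIV K" for K :: "'a set"
  using that unfolding hyperplane_in_def by (auto intro: affine_hyperplane)
 have sub: "hyperplane_in H L" if L: "L \<in> (\<lambda>K. H \<inter> K) ` \<G> - {{}}" for L
 proof -
  obtain K where K: "K \<in> \<G>" "L = H \<inter> K" "L \<noteq> {}" using L by blast
  obtain M b where M: "K = {x. M \<bullet> x = b}" using G(2)[OF K(1)] unfolding hyperplane_in_UNIV by blast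
  have "\<not> H \<subseteq> K" using affine_dim_equal[of H K] aff[OF H] aff[OF G(2)[OF K(1)]] z(1) n K(1) by auto
  hence "aff_dim L = aff_dim H - 1"
   using aff_dim_affine_Int_hyperplane[OF aff(1)[OF H], of M b] K(2,3) M by simp
  moreover have "L = {x \<in> H. M \<bullet> x = b}" using K(2) M by blast
  ultimately show ?thesis unfolding hyperplane_in_def by blast
 qed
 have "\<exists>y\<in>H. \<exists>\<eta>>0. ball y \<eta> \<subseteq> ball z e \<and> ball y \<eta> \<inter> H \<inter> \<Union>((\<lambda>K. H \<inter> K) ` \<G> - {{}}) = {}"
  by (rule avoid_finite_hyperplanes[OF aff(1)[OF H] _ _ z]) (use G(1) sub in auto)
 then obtain y \<eta> where y: "y \<in> H" "\<eta> > 0" "ball y \<eta> \<subseteq> ball z e" "ball y \<eta> \<inter> H \<inter> \<Union>((\<lambda>K. H \<inter> K) ` \<G> - {{}}) = {}"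
  by (elim bexE exE conjE)
 have "y \<in> ball y \<eta>" using y(2) by simp
 then obtain K where "K \<in> \<G>" "y \<in> K" using cov y(1,3) by blast
 thus False using y(1,4) \<open>y \<in> ball y \<eta>\<close> by blast
qed

text \<open>Being a reflected copy is an equivalence relation, so the arrangement \<H> of all face
hyperplanes is invariant under the reflections in its members. It is locally finite: a piece of a
hyperplane H of \<H> in a ball enters no copy, so it is covered by the boundaries of the finitely
many copies that meet the ball, and H is one of the finitely many hyperplanes that contain these
boundaries.\<close>

theorem alcove_if_strictly_tessellates:
 fixes \<Omega> :: "'a::euclidean_space set"
 assumes \<Omega>: "\<Omega> \<in> wp DIM('a)" and tess: "strictly_tessellates \<Omega>"
 shows "\<exists>R A. root_system R \<and> A \<in> alcoves R \<and> congruent_sets A \<Omega>"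
proof -
 note o = wp_open[OF \<Omega>]
 define \<T> where "\<T> = reflected_copies \<Omega>"
 define \<H> where "\<H> = (\<Union>D\<in>\<T>. face_hyperplanes D)"
 obtain E :: "int => 'a set" where E: "range E = \<T>" "(\<Union>j. closure (E j)) = UNIV" "\<And>j. congruent_sets \<Omega> (E j)"
  "\<And>j k H. H \<in> face_hyperplanes (E j) ==> H \<inter> interior (E k) = {}"
  using tess unfolding strictly_tessellates_def \<T>_def[symmetric] by (elim exE conjE) blast
 have idx: "\<exists>j. D = E j" if "D \<in> \<T>" for D using that unfolding E(1)[symmetric] by blast
 have tessT: "\<exists>D\<in>\<T>. x \<in> closure D" "D \<in> \<T> ==> congruent_sets \<Omega> D"
  "D \<in> \<T> ==> D' \<in> \<T> ==> H \<in> face_hyperplanes D ==> H \<inter> interior D' = {}" for x D D' H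
 proof -
  have "x \<in> (\<Union>j. closure (E j))" unfolding E(2) by (rule UNIV_I)
  thus "\<exists>D\<in>\<T>. x \<in> closure D" unfolding E(1)[symmetric] by blast
  show "congruent_sets \<Omega> D" if "D \<in> \<T>" using idx[OF that] E(3) by blast
  show "H \<inter> interior D' = {}" if D: "D \<in> \<T>" "D' \<in> \<T>" "H \<in> face_hyperplanes D"
  proof -
   obtain j k where "D = E j" "D' = E k" using idx[OF D(1)] idx[OF D(2)] by blast
   thus ?thesis using E(4) D(3) by simp
  qed
 qed
 have iso: "\<exists>g. isometry_map g \<and> D = g ` \<Omega>" if "D \<in> \<T>" for D
  using tessT(2)[OF that] unfolding congruent_sets_def isometry_map_def by blast
 have tile: "open D \<and> connected D \<and> D \<noteq> {} \<and> D \<in> wp DIM('a)" if D: "D \<in> \<T>" for D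
 proof -
  obtain g where g: "isometry_map g" "D = g ` \<Omega>" using iso[OF D] by blast
  show ?thesis unfolding g(2) using o \<Omega> isometry_map_images(4-6)[OF g(1)] by auto
 qed
 have "\<forall>D. \<exists>\<C>. D \<in> \<T> --> finite \<C> \<and> \<C> \<subseteq> face_hyperplanes D \<and> frontier D \<subseteq> \<Union>\<C>"
 proof
  fix D
  show "\<exists>\<C>. D \<in> \<T> --> finite \<C> \<and> \<C> \<subseteq> face_hyperplanes D \<and> frontier D \<subseteq> \<Union>\<C>"
  proof (cases "D \<in> \<T>")
   case True
   have "D \<in> wp DIM('a)" using tile[OF True] by blast
   then obtain \<P> where "face_decomposition (wp (DIM('a) - 1)) D \<P>" using wp_open(5) by blast
   then obtain \<C> where "finite \<C>" "\<C> \<subseteq> face_hyperplanes D" "frontier D \<subseteq> \<Union>\<C>"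
    using face_hyperplanes_cover[of D] tile[OF True] by metis
   thus ?thesis by blast
  qed blast
 qed
 from choice[OF this] obtain \<C> where \<C>': "\<forall>D. D \<in> \<T> --> finite (\<C> D) \<and> \<C> D \<subseteq> face_hyperplanes D \<and> frontier D \<subseteq> \<Union>(\<C> D)" ..
 have \<C>: "finite (\<C> D)" "\<C> D \<subseteq> face_hyperplanes D" "frontier D \<subseteq> \<Union>(\<C> D)" if "D \<in> \<T>" for D
  using \<C>'[rule_format, OF that] by simp_all
 have hyp: "hyperplane_in UNIV H" if "H \<in> face_hyperplanes D" for H and D :: "'a set"
  using that unfolding face_hyperplanes_def by blast
 have avoid: "H \<inter> E = {}" if "H \<in> \<H>" "E \<in> \<T>" for H E
  using that tessT(3) tile[OF that(2)] interior_open[of E] unfolding \<H>_def by blast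
 have frH: "frontier D \<subseteq> \<Union>\<H>" if D: "D \<in> \<T>" for D
 proof -
  have "face_hyperplanes D \<subseteq> \<H>" unfolding \<H>_def using D by (rule UN_upper)
  thus ?thesis using order_trans[OF \<C>(3)[OF D] Union_mono[OF order_trans[OF \<C>(2)[OF D]]]] by simp
 qed
 have frT: "D \<inter> frontier E = {}" if D: "D \<in> \<T>" and E: "E \<in> \<T>" for D E
 proof (rule equals0I)
  fix x assume x: "x \<in> D \<inter> frontier E"
  then obtain H where "H \<in> \<H>" "x \<in> H" using frH[OF E] by blast
  thus False using avoid[OF _ D] x by blast
 qed
 have disj: "D = E" if "D \<in> \<T>" "E \<in> \<T>" "D \<inter> E \<noteq> {}" for D E
  using open_connected_disjoint_or_equal[OF _ _ that(3) frT[OF that(1,2)] frT[OF that(2,1)]] tile that(1,2) by simp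
 have \<Omega>T: "\<Omega> \<in> \<T>" unfolding \<T>_def by (rule reflected_copies.start)
 have refl: "reflection M b ` H \<in> \<H>" if M: "{x. M \<bullet> x = b} \<in> \<H>" and H: "H \<in> \<H>" for M b H
 proof -
  obtain D where D: "D \<in> \<T>" "{x. M \<bullet> x = b} \<in> face_hyperplanes D" using M by (auto simp: \<H>_def)
  obtain E where E: "E \<in> \<T>" "H \<in> face_hyperplanes E" using H by (auto simp: \<H>_def)
  have "reflection M b ` D \<in> \<T>" using reflected_copies.reflect D unfolding \<T>_def by blast
  moreover have "E \<in> reflected_copies D"
   using reflected_copies_trans reflected_copies_sym[OF o(1,4)] D(1) E(1) unfolding \<T>_def by blast
  ultimately have "reflection M b ` E \<in> \<T>"
   using reflected_copies_image[OF isometry_reflection] reflected_copies_trans tile[OF D(1)] unfolding \<T>_def by metis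
  moreover have "reflection M b ` H \<in> face_hyperplanes (reflection M b ` E)"
   using face_hyperplanes_image_sub[OF isometry_reflection _ _ E(2)] tile[OF E(1)] by blast
  ultimately show ?thesis by (auto simp: \<H>_def)
 qed
 have sym: "\<exists>g. isometry_map g \<and> D = g ` \<Omega> \<and> (\<forall>H. g ` H \<in> \<H> \<longleftrightarrow> H \<in> \<H>)" if "D \<in> \<T>" for D
  using that unfolding \<T>_def
 proof (induction rule: reflected_copies.induct)
  case start
  show ?case by (rule exI[of _ id]) (simp add: isometry_map_def)
 next
  case (reflect D M b)
  then obtain g where g: "isometry_map g" "D = g ` \<Omega>" "\<And>H. g ` H \<in> \<H> \<longleftrightarrow> H \<in> \<H>" by blast
  have M: "M \<noteq> 0" by (rule face_hyperplane_normal_nonzero[OF reflect(2)])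
  have MH: "{x. M \<bullet> x = b} \<in> \<H>" using reflect(1,2) by (auto simp: \<H>_def \<T>_def)
  have "reflection M b ` H \<in> \<H> \<longleftrightarrow> H \<in> \<H>" for H
   using refl[OF MH, of H] refl[OF MH, of "reflection M b ` H"] unfolding reflection_image_image[OF M] by blast
  hence "(reflection M b \<circ> g) ` H \<in> \<H> \<longleftrightarrow> H \<in> \<H>" for H by (simp only: image_comp[symmetric] g(3))
  moreover have "reflection M b ` D = (reflection M b \<circ> g) ` \<Omega>" by (simp add: g(2) image_comp)
  ultimately show ?case using isometry_map_compose[OF isometry_reflection g(1)] by blast
 qed
 interpret cocompact_arrangement \<H> "closure \<Omega>" \<Omega>
 proof
  show "hyperplane_in UNIV H" if "H \<in> \<H>" for H using that hyp unfolding \<H>_def by blast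
  show "reflection M b ` H \<in> \<H>" if "{x. M \<bullet> x = b} \<in> \<H>" "H \<in> \<H>" for M b H using refl that .
  show "bounded (closure \<Omega>)" "bounded \<Omega>" using o(3) by auto
  show "\<Omega> \<in> components (- \<Union>\<H>)"
   unfolding in_components_maximal
  proof (intro conjI allI impI)
   show "\<Omega> \<subseteq> - \<Union>\<H>" using avoid[OF _ \<Omega>T] by blast
   fix D assume D: "D \<noteq> {} \<and> \<Omega> \<subseteq> D \<and> D \<subseteq> - \<Union>\<H> \<and> connected D"
   have "D \<inter> frontier \<Omega> = {}" using D frH[OF \<Omega>T] by blast
   thus "D = \<Omega>" using connected_Int_frontier[of D \<Omega>] D o(4) by blast
  qed (use o in auto)
  show "\<exists>g. isometry_map g \<and> g x \<in> closure \<Omega> \<and> (\<forall>H. g ` H \<in> \<H> \<longleftrightarrow> H \<in> \<H>)" for x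
  proof -
   obtain D where D: "D \<in> \<T>" "x \<in> closure D" using tessT(1) by blast
   obtain g where g: "isometry_map g" "D = g ` \<Omega>" "\<And>H. g ` H \<in> \<H> \<longleftrightarrow> H \<in> \<H>" using sym[OF D(1)] by blast
   note bij = isometry_map_bij[OF g(1)]
   have "inv g x \<in> closure \<Omega>"
    using D(2) unfolding g(2) isometry_map_images(1)[OF g(1)] using bij by (auto simp: bij_is_inj)
   moreover have "inv g ` H \<in> \<H> \<longleftrightarrow> H \<in> \<H>" for H
    using g(3)[of "inv g ` H"] bij by (simp add: bij_is_surj image_f_inv_f)
   ultimately show ?thesis using isometry_map_inv[OF g(1)] by blast
  qed
  show "finite {H \<in> \<H>. H \<inter> cball x r \<noteq> {}}" for x r
  proof -
   define F where "F = {D \<in> \<T>. D \<inter> cball x (r + 1) \<noteq> {}}"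
   have "finite F" unfolding F_def by (rule finite_tiles_meeting_ball[OF o(1,3,4) iso disj])
   hence fin: "finite (\<Union>(\<C> ` F))" using \<C>(1) by (auto simp: F_def)
   have "{H \<in> \<H>. H \<inter> cball x r \<noteq> {}} \<subseteq> \<Union>(\<C> ` F)"
   proof
    fix H assume "H \<in> {H \<in> \<H>. H \<inter> cball x r \<noteq> {}}"
    then obtain z where z: "H \<in> \<H>" "z \<in> H" "dist x z \<le> r" by auto
    show "H \<in> \<Union>(\<C> ` F)"
    proof (rule hyperplane_eq_if_locally_covered[OF _ z(2) zero_less_one fin])
     show "hyperplane_in UNIV H" using z(1) hyp unfolding \<H>_def by blast
     show "hyperplane_in UNIV K" if "K \<in> \<Union>(\<C> ` F)" for K using that \<C>(2) hyp unfolding F_def by blast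
     show "H \<inter> ball z 1 \<subseteq> \<Union>(\<Union>(\<C> ` F))"
     proof
      fix y assume y: "y \<in> H \<inter> ball z 1"
      obtain D where D: "D \<in> \<T>" "y \<in> closure D" using tessT(1) by blast
      have "y \<notin> D" using avoid[OF z(1) D(1)] y by blast
      hence "y \<in> frontier D" using D tile[OF D(1)] by (simp add: frontier_def interior_open)
      hence "y \<in> \<Union>(\<C> D)" using \<C>(3)[OF D(1)] by blast
      moreover have "y \<in> ball x (r + 1)" using z(3) y dist_triangle[of x y z] by auto
      hence "ball x (r + 1) \<inter> D \<noteq> {}" using D(2) open_Int_closure_eq_empty[OF open_ball] by blast
      hence "D \<in> F" using D(1) ball_subset_cball[of x "r + 1"] unfolding F_def by blast
      ultimately show "y \<in> \<Union>(\<Union>(\<C> ` F))" by blast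
     qed
    qed
   qed
   thus ?thesis using fin by (rule finite_subset)
  qed
 qed
 show ?thesis by (rule congruent_to_alcove)
qed

section \<open>Trigonometric functions\<close>

text \<open>The product of the exponential series, one for each coordinate.\<close>

lemma has_sum_multi_exp:
 fixes z :: "'n::finite => complex"
 shows "((\<lambda>\<alpha>. \<Prod>i\<in>UNIV. z i ^ \<alpha> i /\<^sub>R fact (\<alpha> i)) has_sum exp (\<Sum>i\<in>UNIV. z i)) UNIV"
proof -
 define f where "f i k = z i ^ k /\<^sub>R fact k" for i k
 have sm: "summable (\<lambda>k. norm (f i k))" for i unfolding f_def by (rule summable_norm_exp)
 have hs: "(f i has_sum exp (z i)) UNIV" for i
  by (rule norm_summable_imp_has_sum[OF sm]) (unfold f_def, rule exp_converges)
 have ab: "(\<lambda>k. norm (f i k)) summable_on UNIV" for i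
  using norm_summable_imp_summable_on[of "\<lambda>k. norm (f i k)"] sm by simp
 have U: "(UNIV :: ('n => nat) set) = PiE UNIV (\<lambda>_. UNIV)" by (auto simp: PiE_def)
 have "(\<lambda>\<alpha>. norm (\<Prod>i\<in>UNIV. f i (\<alpha> i))) summable_on UNIV"
 proof (rule nonneg_bdd_above_summable_on)
  show "bdd_above (sum (\<lambda>\<alpha>. norm (\<Prod>i\<in>UNIV. f i (\<alpha> i))) ` {F. F \<subseteq> UNIV \<and> finite F})"
  proof (rule bdd_aboveI2)
   fix F :: "('n => nat) set" assume "F \<in> {F. F \<subseteq> UNIV \<and> finite F}"
   hence F: "finite F" by simp
   define k where "k = (\<Sum>\<alpha>\<in>F. \<Sum>i\<in>UNIV. \<alpha> i)"
   have "F \<subseteq> PiE UNIV (\<lambda>_. {..k})"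
   proof
    fix \<alpha> assume \<alpha>: "\<alpha> \<in> F"
    have "\<alpha> i \<le> k" for i
    proof -
     have "\<alpha> i \<le> (\<Sum>i\<in>UNIV. \<alpha> i)" by (rule member_le_sum) auto
     also have "... \<le> k" unfolding k_def using \<alpha> F by (intro member_le_sum) auto
     finally show ?thesis .
    qed
    thus "\<alpha> \<in> PiE UNIV (\<lambda>_. {..k})" by auto
   qed
   hence "(\<Sum>\<alpha>\<in>F. norm (\<Prod>i\<in>UNIV. f i (\<alpha> i))) \<le> (\<Sum>\<alpha>\<in>PiE UNIV (\<lambda>_. {..k}). \<Prod>i\<in>UNIV. norm (f i (\<alpha> i)))"
    unfolding prod_norm by (intro sum_mono2 finite_PiE) auto
   also have "... = (\<Prod>i\<in>UNIV. \<Sum>j\<le>k. norm (f i j))" by (subst prod_sum_PiE) auto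
   also have "... \<le> (\<Prod>i\<in>UNIV. \<Sum>j. norm (f i j))" by (intro prod_mono conjI sum_nonneg sum_le_suminf sm) auto
   finally show "(\<Sum>\<alpha>\<in>F. norm (\<Prod>i\<in>UNIV. f i (\<alpha> i))) \<le> (\<Prod>i\<in>UNIV. \<Sum>j. norm (f i j))" .
  qed
 qed simp
 hence "((\<lambda>\<alpha>. \<Prod>i\<in>UNIV. f i (\<alpha> i)) has_sum infsum (\<lambda>\<alpha>. \<Prod>i\<in>UNIV. f i (\<alpha> i)) UNIV) UNIV"
  by (rule has_sum_infsum[OF abs_summable_summable])
 moreover have "infsum (\<lambda>\<alpha>. \<Prod>i\<in>UNIV. f i (\<alpha> i)) UNIV = exp (\<Sum>i\<in>UNIV. z i)"
  unfolding U by (subst infsum_prod_PiE_abs) (use ab infsumI[OF hs] in "auto simp: exp_sum")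
 ultimately show ?thesis by (simp only: f_def)
qed

lemma analytic_cos:
 fixes m :: "real^'n"
 shows "real_analytic_on S (\<lambda>x. cos (m \<bullet> x + c))"
 unfolding real_analytic_on_iff
proof
 fix x
 define K where "K = exp (\<i> * of_real (m \<bullet> x + c))"
 define a where "a \<alpha> = Re (K * (\<Prod>i\<in>UNIV. (\<i> * of_real (m $ i)) ^ \<alpha> i /\<^sub>R fact (\<alpha> i)))" for \<alpha> :: "'n => nat"
 have "((\<lambda>\<alpha>. a \<alpha> * multi_power (y - x) \<alpha>) has_sum cos (m \<bullet> y + c)) UNIV" for y
 proof -
  define z where "z i = \<i> * of_real (m $ i) * of_real ((y - x) $ i)" for i
  have "(\<Prod>i\<in>UNIV. z i ^ \<alpha> i /\<^sub>R fact (\<alpha> i)) = (\<Prod>i\<in>UNIV. (\<i> * of_real (m $ i)) ^ \<alpha> i /\<^sub>R fact (\<alpha> i)) * of_real (multi_power (y - x) \<alpha>)" for \<alpha>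
   unfolding z_def multi_power_def of_real_prod prod.distrib[symmetric] by (simp add: power_mult_distrib)
  hence 1: "Re (K * (\<Prod>i\<in>UNIV. z i ^ \<alpha> i /\<^sub>R fact (\<alpha> i))) = a \<alpha> * multi_power (y - x) \<alpha>" for \<alpha>
   by (simp only: a_def mult.assoc[symmetric] Re_complex_of_real times_complex.sel Im_complex_of_real)
  have "(\<Sum>i\<in>UNIV. z i) = \<i> * of_real (m \<bullet> (y - x))"
   by (simp add: z_def inner_vec_def sum_distrib_left mult.assoc)
  hence "K * exp (\<Sum>i\<in>UNIV. z i) = exp (\<i> * of_real (m \<bullet> x + c) + \<i> * of_real (m \<bullet> (y - x)))"
   by (simp only: K_def exp_add)
  also have "\<i> * of_real (m \<bullet> x + c) + \<i> * of_real (m \<bullet> (y - x)) = \<i> * of_real (m \<bullet> y + c)"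
   by (simp add: inner_diff_right algebra_simps)
  finally have "K * exp (\<Sum>i\<in>UNIV. z i) = exp (\<i> * of_real (m \<bullet> y + c))" .
  hence "Re (K * exp (\<Sum>i\<in>UNIV. z i)) = cos (m \<bullet> y + c)" by (simp add: Re_exp)
  moreover have "((\<lambda>\<alpha>. Re (K * (\<Prod>i\<in>UNIV. z i ^ \<alpha> i /\<^sub>R fact (\<alpha> i)))) has_sum Re (K * exp (\<Sum>i\<in>UNIV. z i))) UNIV"
   by (intro has_sum_Re has_sum_cmult_right has_sum_multi_exp)
  ultimately show ?thesis unfolding 1 by simp
 qed
 thus "\<exists>a r. has_power_series (\<lambda>x. cos (m \<bullet> x + c)) x a r"
  unfolding has_power_series_def by (intro exI[of _ a] exI[of _ 1]) auto
qed

text \<open>Induction with \<open>2 * cos s * sin t = sin (s + t) - sin (s - t)\<close>, where sin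
is cos with its phase shifted by \<open>pi / 2\<close>.\<close>

lemma prod_sin_expansion:
 fixes \<theta> :: "'a => real"
 assumes "finite A"
 shows "(\<Prod>v\<in>A. sin (\<theta> v)) =
  (1 / 2) ^ card A * (\<Sum>T\<in>Pow A. (- 1) ^ card T * cos (sum \<theta> A - 2 * sum \<theta> T - real (card A) * (pi / 2)))"
 using assms
proof (induction A rule: finite_induct)
 case (insert v A)
 define X where "X T = sum \<theta> A - 2 * sum \<theta> T - real (card A) * (pi / 2)" for T
 let ?g = "\<lambda>T. (- 1) ^ card T * cos (sum \<theta> (insert v A) - 2 * sum \<theta> T - real (card (insert v A)) * (pi / 2))"
 have dj: "Pow A \<inter> insert v ` Pow A = {}" using insert(2) by auto
 have inj: "inj_on (insert v) (Pow A)" using insert(2) by (auto simp: inj_on_def)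
 have fT: "finite T" "v \<notin> T" if "T \<in> Pow A" for T using that insert(1,2) finite_subset by auto
 have "(\<Sum>T\<in>Pow (insert v A). ?g T) = (\<Sum>T\<in>Pow A. ?g T) + (\<Sum>T\<in>Pow A. ?g (insert v T))"
  unfolding Pow_insert using insert(1) dj inj by (subst sum.union_disjoint) (auto simp: sum.reindex)
 also have "... = (\<Sum>T\<in>Pow A. 2 * ((- 1) ^ card T * cos (X T)) * sin (\<theta> v))"
  unfolding sum.distrib[symmetric]
 proof (rule sum.cong[OF refl])
  fix T assume T: "T \<in> Pow A"
  have c: "cos (t - pi / 2) = sin t" for t by (simp add: cos_diff)
  have "?g T = (- 1) ^ card T * cos (X T + \<theta> v - pi / 2)"
   using insert(1,2) by (simp add: X_def algebra_simps add_divide_distrib)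
  moreover have "?g (insert v T) = - ((- 1) ^ card T * cos (X T - \<theta> v - pi / 2))"
   using insert(1,2) fT[OF T] by (simp add: X_def algebra_simps add_divide_distrib)
  ultimately show "?g T + ?g (insert v T) = 2 * ((- 1) ^ card T * cos (X T)) * sin (\<theta> v)"
   unfolding c sin_add sin_diff by (simp add: algebra_simps)
 qed
 also have "... = 2 * (\<Sum>T\<in>Pow A. (- 1) ^ card T * cos (X T)) * sin (\<theta> v)"
  by (simp only: sum_distrib_left sum_distrib_right)
 finally show ?case using insert(1,2) unfolding prod.insert[OF insert(1,2)] insert(3) X_def by simp
qed simp

section \<open>The Weyl denominator\<close>

lemma linear_reflection0: "linear (reflection a 0)"
 by (rule linearI) (simp_all add: reflection_def inner_add_right algebra_simps add_divide_distrib scaleR_add_left)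

text \<open>For the set of positive roots this is the Weyl vector.\<close>

definition half_sum :: "'a::euclidean_space set => 'a" where "half_sum P = (1 / 2) *\<^sub>R \<Sum>P"

text \<open>The coefficient of the formal exponential of \<mu> in the Weyl denominator, the
product of \<open>exp (v / 2) - exp (- v / 2)\<close> over v in P.\<close>

definition net_sign :: "'a::euclidean_space set => 'a => real" where
 "net_sign P \<mu> = (\<Sum>T\<in>{T \<in> Pow P. half_sum P - \<Sum>T = \<mu>}. (- 1) ^ card T)"

context
 fixes R P :: "'a::euclidean_space set" and \<phi> :: 'a
 assumes R: "root_system R" and g: "generic_for \<phi> R" and P_def: "P = positive_roots \<phi> R"
begin

lemma finite_positive: "finite P"
 using root_systemD(1)[OF R] by (simp add: P_def positive_roots_def)

context
 fixes a assumes a: "a \<in> simple_roots \<phi> R"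
begin

lemma simple_facts: "a \<in> P" "a \<in> R" "a \<noteq> 0" "\<phi> \<bullet> a > 0"
 using a root_systemD(2)[OF R] by (auto simp: simple_roots_def P_def positive_roots_def)

lemma simple_reflection_involution: "reflection a 0 (reflection a 0 x) = x"
 by (rule reflection_involution[OF simple_facts(3)])

lemma simple_reflection_self: "reflection a 0 a = - a"
 using simple_facts(3) by (simp add: reflection_def power2_norm_eq_inner scaleR_2)

lemma simple_reflection_inj: "inj_on (reflection a 0) S"
 by (rule inj_on_inverseI[of _ "reflection a 0"]) (rule simple_reflection_involution)

lemma simple_reflection_permutes: "reflection a 0 ` (P - {a}) = P - {a}"
proof
 have pos: "reflection a 0 v \<in> P - {a}" if "v \<in> P - {a}" for v
  using simple_reflection_positive[OF R g a, folded P_def, of v] that by simp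
 thus "reflection a 0 ` (P - {a}) \<subseteq> P - {a}" by (rule image_subsetI)
 show "P - {a} \<subseteq> reflection a 0 ` (P - {a})"
 proof
  fix v assume "v \<in> P - {a}"
  from imageI[OF pos[OF this], of "reflection a 0"] show "v \<in> reflection a 0 ` (P - {a})"
   unfolding simple_reflection_involution .
 qed
qed

lemma reflection_sum: "reflection a 0 (\<Sum>T) = \<Sum>(reflection a 0 ` T)"
 using linear_sum[OF linear_reflection0, of a id T] by (simp add: sum.reindex[OF simple_reflection_inj])

lemma reflection_half_sum: "reflection a 0 (half_sum P) = half_sum P - a"
proof -
 have s: "\<Sum>P = a + \<Sum>(P - {a})" using simple_facts(1) finite_positive by (simp add: sum.remove)
 have "reflection a 0 (\<Sum>P) = \<Sum>P - 2 *\<^sub>R a"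
  unfolding s linear_add[OF linear_reflection0] reflection_sum simple_reflection_permutes simple_reflection_self
  by (simp add: scaleR_2)
 thus ?thesis unfolding half_sum_def linear_scale[OF linear_reflection0] by (simp add: scaleR_diff_right)
qed

text \<open>What the reflection in the simple root a does to the terms of the expanded product: it
permutes the other positive roots and exchanges the two exponentials that belong to a.\<close>

definition switch :: "'a set => 'a set" where
 "switch T = reflection a 0 ` (T - {a}) \<union> (if a \<in> T then {} else {a})"

lemma switch:
 assumes "T \<subseteq> P"
 shows "switch T \<subseteq> P" "switch (switch T) = T" "(- 1 :: real) ^ card (switch T) = - ((- 1) ^ card T)"
  "half_sum P - \<Sum>(switch T) = reflection a 0 (half_sum P - \<Sum>T)"
proof -
 have fT: "finite T" using assms finite_positive finite_subset by blast
 have sub: "reflection a 0 ` (T - {a}) \<subseteq> P - {a}"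
  using image_mono[of "T - {a}" "P - {a}" "reflection a 0"] assms unfolding simple_reflection_permutes by blast
 thus "switch T \<subseteq> P" using simple_facts(1) by (auto simp: switch_def)
 have na: "a \<notin> reflection a 0 ` (T - {a})" using sub by blast
 have "(A \<union> (if a \<in> T then {} else {a})) - {a} = A" "a \<in> A \<union> (if a \<in> T then {} else {a}) \<longleftrightarrow> a \<notin> T"
  if "a \<notin> A" for A using that by auto
 from this[OF na] have "switch T - {a} = reflection a 0 ` (T - {a})" "a \<in> switch T \<longleftrightarrow> a \<notin> T"
  unfolding switch_def by simp_all
 hence "switch (switch T) = reflection a 0 ` reflection a 0 ` (T - {a}) \<union> (if a \<in> T then {a} else {})"
  unfolding switch_def[of "switch T"] by simp
 also have "... = T" unfolding reflection_image_image[OF simple_facts(3)] by auto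
 finally show "switch (switch T) = T" .
 have c: "card (reflection a 0 ` (T - {a})) = card (T - {a})" by (rule card_image[OF simple_reflection_inj])
 have l: "reflection a 0 (half_sum P - \<Sum>T) = half_sum P - a - reflection a 0 (\<Sum>T)"
  unfolding linear_diff[OF linear_reflection0] reflection_half_sum ..
 have e: "\<Sum>(reflection a 0 ` (T - {a})) = reflection a 0 (\<Sum>(T - {a}))" by (rule reflection_sum[symmetric])
 show "(- 1 :: real) ^ card (switch T) = - ((- 1) ^ card T)"
 proof (cases "a \<in> T")
  case True
  hence "card T = Suc (card (switch T))"
   using card_Suc_Diff1[OF fT True] c by (simp add: switch_def del: card_Diff_insert)
  thus ?thesis by simp
 next
  case False
  thus ?thesis using c na fT by (simp add: switch_def)
 qed
 show "half_sum P - \<Sum>(switch T) = reflection a 0 (half_sum P - \<Sum>T)"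
 proof (cases "a \<in> T")
  case True
  hence "\<Sum>T = a + \<Sum>(T - {a})" using fT by (simp add: sum.remove)
  hence "reflection a 0 (\<Sum>T) = - a + reflection a 0 (\<Sum>(T - {a}))"
   by (simp only: linear_add[OF linear_reflection0] simple_reflection_self)
  thus ?thesis using True unfolding l by (simp add: switch_def e)
 next
  case False
  hence "switch T = insert a (reflection a 0 ` T)" "a \<notin> reflection a 0 ` T" using na by (auto simp: switch_def)
  thus ?thesis unfolding l using fT by (simp add: reflection_sum)
 qed
qed

lemma net_sign_reflection: "net_sign P (reflection a 0 \<mu>) = - net_sign P \<mu>"
proof -
 have mem: "switch T \<in> {T \<in> Pow P. half_sum P - \<Sum>T = reflection a 0 \<mu>}"
  if "T \<in> {T \<in> Pow P. half_sum P - \<Sum>T = \<mu>}" for T \<mu>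
  using that switch(1,4) by auto
 have "net_sign P (reflection a 0 \<mu>) = (\<Sum>T\<in>{T \<in> Pow P. half_sum P - \<Sum>T = \<mu>}. - ((- 1) ^ card T))"
  unfolding net_sign_def
 proof (rule sum.reindex_bij_witness[of _ switch switch])
  show "switch T \<in> {T \<in> Pow P. half_sum P - \<Sum>T = \<mu>}" if "T \<in> {T \<in> Pow P. half_sum P - \<Sum>T = reflection a 0 \<mu>}" for T
   using mem[OF that] unfolding simple_reflection_involution .
 qed (use mem switch in auto)
 thus ?thesis by (simp add: sum_negf net_sign_def)
qed

end

text \<open>Among the frequencies of the given norm with nonzero coefficient take one, \<mu>, for
which \<open>\<phi> \<bullet> \<mu>\<close> is largest. The choice gives \<open>n \<mu> \<ge>
0\<close> for each simple root, and \<open>n \<mu> = 0\<close> is excluded because the coefficient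
would equal its negative. Since n is 1 at the Weyl vector and an integer at
\<open>\<Sum>T\<close>, it follows that \<open>n (\<Sum>T) \<le> 0\<close>. Hence
\<open>\<Sum>T\<close> has no positive inner product with a positive root, in particular not with
itself, and \<mu> is the Weyl vector.\<close>

lemma norm_of_net_sign_nonzero:
 assumes nz: "net_sign P \<mu>0 \<noteq> 0"
 shows "norm \<mu>0 = norm (half_sum P)"
proof -
 define S where "S = {\<mu>. net_sign P \<mu> \<noteq> 0 \<and> norm \<mu> = norm \<mu>0}"
 have ex: "\<exists>T\<subseteq>P. \<mu> = half_sum P - \<Sum>T" if n: "net_sign P \<mu> \<noteq> 0" for \<mu>
 proof (rule ccontr)
  assume "\<not> ?thesis"
  hence e: "{T \<in> Pow P. half_sum P - \<Sum>T = \<mu>} = {}" by blast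
  show False using n unfolding net_sign_def e by simp
 qed
 have "finite S"
 proof (rule finite_subset)
  show "S \<subseteq> (\<lambda>T. half_sum P - \<Sum>T) ` Pow P" using ex by (auto simp: S_def)
 qed (simp add: finite_positive)
 moreover have "S \<noteq> {}" using nz by (auto simp: S_def)
 ultimately have "Max ((\<bullet>) \<phi> ` S) \<in> (\<bullet>) \<phi> ` S" by (intro Max_in) auto
 then obtain \<mu> where \<mu>: "\<mu> \<in> S" "\<phi> \<bullet> \<mu> = Max ((\<bullet>) \<phi> ` S)" by auto
 hence mx: "\<phi> \<bullet> \<nu> \<le> \<phi> \<bullet> \<mu>" if "\<nu> \<in> S" for \<nu> using that \<open>finite S\<close> by simp
 have n\<mu>: "net_sign P \<mu> \<noteq> 0" "norm \<mu> = norm \<mu>0" using \<mu>(1) by (auto simp: S_def)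
 obtain T where T: "T \<subseteq> P" "\<mu> = half_sum P - \<Sum>T" using ex[OF n\<mu>(1)] by blast
 have simple: "a \<bullet> \<Sum>T \<le> 0" if a: "a \<in> simple_roots \<phi> R" for a
 proof -
  note sf = simple_facts[OF a]
  have aa: "a \<bullet> a > 0" using sf(3) by simp
  define n where "n x = 2 * (a \<bullet> x) / (a \<bullet> a)" for x
  have refl: "reflection a 0 x = x - n x *\<^sub>R a" for x by (simp add: reflection_def n_def power2_norm_eq_inner)
  have "isometry_map (reflection a 0)" by (rule isometry_reflection)
  moreover have "reflection a 0 0 = 0" by (simp add: reflection_def)
  ultimately have "norm (reflection a 0 \<mu>) = norm \<mu>" unfolding isometry_map_def by (metis dist_0_norm)
  hence "reflection a 0 \<mu> \<in> S" using n\<mu> net_sign_reflection[OF a, of \<mu>] by (simp add: S_def)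
  from mx[OF this] have "n \<mu> * (\<phi> \<bullet> a) \<ge> 0" by (simp add: refl inner_diff_right)
  hence "n \<mu> \<ge> 0" using sf(4) by (simp add: zero_le_mult_iff)
  moreover have "n \<mu> \<noteq> 0"
  proof
   assume "n \<mu> = 0"
   hence "reflection a 0 \<mu> = \<mu>" by (simp add: refl)
   thus False using net_sign_reflection[OF a, of \<mu>] n\<mu>(1) by simp
  qed
  ultimately have pos: "n \<mu> > 0" by simp
  have "n (half_sum P) *\<^sub>R a = 1 *\<^sub>R a" using reflection_half_sum[OF a] by (simp add: refl)
  hence "n (half_sum P) = 1" using sf(3) scaleR_cancel_right by blast
  moreover have "n \<mu> = n (half_sum P) - n (\<Sum>T)"
   unfolding T(2) n_def inner_diff_right right_diff_distrib diff_divide_distrib ..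
  ultimately have eq: "n \<mu> = 1 - n (\<Sum>T)" by simp
  have "n (\<Sum>T) = (\<Sum>v\<in>T. n v)" by (simp add: n_def inner_sum_right sum_distrib_left sum_divide_distrib)
  also have "... \<in> \<int>" using root_systemD(6)[OF R sf(2)] T(1) by (intro Ints_sum) (auto simp: n_def P_def positive_roots_def)
  finally obtain k where "n (\<Sum>T) = of_int k" by (rule Ints_cases)
  hence "n (\<Sum>T) \<le> 0" using pos eq by simp
  thus ?thesis using aa by (simp add: n_def divide_le_0_iff)
 qed
 have "v \<bullet> \<Sum>T \<le> 0" if "v \<in> P" for v
  using R that[unfolded P_def] by (induction rule: positive_root_induct) (use simple in "auto simp: inner_add_left")
 hence "\<Sum>T \<bullet> \<Sum>T \<le> 0" unfolding inner_sum_left[of _ T] using T(1) by (intro sum_nonpos) auto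
 hence "\<Sum>T = 0" by (metis inner_ge_zero inner_eq_zero_iff antisym)
 thus ?thesis using T(2) n\<mu>(2) by simp
qed

text \<open>The terms of \<open>prod_sin_expansion\<close> are collected by frequency; those of a
length different from that of the Weyl vector cancel.\<close>

lemma prod_sin_equal_frequencies:
 obtains \<Lambda> A c r where "finite \<Lambda>" "\<And>\<mu>. \<mu> \<in> \<Lambda> ==> norm \<mu> = r"
  "\<And>x. (\<Prod>v\<in>P. sin (pi * (v \<bullet> x))) = (\<Sum>\<mu>\<in>\<Lambda>. A \<mu> * cos (2 * pi * (\<mu> \<bullet> x) + c))"
proof -
 define l where "l T = half_sum P - \<Sum>T" for T
 define c where "c = - (real (card P) * (pi / 2))"
 define \<Lambda> where "\<Lambda> = {\<mu> \<in> l ` Pow P. net_sign P \<mu> \<noteq> 0}"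
 have fin: "finite (Pow P)" using finite_positive by simp
 have e: "(\<Prod>v\<in>P. sin (pi * (v \<bullet> x))) = (\<Sum>\<mu>\<in>\<Lambda>. ((1 / 2) ^ card P * net_sign P \<mu>) * cos (2 * pi * (\<mu> \<bullet> x) + c))" for x
 proof -
  have arg: "(\<Sum>v\<in>P. pi * (v \<bullet> x)) - 2 * (\<Sum>v\<in>T. pi * (v \<bullet> x)) - real (card P) * (pi / 2) = 2 * pi * (l T \<bullet> x) + c" for T
   by (simp add: l_def half_sum_def c_def inner_diff_left inner_sum_left sum_distrib_left[symmetric] algebra_simps)
  have "(\<Sum>T\<in>Pow P. (- 1) ^ card T * cos (2 * pi * (l T \<bullet> x) + c)) =
    (\<Sum>\<mu>\<in>l ` Pow P. \<Sum>T\<in>{T \<in> Pow P. l T = \<mu>}. (- 1) ^ card T * cos (2 * pi * (l T \<bullet> x) + c))"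
   by (rule sum.image_gen[OF fin])
  also have "... = (\<Sum>\<mu>\<in>l ` Pow P. net_sign P \<mu> * cos (2 * pi * (\<mu> \<bullet> x) + c))"
   unfolding net_sign_def sum_distrib_right l_def[symmetric] by (intro sum.cong refl) auto
  also have "... = (\<Sum>\<mu>\<in>\<Lambda>. net_sign P \<mu> * cos (2 * pi * (\<mu> \<bullet> x) + c))"
   unfolding \<Lambda>_def by (rule sum.mono_neutral_right) (use fin in auto)
  finally show ?thesis
   unfolding prod_sin_expansion[OF finite_positive] arg by (simp add: sum_distrib_left mult.assoc)
 qed
 have f: "finite \<Lambda>" using fin by (simp add: \<Lambda>_def)
 have n: "norm \<mu> = norm (half_sum P)" if "\<mu> \<in> \<Lambda>" for \<mu>
  using that norm_of_net_sign_nonzero by (auto simp: \<Lambda>_def)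
 show ?thesis by (rule that[OF f n e])
qed

end

section \<open>First eigenfunctions of alcoves\<close>

lemma C2_with_cosine_sum:
 fixes m :: "'k => real^'n"
 assumes "finite I"
 obtains p q where "C2_with UNIV (\<lambda>x. \<Sum>k\<in>I. A k * cos (m k \<bullet> x + c k)) p q" "\<And>i. continuous_on UNIV (q i)"
  "\<And>x. (\<Sum>i\<in>UNIV. q i x $ i) = (\<Sum>k\<in>I. - (m k \<bullet> m k) * (A k * cos (m k \<bullet> x + c k)))"
proof -
 define p where "p k x = A k *\<^sub>R ((- sin (m k \<bullet> x - (- c k))) *\<^sub>R m k)" for k x
 define q where "q k i x = A k *\<^sub>R ((- cos (m k \<bullet> x - (- c k)) * m k $ i) *\<^sub>R m k)" for k i x
 have "C2_with UNIV (\<lambda>x. A k * cos (m k \<bullet> x - (- c k))) (p k) (q k)" for k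
 proof -
  have "C2_with UNIV (\<lambda>x. cos (m k \<bullet> x - (- c k))) (\<lambda>x. (- sin (m k \<bullet> x - (- c k))) *\<^sub>R m k)
    (\<lambda>i x. (- cos (m k \<bullet> x - (- c k)) * m k $ i) *\<^sub>R m k)"
   by (rule C2_with_ridge) (auto intro!: derivative_eq_intros)
  from C2_with_lincomb[OF this this, of "A k" 0] show ?thesis by (simp add: p_def[abs_def] q_def[abs_def])
 qed
 hence C: "C2_with UNIV (\<lambda>x. A k * cos (m k \<bullet> x + c k)) (p k) (q k)" for k by simp
 show ?thesis
 proof (rule that[OF C2_with_sum[OF assms C]])
  show "continuous_on UNIV (\<lambda>x. \<Sum>k\<in>I. q k i x)" for i unfolding q_def by (intro continuous_intros)
  fix x
  have "(\<Sum>i\<in>UNIV. q k i x $ i) = - (m k \<bullet> m k) * (A k * cos (m k \<bullet> x + c k))" for k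
   by (simp add: q_def inner_vec_def sum_distrib_left sum_distrib_right sum_negf ac_simps)
  thus "(\<Sum>i\<in>UNIV. (\<Sum>k\<in>I. q k i x) $ i) = (\<Sum>k\<in>I. - (m k \<bullet> m k) * (A k * cos (m k \<bullet> x + c k)))"
   by (simp only: sum_component) (subst sum.swap, simp)
 qed
qed

lemma C2_with_scale:
 assumes "C2_with UNIV u p q"
 shows "C2_with UNIV (\<lambda>x. u (a + t *\<^sub>R (x - a))) (\<lambda>x. t *\<^sub>R p (a + t *\<^sub>R (x - a)))
  (\<lambda>i x. t\<^sup>2 *\<^sub>R q i (a + t *\<^sub>R (x - a)))"
 unfolding C2_with_def
proof (intro ballI conjI allI)
 fix x i
 have d: "((\<lambda>x. a + t *\<^sub>R (x - a)) has_derivative (\<lambda>h. t *\<^sub>R h)) (at x)" by (auto intro!: derivative_eq_intros)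
 from has_derivative_compose[OF d C2_withD(1)[OF assms UNIV_I]]
 show "((\<lambda>x. u (a + t *\<^sub>R (x - a))) has_derivative (\<bullet>) (t *\<^sub>R p (a + t *\<^sub>R (x - a)))) (at x)" by (simp add: inner_scaleR_left_fun)
 from has_derivative_mult_right[OF has_derivative_compose[OF d C2_withD(2)[OF assms UNIV_I]], of t i]
 show "((\<lambda>x. (t *\<^sub>R p (a + t *\<^sub>R (x - a))) $ i) has_derivative (\<bullet>) (t\<^sup>2 *\<^sub>R q i (a + t *\<^sub>R (x - a)))) (at x)"
  by (simp add: power2_eq_square mult.assoc inner_scaleR_left_fun)
qed

text \<open>If \<open>\<nu> < \<mu>\<close>, choose \<open>t < 1\<close> with \<open>\<nu> <
t\<^sup>2 * \<mu>\<close>. The scaled function W is positive on the closure, and its eigenvalue is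
\<open>t\<^sup>2 * \<mu>\<close>. At the maximum of \<open>v / W\<close> the multiple of W that
touches v from above contradicts the second derivative test.\<close>

lemma positive_eigenvalue_minimal:
 fixes w v :: "real^'n => real"
 assumes \<Omega>: "open \<Omega>" "bounded \<Omega>" and star: "\<And>x t. x \<in> closure \<Omega> ==> 0 \<le> t ==> t < 1 ==> a + t *\<^sub>R (x - a) \<in> \<Omega>"
  and w: "C2_with UNIV w p q" "\<And>x. (\<Sum>i\<in>UNIV. q i x $ i) = - \<mu> * w x" "\<And>x. x \<in> \<Omega> ==> w x > 0"
  and v: "continuous_on (closure \<Omega>) v" "C2_with \<Omega> v p' q'" "\<And>x. x \<in> \<Omega> ==> (\<Sum>i\<in>UNIV. q' i x $ i) = - \<nu> * v x"
   "\<And>x. x \<in> frontier \<Omega> ==> v x = 0" "x0 \<in> \<Omega>" "v x0 > 0"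
 shows "\<mu> \<le> \<nu>"
proof (rule ccontr)
 assume "\<not> ?thesis"
 hence "eventually (\<lambda>t::real. t\<^sup>2 * \<mu> > \<nu>) (at_left 1)"
  by (intro order_tendstoD(1)[of _ "1\<^sup>2 * \<mu>"] tendsto_intros tendsto_ident_at) simp
 moreover have "eventually (\<lambda>t::real. t \<in> {0<..<1}) (at_left 1)" by (rule eventually_at_left_real) simp
 ultimately obtain t where t: "\<nu> < t\<^sup>2 * \<mu>" "0 < t" "t < 1"
  using eventually_happens'[OF trivial_limit_at_left_real eventually_conj] by fastforce
 define W where "W x = w (a + t *\<^sub>R (x - a))" for x
 have C: "C2_with UNIV W (\<lambda>x. t *\<^sub>R p (a + t *\<^sub>R (x - a))) (\<lambda>i x. t\<^sup>2 *\<^sub>R q i (a + t *\<^sub>R (x - a)))"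
  unfolding W_def by (rule C2_with_scale[OF w(1)])
 have Wpos: "W x > 0" if "x \<in> closure \<Omega>" for x using w(3) star[OF that] t by (simp add: W_def)
 have "continuous_on (closure \<Omega>) W"
  using C2_with_continuous_on[OF C] continuous_on_subset by blast
 hence "continuous_on (closure \<Omega>) (\<lambda>x. v x / W x)" using Wpos by (intro continuous_on_divide v(1)) force+
 moreover have "compact (closure \<Omega>)" using \<Omega>(2) by (simp add: compact_closure)
 ultimately obtain x where x: "x \<in> closure \<Omega>" "\<And>y. y \<in> closure \<Omega> ==> v y / W y \<le> v x / W x"
  using continuous_attains_sup[of "closure \<Omega>" "\<lambda>x. v x / W x"] v(5) closure_subset by blast
 have sub: "y \<in> closure \<Omega>" if "y \<in> \<Omega>" for y using that closure_subset by blast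
 define M where "M = v x / W x"
 have "v x0 / W x0 > 0" using v(6) Wpos[OF sub[OF v(5)]] by simp
 hence M: "M > 0" using x(2)[OF sub[OF v(5)]] by (simp add: M_def)
 hence "v x \<noteq> 0" by (auto simp: M_def)
 hence x\<Omega>: "x \<in> \<Omega>" using v(4)[of x] x(1) \<Omega>(1) by (auto simp: frontier_def interior_open)
 have vx: "v x = M * W x" using Wpos[OF x(1)] by (simp add: M_def)
 have "(\<Sum>i\<in>UNIV. (M *\<^sub>R (t\<^sup>2 *\<^sub>R q i (a + t *\<^sub>R (x - a))) + (-1) *\<^sub>R q' i x) $ i) \<ge> 0"
 proof (rule C2_with_local_min[OF \<Omega>(1) C2_with_lincomb[OF C2_with_subset[OF C] v(2)] x\<Omega>])
  fix y assume y: "y \<in> \<Omega>"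
  have "v y / W y \<le> M" using x(2)[OF sub[OF y]] by (simp add: M_def)
  hence "v y \<le> M * W y" using Wpos[OF sub[OF y]] by (simp add: divide_le_eq)
  thus "M * W x + - 1 * v x \<le> M * W y + - 1 * v y" using vx by simp
 qed simp
 moreover have "(\<Sum>i\<in>UNIV. (M *\<^sub>R (t\<^sup>2 *\<^sub>R q i (a + t *\<^sub>R (x - a))) + (-1) *\<^sub>R q' i x) $ i) =
   M * t\<^sup>2 * (\<Sum>i\<in>UNIV. q i (a + t *\<^sub>R (x - a)) $ i) - (\<Sum>i\<in>UNIV. q' i x $ i)"
  by (simp add: sum_subtractf sum_distrib_left mult.assoc)
 ultimately have "0 \<le> \<nu> * v x - t\<^sup>2 * \<mu> * (M * W x)"
  unfolding w(2) v(3)[OF x\<Omega>] W_def[symmetric] by (simp add: algebra_simps)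
 also have "... = (\<nu> - t\<^sup>2 * \<mu>) * (M * W x)" unfolding vx by (simp add: algebra_simps)
 finally show False using t(1) mult_pos_pos[OF M Wpos[OF x(1)]] by (simp add: zero_le_mult_iff)
qed

text \<open>An alcove is cut out by the strict inequalities between consecutive integers that hold
at one of its points; its closure satisfies the weak ones.\<close>

lemma alcove_star_shaped:
 fixes R :: "'a::euclidean_space set"
 assumes A: "A \<in> alcoves R" "a \<in> A" and y: "y \<in> closure A" and t: "0 \<le> t" "t < 1"
 shows "a + t *\<^sub>R (y - a) \<in> A"
proof -
 let ?W = "UNIV - (\<Union>v\<in>R. \<Union>k::int. {x. v \<bullet> x = of_int k})"
 have C: "A \<in> components ?W" using A(1) by (simp add: alcoves_def)
 have sub: "A \<subseteq> ?W" by (rule in_components_subset[OF C])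
 define k where "k v = \<lfloor>v \<bullet> a\<rfloor>" for v
 define B where "B = (\<Inter>v\<in>R. {x. v \<bullet> x > of_int (k v)} \<inter> {x. v \<bullet> x < of_int (k v + 1)})"
 have "convex B" unfolding B_def by (intro convex_INT convex_Int convex_halfspace_gt convex_halfspace_lt)
 hence "connected B" by (rule convex_connected)
 moreover have "B \<subseteq> ?W" by (force simp: B_def)
 moreover have ak: "of_int (k v) < v \<bullet> a \<and> v \<bullet> a < of_int (k v + 1)" if v: "v \<in> R" for v
 proof -
  have "v \<bullet> a \<noteq> of_int (k v)" using sub A(2) v by blast
  thus ?thesis unfolding k_def by linarith
 qed
 hence "a \<in> B" by (auto simp: B_def)
 ultimately have BA: "B \<subseteq> A" using components_maximal[OF C, of B] A(2) by blast
 have AB: "of_int (k v) \<le> v \<bullet> x \<and> v \<bullet> x \<le> of_int (k v + 1)" if v: "v \<in> R" and x: "x \<in> A" for v x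
 proof (rule ccontr)
  assume n: "\<not> ?thesis"
  have conn: "connected A" by (rule in_components_connected[OF C])
  have "\<exists>z\<in>A. \<exists>j::int. v \<bullet> z = of_int j"
  proof (cases "v \<bullet> x < of_int (k v)")
   case True
   thus ?thesis using connected_ivt_hyperplane[OF conn x A(2), of v "of_int (k v)"] ak[OF v] by fastforce
  next
   case False
   thus ?thesis using connected_ivt_hyperplane[OF conn A(2) x, of v "of_int (k v + 1)"] ak[OF v] n by fastforce
  qed
  thus False using sub v by blast
 qed
 have clB: "of_int (k v) \<le> v \<bullet> y \<and> v \<bullet> y \<le> of_int (k v + 1)" if v: "v \<in> R" for v
 proof -
  have "closure A \<subseteq> {x. v \<bullet> x \<ge> of_int (k v)} \<inter> {x. v \<bullet> x \<le> of_int (k v + 1)}"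
   using AB[OF v] by (intro closure_minimal closed_Int closed_halfspace_ge closed_halfspace_le) auto
  thus ?thesis using y by auto
 qed
 have "a + t *\<^sub>R (y - a) \<in> B"
  unfolding B_def
 proof (intro INT_I IntI CollectI)
  fix v assume v: "v \<in> R"
  have e: "v \<bullet> (a + t *\<^sub>R (y - a)) = (1 - t) * (v \<bullet> a) + t * (v \<bullet> y)" by (simp add: inner_add_right inner_diff_right algebra_simps)
  have "(1 - t) * of_int (k v) < (1 - t) * (v \<bullet> a)" "(1 - t) * (v \<bullet> a) < (1 - t) * of_int (k v + 1)"
   using ak[OF v] t(2) by simp_all
  moreover have "t * of_int (k v) \<le> t * (v \<bullet> y)" "t * (v \<bullet> y) \<le> t * of_int (k v + 1)"
   using clB[OF v] t(1) by (intro mult_left_mono; simp)+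
  ultimately show "of_int (k v) < v \<bullet> (a + t *\<^sub>R (y - a))" "v \<bullet> (a + t *\<^sub>R (y - a)) < of_int (k v + 1)"
   unfolding e by (simp_all add: algebra_simps)
 qed
 thus ?thesis using BA by blast
qed

theorem analytic_if_alcove:
 fixes \<Omega> :: "(real^'n) set"
 assumes \<Omega>: "\<Omega> \<in> wp CARD('n)" and R: "root_system R" and A: "A \<in> alcoves R" and cong: "congruent_sets A \<Omega>"
 shows "first_eigenfunction_extends_analytically \<Omega>"
proof -
 have \<Omega>': "\<Omega> \<in> wp DIM(real^'n)" using \<Omega> by simp
 note o = wp_open[OF \<Omega>']
 obtain g where g: "isometry_map g" "\<Omega> = g ` A" using cong unfolding congruent_sets_def isometry_map_def by blast
 obtain L where L: "orthogonal_transformation L" "\<And>x. g x = g 0 + L x" by (rule isometry_map_form[OF g(1)]) (rule that)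
 have ip: "L x \<bullet> L y = x \<bullet> y" for x y using L(1) by (simp add: orthogonal_transformation_def)
 have lin: "linear L" using L(1) by (rule orthogonal_transformation_linear)
 obtain \<phi> where \<phi>: "generic_for \<phi> R" by (rule ex_generic[OF root_systemD(1,2)[OF R]])
 define P where "P = positive_roots \<phi> R"
 have fP: "finite P" using root_systemD(1)[OF R] by (simp add: P_def positive_roots_def)
 obtain \<Lambda> B c r where tr: "finite \<Lambda>" "\<And>\<mu>. \<mu> \<in> \<Lambda> ==> norm \<mu> = r"
  "\<And>x. (\<Prod>v\<in>P. sin (pi * (v \<bullet> x))) = (\<Sum>\<mu>\<in>\<Lambda>. B \<mu> * cos (2 * pi * (\<mu> \<bullet> x) + c))"
  by (rule prod_sin_equal_frequencies[OF R \<phi> P_def]) (rule that)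
 define m where "m \<mu> = (2 * pi) *\<^sub>R L \<mu>" for \<mu>
 \<comment> \<open>The product of sines, carried from A to \<Omega> by the congruence g.\<close>
 define f where "f x = (\<Sum>\<mu>\<in>\<Lambda>. B \<mu> * cos (m \<mu> \<bullet> x + (c - m \<mu> \<bullet> g 0)))" for x
 define \<mu>1 where "\<mu>1 = (2 * pi * r)\<^sup>2"
 have fg: "f (g y) = (\<Prod>v\<in>P. sin (pi * (v \<bullet> y)))" for y
  unfolding tr(3) f_def m_def L(2)[of y] by (intro sum.cong refl) (simp add: inner_add_right ip)
 let ?W = "UNIV - (\<Union>v\<in>R. \<Union>k::int. {x. v \<bullet> x = of_int k})"
 have zero: "f (g y) \<noteq> 0 \<longleftrightarrow> y \<in> ?W" for y
 proof -
  have "f (g y) = 0 \<longleftrightarrow> (\<exists>v\<in>P. \<exists>k::int. v \<bullet> y = of_int k)"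
   unfolding fg prod_zero_iff[OF fP] sin_zero_iff_int2 by (simp add: mult.commute[of pi])
  also have "... \<longleftrightarrow> (\<exists>v\<in>R. \<exists>k::int. v \<bullet> y = of_int k)"
  proof
   assume "\<exists>v\<in>R. \<exists>k::int. v \<bullet> y = of_int k"
   then obtain v k where v: "v \<in> R" "v \<bullet> y = of_int k" by blast
   have "v \<in> P \<or> - v \<in> P" using v(1) \<phi> root_systemD(4)[OF R v(1)] by (force simp: P_def positive_roots_def generic_for_def)
   moreover have "(- v) \<bullet> y = of_int (- k)" using v(2) by simp
   ultimately show "\<exists>v\<in>P. \<exists>k::int. v \<bullet> y = of_int k" using v(2) by blast
  qed (auto simp: P_def positive_roots_def)
  finally show ?thesis by blast
 qed
 obtain p q where C: "C2_with UNIV f p q" "\<And>i. continuous_on UNIV (q i)"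
  and eig0: "\<And>x. (\<Sum>i\<in>UNIV. q i x $ i) = (\<Sum>\<mu>\<in>\<Lambda>. - (m \<mu> \<bullet> m \<mu>) * (B \<mu> * cos (m \<mu> \<bullet> x + (c - m \<mu> \<bullet> g 0))))"
  by (rule C2_with_cosine_sum[OF tr(1), of B m "\<lambda>\<mu>. c - m \<mu> \<bullet> g 0", folded f_def[abs_def]]) (rule that)
 have eig: "(\<Sum>i\<in>UNIV. q i x $ i) = - \<mu>1 * f x" for x
 proof -
  have "m \<mu> \<bullet> m \<mu> = \<mu>1" if "\<mu> \<in> \<Lambda>" for \<mu>
   using tr(2)[OF that] by (simp add: m_def ip \<mu>1_def power_mult_distrib dot_square_norm power2_eq_square orthogonal_transformation_norm[OF L(1)])
  thus ?thesis unfolding eig0 f_def sum_distrib_left by (intro sum.cong refl) simp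
 qed
 have cf: "continuous_on S f" for S using C2_with_continuous_on[OF C(1)] continuous_on_subset by blast
 have comp: "A \<in> components ?W" using A by (simp add: alcoves_def)
 have nz: "f x \<noteq> 0" if "x \<in> \<Omega>" for x using that in_components_subset[OF comp] zero unfolding g(2) by blast
 have fr: "f x = 0" if "x \<in> frontier \<Omega>" for x
 proof -
  obtain y where y: "x = g y" "y \<in> frontier A" using \<open>x \<in> frontier \<Omega>\<close> unfolding g(2) isometry_map_images(3)[OF g(1)] by blast
  have "continuous_on UNIV (\<lambda>y. f (g y))" unfolding fg by (intro continuous_intros)
  hence "open {y. f (g y) \<noteq> 0}" by (intro open_Collect_neq) (auto intro: continuous_intros)
  moreover have "{y. f (g y) \<noteq> 0} = ?W" using zero by blast
  ultimately have "open ?W" by simp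
  moreover have "y \<in> frontier ?W" using frontier_of_components_subset[OF comp] y(2) by blast
  ultimately have "y \<notin> ?W" by (simp add: frontier_def interior_open)
  thus ?thesis using zero y(1) by blast
 qed
 obtain x0 where x0: "x0 \<in> \<Omega>" using o(4) by blast
 then obtain a where a: "a \<in> A" "x0 = g a" using g(2) by blast
 have star: "x0 + t *\<^sub>R (x - x0) \<in> \<Omega>" if x: "x \<in> closure \<Omega>" and t: "0 \<le> t" "t < 1" for x t
 proof -
  obtain y where y: "x = g y" "y \<in> closure A" using x unfolding g(2) isometry_map_images(1)[OF g(1)] by blast
  have "g (a + t *\<^sub>R (y - a)) = x0 + t *\<^sub>R (x - x0)"
   unfolding a(2) y(1) L(2)[of a] L(2)[of y] L(2)[of "a + t *\<^sub>R (y - a)"]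
   by (simp add: linear_add[OF lin] linear_scale[OF lin] linear_diff[OF lin])
  moreover have "a + t *\<^sub>R (y - a) \<in> A" by (rule alcove_star_shaped[OF A a(1) y(2) t])
  ultimately show ?thesis unfolding g(2) by (metis imageI)
 qed
 define w where "w x = f x0 * f x" for x
 have Cw: "C2_with UNIV w (\<lambda>x. f x0 *\<^sub>R p x) (\<lambda>i x. f x0 *\<^sub>R q i x)"
  using C2_with_lincomb[OF C(1) C(1), of "f x0" 0] by (simp add: w_def[abs_def])
 have ew: "(\<Sum>i\<in>UNIV. (f x0 *\<^sub>R q i x) $ i) = - \<mu>1 * w x" for x
  using eig[of x] by (simp add: w_def sum_distrib_left[symmetric])
 have wpos: "w x > 0" if x: "x \<in> \<Omega>" for x
 proof (rule ccontr)
  assume n: "\<not> w x > 0"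
  have "connected (w ` \<Omega>)" unfolding w_def by (intro connected_continuous_image continuous_intros cf o(2))
  moreover have "w x0 \<ge> 0" by (simp add: w_def)
  ultimately have "0 \<in> w ` \<Omega>" using connectedD_interval[of "w ` \<Omega>" "w x" "w x0" 0] n x x0 by auto
  thus False using nz x0 by (auto simp: w_def)
 qed
 have de: "dirichlet_eigenfunction \<Omega> \<mu>1 f"
  unfolding dirichlet_eigenfunction_def
 proof (intro conjI ballI)
  have C\<Omega>: "C2_with \<Omega> f p q" by (rule C2_with_subset[OF C(1)]) simp
  show "C2_on \<Omega> f" by (rule C2_with_imp_C2_on[OF C\<Omega>]) (rule continuous_on_subset[OF C(2)], simp)
  show "laplacian f x = \<mu>1 * f x" if "x \<in> \<Omega>" for x
   using laplacian_C2_with[OF o(1) C\<Omega> that] eig by simp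
  show "\<exists>x\<in>\<Omega>. f x \<noteq> 0" using nz x0 by blast
 qed (use cf fr in auto)
 have "\<mu>1 \<le> \<nu>" if v: "dirichlet_eigenfunction \<Omega> \<nu> v" for \<nu> v
 proof -
  have vf: "continuous_on (closure \<Omega>) v" "C2_on \<Omega> v" "\<exists>x\<in>\<Omega>. v x \<noteq> 0" "\<And>x. x \<in> frontier \<Omega> ==> v x = 0"
   "\<And>x. x \<in> \<Omega> ==> laplacian v x = \<nu> * v x"
   using v unfolding dirichlet_eigenfunction_def by auto
  obtain p' q' where Cv: "C2_with \<Omega> v p' q'" using C2_on_imp_C2_with[OF vf(2)] .
  obtain y where y: "y \<in> \<Omega>" "v y \<noteq> 0" using vf(3) by blast
  have "C2_with \<Omega> (\<lambda>x. v y * v x + 0 * v x) (\<lambda>x. v y *\<^sub>R p' x + 0 *\<^sub>R p' x) (\<lambda>i x. v y *\<^sub>R q' i x + 0 *\<^sub>R q' i x)"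
   by (rule C2_with_lincomb[OF Cv Cv])
  hence Cv': "C2_with \<Omega> (\<lambda>x. v y * v x) (\<lambda>x. v y *\<^sub>R p' x) (\<lambda>i x. v y *\<^sub>R q' i x)" by simp
  have ev: "(\<Sum>i\<in>UNIV. (v y *\<^sub>R q' i x) $ i) = - \<nu> * (v y * v x)" if "x \<in> \<Omega>" for x
  proof -
   have "(\<Sum>i\<in>UNIV. q' i x $ i) = - (\<nu> * v x)"
    using vf(5)[OF that] laplacian_C2_with[OF o(1) Cv that] by simp
   thus ?thesis by (simp add: sum_distrib_left[symmetric])
  qed
  show ?thesis
  proof (rule positive_eigenvalue_minimal[OF o(1,3) star Cw ew wpos _ Cv' ev])
   show "continuous_on (closure \<Omega>) (\<lambda>x. v y * v x)" by (intro continuous_intros vf(1))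
   show "v y * v y > 0" using y(2) by (simp add: zero_less_mult_iff) linarith
  qed (use vf(4) y in auto)
 qed
 hence "first_eigenfunction \<Omega> f" unfolding first_eigenfunction_def using de by blast
 moreover have "real_analytic_on UNIV f"
  unfolding f_def by (intro analytic_sum analytic_cmult analytic_cos tr(1))
 ultimately show ?thesis unfolding first_eigenfunction_extends_analytically_def by blast
qed

section \<open>The equivalence\<close>

theorem theorem2:
  fixes \<Omega> :: "(real ^ 'n) set"
  assumes "\<Omega> \<in> wp CARD('n)"
  shows "(first_eigenfunction_extends_analytically \<Omega> \<longleftrightarrow> strictly_tessellates \<Omega>) \<and>
         (strictly_tessellates \<Omega> \<longleftrightarrow>
            (\<exists>R A. root_system R \<and> A \<in> alcoves R \<and> congruent_sets A \<Omega>))"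
proof -
  have "strictly_tessellates \<Omega>" if "first_eigenfunction_extends_analytically \<Omega>"
    using assms that by (rule strictly_tessellates_if_analytic)
  moreover have "\<exists>R A. root_system R \<and> A \<in> alcoves R \<and> congruent_sets A \<Omega>" if "strictly_tessellates \<Omega>"
    using alcove_if_strictly_tessellates[of \<Omega>] assms that by simp
  moreover have "first_eigenfunction_extends_analytically \<Omega>"
    if "\<exists>R A. root_system R \<and> A \<in> alcoves R \<and> congruent_sets A \<Omega>"
    using that analytic_if_alcove[OF assms] by blast
  ultimately show ?thesis by blast
qed

end
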